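(* Let $f:(0,\infty)\to\mathbb R$ be operator convex, let $\mathcal H$ be a Hilbert space and $A,B\in B(\mathcal H)_+$, and let $\phi_f(\cdot,\cdot)$ denote the (extended) operator perspective associated with $f$. If $X_n\in B(\mathcal H)_+$ ($n\in\mathbb N$) and $X_n\to0$ in the strong operator topology, then $$\phi_f(A,B)(\rho)=\lim_{n\to\infty}\phi_f(A+X_n,B+X_n)(\rho),\qquad\rho\in B(\mathcal H)_*^+.$$ Furthermore, when $f(1)=0$ and $X_n\searrow0$, this convergence is increasing (in $n$).
   Context: $B(\mathcal H)_+$ is the set of positive bounded operators on $\mathcal H$. $B(\mathcal H)_*^+$ is the set of positive normal functionals on $B(\mathcal H)$ (i.e. $X\mapsto\mathrm{Tr}(X\rho)$ with $\rho$ positive trace-class). $X_n\searrow0$ means $X_1\ge X_2\ge\cdots$ and $X_n\to0$ in the strong operator topology. Extended lower semibounded self-adjoint part: $\widehat{B(\mathcal H)}_{\mathrm{lb}}$ is the set of maps $m:B(\mathcal H)_*^+\to(-\infty,\infty]$ that are positively homogeneous (with $0\cdot\infty=0$), additive, lower semicontinuous (in norm), and satisfy $m(\rho)+\ell\rho(I)\ge0$ for all $\rho$ for some $\ell\ge0$. Extended operator perspective: for operator convex $f:(0,\infty)\to\mathbb R$, put $f'(\infty):=\lim_{t\to\infty}f(t)/t$ and $f(0^+):=\lim_{t\searrow0}f(t)$, both in $(-\infty,\infty]$, and define $\phi_f:[0,\infty)^2\to(-\infty,\infty]$ by $\phi_f(x,y):=yf(x/y)$ for $x,y>0$, $\phi_f(x,0):=f'(\infty)x$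 for $x\ge0$, $\phi_f(0,y):=f(0^+)y$ for $y\ge0$ (with $0\cdot\infty=0$). For $A,B\in B(\mathcal H)_+$ put $\mathcal H_{A,B}:=\overline{\mathrm{ran}}(A+B)$ and $T_{A,B}:\mathcal H\to\mathcal H_{A,B}$, $T_{A,B}\xi:=(A+B)^{1/2}\xi$. There are unique positive contractions $R_{A,B},S_{A,B}$ on $\mathcal H_{A,B}$ with $R_{A,B}+S_{A,B}=I$, $A=T_{A,B}^*R_{A,B}T_{A,B}$, $B=T_{A,B}^*S_{A,B}T_{A,B}$. Then $\phi_f(A,B)\in\widehat{B(\mathcal H)}_{\mathrm{lb}}$ is defined by $\phi_f(A,B)(\rho):=\int_{[0,1]}\phi_f(r,1-r)\,d\rho(T_{A,B}^*E_{R_{A,B}}(r)T_{A,B})$, where $E_{R_{A,B}}$ is the spectral measure of $R_{A,B}$ (this is the Pusz--Woronowicz functional calculus associated with $\phi_f$). *)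

theory Defs
  imports "HOL-Analysis.Analysis" "Jordan_Normal_Form.Schur_Decomposition"
begin

section \<open>Complex Hilbert spaces\<close>

text \<open>Only the complex structure is new: the underlying real inner product is the library's, so that
  norm, topology and completeness are inherited. The inner product is linear in its second
  argument. No separability is assumed.\<close>

class complex_hilbert = real_inner + banach +
  fixes scaleC :: "complex \<Rightarrow> 'a \<Rightarrow> 'a"  (infixr \<open>*\<^sub>C\<close> 75)
    and cinner :: "'a \<Rightarrow> 'a \<Rightarrow> complex"
  assumes scaleC_of_real: "complex_of_real r *\<^sub>C x = r *\<^sub>R x"
    and scaleC_scaleC: "a *\<^sub>C (b *\<^sub>C x) = (a * b) *\<^sub>C x"
    and scaleC_add_left: "(a + b) *\<^sub>C x = a *\<^sub>C x + b *\<^sub>C x"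
    and scaleC_add_right: "a *\<^sub>C (x + y) = a *\<^sub>C x + a *\<^sub>C y"
    and cinner_commute: "cinner x y = cnj (cinner y x)"
    and cinner_add_right: "cinner x (y + z) = cinner x y + cinner x z"
    and cinner_scaleC_right: "cinner x (a *\<^sub>C y) = a * cinner x y"
    and Re_cinner: "Re (cinner x y) = inner x y"

instantiation complex :: complex_hilbert
begin
definition "scaleC_complex a (x::complex) = a * x"
definition "cinner_complex (x::complex) y = cnj x * y"
instance
  by standard
    (auto simp: scaleC_complex_def cinner_complex_def scaleR_conv_of_real inner_complex_def
      algebra_simps)
end

section \<open>Bounded operators\<close>

text \<open>Elements of \<open>B(H)\<close> are the complex-linear elements of the library type of bounded real-linear
  maps.\<close>

definition clinear_op :: "('a::complex_hilbert \<Rightarrow>\<^sub>L 'a) \<Rightarrow> bool" where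
  "clinear_op A \<longleftrightarrow> (\<forall>c x. A (c *\<^sub>C x) = c *\<^sub>C A x)"

text \<open>The order on \<open>complex\<close> makes \<open>0 \<le> z\<close> say that \<open>z\<close> is real and nonnegative.\<close>

definition pos_op :: "('a::complex_hilbert \<Rightarrow>\<^sub>L 'a) \<Rightarrow> bool" where
  "pos_op A \<longleftrightarrow> clinear_op A \<and> (\<forall>x. 0 \<le> cinner x (A x))"

definition op_adj :: "('a::complex_hilbert \<Rightarrow>\<^sub>L 'a) \<Rightarrow> ('a \<Rightarrow>\<^sub>L 'a)" where
  "op_adj A = (THE A' :: 'a \<Rightarrow>\<^sub>L 'a. \<forall>x y. cinner (A' x) y = cinner x (A y))"

definition op_sqrt :: "('a::complex_hilbert \<Rightarrow>\<^sub>L 'a) \<Rightarrow> ('a \<Rightarrow>\<^sub>L 'a)" where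
  "op_sqrt A = (THE C. pos_op C \<and> C o\<^sub>L C = A)"

definition orthogonal_projection :: "('a::complex_hilbert \<Rightarrow>\<^sub>L 'a) \<Rightarrow> bool" where
  "orthogonal_projection P \<longleftrightarrow> clinear_op P \<and> P o\<^sub>L P = P \<and> op_adj P = P"

text \<open>For a closed subspace \<open>M\<close> of \<open>H\<close>, the algebra \<open>B(M)\<close> is represented by the operators on \<open>H\<close>
  with range in \<open>M\<close> that vanish on the orthogonal complement of \<open>M\<close> (extension by zero).\<close>

definition op_on :: "'a::complex_hilbert set \<Rightarrow> ('a \<Rightarrow>\<^sub>L 'a) \<Rightarrow> bool" where
  "op_on M A \<longleftrightarrow> clinear_op A \<and> range A \<subseteq> M \<and> (\<forall>x. (\<forall>y\<in>M. cinner y x = 0) \<longrightarrow> A x = 0)"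

section \<open>Spectral measures\<close>

text \<open>A projection-valued measure on the Borel sets of the line with values in \<open>B(M)\<close>; countable
  additivity is in the strong operator topology.\<close>

definition projection_valued_measure ::
    "'a::complex_hilbert set \<Rightarrow> (real set \<Rightarrow> 'a \<Rightarrow>\<^sub>L 'a) \<Rightarrow> bool" where
  "projection_valued_measure M E \<longleftrightarrow>
     (\<forall>\<Delta>\<in>sets borel. op_on M (E \<Delta>) \<and> orthogonal_projection (E \<Delta>)) \<and>
     (\<forall>x\<in>M. E UNIV x = x) \<and>
     (\<forall>\<Delta>\<in>sets borel. \<forall>\<Delta>'\<in>sets borel. E (\<Delta> \<inter> \<Delta>') = E \<Delta> o\<^sub>L E \<Delta>') \<and>
     (\<forall>F :: nat \<Rightarrow> real set. range F \<subseteq> sets borel \<longrightarrow> disjoint_family F \<longrightarrow>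
        (\<forall>x. (\<lambda>n. E (F n) x) sums E (\<Union>n. F n) x))"

text \<open>The scalar Borel measure with the given (real and nonnegative) values.\<close>

definition scalar_measure :: "(real set \<Rightarrow> complex) \<Rightarrow> real measure" where
  "scalar_measure \<mu> = measure_of UNIV (sets borel) (\<lambda>\<Delta>. ennreal (Re (\<mu> \<Delta>)))"

text \<open>The spectral measure of a self-adjoint \<open>R\<close> in \<open>B(M)\<close>, characterised by
  \<open>\<langle>x, R x\<rangle> = \<integral> r d\<langle>x, E(r) x\<rangle>\<close>. Its value outside the Borel sets is set to \<open>0\<close> only to make it
  unique as a HOL function.\<close>

definition spectral_measure ::
    "'a::complex_hilbert set \<Rightarrow> ('a \<Rightarrow>\<^sub>L 'a) \<Rightarrow> real set \<Rightarrow> ('a \<Rightarrow>\<^sub>L 'a)" where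
  "spectral_measure M R = (THE E. projection_valued_measure M E \<and>
     (\<forall>\<Delta>. \<Delta> \<notin> sets borel \<longrightarrow> E \<Delta> = 0) \<and>
     (\<forall>x\<in>M. has_bochner_integral (scalar_measure (\<lambda>\<Delta>. cinner x (E \<Delta> x)))
        complex_of_real (cinner x (R x))))"

section \<open>Positive normal functionals\<close>

definition orthonormal_basis :: "'a::complex_hilbert set \<Rightarrow> bool" where
  "orthonormal_basis B \<longleftrightarrow>
     (\<forall>e\<in>B. \<forall>e'\<in>B. cinner e e' = (if e = e' then 1 else 0)) \<and>
     (\<forall>x. (\<forall>e\<in>B. cinner e x = 0) \<longrightarrow> x = 0)"

definition pos_trace_class :: "('a::complex_hilbert \<Rightarrow>\<^sub>L 'a) \<Rightarrow> bool" where
  "pos_trace_class D \<longleftrightarrow> pos_op D \<and>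
     (\<forall>B. orthonormal_basis B \<longrightarrow> (\<lambda>e. cinner e (D e)) summable_on B)"

text \<open>On trace-class operators the value does not depend on the chosen orthonormal basis.\<close>

definition op_trace :: "('a::complex_hilbert \<Rightarrow>\<^sub>L 'a) \<Rightarrow> complex" where
  "op_trace A = (\<Sum>\<^sub>\<infinity>e\<in>(SOME B. orthonormal_basis B). cinner e (A e))"

definition pos_normal_functionals :: "(('a::complex_hilbert \<Rightarrow>\<^sub>L 'a) \<Rightarrow> complex) set" where
  "pos_normal_functionals = {\<lambda>X. op_trace (X o\<^sub>L D) | D. pos_trace_class D}"

section \<open>Operator convex functions\<close>

text \<open>Convexity with respect to the Loewner order for Hermitian matrices of every size with
  spectrum in \<open>(0, \<infinity>)\<close>, i.e. for positive definite matrices; \<open>f\<close> is only evaluated there.\<close>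

definition mat_possemidef :: "complex mat \<Rightarrow> bool" where
  "mat_possemidef A \<longleftrightarrow> A \<in> carrier_mat (dim_row A) (dim_row A) \<and>
     (\<forall>v\<in>carrier_vec (dim_row A). 0 \<le> (A *\<^sub>v v) \<bullet>c v)"

definition mat_posdef :: "complex mat \<Rightarrow> bool" where
  "mat_posdef A \<longleftrightarrow> A \<in> carrier_mat (dim_row A) (dim_row A) \<and>
     (\<forall>v\<in>carrier_vec (dim_row A). v \<noteq> 0\<^sub>v (dim_row A) \<longrightarrow> 0 < (A *\<^sub>v v) \<bullet>c v)"

definition mat_unitary :: "nat \<Rightarrow> complex mat \<Rightarrow> bool" where
  "mat_unitary n U \<longleftrightarrow> U \<in> carrier_mat n n \<and>
     U * mat_adjoint U = 1\<^sub>m n \<and> mat_adjoint U * U = 1\<^sub>m n"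

definition mat_fun :: "(real \<Rightarrow> real) \<Rightarrow> complex mat \<Rightarrow> complex mat" where
  "mat_fun f A = (THE M. \<exists>U d. mat_unitary (dim_row A) U \<and>
     A = U * mat_diag (dim_row A) (\<lambda>i. complex_of_real (d i)) * mat_adjoint U \<and>
     M = U * mat_diag (dim_row A) (\<lambda>i. complex_of_real (f (d i))) * mat_adjoint U)"

definition operator_convex :: "(real \<Rightarrow> real) \<Rightarrow> bool" where
  "operator_convex f \<longleftrightarrow>
     (\<forall>n. \<forall>A\<in>carrier_mat n n. \<forall>B\<in>carrier_mat n n. \<forall>t\<in>{0..1::real}.
        mat_posdef A \<longrightarrow> mat_posdef B \<longrightarrow>
        mat_possemidef
          (complex_of_real t \<cdot>\<^sub>m mat_fun f A + complex_of_real (1 - t) \<cdot>\<^sub>m mat_fun f B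
           - mat_fun f (complex_of_real t \<cdot>\<^sub>m A + complex_of_real (1 - t) \<cdot>\<^sub>m B)))"

section \<open>The extended operator perspective\<close>

definition perspective :: "(real \<Rightarrow> real) \<Rightarrow> real \<Rightarrow> real \<Rightarrow> ereal" where
  "perspective f x y =
     (if y = 0 then Lim at_top (\<lambda>t. ereal (f t / t)) * ereal x
      else if x = 0 then Lim (at_right 0) (\<lambda>t. ereal (f t)) * ereal y
      else ereal (y * f (x / y)))"

text \<open>Integral of a \<open>(-\<infinity>, \<infinity>]\<close>-valued function whose negative part is integrable, as positive part
  minus negative part (\<open>e2ennreal\<close> sends negative values to \<open>0\<close>).\<close>

definition ereal_integral :: "'b measure \<Rightarrow> 'b set \<Rightarrow> ('b \<Rightarrow> ereal) \<Rightarrow> ereal" where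
  "ereal_integral \<mu> S g =
     enn2ereal (\<integral>\<^sup>+x\<in>S. e2ennreal (g x) \<partial>\<mu>) - enn2ereal (\<integral>\<^sup>+x\<in>S. e2ennreal (- g x) \<partial>\<mu>)"

definition pw_space ::
    "('a::complex_hilbert \<Rightarrow>\<^sub>L 'a) \<Rightarrow> ('a \<Rightarrow>\<^sub>L 'a) \<Rightarrow> 'a set" where
  "pw_space A B = closure (range (A + B))"

text \<open>\<open>T\<close> maps \<open>H\<close> into the subspace \<open>pw_space A B\<close>; seen as an operator on \<open>H\<close>, its adjoint
  restricts to \<open>T\<^sup>*\<close> on that subspace.\<close>

definition pw_T ::
    "('a::complex_hilbert \<Rightarrow>\<^sub>L 'a) \<Rightarrow> ('a \<Rightarrow>\<^sub>L 'a) \<Rightarrow> ('a \<Rightarrow>\<^sub>L 'a)" where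
  "pw_T A B = op_sqrt (A + B)"

definition pos_contraction_on :: "'a::complex_hilbert set \<Rightarrow> ('a \<Rightarrow>\<^sub>L 'a) \<Rightarrow> bool" where
  "pos_contraction_on M R \<longleftrightarrow> op_on M R \<and> pos_op R \<and> norm R \<le> 1"

definition pw_R ::
    "('a::complex_hilbert \<Rightarrow>\<^sub>L 'a) \<Rightarrow> ('a \<Rightarrow>\<^sub>L 'a) \<Rightarrow> ('a \<Rightarrow>\<^sub>L 'a)" where
  "pw_R A B = (THE R :: 'a \<Rightarrow>\<^sub>L 'a. \<exists>S :: 'a \<Rightarrow>\<^sub>L 'a.
     pos_contraction_on (pw_space A B) R \<and> pos_contraction_on (pw_space A B) S \<and>
     (\<forall>x\<in>pw_space A B. R x + S x = x) \<and>
     A = op_adj (pw_T A B) o\<^sub>L R o\<^sub>L pw_T A B \<and>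
     B = op_adj (pw_T A B) o\<^sub>L S o\<^sub>L pw_T A B)"

definition operator_perspective ::
    "(real \<Rightarrow> real) \<Rightarrow> ('a::complex_hilbert \<Rightarrow>\<^sub>L 'a) \<Rightarrow> ('a \<Rightarrow>\<^sub>L 'a) \<Rightarrow>
     (('a \<Rightarrow>\<^sub>L 'a) \<Rightarrow> complex) \<Rightarrow> ereal" where
  "operator_perspective f A B \<rho> =
     ereal_integral
       (scalar_measure (\<lambda>\<Delta>. \<rho> (op_adj (pw_T A B) o\<^sub>L
          spectral_measure (pw_space A B) (pw_R A B) \<Delta> o\<^sub>L pw_T A B)))
       {0..1} (\<lambda>r. perspective f r (1 - r))"

end

theory Submission
  imports Defs "HOL-Probability.Probability"
begin

text \<open>Write \<open>\<mu>\<^sub>A\<^sub>,\<^sub>B\<close> for the measure \<open>\<langle>v, T\<^sup>* E\<^sub>R T v\<rangle>\<close> on \<open>[0, 1]\<close>. For \<open>\<alpha>, \<beta> > 0\<close> completing the square gives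
  \<open>\<integral> (2r - 1)\<^sup>2 / (\<alpha>r + \<beta>(1 - r)) d\<mu>\<^sub>A\<^sub>,\<^sub>B = sup\<^sub>\<eta> 2\<langle>(A - B)v, \<eta>\<rangle> - \<langle>\<eta>, (\<alpha>A + \<beta>B)\<eta>\<rangle>\<close>,
  so this integral decreases when the same positive operator is added to \<open>A\<close> and \<open>B\<close>, and it is
  continuous along \<open>X\<^sub>n \<longlongrightarrow> 0\<close>. These kernels are the perspectives of \<open>(t - 1)\<^sup>2 / (t + s)\<close>.

  On compact subsets of \<open>(0, \<infinity>)\<close> an operator convex \<open>f\<close> is a uniform limit of sums of affine functions and
  nonnegative multiples of \<open>(t - 1)\<^sup>2 / (t + s)\<close>. By convexity finite sets suffice, and there duality reduces the
  claim to \<open>\<Sum> a\<^sub>x f(x) \<ge> 0\<close> for all \<open>a\<close> that are nonnegative on the generators. Up to a Vandermonde factor such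
  an \<open>a\<close> consists of the values of a polynomial that is nonnegative on a half line, hence a combination of
  \<open>q\<^sup>2\<close> and \<open>x r\<^sup>2\<close>; for these the inequality is midpoint convexity at a pair of matrices differing by a
  reflection (Kraus).

  Subtracting the supporting line of \<open>f\<close> at \<open>1\<close> makes the perspective nonnegative and zero on the
  diagonal. Contracting \<open>[0, 1]\<close> towards \<open>1/2\<close> exhibits it as an increasing limit of functions within reach of the
  approximation, endpoint values included. So the value at \<open>(A + X\<^sub>n, B + X\<^sub>n)\<close> is at most that at \<open>(A, B)\<close>,
  and Fatou's lemma gives the reverse inequality in the limit.\<close>

section \<open>The Hausdorff moment problem\<close>

text \<open>The operator R depends on A and B through an inverse square root of A + B, so the effect
  of a common summand X cannot be read off the integrals over \<mu>. The supremum formula contains A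
  and B only linearly: for a fixed \<eta> the difference A - B ignores X, the subtracted form grows
  with it, and the value is continuous. These properties pass to sums, nonnegative multiples and
  uniform limits of kernels, which fixes the kind of approximation wanted for f. Uniform
  approximation fails near r = 0 and r = 1, where the perspective may be infinite. The contraction
  towards 1/2 is affine because an affine contraction turns a kernel into a multiple of a kernel; it
  increases to the perspective because a convex function with minimum 0 at 1 has a perspective
  growing away from 1/2. The point 1/2 is the diagonal: the pair (X, X) has its whole measure there,
  so X contributes nothing when the value at 1/2 is 0. A normal functional is split by the square
  root of its density into a countable sum of vector functionals, and for a single vector the
  spectral measure comes from a moment problem.\<close>

definition poly_moment :: "(nat \<Rightarrow> real) \<Rightarrow> real poly \<Rightarrow> real" where
  "poly_moment m p = (\<Sum>i\<le>degree p. coeff p i * m i)"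

lemma poly_moment_eq:
  assumes "degree p \<le> N"
  shows "poly_moment m p = (\<Sum>i\<le>N. coeff p i * m i)"
  unfolding poly_moment_def
  by (rule sum.mono_neutral_left) (use assms in \<open>auto simp: coeff_eq_0\<close>)

lemma poly_moment_add: "poly_moment m (p + q) = poly_moment m p + poly_moment m q"
proof -
  let ?N = "max (degree p) (degree q)"
  have "poly_moment m (p + q) = (\<Sum>i\<le>?N. coeff (p + q) i * m i)"
    by (rule poly_moment_eq) (simp add: degree_add_le_max)
  also have "\<dots> = (\<Sum>i\<le>?N. coeff p i * m i) + (\<Sum>i\<le>?N. coeff q i * m i)"
    by (simp add: algebra_simps sum.distrib)
  also have "\<dots> = poly_moment m p + poly_moment m q"
    by (simp add: poly_moment_eq[symmetric])
  finally show ?thesis .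
qed

lemma poly_moment_smult: "poly_moment m (Polynomial.smult c p) = c * poly_moment m p"
  by (subst poly_moment_eq[of "Polynomial.smult c p" "degree p"])
    (auto simp: poly_moment_def sum_distrib_left mult.assoc)

lemma poly_moment_diff: "poly_moment m (p - q) = poly_moment m p - poly_moment m q"
  using poly_moment_add[of m p "Polynomial.smult (-1) q"] poly_moment_smult[of m "-1" q] by simp

lemma poly_moment_sum: "poly_moment m (\<Sum>i\<in>A. f i) = (\<Sum>i\<in>A. poly_moment m (f i))"
  by (induction A rule: infinite_finite_induct) (auto simp: poly_moment_add, simp_all add: poly_moment_def)

lemma poly_moment_X_power: "poly_moment m ([:0, 1:] ^ n) = m n"
proof -
  have e: "[:0, 1::real:] ^ n = monom 1 n"
    by (simp add: monom_altdef)
  show ?thesis unfolding e poly_moment_def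
    by (subst sum.remove[of _ n]) (auto simp: degree_monom_eq)
qed

text \<open>Ratios of falling factorials replace (k/n)^j because they are exact against binomial
  weights: each factor lowers both entries of the binomial coefficient by one. The discrete laws
  below then have the prescribed moments in this factorial form.\<close>

lemma binomial_falling_ratio:
  assumes "j \<le> n" "k \<le> n"
  shows "real (n choose k) * (\<Prod>i<j. (real k - real i) / (real n - real i)) =
    (if j \<le> k then real ((n - j) choose (k - j)) else 0)"
  using assms
proof (induction j)
  case 0
  then show ?case by simp
next
  case (Suc j)
  have IH: "real (n choose k) * (\<Prod>i<j. (real k - real i) / (real n - real i)) =
    (if j \<le> k then real ((n - j) choose (k - j)) else 0)" using Suc by simp
  have "real (n choose k) * (\<Prod>i<Suc j. (real k - real i) / (real n - real i)) =
     (if j \<le> k then real ((n - j) choose (k - j)) else 0) * ((real k - real j) / (real n - real j))"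
    by (simp add: IH[symmetric])
  also have "\<dots> = (if Suc j \<le> k then real ((n - Suc j) choose (k - Suc j)) else 0)"
  proof (cases "Suc j \<le> k")
    case True
    then obtain l where k: "k = Suc j + l" by (metis le_Suc_ex)
    from Suc.prems obtain d where n: "n = Suc j + d" by (metis le_Suc_ex)
    have "real (Suc l) * real (Suc d choose Suc l) = real (Suc d) * real (d choose l)"
      by (metis Suc_times_binomial of_nat_mult)
    then show ?thesis by (simp add: k n field_simps)
  qed auto
  finally show ?case .
qed

text \<open>All factors have modulus at most 1, so the products differ by at most the sum of the
  differences of their factors. The assumption 2 j \<le> n serves twice: it keeps the negative
  factors, those with k < i, above -1, and it bounds n - i from below by n / 2.\<close>

lemma falling_ratio_approx:
  assumes "k \<le> n" "2 * j \<le> n" "0 < n"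
  shows "\<bar>(\<Prod>i<j. (real k - real i) / (real n - real i)) - (real k / real n) ^ j\<bar>
    \<le> real j * (2 * real j / real n)"
proof -
  have 1: "norm ((\<Prod>i\<in>{..<j}. (real k - real i) / (real n - real i)) - (\<Prod>i\<in>{..<j}. real k / real n))
    \<le> (\<Sum>i\<in>{..<j}. norm ((real k - real i) / (real n - real i) - real k / real n))"
  proof (rule norm_prod_diff)
    fix i assume "i \<in> {..<j}"
    then have "i < j" by simp
    then show "norm ((real k - real i) / (real n - real i)) \<le> 1"
      using assms by (auto simp: abs_le_iff divide_le_eq)
    show "norm (real k / real n) \<le> 1" using assms by simp
  qed
  also have "\<dots> \<le> (\<Sum>i\<in>{..<j}. 2 * real j / real n)"
  proof (rule sum_mono)
    fix i assume "i \<in> {..<j}"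
    then have i: "i < j" by simp
    with assms have ilt: "i < n" "real i \<le> real n / 2" by auto
    have e: "(real k - real i) / (real n - real i) - real k / real n
      = - (real i * (real n - real k) / (real n * (real n - real i)))"
      using ilt assms by (simp add: field_simps)
    have "real i * (real n - real k) / (real n * (real n - real i)) \<le> real j * real n / (real n * (real n / 2))"
      using ilt i assms by (intro frac_le mult_mono mult_pos_pos) auto
    moreover have "0 \<le> real i * (real n - real k) / (real n * (real n - real i))"
      using ilt assms by (intro divide_nonneg_nonneg mult_nonneg_nonneg) auto
    moreover have "real j * real n / (real n * (real n / 2)) = 2 * real j / real n"
      using assms by (simp add: field_simps)
    ultimately show "norm ((real k - real i) / (real n - real i) - real k / real n) \<le> 2 * real j / real n"
      unfolding e by (metis abs_minus_cancel abs_of_nonneg real_norm_def)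
  qed
  finally show ?thesis by simp
qed

text \<open>The binomial theorem for X + (1 - X) = 1 with exponent n - j, after X^j has been taken
  out.\<close>

lemma sum_falling_ratio_poly:
  assumes "j \<le> n"
  shows "(\<Sum>k\<le>n. Polynomial.smult (real (n choose k) * (\<Prod>i<j. (real k - real i) / (real n - real i)))
    ([:0, 1:] ^ k * [:1, -1:] ^ (n - k))) = [:0, 1:] ^ j"
proof -
  let ?X = "[:0, 1::real:]" and ?Y = "[:1, -1::real:]"
  have "(\<Sum>k\<le>n. Polynomial.smult (real (n choose k) * (\<Prod>i<j. (real k - real i) / (real n - real i))) (?X ^ k * ?Y ^ (n - k)))
    = (\<Sum>k\<le>n. Polynomial.smult (if j \<le> k then real ((n - j) choose (k - j)) else 0) (?X ^ k * ?Y ^ (n - k)))"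
    using assms by (intro sum.cong) (auto simp: binomial_falling_ratio)
  also have "\<dots> = (\<Sum>k\<in>{j..n}. Polynomial.smult (real ((n - j) choose (k - j))) (?X ^ k * ?Y ^ (n - k)))"
    by (rule sum.mono_neutral_cong_right) auto
  also have "\<dots> = (\<Sum>i\<le>n - j. Polynomial.smult (real ((n - j) choose i)) (?X ^ (i + j) * ?Y ^ (n - j - i)))"
    by (rule sum.reindex_bij_witness[of _ "\<lambda>i. i + j" "\<lambda>k. k - j"]) (use assms in auto)
  also have "\<dots> = ?X ^ j * (\<Sum>i\<le>n - j. of_nat ((n - j) choose i) * ?X ^ i * ?Y ^ (n - j - i))"
    by (simp add: sum_distrib_left power_add of_nat_poly mult_ac)
  also have "\<dots> = ?X ^ j * (?X + ?Y) ^ (n - j)"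
    by (simp only: binomial_ring)
  also have "?X + ?Y = 1" by simp
  finally show ?thesis by simp
qed

lemma isCont_clamp_power: "isCont (\<lambda>x::real. (max 0 (min 1 x)) ^ j) x"
  by (intro continuous_intros)

text \<open>Bernstein's construction: the value of the functional at C(n,k) X^k (1 - X)^(n-k)
  becomes the probability of an atom at k/n. All these laws live on [0,1], hence are tight, and a
  weak limit along a subsequence has the prescribed moments.\<close>

lemma hausdorff_moment_normalized:
  fixes m :: "nat \<Rightarrow> real"
  assumes pos: "\<And>k l. 0 \<le> poly_moment m ([:0, 1:] ^ k * [:1, -1:] ^ l)" and m0: "m 0 = 1"
  shows "\<exists>M. real_distribution M \<and> (AE x in M. x \<in> {0..1}) \<and> (\<forall>n. (\<integral>x. x ^ n \<partial>M) = m n)"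
proof -
  define w where "w n k = (if k \<le> n then real (n choose k) * poly_moment m ([:0, 1:] ^ k * [:1, -1:] ^ (n - k)) else 0)"
    for n k
  have w_nonneg: "0 \<le> w n k" for n k by (simp add: w_def pos)
  have w_fall: "(\<Sum>k\<le>n. w n k * (\<Prod>i<j. (real k - real i) / (real n - real i))) = m j" if "j \<le> n" for n j
  proof -
    have "(\<Sum>k\<le>n. w n k * (\<Prod>i<j. (real k - real i) / (real n - real i))) =
      (\<Sum>k\<le>n. poly_moment m (Polynomial.smult (real (n choose k) * (\<Prod>i<j. (real k - real i) / (real n - real i)))
         ([:0, 1:] ^ k * [:1, -1:] ^ (n - k))))"
      by (intro sum.cong) (auto simp: w_def poly_moment_smult mult_ac)
    also have "\<dots> = poly_moment m ([:0, 1:] ^ j)"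
      by (simp only: sum_falling_ratio_poly[OF that] poly_moment_sum[symmetric])
    finally show ?thesis by (simp add: poly_moment_X_power)
  qed
  have w_sum: "(\<Sum>k\<le>n. w n k) = 1" for n
    using w_fall[of 0 n] m0 by simp
  have w_int: "(\<integral>\<^sup>+k. ennreal (w n k) \<partial>count_space UNIV) = 1" for n
  proof -
    have "(\<integral>\<^sup>+k. ennreal (w n k) \<partial>count_space UNIV) = (\<Sum>k\<in>{..n}. ennreal (w n k))"
      by (rule nn_integral_count_space') (auto simp: w_def)
    then show ?thesis using w_sum[of n] w_nonneg by (simp add: sum_ennreal)
  qed
  define P where "P n = embed_pmf (w n)" for n
  have pmf_P: "pmf (P n) k = w n k" for n k
    unfolding P_def by (rule pmf_embed_pmf[OF w_nonneg w_int])
  have set_P: "set_pmf (P n) \<subseteq> {..n}" for n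
    by (auto simp: set_pmf_iff pmf_P w_def split: if_splits)
  define D where "D n = distr (measure_pmf (P n)) borel (\<lambda>k. real k / real n)" for n
  have D_dist: "real_distribution (D n)" for n
    unfolding D_def by (rule prob_space.real_distribution_distr) (auto simp: measure_pmf.prob_space_axioms)
  have D_int: "(\<integral>x. f x \<partial>D n) = (\<Sum>k\<le>n. f (real k / real n) * w n k)"
    if [measurable]: "f \<in> borel_measurable borel" for f :: "real \<Rightarrow> real" and n
  proof -
    have "(\<integral>x. f x \<partial>D n) = (\<integral>k. f (real k / real n) \<partial>measure_pmf (P n))"
      unfolding D_def by (rule integral_distr) auto
    also have "\<dots> = (\<Sum>k\<in>{..n}. f (real k / real n) * pmf (P n) k)"
      by (rule integral_measure_pmf_real) (use set_P[of n] in auto)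
    finally show ?thesis by (simp add: pmf_P)
  qed
  have D_unit: "real k / real n \<in> {0..1}" if "k \<le> n" for k n
    using that by (cases "n = 0") auto
  have "tight D"
    unfolding tight_def
  proof (intro conjI allI impI D_dist)
    fix e :: real assume e: "0 < e"
    have "measure (D n) {-1<..1} = 1" for n
    proof -
      have "measure (D n) {-1<..1} = measure (P n) ((\<lambda>k. real k / real n) -` {-1<..1} \<inter> space (measure_pmf (P n)))"
        unfolding D_def by (rule measure_distr) auto
      also have "\<dots> = 1"
      proof (subst measure_pmf.prob_eq_1)
        have "-1 < real k / real n \<and> real k / real n \<le> 1" if "k \<in> set_pmf (P n)" for k
        proof -
          have "k \<le> n" using that set_P[of n] by auto
          from D_unit[OF this] have "0 \<le> real k / real n" "real k / real n \<le> 1" by simp_all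
          then show ?thesis by linarith
        qed
        then show "AE k in measure_pmf (P n). k \<in> (\<lambda>k. real k / real n) -` {-1<..1} \<inter> space (measure_pmf (P n))"
          by (simp add: AE_measure_pmf_iff)
      qed simp
      finally show ?thesis .
    qed
    with e show "\<exists>a b. a < b \<and> (\<forall>n. 1 - e < measure (D n) {a<..b})"
      by (intro exI[of _ "-1"] exI[of _ 1]) auto
  qed
  from tight_imp_convergent_subsubsequence[OF this strict_mono_id]
  obtain r M where r: "strict_mono r" and M: "real_distribution M" and wc: "weak_conv_m (D \<circ> id \<circ> r) M"
    by blast
  interpret M: real_distribution M by fact
  \<comment> \<open>Weak convergence tests bounded continuous functions on the line, so the powers
    are composed with the clamp to [0,1], which changes nothing on the supports.\<close>
  let ?c = "\<lambda>x::real. max 0 (min 1 x)"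
  have conv: "(\<lambda>n. integral\<^sup>L (D (r n)) f) \<longlonglongrightarrow> integral\<^sup>L M f"
    if "\<And>x. isCont f x" "\<And>x. norm (f x) \<le> B" for f :: "real \<Rightarrow> real" and B
    using weak_conv_imp_integral_bdd_continuous_conv[OF _ M wc that] D_dist by (simp add: o_def)
  have AE: "AE x in M. x \<in> {0..1}"
  proof -
    \<comment> \<open>Bounded, continuous and zero exactly on [0,1]: the integral vanishes along the
      sequence, hence in the limit.\<close>
    let ?g = "\<lambda>x::real. min 1 \<bar>x - ?c x\<bar>"
    have cont: "isCont ?g x" for x by (intro continuous_intros)
    have gm[measurable]: "?g \<in> borel_measurable borel" by measurable
    have "(\<lambda>n. integral\<^sup>L (D (r n)) ?g) \<longlonglongrightarrow> integral\<^sup>L M ?g"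
      by (rule conv[OF cont, of 1]) auto
    moreover have "integral\<^sup>L (D n) ?g = 0" for n
      unfolding D_int[OF gm] using D_unit by (intro sum.neutral) force
    ultimately have "integral\<^sup>L M ?g = 0" by (simp add: LIMSEQ_const_iff)
    moreover have "integrable M ?g"
      by (rule M.integrable_const_bound[where B=1]) auto
    ultimately have "AE x in M. ?g x = 0"
      by (subst (asm) integral_nonneg_eq_0_iff_AE) auto
    then show ?thesis by eventually_elim (auto split: if_splits simp: min_def max_def)
  qed
  have "(\<integral>x. x ^ j \<partial>M) = m j" for j
  proof -
    have "(\<lambda>n. integral\<^sup>L (D (r n)) (\<lambda>x. ?c x ^ j)) \<longlonglongrightarrow> integral\<^sup>L M (\<lambda>x. ?c x ^ j)"
      by (rule conv[of _ 1]) (auto intro!: isCont_clamp_power simp: power_le_one)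
    moreover have "(\<lambda>n. integral\<^sup>L (D n) (\<lambda>x. ?c x ^ j)) \<longlonglongrightarrow> m j"
    proof (rule Lim_null[THEN iffD2], rule Lim_null_comparison)
      show "\<forall>\<^sub>F n in sequentially. norm (integral\<^sup>L (D n) (\<lambda>x. ?c x ^ j) - m j) \<le> real j * (2 * real j / real n)"
        using eventually_gt_at_top[of "2 * j"]
      proof eventually_elim
        case (elim n)
        have "integral\<^sup>L (D n) (\<lambda>x. ?c x ^ j) = (\<Sum>k\<le>n. ?c (real k / real n) ^ j * w n k)"
          by (rule D_int) measurable
        also have "\<dots> = (\<Sum>k\<le>n. w n k * (real k / real n) ^ j)"
          using D_unit by (intro sum.cong) (auto simp: min_absorb2 max_absorb2)
        finally have "norm (integral\<^sup>L (D n) (\<lambda>x. ?c x ^ j) - m j)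
          = norm (\<Sum>k\<le>n. w n k * ((real k / real n) ^ j - (\<Prod>i<j. (real k - real i) / (real n - real i))))"
          using w_fall[of j n] elim by (simp add: sum_subtractf algebra_simps)
        also have "\<dots> \<le> (\<Sum>k\<le>n. w n k * (real j * (2 * real j / real n)))"
        proof (intro order_trans[OF norm_sum] sum_mono)
          fix k assume "k \<in> {..n}"
          then have "\<bar>(real k / real n) ^ j - (\<Prod>i<j. (real k - real i) / (real n - real i))\<bar> \<le> real j * (2 * real j / real n)"
            using falling_ratio_approx[of k n j] elim by (simp add: abs_minus_commute)
          from mult_left_mono[OF this w_nonneg]
          show "norm (w n k * ((real k / real n) ^ j - (\<Prod>i<j. (real k - real i) / (real n - real i))))
            \<le> w n k * (real j * (2 * real j / real n))"
            by (simp only: real_norm_def abs_mult abs_of_nonneg[OF w_nonneg])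
        qed
        also have "\<dots> = (\<Sum>k\<le>n. w n k) * (real j * (2 * real j / real n))"
          by (rule sum_distrib_right[symmetric])
        also have "\<dots> = real j * (2 * real j / real n)"
          by (subst w_sum) simp
        finally show ?case .
      qed
      show "(\<lambda>n. real j * (2 * real j / real n)) \<longlonglongrightarrow> 0"
        by real_asymp
    qed
    then have "(\<lambda>n. integral\<^sup>L (D (r n)) (\<lambda>x. ?c x ^ j)) \<longlonglongrightarrow> m j"
      using LIMSEQ_subseq_LIMSEQ[OF _ r] by (fastforce simp: o_def)
    ultimately have "integral\<^sup>L M (\<lambda>x. ?c x ^ j) = m j" by (rule LIMSEQ_unique)
    moreover have "integral\<^sup>L M (\<lambda>x. ?c x ^ j) = integral\<^sup>L M (\<lambda>x. x ^ j)"
      by (rule integral_cong_AE) (use AE in \<open>auto simp: min_absorb2 max_absorb2\<close>)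
    ultimately show ?thesis by simp
  qed
  with M AE show ?thesis by blast
qed

definition unit_measure :: "real measure \<Rightarrow> bool" where
  "unit_measure M \<longleftrightarrow> finite_measure M \<and> sets M = sets borel \<and> (AE x in M. x \<in> {0..1})"

text \<open>Division by \<open>m 0\<close> reduces to probabilities. If \<open>m 0\<close> is 0, the
  moments are nonnegative and decreasing, so all of them vanish and the null measure serves.\<close>

theorem hausdorff_moment:
  fixes m :: "nat \<Rightarrow> real"
  assumes pos: "\<And>k l. 0 \<le> poly_moment m ([:0, 1:] ^ k * [:1, -1:] ^ l)"
  shows "\<exists>M. unit_measure M \<and> (\<forall>n. (\<integral>x. x ^ n \<partial>M) = m n)"
proof (cases "m 0 = 0")
  case True
  have "0 \<le> m n" for n using pos[of n 0] by (simp add: poly_moment_X_power)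
  moreover have "m (Suc n) \<le> m n" for n
  proof -
    have e: "[:0, 1::real:] ^ n * [:1, -1:] ^ 1 = [:0, 1:] ^ n - [:0, 1:] ^ Suc n"
      by (simp add: algebra_simps)
    show ?thesis using pos[of n 1] unfolding e poly_moment_diff poly_moment_X_power by simp
  qed
  then have "m n \<le> m 0" for n by (metis decseq_Suc_iff decseqD le0)
  ultimately have "m n = 0" for n using True by (metis order_antisym)
  moreover have "finite_measure (null_measure borel :: real measure)"
    by (rule finite_measureI) simp
  moreover have "AE x in null_measure borel. x \<in> {0..1::real}"
    by (rule AE_I[of _ _ UNIV]) auto
  ultimately show ?thesis
    by (intro exI[of _ "null_measure borel"]) (simp add: unit_measure_def)
next
  case False
  have "0 \<le> m 0" using pos[of 0 0] by (simp add: poly_moment_def)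
  with False have m0: "0 < m 0" by simp
  have "poly_moment (\<lambda>i. m i / m 0) p = poly_moment m p / m 0" for p
    by (simp add: poly_moment_def sum_divide_distrib)
  then have "0 \<le> poly_moment (\<lambda>i. m i / m 0) ([:0, 1:] ^ k * [:1, -1:] ^ l)" for k l
    using pos[of k l] m0 by simp
  from hausdorff_moment_normalized[OF this] m0
  obtain M where M: "real_distribution M" "AE x in M. x \<in> {0..1}" "\<And>n. (\<integral>x. x ^ n \<partial>M) = m n / m 0"
    by auto
  interpret real_distribution M by fact
  let ?N = "density M (\<lambda>_. ennreal (m 0))"
  have "finite_measure ?N"
    by (rule finite_measureI) (simp add: emeasure_density nn_integral_cmult ennreal_mult_eq_top_iff emeasure_eq_measure)
  moreover have "AE x in ?N. x \<in> {0..1}"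
    using M(2) by (subst AE_density) auto
  moreover have "(\<integral>x. x ^ n \<partial>?N) = m n" for n
    using m0 M(3)[of n] by (subst integral_density) auto
  ultimately show ?thesis
    by (intro exI[of _ ?N]) (simp add: unit_measure_def)
qed

section \<open>Bounded Borel functional calculus\<close>

text \<open>Boundedness is asked on [0,1] only, the interval that carries all the measures, so that
  polynomials belong to the class.\<close>

definition bdd_borel :: "(real \<Rightarrow> real) \<Rightarrow> bool" where
  "bdd_borel g \<longleftrightarrow> g \<in> borel_measurable borel \<and> (\<exists>K. \<forall>r\<in>{0..1}. \<bar>g r\<bar> \<le> K)"

lemma bdd_borelI:
  "g \<in> borel_measurable borel \<Longrightarrow> (\<And>r. r \<in> {0..1} \<Longrightarrow> \<bar>g r\<bar> \<le> K) \<Longrightarrow> bdd_borel g"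
  unfolding bdd_borel_def by blast

lemma bdd_borel_measurable [measurable_dest]: "bdd_borel g \<Longrightarrow> g \<in> borel_measurable borel"
  by (simp add: bdd_borel_def)

lemma bdd_borelE:
  assumes "bdd_borel g"
  obtains K where "0 \<le> K" "\<And>r. r \<in> {0..1} \<Longrightarrow> \<bar>g r\<bar> \<le> K"
proof -
  from assms obtain K where K: "\<forall>r\<in>{0..1}. \<bar>g r\<bar> \<le> K" by (auto simp: bdd_borel_def)
  show ?thesis
  proof (rule that)
    show "0 \<le> \<bar>K\<bar>" by simp
    show "\<bar>g r\<bar> \<le> \<bar>K\<bar>" if "r \<in> {0..1}" for r using bspec[OF K that] by linarith
  qed
qed

lemma bdd_borel_const [intro, simp]: "bdd_borel (\<lambda>_. c)"
  by (rule bdd_borelI[where K="\<bar>c\<bar>"]) auto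

lemma bdd_borel_power [intro, simp]: "bdd_borel (\<lambda>r. r ^ n)"
  by (rule bdd_borelI[where K=1]) (auto simp: power_abs power_le_one)

lemma bdd_borel_id [intro, simp]: "bdd_borel (\<lambda>r. r)"
  using bdd_borel_power[of 1] by simp

lemma bdd_borel_indicator [intro, simp]: "A \<in> sets borel \<Longrightarrow> bdd_borel (indicator A)"
  by (rule bdd_borelI[where K=1]) (auto simp: indicator_def)

lemma bdd_borel_add [intro]:
  assumes "bdd_borel f" "bdd_borel g" shows "bdd_borel (\<lambda>r. f r + g r)"
proof -
  note [measurable] = assms[THEN bdd_borel_measurable]
  obtain K L where "\<And>r. r \<in> {0..1} \<Longrightarrow> \<bar>f r\<bar> \<le> K" "\<And>r. r \<in> {0..1} \<Longrightarrow> \<bar>g r\<bar> \<le> L"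
    using assms by (metis bdd_borelE)
  then show ?thesis
    by (intro bdd_borelI[where K="K + L"]) (measurable, smt (verit))
qed

lemma bdd_borel_mult [intro]:
  assumes "bdd_borel f" "bdd_borel g" shows "bdd_borel (\<lambda>r. f r * g r)"
proof -
  note [measurable] = assms[THEN bdd_borel_measurable]
  obtain K L where "0 \<le> K" "\<And>r. r \<in> {0..1} \<Longrightarrow> \<bar>f r\<bar> \<le> K" "\<And>r. r \<in> {0..1} \<Longrightarrow> \<bar>g r\<bar> \<le> L"
    using assms by (metis bdd_borelE)
  then show ?thesis
    by (intro bdd_borelI[where K="K * L"]) (measurable, simp add: abs_mult mult_mono)
qed

lemma bdd_borel_diff [intro]:
  assumes "bdd_borel f" "bdd_borel g" shows "bdd_borel (\<lambda>r. f r - g r)"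
  using bdd_borel_add[OF assms(1) bdd_borel_mult[OF bdd_borel_const[of "-1"] assms(2)]] by simp

lemma bdd_borel_sum [intro]:
  "(\<And>i. i \<in> I \<Longrightarrow> bdd_borel (f i)) \<Longrightarrow> bdd_borel (\<lambda>r. \<Sum>i\<in>I. f i r)"
  by (induction I rule: infinite_finite_induct) auto

lemma bdd_borel_continuous:
  assumes "continuous_on UNIV f" shows "bdd_borel f"
proof -
  have "compact (f ` {0..1})"
    by (rule compact_continuous_image) (use assms continuous_on_subset in auto)
  then obtain K where "\<forall>x\<in>f ` {0..1}. norm x \<le> K" using compact_imp_bounded bounded_iff by metis
  then show ?thesis
    by (intro bdd_borelI[where K=K]) (auto intro: borel_measurable_continuous_onI assms)
qed

text \<open>Monomials generate the bounded Borel functions under linear combinations and bounded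
  pointwise limits on [0,1]: Bernstein polynomials reach the continuous functions, ramps the half
  lines, a Dynkin argument the Borel sets, and rounding of values everything else. Existence,
  multiplicativity and commutation of the functional calculus are all proved by this
  induction.\<close>

lemma bounded_borel_unit_induct [consumes 1, case_names power add scale lim]:
  assumes g: "bdd_borel g"
    and pow: "\<And>n. P (\<lambda>r. r ^ n)"
    and add: "\<And>f g. bdd_borel f \<Longrightarrow> bdd_borel g \<Longrightarrow> P f \<Longrightarrow> P g \<Longrightarrow> P (\<lambda>r. f r + g r)"
    and scale: "\<And>c f. bdd_borel f \<Longrightarrow> P f \<Longrightarrow> P (\<lambda>r. c * f r)"
    and lim: "\<And>F f K. (\<And>n::nat. bdd_borel (F n)) \<Longrightarrow> (\<And>n. P (F n)) \<Longrightarrow> bdd_borel f \<Longrightarrow>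
       (\<And>n r. r \<in> {0..1} \<Longrightarrow> \<bar>F n r\<bar> \<le> K) \<Longrightarrow>
       (\<And>r. r \<in> {0..1} \<Longrightarrow> (\<lambda>n. F n r) \<longlonglongrightarrow> f r) \<Longrightarrow> P f"
  shows "P g"
proof -
  have cong: "P f" if "P f'" "bdd_borel f'" "bdd_borel f" "\<And>r. r \<in> {0..1} \<Longrightarrow> f' r = f r" for f f'
  proof -
    obtain K where "\<And>r. r \<in> {0..1} \<Longrightarrow> \<bar>f' r\<bar> \<le> K" using \<open>bdd_borel f'\<close> by (metis bdd_borelE)
    then show ?thesis using that by (intro lim[of "\<lambda>_. f'" f K]) auto
  qed
  have const: "P (\<lambda>_. c)" for c
    using scale[OF _ pow[of 0], of c] by simp
  have sums: "P (\<lambda>r. \<Sum>i\<in>I. c i * f i r)" if "\<And>i. i \<in> I \<Longrightarrow> bdd_borel (f i) \<and> P (f i)"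
    for I and c :: "'i \<Rightarrow> real" and f :: "'i \<Rightarrow> real \<Rightarrow> real"
    using that
  proof (induction I rule: infinite_finite_induct)
    case (insert x F)
    then have "P (\<lambda>r. c x * f x r + (\<Sum>i\<in>F. c i * f i r))"
      by (intro add scale bdd_borel_sum bdd_borel_mult bdd_borel_const) auto
    with insert show ?case by simp
  qed (auto simp: const)
  have bern: "P (\<lambda>r. r ^ k * (1 - r) ^ l)" for k l
  proof (induction l arbitrary: k)
    case 0
    then show ?case using pow[of k] by simp
  next
    case (Suc l)
    have "P (\<lambda>r. r ^ k * (1 - r) ^ l + (-1) * (r ^ Suc k * (1 - r) ^ l))"
      by (intro add scale Suc bdd_borel_mult bdd_borel_const bdd_borel_power bdd_borel_continuous continuous_intros)
    also have "(\<lambda>r::real. r ^ k * (1 - r) ^ l + (-1) * (r ^ Suc k * (1 - r) ^ l)) = (\<lambda>r. r ^ k * (1 - r) ^ Suc l)"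
      by (rule ext) (simp add: algebra_simps)
    finally show ?case .
  qed
  have cont: "P f" if f: "continuous_on UNIV f" for f
  proof -
    have "continuous_on {0..1} f" using f continuous_on_subset by auto
    from Bernstein_Weierstrass[OF this]
    have "\<forall>m::nat. \<exists>N. \<forall>n x. N \<le> n \<and> x \<in> {0..1} \<longrightarrow>
        \<bar>f x - (\<Sum>k\<le>n. f (real k / real n) * Bernstein n k x)\<bar> < inverse (real (Suc m))"
      by (metis inverse_positive_iff_positive of_nat_0_less_iff zero_less_Suc)
    then obtain N where N: "\<And>m x. x \<in> {0..1} \<Longrightarrow>
        \<bar>f x - (\<Sum>k\<le>N m. f (real k / real (N m)) * Bernstein (N m) k x)\<bar> < inverse (real (Suc m))"
      by (metis order_refl)
    define F where "F m x = (\<Sum>k\<le>N m. (f (real k / real (N m)) * real (N m choose k)) * (x ^ k * (1 - x) ^ (N m - k)))"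
      for m x
    have F: "\<bar>f x - F m x\<bar> < inverse (real (Suc m))" if "x \<in> {0..1}" for m x
      using N[OF that, of m] by (simp add: F_def Bernstein_def mult.assoc)
    have contF: "continuous_on UNIV (F m)" for m
      unfolding F_def by (intro continuous_intros)
    obtain K where K: "\<And>r. r \<in> {0..1} \<Longrightarrow> \<bar>f r\<bar> \<le> K"
      using bdd_borel_continuous[OF f] by (metis bdd_borelE)
    show ?thesis
    proof (rule lim[of F f "K + 1"])
      show "P (F m)" for m
        unfolding F_def
        by (rule sums) (auto intro!: bern bdd_borel_continuous continuous_intros)
      show "\<bar>F n r\<bar> \<le> K + 1" if "r \<in> {0..1}" for n r
        using F[OF that, of n] K[OF that] le_imp_inverse_le[of 1 "real (Suc n)"] by (auto simp del: of_nat_Suc)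
      show "(\<lambda>n. F n r) \<longlonglongrightarrow> f r" if "r \<in> {0..1}" for r
      proof (rule Lim_null[THEN iffD2], rule Lim_null_comparison[OF _ LIMSEQ_inverse_real_of_nat])
        show "\<forall>\<^sub>F n in sequentially. norm (F n r - f r) \<le> inverse (real (Suc n))"
          using F[OF that] by (intro always_eventually allI) (simp add: abs_minus_commute less_imp_le del: of_nat_Suc)
      qed
    qed (use bdd_borel_continuous contF f in auto)
  qed
  have atMost: "P (indicator {..a})" for a :: real
  proof (rule lim[of "\<lambda>n r. max 0 (min 1 (1 - real n * (r - a)))" _ 1])
    show "(\<lambda>n. max 0 (min 1 (1 - real n * (r - a)))) \<longlonglongrightarrow> indicator {..a} r" for r
    proof (cases "r \<le> a")
      case True
      then have "max 0 (min 1 (1 - real n * (r - a))) = 1" for n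
        by (auto simp: mult_nonneg_nonpos min_def max_def)
      then show ?thesis using True by simp
    next
      case False
      then have "filterlim (\<lambda>n. real n * (r - a)) at_top sequentially"
        by (intro filterlim_at_top_mult_tendsto_pos[OF tendsto_const] filterlim_real_sequentially) auto
      then have "\<forall>\<^sub>F n in sequentially. 1 \<le> real n * (r - a)"
        by (auto simp: filterlim_at_top)
      then have "\<forall>\<^sub>F n in sequentially. max 0 (min 1 (1 - real n * (r - a))) = indicator {..a} r"
        by eventually_elim (use False in \<open>auto simp: min_def max_def\<close>)
      then show ?thesis by (rule tendsto_eventually)
    qed
  qed (auto intro!: cont bdd_borel_continuous continuous_intros)
  have ind: "P (indicator A)" if "A \<in> sets borel" for A :: "real set"
  proof -
    let ?G = "range (\<lambda>a::real. {..a})"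
    have "Int_stable ?G" by (auto simp: Int_stable_def)
    moreover have "?G \<subseteq> Pow UNIV" by auto
    moreover have eq: "sigma_sets UNIV ?G = sets borel" by (simp add: borel_eq_atMost)
    then have "A \<in> sigma_sets UNIV ?G" using that by simp
    ultimately show ?thesis
    proof (induction rule: sigma_sets_induct_disjoint)
      case (basic A)
      then show ?case using atMost by auto
    next
      case empty
      have "(indicator {} :: real \<Rightarrow> real) = (\<lambda>_. 0)" by auto
      then show ?case using const[of 0] by simp
    next
      case (compl A)
      have "P (\<lambda>r. 1 + (-1) * indicator A r)"
        using compl eq by (intro add scale const bdd_borel_const bdd_borel_mult bdd_borel_indicator) auto
      also have "(\<lambda>r. 1 + (-1) * indicator A r) = (indicator (UNIV - A) :: real \<Rightarrow> real)"
        by (rule ext) (auto simp: indicator_def)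
      finally show ?case .
    next
      case (union A)
      have m: "A i \<in> sets borel" for i using union eq by auto
      have e: "(\<Sum>i<n. indicator (A i) r) = (indicator (\<Union>i<n. A i) r :: real)" for n r
        by (rule indicator_UN_disjoint[symmetric])
           (use union in \<open>auto intro: disjoint_family_on_mono\<close>)
      show ?case
      proof (rule lim[of "\<lambda>n r. \<Sum>i<n. 1 * indicator (A i) r" _ 1])
        show "P (\<lambda>r. \<Sum>i<n. 1 * indicator (A i) r)" for n
          by (rule sums) (use union m in auto)
        show "(\<lambda>n. \<Sum>i<n. 1 * indicator (A i) r) \<longlonglongrightarrow> (indicator (\<Union>i. A i) r :: real)" for r
          using LIMSEQ_indicator_UN[of A r] by (simp add: e)
        show "\<bar>\<Sum>i<n. 1 * indicator (A i) r\<bar> \<le> (1::real)" for n r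
          by (simp only: mult_1 e) (simp add: indicator_def)
      qed (use m in auto)
    qed
  qed
  note [measurable] = bdd_borel_measurable[OF g]
  obtain K where K: "0 \<le> K" "\<And>r. r \<in> {0..1} \<Longrightarrow> \<bar>g r\<bar> \<le> K" using g by (metis bdd_borelE)
  \<comment> \<open>On [0,1] the integer floor((n+1) g) stays in the finite range
    \<open>I n\<close>, so \<open>F n\<close> is g rounded down to the grid of width
    1/(n+1).\<close>
  define S where "S n i = {r. \<lfloor>real (Suc n) * g r\<rfloor> = i}" for n and i :: int
  have S_meas: "S n i \<in> sets borel" for n i
    unfolding S_def by measurable
  define I where "I n = {\<lfloor>- (real (Suc n) * K)\<rfloor>..\<lfloor>real (Suc n) * K\<rfloor>}" for n
  define F where "F n r = (\<Sum>i\<in>I n. (real_of_int i / real (Suc n)) * indicator (S n i) r)" for n r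
  have F_eq: "F n r = real_of_int \<lfloor>real (Suc n) * g r\<rfloor> / real (Suc n)" if "r \<in> {0..1}" for n r
  proof -
    have "- (real (Suc n) * K) \<le> real (Suc n) * g r" "real (Suc n) * g r \<le> real (Suc n) * K"
      using K(2)[OF that] mult_left_mono[of "-K" "g r" "real (Suc n)"] by auto
    then have "\<lfloor>real (Suc n) * g r\<rfloor> \<in> I n" unfolding I_def by (auto intro: floor_mono)
    then show ?thesis
      unfolding F_def by (subst sum.remove[of _ "\<lfloor>real (Suc n) * g r\<rfloor>"]) (auto simp: I_def S_def indicator_def intro!: sum.neutral)
  qed
  have F_approx: "\<bar>F n r - g r\<bar> \<le> inverse (real (Suc n))" if "r \<in> {0..1}" for n r
  proof -
    have "\<bar>real_of_int \<lfloor>real (Suc n) * g r\<rfloor> - real (Suc n) * g r\<bar> \<le> 1" by linarith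
    moreover have "F n r - g r = (real_of_int \<lfloor>real (Suc n) * g r\<rfloor> - real (Suc n) * g r) / real (Suc n)"
      using F_eq[OF that] by (simp add: field_simps)
    ultimately show ?thesis by (simp add: abs_divide divide_right_mono inverse_eq_divide del: of_nat_Suc)
  qed
  show ?thesis
  proof (rule lim[of F g "K + 1"])
    show "P (F n)" for n unfolding F_def
      by (rule sums) (auto intro: S_meas ind)
    show "bdd_borel (F n)" for n unfolding F_def
      by (intro bdd_borel_sum bdd_borel_mult bdd_borel_const bdd_borel_indicator S_meas)
    show "\<bar>F n r\<bar> \<le> K + 1" if "r \<in> {0..1}" for n r
      using F_approx[OF that, of n] K(2)[OF that] le_imp_inverse_le[of 1 "real (Suc n)"] by (auto simp del: of_nat_Suc)
    show "(\<lambda>n. F n r) \<longlonglongrightarrow> g r" if "r \<in> {0..1}" for r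
    proof (rule Lim_null[THEN iffD2], rule Lim_null_comparison[OF _ LIMSEQ_inverse_real_of_nat])
      show "\<forall>\<^sub>F n in sequentially. norm (F n r - g r) \<le> inverse (real (Suc n))"
        using F_approx[OF that] by (intro always_eventually allI) simp
    qed
  qed (use g in auto)
qed

section \<open>Riesz representation and symmetric operators of a real Hilbert space\<close>

text \<open>Minimise |x|^2 - 2 \<phi>(x). By the parallelogram law a minimising sequence is Cauchy,
  and the first-order condition at its limit says that the limit represents \<phi>.\<close>

lemma riesz_representation:
  fixes \<phi> :: "'a::{real_inner,banach} \<Rightarrow> real"
  assumes \<phi>: "bounded_linear \<phi>"
  shows "\<exists>y. \<forall>x. \<phi> x = inner y x"
proof -
  interpret bounded_linear \<phi> by fact
  obtain K where K: "\<And>x. norm (\<phi> x) \<le> norm x * K" "0 < K" using pos_bounded by blast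
  define g where "g x = (norm x)\<^sup>2 - 2 * \<phi> x" for x
  have lower: "- (K\<^sup>2) \<le> g x" for x
  proof -
    have "0 \<le> (norm x - K)\<^sup>2" by simp
    then show ?thesis using K(1)[of x] by (simp add: g_def power2_eq_square algebra_simps)
  qed
  define d where "d = Inf (range g)"
  have bdd: "bdd_below (range g)" using lower by (auto intro!: bdd_belowI2)
  have d_le: "d \<le> g x" for x unfolding d_def by (rule cInf_lower) (use bdd in auto)
  have "\<exists>x. g x < d + inverse (real (Suc n))" for n
    using cInf_lessD[of "range g" "d + inverse (real (Suc n))"] by (auto simp: d_def simp del: of_nat_Suc)
  then obtain x where x: "\<And>n. g (x n) < d + inverse (real (Suc n))" by metis
  have par: "(norm (u - v))\<^sup>2 \<le> 2 * (g u + g v - 2 * d)" for u v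
  proof -
    define w where "w = (1/2) *\<^sub>R (u + v)"
    have "g u + g v - 2 * g w = (norm (u - v))\<^sup>2 / 2"
      unfolding g_def w_def power2_norm_eq_inner
      by (simp add: add scaleR inner_add_left inner_add_right inner_diff_left inner_diff_right inner_commute[of v u] field_simps)
    then show ?thesis using d_le[of w] by simp
  qed
  have "Cauchy x"
  proof (rule metric_CauchyI)
    fix e :: real assume e: "0 < e"
    then obtain N where N: "inverse (real (Suc N)) < e\<^sup>2 / 4"
      using reals_Archimedean[of "e\<^sup>2 / 4"] by auto
    show "\<exists>M. \<forall>m\<ge>M. \<forall>n\<ge>M. dist (x m) (x n) < e"
    proof (intro exI[of _ N] allI impI)
      fix m n assume mn: "N \<le> m" "N \<le> n"
      have "inverse (real (Suc m)) \<le> inverse (real (Suc N))" "inverse (real (Suc n)) \<le> inverse (real (Suc N))"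
        using mn by (auto intro!: le_imp_inverse_le)
      then have "(norm (x m - x n))\<^sup>2 < e\<^sup>2"
        using par[of "x m" "x n"] x[of m] x[of n] N by argo
      then show "dist (x m) (x n) < e"
        using e by (simp add: dist_norm power_less_imp_less_base)
    qed
  qed
  then obtain y where y: "x \<longlonglongrightarrow> y" using Cauchy_convergent_iff convergent_def by metis
  have "(\<lambda>n. g (x n)) \<longlonglongrightarrow> g y"
    unfolding g_def by (intro tendsto_intros y tendsto)
  moreover have "(\<lambda>n. d + inverse (real (Suc n))) \<longlonglongrightarrow> d + 0"
    by (intro tendsto_intros LIMSEQ_inverse_real_of_nat)
  ultimately have "g y \<le> d + 0"
    by (rule LIMSEQ_le) (use x less_imp_le in blast)
  then have min: "g y \<le> g z" for z using d_le[of z] by linarith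
  have "inner y h = \<phi> h" for h
  proof -
    let ?b = "inner y h - \<phi> h" and ?a = "(norm h)\<^sup>2"
    have q: "0 \<le> 2 * t * ?b + t\<^sup>2 * ?a" for t
    proof -
      have "(norm (y + t *\<^sub>R h))\<^sup>2 = (norm y)\<^sup>2 + 2 * t * inner y h + t\<^sup>2 * (norm h)\<^sup>2"
        unfolding power2_norm_eq_inner
        by (simp only: inner_add_left inner_add_right inner_scaleR_left inner_scaleR_right inner_commute[of h y]
            power2_eq_square) (simp add: algebra_simps)
      then have "g (y + t *\<^sub>R h) - g y = 2 * t * ?b + t\<^sup>2 * ?a"
        unfolding g_def by (simp add: add scaleR algebra_simps)
      then show ?thesis using min[of "y + t *\<^sub>R h"] by linarith
    qed
    define a b where "a = ?a" and "b = ?b"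
    have "b = 0"
    proof (cases "a = 0")
      case True
      then show ?thesis by (simp add: a_def b_def zero)
    next
      case False
      \<comment> \<open>The minimum of the quadratic in t is at t = - b / a.\<close>
      have "0 \<le> 2 * (- b / a) * b + (- b / a)\<^sup>2 * a"
        unfolding a_def b_def by (rule q)
      also have "\<dots> = - (b\<^sup>2 / a)"
        using False by (simp add: field_simps power2_eq_square)
      finally have "b\<^sup>2 / a \<le> 0" by simp
      moreover have "0 < a" using False by (simp add: a_def)
      ultimately show ?thesis by (simp add: divide_le_0_iff)
    qed
    then show ?thesis by (simp add: b_def)
  qed
  then show ?thesis by (intro exI[of _ y]) simp
qed

lemma bounded_form_representation:
  fixes b :: "'a::{real_inner,banach} \<Rightarrow> 'a \<Rightarrow> real"
  assumes "\<And>x x' y. b (x + x') y = b x y + b x' y" "\<And>c x y. b (c *\<^sub>R x) y = c * b x y"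
    and "\<And>x y y'. b x (y + y') = b x y + b x y'" "\<And>c x y. b x (c *\<^sub>R y) = c * b x y"
    and "\<And>x y. \<bar>b x y\<bar> \<le> K * norm x * norm y"
  shows "\<exists>G :: 'a \<Rightarrow>\<^sub>L 'a. \<forall>x y. inner x (G y) = b x y"
proof -
  have "\<exists>z. \<forall>x. b x y = inner z x" for y
    by (rule riesz_representation, rule bounded_linear_intro[of _ "K * norm y"])
      (use assms in \<open>auto simp: mult_ac\<close>)
  then obtain G where G: "\<And>y x. b x y = inner (G y) x" by metis
  have K: "0 \<le> \<bar>K\<bar>" by simp
  have "bounded_linear G"
  proof (rule bounded_linear_intro[of _ "\<bar>K\<bar>"])
    show "G (x + y) = G x + G y" for x y
      by (metis (no_types) G assms(3) inner_add_left vector_eq_rdot)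
    show "G (c *\<^sub>R x) = c *\<^sub>R G x" for c x
      by (metis (no_types) G assms(4) inner_scaleR_left vector_eq_rdot)
    show "norm (G x) \<le> norm x * \<bar>K\<bar>" for x
    proof (cases "G x = 0")
      case False
      have "(norm (G x))\<^sup>2 \<le> K * norm (G x) * norm x"
        using assms(5)[of "G x" x] G[of "G x" x] by (simp add: power2_norm_eq_inner)
      also have "\<dots> \<le> \<bar>K\<bar> * norm (G x) * norm x" by (intro mult_right_mono) auto
      finally have "norm (G x) * norm (G x) \<le> norm (G x) * (norm x * \<bar>K\<bar>)"
        by (simp add: power2_eq_square mult_ac)
      then show ?thesis using False by simp
    qed simp
  qed
  then show ?thesis
    by (intro exI[of _ "Blinfun G"]) (simp add: bounded_linear_Blinfun_apply G inner_commute)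
qed

lemma real_adjoint_exists:
  fixes A :: "'a::{real_inner,banach} \<Rightarrow>\<^sub>L 'a"
  shows "\<exists>A' :: 'a \<Rightarrow>\<^sub>L 'a. \<forall>x y. inner (A' x) y = inner x (A y)"
proof -
  have "\<exists>G :: 'a \<Rightarrow>\<^sub>L 'a. \<forall>x y. inner x (G y) = inner (A x) y"
  proof (rule bounded_form_representation[of "\<lambda>x y. inner (A x) y" "norm A"])
    show "\<bar>inner (A x) y\<bar> \<le> norm A * norm x * norm y" for x y
      by (meson Cauchy_Schwarz_ineq2 mult_right_mono norm_blinfun norm_ge_zero order_trans)
  qed (auto simp: blinfun.bilinear_simps inner_simps)
  then show ?thesis by (metis inner_commute)
qed

text \<open>Symmetry refers to the real inner product; together with complex linearity it is
  self-adjointness (\<open>sym_clinear_cinner\<close>). Working with the real form keeps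
  polarisation to two terms.\<close>

definition sym_op :: "('a::real_inner \<Rightarrow>\<^sub>L 'a) \<Rightarrow> bool" where
  "sym_op A \<longleftrightarrow> (\<forall>x y. inner x (A y) = inner (A x) y)"

lemma sym_opD: "sym_op A \<Longrightarrow> inner x (A y) = inner (A x) y"
  by (simp add: sym_op_def)

lemma sym_op_add: "sym_op A \<Longrightarrow> sym_op B \<Longrightarrow> sym_op (A + B)"
  by (simp add: sym_op_def blinfun.add_left inner_add_left inner_add_right)

lemma sym_op_diff: "sym_op A \<Longrightarrow> sym_op B \<Longrightarrow> sym_op (A - B)"
  by (simp add: sym_op_def blinfun.diff_left inner_diff_left inner_diff_right)

lemma sym_op_scaleR: "sym_op A \<Longrightarrow> sym_op (c *\<^sub>R A)"
  by (simp add: sym_op_def blinfun.scaleR_left)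

lemma sym_op_id: "sym_op id_blinfun"
  by (simp add: sym_op_def)

lemma sym_polarization:
  assumes "sym_op A"
  shows "inner x (A y) = (inner (x + y) (A (x + y)) - inner (x - y) (A (x - y))) / 4"
proof -
  have "inner y (A x) = inner x (A y)"
    using sym_opD[OF assms, of y x] by (simp add: inner_commute)
  then show ?thesis
    by (simp add: blinfun.add_right blinfun.diff_right inner_add_left inner_add_right inner_diff_left inner_diff_right)
qed

lemma sym_op_eqI:
  assumes "sym_op A" "sym_op B" "\<And>x. inner x (A x) = inner x (B x)"
  shows "A = B"
proof (rule blinfun_eqI)
  fix y
  have "inner x (A y) = inner x (B y)" for x
    by (simp only: sym_polarization[OF assms(1), of x y] sym_polarization[OF assms(2), of x y] assms(3))
  then show "A y = B y" by (metis vector_eq_ldot)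
qed

text \<open>Polarise <x, A y> at the vector x that is A y rescaled to the length of y; the
  parallelogram law then bounds it by c |y|^2 with no loss in the constant.\<close>

lemma sym_op_norm_le:
  fixes A :: "'a::real_inner \<Rightarrow>\<^sub>L 'a"
  assumes A: "sym_op A" and q: "\<And>x. \<bar>inner x (A x)\<bar> \<le> c * (norm x)\<^sup>2"
  shows "norm (A y) \<le> c * norm y"
proof (cases "A y = 0 \<or> y = 0")
  case True
  have "0 \<le> c * norm y" if "y \<noteq> 0"
  proof -
    have "0 \<le> c * (norm y)\<^sup>2" using q[of y] by linarith
    then show ?thesis using that by (simp add: zero_le_mult_iff)
  qed
  with True show ?thesis by (cases "y = 0") auto
next
  case False
  define t where "t = norm y / norm (A y)"
  define x where "x = t *\<^sub>R A y"
  have nx: "norm x = norm y" using False by (simp add: x_def t_def)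
  have "inner x (A y) \<le> (c * (norm (x + y))\<^sup>2 + c * (norm (x - y))\<^sup>2) / 4"
    using q[of "x + y"] q[of "x - y"] by (simp add: sym_polarization[OF A, of x y])
  also have "\<dots> = c * ((norm (x + y))\<^sup>2 + (norm (x - y))\<^sup>2) / 4"
    by (simp add: distrib_left)
  also have "(norm (x + y))\<^sup>2 + (norm (x - y))\<^sup>2 = 2 * (norm x)\<^sup>2 + 2 * (norm y)\<^sup>2"
    unfolding power2_norm_eq_inner
    by (simp only: inner_add_left inner_add_right inner_diff_left inner_diff_right)
  also have "c * (2 * (norm x)\<^sup>2 + 2 * (norm y)\<^sup>2) / 4 = c * (norm y)\<^sup>2"
    by (simp add: nx)
  finally have "norm y * norm (A y) \<le> c * (norm y)\<^sup>2"
    using False by (simp add: x_def t_def power2_norm_eq_inner[symmetric] power2_eq_square)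
  then show ?thesis using False by (simp add: power2_eq_square)
qed

text \<open>Convergence is assumed on the diagonal only; polarisation extends it to the bilinear
  forms, whose limit is bounded by the same constant and is therefore given by an operator.\<close>

lemma sym_op_weak_limit:
  fixes G :: "nat \<Rightarrow> 'a::{real_inner,banach} \<Rightarrow>\<^sub>L 'a"
  assumes G: "\<And>n. sym_op (G n)" and bd: "\<And>n x. \<bar>inner x (G n x)\<bar> \<le> C * (norm x)\<^sup>2"
    and lim: "\<And>x. (\<lambda>n. inner x (G n x)) \<longlonglongrightarrow> q x"
  shows "\<exists>L. sym_op L \<and> (\<forall>x. inner x (L x) = q x)"
proof -
  define b where "b x y = (q (x + y) - q (x - y)) / 4" for x y
  have blim: "(\<lambda>n. inner x (G n y)) \<longlonglongrightarrow> b x y" for x y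
  proof -
    have e: "inner x (G n y) = (inner (x + y) (G n (x + y)) - inner (x - y) (G n (x - y))) / 4" for n
      by (rule sym_polarization[OF G])
    show ?thesis
      unfolding b_def e by (intro tendsto_intros lim) simp
  qed
  have bd2: "\<bar>inner x (G n y)\<bar> \<le> C * norm x * norm y" for n x y
  proof -
    have "\<bar>inner x (G n y)\<bar> \<le> norm x * norm (G n y)" by (rule Cauchy_Schwarz_ineq2)
    also have "\<dots> \<le> norm x * (C * norm y)"
      by (intro mult_left_mono sym_op_norm_le[OF G bd]) auto
    finally show ?thesis by (simp add: mult_ac)
  qed
  note uniq = LIMSEQ_unique[OF blim]
  have "\<exists>L :: 'a \<Rightarrow>\<^sub>L 'a. \<forall>x y. inner x (L y) = b x y"
  proof (rule bounded_form_representation[of b C])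
    show "b (x + x') y = b x y + b x' y" for x x' y
      by (rule uniq) (simp add: inner_simps, intro tendsto_intros blim)
    show "b (c *\<^sub>R x) y = c * b x y" for c x y
      by (rule uniq) (simp add: inner_simps, intro tendsto_intros blim)
    show "b x (y + y') = b x y + b x y'" for x y y'
      by (rule uniq) (simp add: blinfun.bilinear_simps inner_simps, intro tendsto_intros blim)
    show "b x (c *\<^sub>R y) = c * b x y" for c x y
      by (rule uniq) (simp add: blinfun.bilinear_simps inner_simps, intro tendsto_intros blim)
    show "\<bar>b x y\<bar> \<le> C * norm x * norm y" for x y
      by (rule LIMSEQ_le_const2[OF tendsto_rabs[OF blim]]) (use bd2 in blast)
  qed
  then obtain L :: "'a \<Rightarrow>\<^sub>L 'a" where L: "\<And>x y. inner x (L y) = b x y" by blast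
  have "b x y = b y x" for x y
  proof (rule uniq)
    have "inner x (G n y) = inner y (G n x)" for n
      using sym_opD[OF G, of x n y] by (simp only: inner_commute)
    then show "(\<lambda>n. inner x (G n y)) \<longlonglongrightarrow> b y x"
      using blim[of y x] by simp
  qed
  then have "sym_op L" by (simp add: sym_op_def L inner_commute[of "L _"])
  moreover have "inner x (L x) = q x" for x
    unfolding L by (rule LIMSEQ_unique[OF blim lim])
  ultimately show ?thesis by blast
qed

definition psd_op :: "('a::real_inner \<Rightarrow>\<^sub>L 'a) \<Rightarrow> bool" where
  "psd_op A \<longleftrightarrow> sym_op A \<and> (\<forall>x. 0 \<le> inner x (A x))"

lemma psd_op_Cauchy_Schwarz:
  assumes "psd_op A"
  shows "(inner x (A y))\<^sup>2 \<le> inner x (A x) * inner y (A y)"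
proof -
  have s: "sym_op A" and p: "\<And>x. 0 \<le> inner x (A x)" using assms by (auto simp: psd_op_def)
  let ?a = "inner x (A x)" and ?b = "inner x (A y)" and ?c = "inner y (A y)"
  have q: "0 \<le> s\<^sup>2 * ?a + 2 * s * t * ?b + t\<^sup>2 * ?c" for s t
    using p[of "s *\<^sub>R x + t *\<^sub>R y"] sym_opD[OF \<open>sym_op A\<close>, of y x]
    by (simp add: blinfun.bilinear_simps inner_simps inner_commute power2_eq_square algebra_simps)
  show ?thesis
  proof (cases "?c = 0")
    case True
    have "?b = 0"
    proof (rule ccontr)
      assume "?b \<noteq> 0"
      \<comment> \<open>For \<open>?c = 0\<close> the quadratic is affine in t, and at this t it
        takes the value -1.\<close>
      with q[of 1 "- (?a + 1) / (2 * ?b)"] True show False by (simp add: field_simps)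
    qed
    then show ?thesis using p by simp
  next
    case False
    with p[of y] have c: "0 < ?c" by simp
    have "0 \<le> ?c * (?a * ?c - ?b\<^sup>2)"
      using q[of ?c "- ?b"] by (simp add: power2_eq_square algebra_simps)
    then show ?thesis using c by (simp add: zero_le_mult_iff)
  qed
qed

primrec op_pow :: "('a::real_normed_vector \<Rightarrow>\<^sub>L 'a) \<Rightarrow> nat \<Rightarrow> ('a \<Rightarrow>\<^sub>L 'a)" where
  "op_pow R 0 = id_blinfun"
| "op_pow R (Suc n) = R o\<^sub>L op_pow R n"

lemma op_pow_commute: "op_pow R n (R x) = R (op_pow R n x)"
  by (induction n) auto

lemma op_pow_add: "op_pow R (m + n) x = op_pow R m (op_pow R n x)"
  by (induction m) auto

lemma sym_op_pow: "sym_op R \<Longrightarrow> sym_op (op_pow R n)"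
proof (induction n)
  case (Suc n)
  then show ?case by (auto simp: sym_op_def op_pow_commute)
qed (simp add: sym_op_def)

definition effect :: "('a::real_inner \<Rightarrow>\<^sub>L 'a) \<Rightarrow> bool" where
  "effect R \<longleftrightarrow> sym_op R \<and> (\<forall>x. 0 \<le> inner x (R x) \<and> inner x (R x) \<le> inner x x)"

text \<open>Halving the exponents moves a symmetric factor to either side and leaves exponents 0 or
  1. The one case with content is R Q with Q = 1 - R, where R Q = R Q R + Q R Q. The argument stays
  free of square roots, which are themselves built from this lemma.\<close>

lemma effect_pow_nonneg:
  assumes R: "effect R"
  shows "0 \<le> inner x (op_pow R k (op_pow (id_blinfun - R) l x))"
proof -
  let ?Q = "id_blinfun - R"
  have sR: "sym_op R" using R by (simp add: effect_def)
  have sQ: "sym_op ?Q" using sR by (simp add: sym_op_def blinfun.bilinear_simps inner_simps)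
  have RQ: "R (?Q y) = ?Q (R y)" for y by (simp add: blinfun.bilinear_simps)
  have comm: "op_pow R k (?Q y) = ?Q (op_pow R k y)" for k y
    by (induction k) (simp_all add: blinfun.bilinear_simps)
  have comm2: "op_pow R k (op_pow ?Q l y) = op_pow ?Q l (op_pow R k y)" for k l y
    by (induction l) (simp_all add: comm)
  have p: "0 \<le> inner y (R y)" "0 \<le> inner y (?Q y)" for y
    using R by (auto simp: effect_def blinfun.bilinear_simps inner_simps)
  have pp: "0 \<le> inner y (R (?Q y))" for y
  proof -
    have "R (?Q y) = R (R (?Q y)) + R (?Q (?Q y))"
      by (simp add: blinfun.bilinear_simps)
    moreover have "inner y (R (R (?Q y))) = inner (R y) (?Q (R y))"
      using sym_opD[OF sR, of y "R (?Q y)"] RQ by simp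
    moreover have "inner y (R (?Q (?Q y))) = inner (?Q y) (R (?Q y))"
      unfolding RQ[of "?Q y"] by (rule sym_opD[OF sQ])
    ultimately have "inner y (R (?Q y)) = inner (R y) (?Q (R y)) + inner (?Q y) (R (?Q y))"
      by (metis inner_add_right)
    then show ?thesis using p by simp
  qed
  have e: "0 \<le> inner y (op_pow R e (op_pow ?Q f y))" if "e < 2" "f < 2" for e f y
  proof -
    have "(e = 0 \<or> e = 1) \<and> (f = 0 \<or> f = 1)" using that by auto
    then show ?thesis using p pp by auto
  qed
  define a b where "a = k div 2" and "b = l div 2"
  define y where "y = op_pow R a (op_pow ?Q b x)"
  have "op_pow R k (op_pow ?Q l x) = op_pow R a (op_pow ?Q b (op_pow R (k mod 2) (op_pow ?Q (l mod 2) y)))"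
  proof -
    have "k = a + (k mod 2 + a)" "l = b + (l mod 2 + b)"
      unfolding a_def b_def by presburger+
    then have "op_pow R k (op_pow ?Q l x) =
      op_pow R a (op_pow R (k mod 2) (op_pow R a (op_pow ?Q b (op_pow ?Q (l mod 2) (op_pow ?Q b x)))))"
      by (metis op_pow_add)
    then show ?thesis by (simp add: y_def comm2)
  qed
  then have "inner x (op_pow R k (op_pow ?Q l x)) = inner y (op_pow R (k mod 2) (op_pow ?Q (l mod 2) y))"
    by (simp add: sym_opD[OF sym_op_pow[OF sR]] sym_opD[OF sym_op_pow[OF sQ]] y_def comm2)
  then show ?thesis using e[of "k mod 2" "l mod 2" y] by simp
qed

text \<open>The measure is the spectral measure of R at x. The Hausdorff functional sends X^k (1 -
  X)^l to the form of R^k (1 - R)^l at x, which is nonnegative by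
  \<open>effect_pow_nonneg\<close>.\<close>

lemma effect_moment_measure:
  assumes R: "effect R"
  shows "\<exists>M. unit_measure M \<and> (\<forall>n. (\<integral>r. r ^ n \<partial>M) = inner x (op_pow R n x))"
proof (rule hausdorff_moment)
  let ?m = "\<lambda>n. inner x (op_pow R n x)" and ?Q = "id_blinfun - R"
  have "poly_moment ?m ([:0, 1:] ^ k * [:1, -1:] ^ l) = inner x (op_pow R k (op_pow ?Q l x))" for k l
  proof (induction l arbitrary: k)
    case 0
    then show ?case by (simp add: poly_moment_X_power)
  next
    case (Suc l)
    have "a ^ k * (1 - a) ^ Suc l = a ^ k * (1 - a) ^ l - a ^ Suc k * (1 - a) ^ l" for a :: "real poly"
      by (simp add: algebra_simps)
    moreover have "[:1, -1::real:] = 1 - [:0, 1:]" by (simp add: one_pCons)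
    ultimately have "[:0, 1::real:] ^ k * [:1, -1:] ^ Suc l = [:0, 1:] ^ k * [:1, -1:] ^ l - [:0, 1:] ^ Suc k * [:1, -1:] ^ l"
      by (simp only:)
    then have "poly_moment ?m ([:0, 1:] ^ k * [:1, -1:] ^ Suc l) =
        inner x (op_pow R k (op_pow ?Q l x)) - inner x (op_pow R (Suc k) (op_pow ?Q l x))"
      by (simp only: poly_moment_diff Suc)
    also have "\<dots> = inner x (op_pow R k (op_pow ?Q (Suc l) x))"
      by (simp add: blinfun.diff_left blinfun.diff_right inner_diff_right op_pow_commute)
    finally show ?case .
  qed
  then show "0 \<le> poly_moment ?m ([:0, 1:] ^ k * [:1, -1:] ^ l)" for k l
    using effect_pow_nonneg[OF R] by simp
qed

lemma unit_measureD:
  assumes "unit_measure M"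
  shows "finite_measure M" "sets M = sets borel" "AE x in M. x \<in> {0..1}" "space M = UNIV"
  using assms sets_eq_imp_space_eq[of M borel] by (auto simp: unit_measure_def)

lemma unit_measure_integrable:
  assumes M: "unit_measure M" and g: "bdd_borel g"
  shows "integrable M g"
proof -
  interpret finite_measure M using M by (rule unit_measureD)
  note [measurable_cong] = unit_measureD(2)[OF M]
  note [measurable] = bdd_borel_measurable[OF g]
  obtain K where "\<And>r. r \<in> {0..1} \<Longrightarrow> \<bar>g r\<bar> \<le> K" using g by (metis bdd_borelE)
  then show ?thesis
    using unit_measureD(3)[OF M] by (intro integrable_const_bound[where B=K]) auto
qed

lemma unit_measure_integral_tendsto:
  fixes F :: "nat \<Rightarrow> real \<Rightarrow> real"
  assumes M: "unit_measure M" and "\<And>n. bdd_borel (F n)" "bdd_borel f"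
    and K: "\<And>n r. r \<in> {0..1} \<Longrightarrow> \<bar>F n r\<bar> \<le> K"
    and lim: "\<And>r. r \<in> {0..1} \<Longrightarrow> (\<lambda>n. F n r) \<longlonglongrightarrow> f r"
  shows "(\<lambda>n. \<integral>r. F n r \<partial>M) \<longlonglongrightarrow> (\<integral>r. f r \<partial>M)"
proof (rule integral_dominated_convergence[where w="\<lambda>_. K"])
  interpret finite_measure M using M by (rule unit_measureD)
  note [measurable_cong] = unit_measureD(2)[OF M]
  note [measurable] = assms(2,3)[THEN bdd_borel_measurable]
  show "f \<in> borel_measurable M" "F n \<in> borel_measurable M" for n by measurable
  show "integrable M (\<lambda>_. K)" by simp
  show "AE r in M. (\<lambda>n. F n r) \<longlonglongrightarrow> f r"
    using unit_measureD(3)[OF M] by eventually_elim (rule lim)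
  show "AE r in M. norm (F n r) \<le> K" for n
    using unit_measureD(3)[OF M] by eventually_elim (simp add: K)
qed

lemma unit_measure_integral_bound:
  assumes M: "unit_measure M" and g: "bdd_borel g" and K: "\<And>r. r \<in> {0..1} \<Longrightarrow> \<bar>g r\<bar> \<le> K"
  shows "\<bar>\<integral>r. g r \<partial>M\<bar> \<le> K * (\<integral>r. 1 \<partial>M)"
proof -
  note int = unit_measure_integrable[OF M]
  have "\<bar>\<integral>r. g r \<partial>M\<bar> \<le> (\<integral>r. \<bar>g r\<bar> \<partial>M)"
    using integral_norm_bound[of M g] by simp
  also have "\<dots> \<le> (\<integral>r. K * 1 \<partial>M)"
    using unit_measureD(3)[OF M] K
    by (intro integral_mono_AE integrable_abs int g bdd_borel_const[of "K * 1"]) auto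
  also have "\<dots> = K * (\<integral>r. 1 \<partial>M)" by (rule integral_mult_right_zero)
  finally show ?thesis .
qed

section \<open>The functional calculus of an effect\<close>

definition effect_measure :: "('a::{real_inner,banach} \<Rightarrow>\<^sub>L 'a) \<Rightarrow> 'a \<Rightarrow> real measure" where
  "effect_measure R x = (SOME M. unit_measure M \<and> (\<forall>n. (\<integral>r. r ^ n \<partial>M) = inner x (op_pow R n x)))"

definition bfc :: "('a::{real_inner,banach} \<Rightarrow>\<^sub>L 'a) \<Rightarrow> (real \<Rightarrow> real) \<Rightarrow> ('a \<Rightarrow>\<^sub>L 'a)" where
  "bfc R g = (SOME G. sym_op G \<and> (\<forall>x. inner x (G x) = (\<integral>r. g r \<partial>effect_measure R x)))"

context
  fixes R :: "'a::{real_inner,banach} \<Rightarrow>\<^sub>L 'a"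
  assumes R: "effect R"
begin

lemma effect_measure_unit: "unit_measure (effect_measure R x)"
  and effect_measure_moment: "(\<integral>r. r ^ n \<partial>effect_measure R x) = inner x (op_pow R n x)"
  unfolding effect_measure_def using someI_ex[OF effect_moment_measure[OF R, of x]] by auto

lemma effect_measure_mass: "(\<integral>r. 1 \<partial>effect_measure R x) = inner x x"
  using effect_measure_moment[where n=0 and x=x] by simp

lemma effect_measure_integrable: "bdd_borel g \<Longrightarrow> integrable (effect_measure R x) g"
  by (rule unit_measure_integrable[OF effect_measure_unit])

lemma effect_measure_tendsto:
  fixes F :: "nat \<Rightarrow> real \<Rightarrow> real"
  assumes "\<And>n. bdd_borel (F n)" "bdd_borel f"
    and "\<And>n r. r \<in> {0..1} \<Longrightarrow> \<bar>F n r\<bar> \<le> K"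
    and "\<And>r. r \<in> {0..1} \<Longrightarrow> (\<lambda>n. F n r) \<longlonglongrightarrow> f r"
  shows "(\<lambda>n. \<integral>r. F n r \<partial>effect_measure R x) \<longlonglongrightarrow> (\<integral>r. f r \<partial>effect_measure R x)"
  by (rule unit_measure_integral_tendsto[OF effect_measure_unit assms])

text \<open>Monomials are represented by powers of R, and a bounded pointwise limit of functions
  gives convergent diagonal forms by dominated convergence, hence an operator by
  \<open>sym_op_weak_limit\<close>.\<close>

lemma bfc_exists:
  "bdd_borel g \<Longrightarrow> \<exists>G. sym_op G \<and> (\<forall>x. inner x (G x) = (\<integral>r. g r \<partial>effect_measure R x))"
proof (induction rule: bounded_borel_unit_induct)
  case (power n)
  show ?case
    using sym_op_pow[of R n] R by (auto simp: effect_def effect_measure_moment)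
next
  case (add f g)
  then obtain F G where "sym_op F" "\<And>x. inner x (F x) = (\<integral>r. f r \<partial>effect_measure R x)"
    "sym_op G" "\<And>x. inner x (G x) = (\<integral>r. g r \<partial>effect_measure R x)" by auto
  then show ?case
    by (intro exI[of _ "F + G"])
      (auto simp: sym_op_def blinfun.bilinear_simps inner_simps effect_measure_integrable add)
next
  case (scale c f)
  then obtain F where "sym_op F" "\<And>x. inner x (F x) = (\<integral>r. f r \<partial>effect_measure R x)" by auto
  then show ?case
    by (intro exI[of _ "c *\<^sub>R F"])
      (auto simp: sym_op_def blinfun.bilinear_simps inner_simps effect_measure_integrable scale)
next
  case (lim F f K)
  from lim.IH obtain G where G: "\<And>n. sym_op (G n)"
    "\<And>n x. inner x (G n x) = (\<integral>r. F n r \<partial>effect_measure R x)" by metis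
  show ?case
  proof (rule sym_op_weak_limit[of G K "\<lambda>x. \<integral>r. f r \<partial>effect_measure R x"])
    show "\<bar>inner x (G n x)\<bar> \<le> K * (norm x)\<^sup>2" for n x
      using unit_measure_integral_bound[OF effect_measure_unit[of x] lim.hyps(1)[of n] lim.hyps(3)[of _ n]]
      by (simp only: G effect_measure_mass power2_norm_eq_inner)
    show "(\<lambda>n. inner x (G n x)) \<longlonglongrightarrow> (\<integral>r. f r \<partial>effect_measure R x)" for x
      unfolding G by (rule effect_measure_tendsto[OF lim.hyps])
  qed (use G in auto)
qed

lemma sym_op_bfc: "bdd_borel g \<Longrightarrow> sym_op (bfc R g)"
  and inner_bfc: "bdd_borel g \<Longrightarrow> inner x (bfc R g x) = (\<integral>r. g r \<partial>effect_measure R x)"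
  unfolding bfc_def using someI_ex[OF bfc_exists] by auto

lemma bfc_eqI:
  "bdd_borel g \<Longrightarrow> sym_op G \<Longrightarrow> (\<And>x. inner x (G x) = (\<integral>r. g r \<partial>effect_measure R x)) \<Longrightarrow> bfc R g = G"
  by (rule sym_op_eqI) (auto simp: sym_op_bfc inner_bfc)

lemma bfc_power: "bfc R (\<lambda>r. r ^ n) = op_pow R n"
  using R by (intro bfc_eqI) (auto simp: effect_def sym_op_pow effect_measure_moment)

lemma bfc_one: "bfc R (\<lambda>r. 1) = id_blinfun"
  using bfc_power[of 0] by simp

lemma bfc_id: "bfc R (\<lambda>r. r) = R"
  using bfc_power[of 1] by (simp add: blinfun_eqI)

lemma bfc_add: "bdd_borel f \<Longrightarrow> bdd_borel g \<Longrightarrow> bfc R (\<lambda>r. f r + g r) = bfc R f + bfc R g"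
  by (rule bfc_eqI)
    (auto intro: sym_op_add sym_op_bfc simp: blinfun.add_left inner_add_right inner_bfc effect_measure_integrable)

lemma bfc_scale: "bdd_borel f \<Longrightarrow> bfc R (\<lambda>r. c * f r) = c *\<^sub>R bfc R f"
  by (rule bfc_eqI)
    (auto intro: sym_op_scaleR sym_op_bfc bdd_borel_mult simp: blinfun.scaleR_left inner_bfc effect_measure_integrable)

lemma bfc_const: "bfc R (\<lambda>r. c) = c *\<^sub>R id_blinfun"
  using bfc_scale[of "\<lambda>_. 1" c] by (simp add: bfc_one)

lemma bfc_diff: "bdd_borel f \<Longrightarrow> bdd_borel g \<Longrightarrow> bfc R (\<lambda>r. f r - g r) = bfc R f - bfc R g"
  using bfc_add[of f "\<lambda>r. (-1) * g r"] bfc_scale[of g "-1"] bdd_borel_mult[OF bdd_borel_const[of "-1"], of g]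
  by simp

lemma bfc_cong:
  assumes "bdd_borel f" "bdd_borel g" "\<And>r. r \<in> {0..1} \<Longrightarrow> f r = g r"
  shows "bfc R f = bfc R g"
proof (rule bfc_eqI[OF assms(1) sym_op_bfc[OF assms(2)]])
  fix x
  show "inner x (bfc R g x) = (\<integral>r. f r \<partial>effect_measure R x)"
    unfolding inner_bfc[OF assms(2)]
    using unit_measureD(3)[OF effect_measure_unit, of x] assms(3)
      borel_measurable_integrable[OF effect_measure_integrable[OF assms(1)]]
      borel_measurable_integrable[OF effect_measure_integrable[OF assms(2)]]
    by (intro integral_cong_AE) auto
qed

lemma bfc_weak_tendsto:
  fixes F :: "nat \<Rightarrow> real \<Rightarrow> real"
  assumes "\<And>n. bdd_borel (F n)" "bdd_borel f"
    and "\<And>n r. r \<in> {0..1} \<Longrightarrow> \<bar>F n r\<bar> \<le> K"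
    and "\<And>r. r \<in> {0..1} \<Longrightarrow> (\<lambda>n. F n r) \<longlonglongrightarrow> f r"
  shows "(\<lambda>n. inner x (bfc R (F n) y)) \<longlonglongrightarrow> inner x (bfc R f y)"
proof -
  have e: "inner x (bfc R g y) = ((\<integral>r. g r \<partial>effect_measure R (x + y)) - (\<integral>r. g r \<partial>effect_measure R (x - y))) / 4"
    if "bdd_borel g" for g
    using sym_polarization[OF sym_op_bfc[OF that], of x y] by (simp only: inner_bfc[OF that])
  show ?thesis
    unfolding e[OF assms(1)] e[OF assms(2)]
    by (intro tendsto_intros effect_measure_tendsto[OF assms]) auto
qed

text \<open>T is any bounded real-linear map: multiplication by i yields the complex linearity of
  the calculus, and a second square root, support projections and abstract spectral projections are
  further choices. In the limit case the adjoint of T carries the weak convergence across.\<close>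

lemma bfc_commute:
  fixes T :: "'a \<Rightarrow>\<^sub>L 'a"
  assumes T: "\<And>x. T (R x) = R (T x)" and g: "bdd_borel g"
  shows "bfc R g (T x) = T (bfc R g x)"
proof -
  have "\<forall>x. bfc R g (T x) = T (bfc R g x)"
    using g
  proof (induction rule: bounded_borel_unit_induct)
    case (power n)
    have "op_pow R n (T x) = T (op_pow R n x)" for x
      by (induction n) (simp_all add: T)
    then show ?case by (simp add: bfc_power)
  next
    case (lim F f K)
    obtain T' :: "'a \<Rightarrow>\<^sub>L 'a" where T': "\<And>x y. inner (T' x) y = inner x (T y)"
      using real_adjoint_exists[of T] by blast
    show ?case
    proof
      fix y
      have "inner x (bfc R f (T y)) = inner x (T (bfc R f y))" for x
      proof (rule LIMSEQ_unique[OF bfc_weak_tendsto[OF lim.hyps]])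
        show "(\<lambda>n. inner x (bfc R (F n) (T y))) \<longlonglongrightarrow> inner x (T (bfc R f y))"
          using bfc_weak_tendsto[OF lim.hyps, of "T' x" y] lim.IH by (simp add: T')
      qed
      then show "bfc R f (T y) = T (bfc R f y)" by (metis vector_eq_ldot)
    qed
  qed (auto simp: bfc_add bfc_scale blinfun.bilinear_simps)
  then show ?thesis by simp
qed

text \<open>Two inductions: on the second factor while the first is a monomial, then on the first
  factor while the second is arbitrary and fixed.\<close>

lemma bfc_mult:
  assumes f: "bdd_borel f" and g: "bdd_borel g"
  shows "bfc R (\<lambda>r. f r * g r) x = bfc R f (bfc R g x)"
proof -
  have pow: "bfc R (\<lambda>r. r ^ n * h r) y = op_pow R n (bfc R h y)" if h: "bdd_borel h" for n h y
  proof -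
    have "\<forall>y. bfc R (\<lambda>r. r ^ n * h r) y = op_pow R n (bfc R h y)"
      using h
    proof (induction rule: bounded_borel_unit_induct)
      case (power m)
      show ?case by (simp add: power_add[symmetric] bfc_power op_pow_add)
    next
      case (add f g)
      then have "bfc R (\<lambda>r. r ^ n * (f r + g r)) = bfc R (\<lambda>r. r ^ n * f r) + bfc R (\<lambda>r. r ^ n * g r)"
        by (subst bfc_add[symmetric]) (auto simp: distrib_left)
      with add show ?case by (simp add: bfc_add blinfun.bilinear_simps)
    next
      case (scale c f)
      then have "bfc R (\<lambda>r. r ^ n * (c * f r)) = c *\<^sub>R bfc R (\<lambda>r. r ^ n * f r)"
        by (subst bfc_scale[symmetric]) (auto simp: mult_ac)
      with scale show ?case by (simp add: bfc_scale blinfun.bilinear_simps)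
    next
      case (lim F f K)
      have s: "sym_op (op_pow R n)" using R by (simp add: effect_def sym_op_pow)
      show ?case
      proof
        fix y
        have "inner x (bfc R (\<lambda>r. r ^ n * f r) y) = inner x (op_pow R n (bfc R f y))" for x
        proof (rule LIMSEQ_unique)
          show "(\<lambda>k. inner x (bfc R (\<lambda>r. r ^ n * F k r) y)) \<longlonglongrightarrow> inner x (bfc R (\<lambda>r. r ^ n * f r) y)"
          proof (rule bfc_weak_tendsto[where K=K])
            show "\<bar>r ^ n * F k r\<bar> \<le> K" if "r \<in> {0..1}" for k r
              using lim.hyps(3)[OF that, of k] that mult_mono[of "r ^ n" 1 "\<bar>F k r\<bar>" K]
              by (auto simp: abs_mult power_le_one)
          qed (use lim in \<open>auto intro!: tendsto_mult\<close>)
          show "(\<lambda>k. inner x (bfc R (\<lambda>r. r ^ n * F k r) y)) \<longlonglongrightarrow> inner x (op_pow R n (bfc R f y))"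
            using bfc_weak_tendsto[OF lim.hyps, of "op_pow R n x" y] lim.IH by (simp add: sym_opD[OF s])
        qed
        then show "bfc R (\<lambda>r. r ^ n * f r) y = op_pow R n (bfc R f y)" by (metis vector_eq_ldot)
      qed
    qed
    then show ?thesis by simp
  qed
  have "\<forall>x. bfc R (\<lambda>r. f r * g r) x = bfc R f (bfc R g x)"
    using f
  proof (induction rule: bounded_borel_unit_induct)
    case (power n)
    then show ?case using pow[OF g] by (simp add: bfc_power)
  next
    case (add f1 f2)
    then have "bfc R (\<lambda>r. (f1 r + f2 r) * g r) = bfc R (\<lambda>r. f1 r * g r) + bfc R (\<lambda>r. f2 r * g r)"
      using g by (subst bfc_add[symmetric]) (auto simp: distrib_right)
    with add show ?case by (simp add: bfc_add blinfun.bilinear_simps)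
  next
    case (scale c f)
    then have "bfc R (\<lambda>r. c * f r * g r) = c *\<^sub>R bfc R (\<lambda>r. f r * g r)"
      using g by (subst bfc_scale[symmetric]) (auto simp: mult_ac)
    with scale show ?case by (simp add: bfc_scale blinfun.bilinear_simps)
  next
    case (lim F f K)
    obtain L where L: "0 \<le> L" "\<And>r. r \<in> {0..1} \<Longrightarrow> \<bar>g r\<bar> \<le> L" using g by (metis bdd_borelE)
    show ?case
    proof
      fix y
      have "inner x (bfc R (\<lambda>r. f r * g r) y) = inner x (bfc R f (bfc R g y))" for x
      proof (rule LIMSEQ_unique)
        show "(\<lambda>k. inner x (bfc R (\<lambda>r. F k r * g r) y)) \<longlonglongrightarrow> inner x (bfc R (\<lambda>r. f r * g r) y)"
        proof (rule bfc_weak_tendsto[where K="K * L"])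
          show "\<bar>F k r * g r\<bar> \<le> K * L" if "r \<in> {0..1}" for k r
            using lim.hyps(3)[OF that, of k] L(2)[OF that] order_trans[OF abs_ge_zero lim.hyps(3)[OF that, of k]]
            by (auto simp: abs_mult intro!: mult_mono)
        qed (use lim g in \<open>auto intro!: tendsto_mult\<close>)
        show "(\<lambda>k. inner x (bfc R (\<lambda>r. F k r * g r) y)) \<longlonglongrightarrow> inner x (bfc R f (bfc R g y))"
          using bfc_weak_tendsto[OF lim.hyps, of x "bfc R g y"] lim.IH by simp
      qed
      then show "bfc R (\<lambda>r. f r * g r) y = bfc R f (bfc R g y)" by (metis vector_eq_ldot)
    qed
  qed
  then show ?thesis by simp
qed

lemma bfc_norm_sq: "bdd_borel g \<Longrightarrow> (norm (bfc R g x))\<^sup>2 = (\<integral>r. (g r)\<^sup>2 \<partial>effect_measure R x)"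
  using bfc_mult[of g g x] inner_bfc[of "\<lambda>r. g r * g r" x] sym_opD[OF sym_op_bfc, of g x "bfc R g x"]
  by (simp add: power2_eq_square bdd_borel_mult power2_norm_eq_inner[unfolded power2_eq_square])

text \<open>By multiplicativity |g(R) x|^2 is the integral of g^2, so dominated convergence applied
  to the squares of \<open>F n - f\<close> gives convergence in norm.\<close>

lemma bfc_strong_tendsto:
  fixes F :: "nat \<Rightarrow> real \<Rightarrow> real"
  assumes F: "\<And>n. bdd_borel (F n)" "bdd_borel f"
    and K: "\<And>n r. r \<in> {0..1} \<Longrightarrow> \<bar>F n r\<bar> \<le> K"
    and lim: "\<And>r. r \<in> {0..1} \<Longrightarrow> (\<lambda>n. F n r) \<longlonglongrightarrow> f r"
  shows "(\<lambda>n. bfc R (F n) x) \<longlonglongrightarrow> bfc R f x"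
proof -
  have b: "\<bar>f r\<bar> \<le> K" if "r \<in> {0..1}" for r
    by (rule LIMSEQ_le_const2[OF tendsto_rabs[OF lim[OF that]]]) (use K[OF that] in blast)
  have "(\<lambda>n. \<integral>r. (F n r - f r)\<^sup>2 \<partial>effect_measure R x) \<longlonglongrightarrow> (\<integral>r. 0 \<partial>effect_measure R x)"
  proof (rule effect_measure_tendsto[where K="(2 * K)\<^sup>2"])
    show "bdd_borel (\<lambda>r. (F n r - f r)\<^sup>2)" for n
      unfolding power2_eq_square by (intro bdd_borel_mult bdd_borel_diff F)
    show "\<bar>(F n r - f r)\<^sup>2\<bar> \<le> (2 * K)\<^sup>2" if "r \<in> {0..1}" for n r
    proof -
      have "\<bar>F n r - f r\<bar> \<le> \<bar>2 * K\<bar>" using K[OF that, of n] b[OF that] by linarith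
      then show ?thesis by (simp only: abs_le_square_iff abs_power2)
    qed
    show "(\<lambda>n. (F n r - f r)\<^sup>2) \<longlonglongrightarrow> 0" if "r \<in> {0..1}" for r
      using tendsto_power[OF tendsto_diff[OF lim[OF that] tendsto_const[of "f r"]], of 2] by simp
  qed auto
  then have "(\<lambda>n. (norm (bfc R (\<lambda>r. F n r - f r) x))\<^sup>2) \<longlonglongrightarrow> 0"
    by (simp add: bfc_norm_sq bdd_borel_diff F)
  then have "(\<lambda>n. sqrt ((norm (bfc R (\<lambda>r. F n r - f r) x))\<^sup>2)) \<longlonglongrightarrow> sqrt 0"
    by (rule tendsto_real_sqrt)
  then have "(\<lambda>n. norm (bfc R (F n) x - bfc R f x)) \<longlonglongrightarrow> 0"
    by (simp add: bfc_diff F blinfun.bilinear_simps)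
  then show ?thesis by (simp add: tendsto_norm_zero_iff LIM_zero_iff)
qed

lemma bfc_nonneg:
  assumes g: "bdd_borel g" and nn: "\<And>r. r \<in> {0..1} \<Longrightarrow> 0 \<le> g r"
  shows "0 \<le> inner x (bfc R g x)"
  unfolding inner_bfc[OF g]
  by (rule integral_nonneg_AE) (use unit_measureD(3)[OF effect_measure_unit, of x] nn in auto)

end

section \<open>Complex Hilbert spaces\<close>

lemma cinner_scaleC_left: "cinner (c *\<^sub>C x) y = cnj c * cinner x (y::'a::complex_hilbert)"
  by (metis cinner_commute cinner_scaleC_right complex_cnj_mult)

lemma cinner_add_left: "cinner (x + y) z = cinner x z + cinner y (z::'a::complex_hilbert)"
  by (metis cinner_add_right cinner_commute complex_cnj_add)

lemma scaleC_ii_ii: "\<i> *\<^sub>C \<i> *\<^sub>C x = - (x::'a::complex_hilbert)"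
  using scaleC_of_real[of "-1" x] by (simp add: scaleC_scaleC)

lemma scaleC_eq: "c *\<^sub>C x = Re c *\<^sub>R x + Im c *\<^sub>R (\<i> *\<^sub>C (x::'a::complex_hilbert))"
proof -
  have "c *\<^sub>C x = (complex_of_real (Re c) + complex_of_real (Im c) * \<i>) *\<^sub>C x"
    by (simp add: complex_eq[symmetric] mult.commute)
  then show ?thesis
    by (simp only: scaleC_add_left scaleC_scaleC[symmetric] scaleC_of_real)
qed

lemma Im_cinner: "Im (cinner x y) = inner (\<i> *\<^sub>C x) (y::'a::complex_hilbert)"
  by (simp add: Re_cinner[symmetric] cinner_scaleC_left)

lemma cinner_eq: "cinner x y = Complex (inner x y) (inner (\<i> *\<^sub>C x) (y::'a::complex_hilbert))"
  by (simp add: complex_eq_iff Re_cinner Im_cinner)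

lemma inner_ii: "inner (\<i> *\<^sub>C x) (\<i> *\<^sub>C y) = inner x (y::'a::complex_hilbert)"
  by (simp add: Re_cinner[symmetric] cinner_scaleC_left cinner_scaleC_right)

lemma inner_ii_left: "inner (\<i> *\<^sub>C x) y = - inner x (\<i> *\<^sub>C (y::'a::complex_hilbert))"
  by (simp add: Re_cinner[symmetric] cinner_scaleC_left cinner_scaleC_right)

lemma norm_ii: "norm (\<i> *\<^sub>C x) = norm (x::'a::complex_hilbert)"
  by (simp add: norm_eq_sqrt_inner inner_ii)

lemma scaleC_ii_scaleR: "\<i> *\<^sub>C (r *\<^sub>R x) = r *\<^sub>R (\<i> *\<^sub>C (x::'a::complex_hilbert))"
  by (simp add: scaleC_of_real[symmetric] scaleC_scaleC mult.commute)

lemma bounded_linear_ii: "bounded_linear (\<lambda>x::'a::complex_hilbert. \<i> *\<^sub>C x)"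
  by (rule bounded_linear_intro[of _ 1]) (auto simp: scaleC_add_right scaleC_ii_scaleR norm_ii)

definition ii_op :: "'a::complex_hilbert \<Rightarrow>\<^sub>L 'a" where
  "ii_op = Blinfun (\<lambda>x. \<i> *\<^sub>C x)"

lemma ii_op_apply [simp]: "ii_op x = \<i> *\<^sub>C x"
  by (simp add: ii_op_def bounded_linear_Blinfun_apply bounded_linear_ii)

lemma clinear_op_iff: "clinear_op A \<longleftrightarrow> (\<forall>x. A (\<i> *\<^sub>C x) = \<i> *\<^sub>C A x)"
proof
  assume "\<forall>x. A (\<i> *\<^sub>C x) = \<i> *\<^sub>C A x"
  then show "clinear_op A"
    unfolding clinear_op_def
    by (metis blinfun.add_right blinfun.scaleR_right scaleC_eq)
qed (simp add: clinear_op_def)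

lemma clinear_opD: "clinear_op A \<Longrightarrow> A (\<i> *\<^sub>C x) = \<i> *\<^sub>C A x"
  by (simp add: clinear_op_def)

lemma clinear_op_add: "clinear_op A \<Longrightarrow> clinear_op B \<Longrightarrow> clinear_op (A + B)"
  by (simp add: clinear_op_iff blinfun.add_left scaleC_add_right)

lemma clinear_op_scaleR: "clinear_op A \<Longrightarrow> clinear_op (r *\<^sub>R A)"
  by (simp add: clinear_op_iff blinfun.scaleR_left scaleC_ii_scaleR)

lemma clinear_op_diff: "clinear_op A \<Longrightarrow> clinear_op B \<Longrightarrow> clinear_op (A - B)"
  using clinear_op_add[of A "(-1) *\<^sub>R B"] clinear_op_scaleR[of B "-1"] by simp

lemma clinear_op_compose: "clinear_op A \<Longrightarrow> clinear_op B \<Longrightarrow> clinear_op (A o\<^sub>L B)"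
  by (simp add: clinear_op_iff)

lemma clinear_op_id: "clinear_op id_blinfun"
  by (simp add: clinear_op_iff)

lemma clinear_op_bfc:
  assumes "effect R" "clinear_op R" "bdd_borel g"
  shows "clinear_op (bfc R g)"
  using bfc_commute[OF assms(1) _ assms(3), of ii_op] assms(2) by (simp add: clinear_op_iff)

text \<open>The operator - i G i is symmetric and has the same quadratic form as G, so it equals
  G.\<close>

lemma sym_op_clinearI:
  fixes G :: "'a::complex_hilbert \<Rightarrow>\<^sub>L 'a"
  assumes G: "sym_op G" and q: "\<And>x. inner (\<i> *\<^sub>C x) (G (\<i> *\<^sub>C x)) = inner x (G x)"
  shows "clinear_op G"
  unfolding clinear_op_iff
proof
  fix x :: 'a
  let ?H = "- (ii_op o\<^sub>L G o\<^sub>L ii_op)"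
  have H: "?H y = - (\<i> *\<^sub>C G (\<i> *\<^sub>C y))" for y by (simp add: blinfun.bilinear_simps)
  have e: "inner x (?H y) = inner (\<i> *\<^sub>C x) (G (\<i> *\<^sub>C y))" for x y
    unfolding H using inner_ii_left[of x "G (\<i> *\<^sub>C y)"] by simp
  have "sym_op ?H"
    unfolding sym_op_def
  proof (intro allI)
    fix x y
    show "inner x (?H y) = inner (?H x) y"
      by (metis e inner_commute sym_opD[OF G])
  qed
  then have "?H = G"
    by (rule sym_op_eqI[OF _ G]) (simp only: e q)
  then have "G x = - (\<i> *\<^sub>C G (\<i> *\<^sub>C x))" by (metis H)
  then have "\<i> *\<^sub>C G x = - (\<i> *\<^sub>C (\<i> *\<^sub>C G (\<i> *\<^sub>C x)))"
    using scaleC_ii_scaleR[of "-1" "\<i> *\<^sub>C G (\<i> *\<^sub>C x)"] by simp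
  then show "G (\<i> *\<^sub>C x) = \<i> *\<^sub>C G x" by (simp add: scaleC_ii_ii)
qed

lemma sym_clinear_cinner:
  assumes "sym_op A" "clinear_op A"
  shows "cinner x (A y) = cinner (A x) y"
  unfolding cinner_eq clinear_opD[OF assms(2), symmetric] by (simp only: sym_opD[OF assms(1)])

text \<open>A real-valued form <x, A x> forces symmetry: polarise the vanishing of its imaginary
  part and replace x by i x. Positivity is handled through the real inner product from here
  on.\<close>

lemma pos_op_iff: "pos_op A \<longleftrightarrow> clinear_op A \<and> psd_op A"
proof
  assume A: "pos_op A"
  then have lin: "clinear_op A" and re: "\<And>x. 0 \<le> inner x (A x)" and im: "\<And>x. inner (\<i> *\<^sub>C x) (A x) = 0"
    by (auto simp: pos_op_def less_eq_complex_def Re_cinner Im_cinner)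
  have im2: "inner (\<i> *\<^sub>C x) (A y) = - inner (\<i> *\<^sub>C y) (A x)" for x y
    using im[of "x + y"] im[of x] im[of y]
    by (simp add: scaleC_add_right blinfun.add_right inner_add_left inner_add_right)
  have "inner x (A y) = inner (A x) y" for x y
  proof -
    have "inner x (A y) = inner (\<i> *\<^sub>C (\<i> *\<^sub>C x)) (- A y)"
      by (simp add: scaleC_ii_ii)
    also have "\<dots> = inner (\<i> *\<^sub>C y) (A (\<i> *\<^sub>C x))"
      using im2[of "\<i> *\<^sub>C x" y] by simp
    also have "\<dots> = inner y (A x)"
      by (simp add: clinear_opD[OF lin] inner_ii)
    finally show ?thesis by (simp add: inner_commute)
  qed
  with lin re show "clinear_op A \<and> psd_op A" by (simp add: psd_op_def sym_op_def)
next
  assume A: "clinear_op A \<and> psd_op A"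
  have "inner (\<i> *\<^sub>C x) (A x) = 0" for x
  proof -
    have "inner (\<i> *\<^sub>C x) (A x) = inner (A (\<i> *\<^sub>C x)) x"
      using A by (simp add: psd_op_def sym_opD)
    also have "\<dots> = inner (\<i> *\<^sub>C A x) x" using A by (simp add: clinear_opD)
    also have "\<dots> = - inner (\<i> *\<^sub>C x) (A x)" by (metis inner_commute inner_ii_left)
    finally show ?thesis by simp
  qed
  with A show "pos_op A"
    by (auto simp: pos_op_def psd_op_def less_eq_complex_def Re_cinner Im_cinner)
qed

lemma op_adj_eqI:
  fixes A A' :: "'a::complex_hilbert \<Rightarrow>\<^sub>L 'a"
  assumes "\<And>x y. cinner (A' x) y = cinner x (A y)"
  shows "op_adj A = A'"
  unfolding op_adj_def
proof (rule the_equality)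
  show "\<forall>x y. cinner (A' x) y = cinner x (A y)" using assms by simp
next
  fix B :: "'a \<Rightarrow>\<^sub>L 'a"
  assume "\<forall>x y. cinner (B x) y = cinner x (A y)"
  then have "inner (B x) y = inner (A' x) y" for x y
    using assms by (simp add: Re_cinner[symmetric])
  then show "B = A'" by (intro blinfun_eqI) (metis vector_eq_rdot)
qed

lemma op_adj_sym: "sym_op A \<Longrightarrow> clinear_op A \<Longrightarrow> op_adj A = A"
  by (rule op_adj_eqI) (simp add: sym_clinear_cinner)

lemma cinner_op_adj:
  fixes A :: "'a::complex_hilbert \<Rightarrow>\<^sub>L 'a"
  assumes A: "clinear_op A"
  shows "cinner (op_adj A x) y = cinner x (A y)"
proof -
  obtain A' :: "'a \<Rightarrow>\<^sub>L 'a" where A': "\<And>x y. inner (A' x) y = inner x (A y)"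
    using real_adjoint_exists[of A] by blast
  have "inner (\<i> *\<^sub>C A' x) y = inner (\<i> *\<^sub>C x) (A y)" for x y
    by (simp add: inner_ii_left A' clinear_opD[OF A])
  then have "op_adj A = A'"
    by (intro op_adj_eqI) (simp add: cinner_eq A')
  then show ?thesis
    using \<open>\<And>x y. inner (\<i> *\<^sub>C A' x) y = inner (\<i> *\<^sub>C x) (A y)\<close> by (simp add: cinner_eq A')
qed

lemma orthogonal_projection_iff:
  "orthogonal_projection P \<longleftrightarrow> clinear_op P \<and> sym_op P \<and> (\<forall>x. P (P x) = P x)"
proof
  assume P: "orthogonal_projection P"
  then have "inner x (P y) = inner (P x) y" for x y
    using cinner_op_adj[of P x y] by (simp add: orthogonal_projection_def Re_cinner[symmetric])
  moreover have "P (P x) = P x" for x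
    using P by (metis blinfun_apply_blinfun_compose orthogonal_projection_def)
  ultimately show "clinear_op P \<and> sym_op P \<and> (\<forall>x. P (P x) = P x)"
    using P by (simp add: orthogonal_projection_def sym_op_def)
next
  assume "clinear_op P \<and> sym_op P \<and> (\<forall>x. P (P x) = P x)"
  then show "orthogonal_projection P"
    by (auto simp: orthogonal_projection_def op_adj_sym intro!: blinfun_eqI)
qed

section \<open>Positive square roots\<close>

lemma psd_op_zero:
  assumes "psd_op A" "inner y (A y) = 0"
  shows "A y = 0"
  using psd_op_Cauchy_Schwarz[OF assms(1), of "A y" y] assms(2) by simp

lemma psd_op_norm_bound:
  fixes A :: "'a::real_inner \<Rightarrow>\<^sub>L 'a"
  shows "inner x (A x) \<le> norm A * inner x x"
proof -
  have "inner x (A x) \<le> norm x * norm (A x)" by (rule norm_cauchy_schwarz)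
  also have "\<dots> \<le> norm x * (norm A * norm x)" by (intro mult_left_mono norm_blinfun) simp
  finally show ?thesis by (simp add: power2_norm_eq_inner[symmetric] power2_eq_square mult_ac)
qed

lemma effect_scaled:
  assumes A: "psd_op A" and c: "norm A \<le> c" "0 < c"
  shows "effect ((1 / c) *\<^sub>R A)"
proof -
  have "inner x (A x) \<le> c * inner x x" for x
    using psd_op_norm_bound[of x A] mult_right_mono[OF c(1), of "inner x x"] by simp
  then show ?thesis
    using A c by (simp add: effect_def psd_op_def sym_op_scaleR blinfun.scaleR_left divide_simps mult.commute)
qed

lemma bdd_borel_sqrt [intro, simp]: "bdd_borel sqrt"
  by (rule bdd_borelI[where K=1]) auto

text \<open>The summand 1 keeps the scale positive when A = 0, so that division by it is always
  legitimate.\<close>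

definition pos_scale :: "('a::real_normed_vector \<Rightarrow>\<^sub>L 'a) \<Rightarrow> real" where
  "pos_scale A = norm A + 1"

lemma pos_scale_pos: "0 < pos_scale A"
  using norm_ge_zero[of A] by (simp add: pos_scale_def add_nonneg_pos)

definition scaled_op :: "('a::real_normed_vector \<Rightarrow>\<^sub>L 'a) \<Rightarrow> ('a \<Rightarrow>\<^sub>L 'a)" where
  "scaled_op A = (1 / pos_scale A) *\<^sub>R A"

lemma effect_scaled_op: "psd_op A \<Longrightarrow> effect (scaled_op A)"
  unfolding scaled_op_def by (rule effect_scaled[OF _ _ pos_scale_pos]) (simp_all add: pos_scale_def)

text \<open>Existence is the functional calculus of A scaled to an effect. For uniqueness let C be
  that root: another root D commutes with A, hence with C, so (C + D) y = 0 for y = C x - D x. Both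
  forms are nonnegative and thus vanish at y, whence C y = D y = 0 and |y|^2 = <C x - D x, y> =
  0.\<close>

theorem op_sqrt_eq:
  assumes A: "pos_op A"
  shows "op_sqrt A = sqrt (pos_scale A) *\<^sub>R bfc (scaled_op A) sqrt" (is "_ = ?C")
    and "pos_op (op_sqrt A)" and "op_sqrt A (op_sqrt A x) = A x"
proof -
  let ?R = "scaled_op A"
  have R: "effect ?R" using A by (simp add: pos_op_iff effect_scaled_op)
  have linR: "clinear_op ?R" using A by (simp add: pos_op_iff scaled_op_def clinear_op_scaleR)
  have psdC: "psd_op ?C"
    using bfc_nonneg[OF R bdd_borel_sqrt] pos_scale_pos[of A]
    by (auto simp: psd_op_def blinfun.scaleR_left intro!: sym_op_scaleR sym_op_bfc[OF R] mult_nonneg_nonneg)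
  have C: "pos_op ?C"
    by (simp add: pos_op_iff psdC clinear_op_scaleR clinear_op_bfc[OF R linR])
  have CC: "?C (?C x) = A x" for x
  proof -
    have "bfc ?R (\<lambda>r. sqrt r * sqrt r) = bfc ?R (\<lambda>r. r)"
      by (rule bfc_cong[OF R bdd_borel_mult[OF bdd_borel_sqrt bdd_borel_sqrt] bdd_borel_id]) simp
    then have "bfc ?R sqrt (bfc ?R sqrt x) = ?R x"
      using bfc_mult[OF R bdd_borel_sqrt bdd_borel_sqrt, of x] by (simp add: bfc_id[OF R])
    then have "?C (?C x) = pos_scale A *\<^sub>R ?R x"
      using pos_scale_pos[of A] by (simp add: blinfun.bilinear_simps less_imp_le)
    then show ?thesis
      using pos_scale_pos[of A] by (simp add: scaled_op_def blinfun.scaleR_left)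
  qed
  have uniq: "D = ?C" if D: "pos_op D" "D o\<^sub>L D = A" for D
  proof (rule blinfun_eqI)
    fix x
    have psdD: "psd_op D" using D by (simp add: pos_op_iff)
    have DD: "D (D x) = A x" for x using D(2) by (metis blinfun_apply_blinfun_compose)
    have "D (?R x) = ?R (D x)" for x
      by (simp add: scaled_op_def blinfun.bilinear_simps DD[symmetric])
    then have comm: "?C (D x) = D (?C x)" for x
      using bfc_commute[OF R _ bdd_borel_sqrt, of D] by (simp add: blinfun.bilinear_simps)
    define y where "y = ?C x - D x"
    have "?C y + D y = 0"
      by (simp add: y_def blinfun.diff_right CC DD comm)
    then have "inner y (?C y) + inner y (D y) = 0" by (metis inner_add_right inner_zero_right)
    moreover have "0 \<le> inner y (?C y)" "0 \<le> inner y (D y)"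
      using psdC psdD by (auto simp: psd_op_def)
    ultimately have "inner y (?C y) = 0" "inner y (D y) = 0" by linarith+
    then have z: "?C y = 0" "D y = 0"
      using psd_op_zero[OF psdC] psd_op_zero[OF psdD] by blast+
    have "sym_op ?C" "sym_op D" using psdC psdD by (simp_all add: psd_op_def)
    then have "inner (?C x) y = inner x (?C y)" "inner (D x) y = inner x (D y)"
      by (simp_all only: sym_opD)
    then have "inner (?C x) y = 0" "inner (D x) y = 0" unfolding z by simp_all
    then have "inner y y = 0"
      unfolding y_def inner_diff_left by simp
    then show "D x = ?C x" by (simp add: y_def)
  qed
  have eq: "op_sqrt A = ?C"
    unfolding op_sqrt_def
  proof (rule the_equality)
    show "pos_op ?C \<and> ?C o\<^sub>L ?C = A"
      using C by (rule conjI) (rule blinfun_eqI, simp only: blinfun_apply_blinfun_compose CC)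
  qed (use uniq in blast)
  show "op_sqrt A = ?C" "pos_op (op_sqrt A)" "op_sqrt A (op_sqrt A x) = A x"
    unfolding eq using C CC by auto
qed

section \<open>Spectral measures\<close>

definition proj_onto :: "'a::complex_hilbert set \<Rightarrow> ('a \<Rightarrow>\<^sub>L 'a) \<Rightarrow> bool" where
  "proj_onto M P \<longleftrightarrow> clinear_op P \<and> sym_op P \<and> (\<forall>x. P (P x) = P x) \<and> M = range P"

lemma proj_onto_mem: "proj_onto M P \<Longrightarrow> x \<in> M \<longleftrightarrow> P x = x"
  unfolding proj_onto_def by (metis rangeE rangeI)

lemma proj_onto_residual:
  assumes P: "proj_onto M P" and y: "y \<in> M"
  shows "cinner y (x - P x) = 0"
proof -
  have r: "inner z (x - P x) = 0" if "P z = z" for z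
  proof -
    have "inner z (x - P x) = inner (P z) (x - P x)" using that by simp
    also have "\<dots> = inner z (P (x - P x))" using P by (simp add: proj_onto_def sym_opD)
    also have "\<dots> = 0" using P by (simp add: proj_onto_def blinfun.diff_right)
    finally show ?thesis .
  qed
  have "P y = y" using proj_onto_mem[OF P] y by simp
  moreover have "P (\<i> *\<^sub>C y) = \<i> *\<^sub>C y"
    using P \<open>P y = y\<close> by (simp add: proj_onto_def clinear_opD)
  ultimately show ?thesis by (simp add: cinner_eq r complex_eq_iff)
qed

lemma op_on_iff:
  assumes P: "proj_onto M P"
  shows "op_on M A \<longleftrightarrow> clinear_op A \<and> (\<forall>x. P (A x) = A x) \<and> (\<forall>x. A (P x) = A x)"
proof
  assume A: "op_on M A"
  have "A (x - P x) = 0" for x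
    using A proj_onto_residual[OF P] by (simp add: op_on_def)
  then have "A (P x) = A x" for x by (simp add: blinfun.diff_right)
  moreover have "P (A x) = A x" for x
    using A proj_onto_mem[OF P] by (auto simp: op_on_def)
  ultimately show "clinear_op A \<and> (\<forall>x. P (A x) = A x) \<and> (\<forall>x. A (P x) = A x)"
    using A by (simp add: op_on_def)
next
  assume A: "clinear_op A \<and> (\<forall>x. P (A x) = A x) \<and> (\<forall>x. A (P x) = A x)"
  have "A x = 0" if "\<forall>y\<in>M. cinner y x = 0" for x
  proof -
    have "P x \<in> M" using P by (simp add: proj_onto_def)
    then have "inner (P x) x = 0" using that by (metis Re_cinner zero_complex.sel(1))
    then have "inner (P x) (P x) = 0"
      using P by (metis proj_onto_def sym_opD)
    then have "P x = 0" by simp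
    then show ?thesis using A by (metis blinfun.zero_right)
  qed
  moreover have "range A \<subseteq> M" using A proj_onto_mem[OF P] by auto
  ultimately show "op_on M A" using A by (simp add: op_on_def)
qed

lemma scalar_measure_eqI:
  assumes N: "sets N = sets borel"
    and eq: "\<And>\<Delta>. \<Delta> \<in> sets borel \<Longrightarrow> ennreal (Re (\<mu> \<Delta>)) = emeasure N \<Delta>"
  shows "scalar_measure \<mu> = N"
proof -
  have sp: "space N = UNIV" using sets_eq_imp_space_eq[OF N] by simp
  have "scalar_measure \<mu> = measure_of UNIV (sets borel) (emeasure N)"
    unfolding scalar_measure_def
    by (rule measure_of_eq) (use eq sets.sigma_sets_eq[of "borel :: real measure"] in auto)
  also have "\<dots> = N"
    using measure_of_of_measure[of N] sp N by simp
  finally show ?thesis .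
qed

lemma sets_scalar_measure [simp]: "sets (scalar_measure \<mu>) = sets borel"
  using sets.sigma_sets_eq[of "borel :: real measure"] by (simp add: scalar_measure_def)

lemma space_scalar_measure [simp]: "space (scalar_measure \<mu>) = UNIV"
  by (simp add: scalar_measure_def space_measure_of_conv)

context
  fixes M :: "'a::complex_hilbert set" and P :: "'a \<Rightarrow>\<^sub>L 'a" and E :: "real set \<Rightarrow> 'a \<Rightarrow>\<^sub>L 'a"
  assumes P: "proj_onto M P" and E: "projection_valued_measure M E"
begin

lemma pvm_props:
  assumes "\<Delta> \<in> sets borel"
  shows "clinear_op (E \<Delta>)" "sym_op (E \<Delta>)" "P (E \<Delta> x) = E \<Delta> x" "E \<Delta> (P x) = E \<Delta> x"
  using E assms by (auto simp: projection_valued_measure_def op_on_iff[OF P] orthogonal_projection_iff)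

lemma pvm_Int: "\<Delta> \<in> sets borel \<Longrightarrow> \<Delta>' \<in> sets borel \<Longrightarrow> E \<Delta> (E \<Delta>' x) = E (\<Delta> \<inter> \<Delta>') x"
  using E by (metis blinfun_apply_blinfun_compose projection_valued_measure_def)

lemma pvm_sums: "range F \<subseteq> sets borel \<Longrightarrow> disjoint_family F \<Longrightarrow> (\<lambda>n. E (F n) x) sums E (\<Union>n. F n) x"
  for F :: "nat \<Rightarrow> real set"
  using E by (simp add: projection_valued_measure_def)

lemma pvm_empty: "E {} x = 0"
proof -
  have "(\<lambda>n::nat. E {} x) sums E {} x"
    using pvm_sums[of "\<lambda>_. {}" x] by (auto simp: disjoint_family_on_def)
  then have "summable (\<lambda>n::nat. E {} x)" by (rule sums_summable)
  then show ?thesis by (simp add: summable_const_iff)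
qed

lemma pvm_UNIV: "E UNIV x = P x"
proof -
  have "P x \<in> M" using P by (simp add: proj_onto_def)
  then have "E UNIV (P x) = P x" using E by (simp add: projection_valued_measure_def)
  then show ?thesis by (simp add: pvm_props)
qed

lemma pvm_Compl:
  assumes D: "\<Delta> \<in> sets borel"
  shows "E \<Delta> x + E (- \<Delta>) x = P x"
proof -
  have "(\<lambda>n. E (binaryset \<Delta> (- \<Delta>) n) x) sums (E \<Delta> x + E (- \<Delta>) x)"
    by (rule binaryset_sums) (rule pvm_empty)
  moreover have "(\<lambda>n. E (binaryset \<Delta> (- \<Delta>) n) x) sums E (\<Union>n. binaryset \<Delta> (- \<Delta>) n) x"
  proof (rule pvm_sums)
    show "range (binaryset \<Delta> (- \<Delta>)) \<subseteq> sets borel" using D by (auto simp: range_binaryset_eq)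
    show "disjoint_family (binaryset \<Delta> (- \<Delta>))" by (auto simp: disjoint_family_on_def binaryset_def)
  qed
  ultimately have "E \<Delta> x + E (- \<Delta>) x = E (\<Union>n. binaryset \<Delta> (- \<Delta>) n) x" by (rule sums_unique2)
  also have "(\<Union>n. binaryset \<Delta> (- \<Delta>) n) = UNIV" by (simp add: UN_binaryset_eq)
  finally show ?thesis by (simp add: pvm_UNIV)
qed

lemma pvm_inner: "\<Delta> \<in> sets borel \<Longrightarrow> inner x (E \<Delta> y) = inner (E \<Delta> x) (E \<Delta> y)"
  using pvm_Int[of \<Delta> \<Delta> y] sym_opD[OF pvm_props(2), of \<Delta> x "E \<Delta> y"] by simp

lemma pvm_emeasure:
  assumes D: "\<Delta> \<in> sets borel"
  shows "emeasure (scalar_measure (\<lambda>\<Delta>. cinner x (E \<Delta> x))) \<Delta> = ennreal (inner x (E \<Delta> x))"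
proof -
  let ?N = "scalar_measure (\<lambda>\<Delta>. cinner x (E \<Delta> x))"
  have "emeasure ?N \<Delta> = ennreal (Re (cinner x (E \<Delta> x)))"
  proof (rule emeasure_measure_of[OF scalar_measure_def])
    show "positive (sets ?N) (\<lambda>\<Delta>. ennreal (Re (cinner x (E \<Delta> x))))"
      by (simp add: positive_def pvm_empty Re_cinner)
    show "countably_additive (sets ?N) (\<lambda>\<Delta>. ennreal (Re (cinner x (E \<Delta> x))))"
    proof (rule countably_additiveI)
      fix F :: "nat \<Rightarrow> real set" assume F: "range F \<subseteq> sets ?N" "disjoint_family F"
      have nn: "0 \<le> inner x (E (F n) x)" for n
        using F pvm_inner[of "F n" x x] by auto
      have "(\<lambda>n. inner x (E (F n) x)) sums inner x (E (\<Union>n. F n) x)"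
        using F pvm_sums[of F x] by (intro bounded_linear.sums[OF bounded_linear_inner_right]) auto
      from suminf_ennreal_eq[OF nn this]
      show "(\<Sum>i. ennreal (Re (cinner x (E (F i) x)))) = ennreal (Re (cinner x (E (\<Union> (range F)) x)))"
        by (simp add: Re_cinner)
    qed
  qed (use D in auto)
  then show ?thesis by (simp add: Re_cinner)
qed

lemma pvm_measure_cong:
  assumes "\<And>\<Delta>. \<Delta> \<in> sets borel \<Longrightarrow> inner x (E \<Delta> x) = inner y (E \<Delta> y)"
  shows "scalar_measure (\<lambda>\<Delta>. cinner x (E \<Delta> x)) = scalar_measure (\<lambda>\<Delta>. cinner y (E \<Delta> y))"
  by (rule scalar_measure_eqI) (simp_all add: pvm_emeasure Re_cinner assms)

end

lemma AE_imp_mass_zero: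
  fixes h :: "real \<Rightarrow> real"
  assumes h: "integrable N h" and pos: "AE r in N. 0 < h r" and le: "(\<integral>r. h r \<partial>N) \<le> 0"
  shows "emeasure N (space N) = 0"
proof -
  have nn: "AE r in N. 0 \<le> h r" using pos by eventually_elim simp
  then have "(\<integral>r. h r \<partial>N) = 0" using le by (intro antisym integral_nonneg_AE)
  then have "AE r in N. h r = 0" using integral_nonneg_eq_0_iff_AE[OF h nn] by simp
  then have "AE r in N. False" using pos by eventually_elim simp
  then show ?thesis by (simp add: AE_iff_measurable[of "space N"])
qed

lemma integral_nonpos_AE': "AE r in N. h r \<le> 0 \<Longrightarrow> (\<integral>r. h r \<partial>N) \<le> (0::real)"
  using integral_nonneg_AE[of "\<lambda>r. - h r" N] by simp

text \<open>The definition ties a projection-valued measure E to R by its first moment only, so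
  uniqueness is the main point. Equal first moments force E to commute with R. A vector in the range
  of E on one side of a and in the range of the calculus projection on the other side has two
  measures with the same mass and the same mean, lying on opposite sides of a; so it is 0. The two
  families agree on half lines and then, by a Dynkin argument, on all Borel sets.\<close>

theorem spectral_measure_eq:
  fixes R :: "'a::complex_hilbert \<Rightarrow>\<^sub>L 'a"
  assumes P: "proj_onto M P" and R: "effect R" and lin: "clinear_op R" and on: "op_on M R"
  shows "spectral_measure M R = (\<lambda>\<Delta>. if \<Delta> \<in> sets borel then bfc R (indicator \<Delta>) o\<^sub>L P else 0)"
    (is "_ = ?E")
  unfolding spectral_measure_def
proof (rule the_equality)
  have linP: "clinear_op P" and symP: "sym_op P" and PP: "P (P x) = P x" for x
    using P by (auto simp: proj_onto_def)
  have PR: "P (R x) = R x" "R (P x) = R x" for x using on by (auto simp: op_on_iff[OF P])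
  let ?e = "\<lambda>\<Delta>. bfc R (indicator \<Delta>)"
  have Pe: "?e \<Delta> (P x) = P (?e \<Delta> x)" if "\<Delta> \<in> sets borel" for \<Delta> x
    using that by (intro bfc_commute[OF R]) (auto simp: PR)
  have sym_e: "sym_op (?e \<Delta>)" if "\<Delta> \<in> sets borel" for \<Delta>
    using that by (intro sym_op_bfc[OF R]) auto
  have int_e: "?e \<Delta> (?e \<Delta>' x) = ?e (\<Delta> \<inter> \<Delta>') x" if "\<Delta> \<in> sets borel" "\<Delta>' \<in> sets borel" for \<Delta> \<Delta>' x
    using that bfc_mult[OF R, of "indicator \<Delta>" "indicator \<Delta>'" x]
    by (simp add: indicator_inter_arith[symmetric])
  have UNIV_e: "?e UNIV x = x" for x
    using bfc_one[OF R] by (simp add: indicator_def[abs_def])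
  have sums_e: "(\<lambda>n. ?e (F n) x) sums ?e (\<Union>n. F n) x"
    if F: "range F \<subseteq> sets borel" "disjoint_family F" for F :: "nat \<Rightarrow> real set" and x
  proof -
    have m: "F n \<in> sets borel" for n using F by auto
    have e: "(\<Sum>i<n. indicator (F i) r) = (indicator (\<Union>i<n. F i) r :: real)" for n r
      by (rule indicator_UN_disjoint[symmetric])
         (use F in \<open>auto intro: disjoint_family_on_mono\<close>)
    have p: "bfc R (\<lambda>r. \<Sum>i<n. indicator (F i) r) = (\<Sum>i<n. ?e (F i))" for n
      by (induction n) (simp_all add: bfc_add[OF R] bfc_const[OF R] m bdd_borel_sum)
    have "(\<lambda>n. bfc R (\<lambda>r. \<Sum>i<n. indicator (F i) r) x) \<longlonglongrightarrow> ?e (\<Union>n. F n) x"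
    proof (rule bfc_strong_tendsto[OF R, where K=1])
      show "(\<lambda>n. \<Sum>i<n. indicator (F i) r) \<longlonglongrightarrow> (indicator (\<Union>n. F n) r :: real)" for r
        unfolding e by (rule LIMSEQ_indicator_UN)
      show "\<bar>\<Sum>i<n. indicator (F i) r\<bar> \<le> (1::real)" for n r
        unfolding e by (simp add: indicator_def)
    qed (use m in \<open>auto intro!: bdd_borel_sum\<close>)
    then show ?thesis by (simp add: p sums_def blinfun.sum_left)
  qed
  have E_eq: "?E \<Delta> x = ?e \<Delta> (P x)" if "\<Delta> \<in> sets borel" for \<Delta> x using that by simp
  have pvm: "projection_valued_measure M ?E"
    unfolding projection_valued_measure_def
  proof (intro conjI ballI allI impI)
    fix \<Delta> :: "real set" assume D: "\<Delta> \<in> sets borel"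
    have lin_e: "clinear_op (?e \<Delta>)" using D by (intro clinear_op_bfc[OF R lin]) auto
    then have linE: "clinear_op (?E \<Delta>)" using D linP by (simp add: clinear_op_compose)
    show "op_on M (?E \<Delta>)"
      unfolding op_on_iff[OF P] using D linE by (simp add: Pe PP)
    have "inner x (?e \<Delta> (P y)) = inner (?e \<Delta> (P x)) y" for x y
      using sym_opD[OF sym_e[OF D]] sym_opD[OF symP] Pe[OF D] by metis
    then have "sym_op (?E \<Delta>)" using D by (simp add: sym_op_def)
    moreover have "?E \<Delta> (?E \<Delta> x) = ?E \<Delta> x" for x
      using D int_e[OF D D, of "P x"] by (simp add: Pe[symmetric] PP)
    ultimately show "orthogonal_projection (?E \<Delta>)"
      using linE by (simp add: orthogonal_projection_iff)
  next
    fix x assume "x \<in> M"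
    then show "?E UNIV x = x" using proj_onto_mem[OF P] by (simp add: bfc_one[OF R])
  next
    fix \<Delta> \<Delta>' :: "real set" assume D: "\<Delta> \<in> sets borel" "\<Delta>' \<in> sets borel"
    show "?E (\<Delta> \<inter> \<Delta>') = ?E \<Delta> o\<^sub>L ?E \<Delta>'"
    proof (rule blinfun_eqI)
      fix x
      have "?E \<Delta> (?E \<Delta>' x) = ?e \<Delta> (?e \<Delta>' (P (P x)))"
        using D by (simp add: Pe)
      then show "?E (\<Delta> \<inter> \<Delta>') x = (?E \<Delta> o\<^sub>L ?E \<Delta>') x"
        using D by (simp add: PP int_e)
    qed
  next
    fix F :: "nat \<Rightarrow> real set" and x
    assume F: "range F \<subseteq> sets borel" "disjoint_family F"
    then have "F n \<in> sets borel" "(\<Union>n. F n) \<in> sets borel" for n by auto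
    then show "(\<lambda>n. ?E (F n) x) sums ?E (\<Union>n. F n) x"
      using sums_e[OF F, of "P x"] by simp
  qed
  have emeas: "scalar_measure (\<lambda>\<Delta>. cinner x (?E \<Delta> x)) = effect_measure R x" if x: "P x = x" for x
  proof (rule scalar_measure_eqI)
    note unit = unit_measureD[OF effect_measure_unit[OF R, of x]]
    show "sets (effect_measure R x) = sets borel" by (rule unit(2))
    fix \<Delta> :: "real set" assume D: "\<Delta> \<in> sets borel"
    interpret finite_measure "effect_measure R x" by (rule unit(1))
    have "Re (cinner x (?E \<Delta> x)) = measure (effect_measure R x) \<Delta>"
      using D x unit(2,4) by (simp add: Re_cinner inner_bfc[OF R])
    then show "ennreal (Re (cinner x (?E \<Delta> x))) = emeasure (effect_measure R x) \<Delta>"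
      by (simp add: emeasure_eq_measure)
  qed
  have symR: "sym_op R" using R by (simp add: effect_def)
  have first: "(\<integral>r. r \<partial>effect_measure R x) = inner x (R x)" for x
    using inner_bfc[OF R bdd_borel_id, of x] by (simp add: bfc_id[OF R])
  have cR: "cinner x (R x) = complex_of_real (inner x (R x))" for x
  proof -
    have "pos_op R" using R lin by (simp add: pos_op_iff psd_op_def effect_def)
    then show ?thesis by (simp add: pos_op_def less_eq_complex_def complex_eq_iff Re_cinner)
  qed
  show "projection_valued_measure M ?E \<and> (\<forall>\<Delta>. \<Delta> \<notin> sets borel \<longrightarrow> ?E \<Delta> = 0) \<and>
     (\<forall>x\<in>M. has_bochner_integral (scalar_measure (\<lambda>\<Delta>. cinner x (?E \<Delta> x)))
        complex_of_real (cinner x (R x)))"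
  proof (intro conjI ballI pvm)
    fix x assume "x \<in> M"
    then have x: "P x = x" using proj_onto_mem[OF P] by simp
    have "has_bochner_integral (effect_measure R x) (\<lambda>r. r) (inner x (R x))"
      using effect_measure_integrable[OF R bdd_borel_id] first by (simp add: has_bochner_integral_iff)
    then have "has_bochner_integral (effect_measure R x) complex_of_real (complex_of_real (inner x (R x)))"
      by (rule has_bochner_integral_of_real)
    then show "has_bochner_integral (scalar_measure (\<lambda>\<Delta>. cinner x (?E \<Delta> x))) complex_of_real (cinner x (R x))"
      by (simp only: emeas[OF x] cR)
  qed simp
  fix E
  assume E: "projection_valued_measure M E \<and> (\<forall>\<Delta>. \<Delta> \<notin> sets borel \<longrightarrow> E \<Delta> = 0) \<and>
     (\<forall>x\<in>M. has_bochner_integral (scalar_measure (\<lambda>\<Delta>. cinner x (E \<Delta> x)))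
        complex_of_real (cinner x (R x)))"
  then have pvmE: "projection_valued_measure M E" by simp
  note props = pvm_props[OF P pvmE] and intE = pvm_Int[OF P pvmE] and innerE = pvm_inner[OF P pvmE]
  let ?N = "\<lambda>x. scalar_measure (\<lambda>\<Delta>. cinner x (E \<Delta> x))"
  have mom: "integrable (?N x) (\<lambda>r. r)" "(\<integral>r. r \<partial>?N x) = inner x (R x)" if "P x = x" for x
  proof -
    have "x \<in> M" using that proj_onto_mem[OF P] by simp
    then have h: "has_bochner_integral (?N x) complex_of_real (complex_of_real (inner x (R x)))"
      using E cR by simp
    from has_bochner_integral_Re[OF this] show "integrable (?N x) (\<lambda>r. r)" "(\<integral>r. r \<partial>?N x) = inner x (R x)"
      by (auto simp: has_bochner_integral_iff)
  qed
  \<comment> \<open>For u in the range of E(\<Delta>) and v in that of the complement, u + v and u -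
    v have the same measure and hence the same value of the form of R; by polarisation <u, R v> =
    0.\<close>
  have orth: "inner (E \<Delta> x) (R (E (- \<Delta>) y)) = 0" if D: "\<Delta> \<in> sets borel" for \<Delta> x y
  proof -
    define u v where "u = E \<Delta> x" and "v = E (- \<Delta>) y"
    have D': "- \<Delta> \<in> sets borel" using D by auto
    have uv: "P u = u" "P v = v" using D D' by (simp_all add: u_def v_def props)
    have c: "inner u (E \<Delta>' v) = 0" "inner v (E \<Delta>' u) = 0" if D'': "\<Delta>' \<in> sets borel" for \<Delta>'
    proof -
      have "E \<Delta> (E \<Delta>' v) = 0"
        using D D' D'' pvm_empty[OF P pvmE] by (simp add: v_def intE inf_assoc[symmetric] inf_commute[of _ \<Delta>'] Int_assoc)
      then show "inner u (E \<Delta>' v) = 0"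
        using sym_opD[OF props(2)[OF D], of x "E \<Delta>' v"] by (simp add: u_def)
      then show "inner v (E \<Delta>' u) = 0"
        using sym_opD[OF props(2)[OF D''], of v u] by (simp add: inner_commute)
    qed
    have "?N (u + v) = ?N (u - v)"
      by (rule pvm_measure_cong[OF P pvmE])
        (simp add: blinfun.bilinear_simps inner_add_left inner_add_right inner_diff_left inner_diff_right c)
    then have "inner (u + v) (R (u + v)) = inner (u - v) (R (u - v))"
      using mom(2)[of "u + v"] mom(2)[of "u - v"] uv by (simp add: blinfun.add_right blinfun.diff_right)
    then show ?thesis
      using sym_polarization[OF symR, of u v] by (simp add: u_def v_def)
  qed
  have RE: "R (E \<Delta> y) = E \<Delta> (R y)" if D: "\<Delta> \<in> sets borel" for \<Delta> y
  proof -
    have D': "- \<Delta> \<in> sets borel" using D by auto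
    have "inner x (R (E \<Delta> y)) = inner x (E \<Delta> (R y))" for x
    proof -
      have "inner x (R (E \<Delta> y)) = inner (P x) (R (E \<Delta> y))"
        using sym_opD[OF symP, of x "R (E \<Delta> y)"] by (simp add: PR)
      also have "\<dots> = inner (E \<Delta> x) (R (E \<Delta> y)) + inner (E (- \<Delta>) x) (R (E \<Delta> y))"
        by (simp only: pvm_Compl[OF P pvmE D, symmetric] inner_add_left)
      also have "inner (E (- \<Delta>) x) (R (E \<Delta> y)) = 0"
        using orth[OF D', of x y] by simp
      also have "inner (E \<Delta> x) (R (E \<Delta> y)) + 0 = inner (E \<Delta> x) (R (E \<Delta> y)) + inner (E \<Delta> x) (R (E (- \<Delta>) y))"
        using orth[OF D, of x y] by simp
      also have "\<dots> = inner (E \<Delta> x) (R (P y))"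
        by (simp only: pvm_Compl[OF P pvmE D, symmetric] blinfun.add_right inner_add_right)
      also have "\<dots> = inner x (E \<Delta> (R y))"
        using sym_opD[OF props(2)[OF D], of x "R y"] by (simp add: PR)
      finally show ?thesis .
    qed
    then show ?thesis by (metis vector_eq_ldot)
  qed
  have Ee: "E \<Delta> (?e \<Delta>' y) = ?e \<Delta>' (E \<Delta> y)" if "\<Delta> \<in> sets borel" "\<Delta>' \<in> sets borel" for \<Delta> \<Delta>' y
    using that by (intro bfc_commute[OF R, symmetric]) (auto simp: RE)
  have AE_N: "AE r in ?N z. r \<in> \<Delta>" if D: "\<Delta> \<in> sets borel" and z: "E \<Delta> z = z" for \<Delta> z
  proof (rule AE_I[of _ _ "- \<Delta>"])
    have "E (- \<Delta>) z = 0"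
      using intE[of "- \<Delta>" \<Delta> z] D z pvm_empty[OF P pvmE] by auto
    then show "emeasure (?N z) (- \<Delta>) = 0" using D by (subst pvm_emeasure[OF P pvmE]) auto
  qed (use D in auto)
  have AE_e: "AE r in effect_measure R z. r \<in> \<Delta>" if D: "\<Delta> \<in> sets borel" and z: "?e \<Delta> z = z" for \<Delta> z
  proof (rule AE_I[of _ _ "- \<Delta>"])
    interpret finite_measure "effect_measure R z" by (rule unit_measureD(1)[OF effect_measure_unit[OF R]])
    note unit = unit_measureD[OF effect_measure_unit[OF R, of z]]
    have "?e (- \<Delta>) (?e \<Delta> z) = ?e (- \<Delta> \<inter> \<Delta>) z" using D by (intro int_e) auto
    then have "?e (- \<Delta>) z = 0" using z bfc_const[OF R, of 0] by (simp add: indicator_def[abs_def])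
    moreover have "inner z (?e (- \<Delta>) z) = measure (effect_measure R z) (- \<Delta>)"
      using D unit(2,4) by (subst inner_bfc[OF R]) auto
    ultimately show "emeasure (effect_measure R z) (- \<Delta>) = 0" by (simp add: emeasure_eq_measure)
  qed (use D unit_measureD[OF effect_measure_unit[OF R, of z]] in auto)
  have finN: "finite_measure (?N z)" for z
    by (rule finite_measureI) (simp add: pvm_emeasure[OF P pvmE])
  have massN: "inner z z = 0" if "P z = z" "emeasure (?N z) (space (?N z)) = 0" for z
  proof (rule antisym[OF _ inner_ge_zero])
    show "inner z z \<le> 0"
      using that pvm_emeasure[OF P pvmE, of UNIV z] pvm_UNIV[OF P pvmE, of z] by (simp add: ennreal_eq_0_iff)
  qed
  have mass_e: "inner z z = 0" if "emeasure (effect_measure R z) (space (effect_measure R z)) = 0" for z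
    using that effect_measure_mass[OF R, of z] by (simp add: measure_def)
  have int_N: "(\<integral>r. r - a \<partial>?N z) = inner z (R z) - a * inner z z" "integrable (?N z) (\<lambda>r. r - a)"
    if z: "P z = z" for z a
  proof -
    interpret finite_measure "?N z" by (rule finN)
    have "measure (?N z) UNIV = inner z z"
      using pvm_emeasure[OF P pvmE, of UNIV z] pvm_UNIV[OF P pvmE, of z] z by (simp add: emeasure_eq_measure)
    then show "(\<integral>r. r - a \<partial>?N z) = inner z (R z) - a * inner z z" "integrable (?N z) (\<lambda>r. r - a)"
      using mom[OF z] by (simp_all add: mult.commute)
  qed
  have int_em: "(\<integral>r. r - a \<partial>effect_measure R z) = inner z (R z) - a * inner z z"
    "integrable (effect_measure R z) (\<lambda>r. r - a)" for z a
  proof -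
    interpret finite_measure "effect_measure R z" by (rule unit_measureD(1)[OF effect_measure_unit[OF R]])
    have "measure (effect_measure R z) UNIV = inner z z"
      using effect_measure_mass[OF R, of z] unit_measureD(4)[OF effect_measure_unit[OF R, of z]] by simp
    then show "(\<integral>r. r - a \<partial>effect_measure R z) = inner z (R z) - a * inner z z"
      "integrable (effect_measure R z) (\<lambda>r. r - a)"
      using effect_measure_integrable[OF R bdd_borel_id] unit_measureD(4)[OF effect_measure_unit[OF R, of z]]
      by (simp_all add: first mult.commute)
  qed
  \<comment> \<open>The measure of E at z lies on r \<le> a, that of the calculus on r > a. Both
    integrate r - a to <z, R z> - a |z|^2, so the second measure has mass 0.\<close>
  have zero1: "z = 0" if z: "E {..a} z = z" "?e {a<..} z = z" for z a
  proof -
    have Pz: "P z = z" using z(1) props(3)[of "{..a}" z] by simp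
    have "(\<integral>r. r - a \<partial>?N z) \<le> 0"
      using AE_N[OF _ z(1)] by (intro integral_nonpos_AE') auto
    then have "(\<integral>r. r - a \<partial>effect_measure R z) \<le> 0" using int_N(1)[OF Pz] int_em(1) by simp
    then have "emeasure (effect_measure R z) (space (effect_measure R z)) = 0"
      using AE_e[OF _ z(2)] by (intro AE_imp_mass_zero[OF int_em(2)]) auto
    then show "z = 0" using mass_e[of z] by simp
  qed
  have zero2: "z = 0" if z: "E {a<..} z = z" "?e {..a} z = z" for z a
  proof -
    have Pz: "P z = z" using z(1) props(3)[of "{a<..}" z] by simp
    have "(\<integral>r. r - a \<partial>effect_measure R z) \<le> 0"
      using AE_e[OF _ z(2)] by (intro integral_nonpos_AE') auto
    then have "(\<integral>r. r - a \<partial>?N z) \<le> 0" using int_N(1)[OF Pz] int_em(1) by simp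
    then have "emeasure (?N z) (space (?N z)) = 0"
      using AE_N[OF _ z(1)] by (intro AE_imp_mass_zero[OF int_N(2)[OF Pz]]) auto
    then show "z = 0" using massN[OF Pz] by simp
  qed
  have compl: "UNIV - {..a} = {a<..}" "- {..a} = {a<..}" for a :: real by auto
  have half: "E {..a} x = ?e {..a} (P x)" for a x
  proof -
    have "?e {a<..} (E {..a} x) = 0"
      by (rule zero1[of a]) (simp_all add: Ee intE int_e)
    moreover have "?e {..a} (E {a<..} x) = 0"
      by (rule zero2[of a]) (simp_all add: Ee intE int_e)
    moreover have "?e {..a} y + ?e {a<..} y = y" for y
    proof -
      have "bfc R (\<lambda>r. indicator {..a} r + indicator {a<..} r) = bfc R (\<lambda>r. 1)"
        by (rule bfc_cong[OF R bdd_borel_add[OF bdd_borel_indicator bdd_borel_indicator] bdd_borel_const])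
          (auto simp: indicator_def)
      then show ?thesis
        by (simp add: bfc_add[OF R] bfc_one[OF R]) (metis blinfun.add_left blinfun_apply_id_blinfun id_apply)
    qed
    moreover have "E {..a} x + E {a<..} x = P x"
      using pvm_Compl[OF P pvmE, of "{..a}" x] by (simp add: compl)
    ultimately show ?thesis
      by (metis add.right_neutral blinfun.add_right)
  qed
  define G where "G = ?E"
  have pvmG: "projection_valued_measure M G" unfolding G_def by (rule pvm)
  have "E \<Delta> x = G \<Delta> x" if "\<Delta> \<in> sets borel" for \<Delta> x
  proof -
    let ?H = "range (\<lambda>a::real. {..a})"
    have "Int_stable ?H" by (auto simp: Int_stable_def)
    moreover have "?H \<subseteq> Pow UNIV" by auto
    moreover have eq: "sigma_sets UNIV ?H = sets borel" by (simp add: borel_eq_atMost)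
    then have "\<Delta> \<in> sigma_sets UNIV ?H" using that by simp
    ultimately show ?thesis
    proof (induction rule: sigma_sets_induct_disjoint)
      case (basic A)
      then show ?case using half by (auto simp: G_def)
    next
      case empty
      show ?case by (simp only: pvm_empty[OF P pvmE] pvm_empty[OF P pvmG])
    next
      case (compl A)
      then have A: "A \<in> sets borel" using eq by simp
      have "E A x + E (- A) x = E A x + G (- A) x"
        using pvm_Compl[OF P pvmE A, of x] pvm_Compl[OF P pvmG A, of x] compl.IH by simp
      then show ?case by (simp add: Compl_eq_Diff_UNIV)
    next
      case (union F)
      then have F: "range F \<subseteq> sets borel" using eq by auto
      have "(\<lambda>n. E (F n) x) = (\<lambda>n. G (F n) x)" by (rule ext) (rule union.IH)
      then have "(\<lambda>n. G (F n) x) sums E (\<Union>n. F n) x"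
        using pvm_sums[OF P pvmE F union.hyps(1), of x] by simp
      then show ?case
        by (rule sums_unique2) (rule pvm_sums[OF P pvmG F union.hyps(1)])
    qed
  qed
  moreover have "E \<Delta> = G \<Delta>" if "\<Delta> \<notin> sets borel" for \<Delta> using that E by (simp add: G_def)
  ultimately have "E \<Delta> = G \<Delta>" for \<Delta>
    by (cases "\<Delta> \<in> sets borel") (auto intro: blinfun_eqI)
  then show "E = ?E" unfolding G_def by (rule ext)
qed

section \<open>Truncated inverse square roots\<close>

text \<open>The indicator of the positive spectrum of S, that is the projection onto the closure of
  its range (\<open>proj_onto_supp\<close>).\<close>

definition supp_proj :: "('a::{real_inner,banach} \<Rightarrow>\<^sub>L 'a) \<Rightarrow> ('a \<Rightarrow>\<^sub>L 'a)" where
  "supp_proj S = bfc (scaled_op S) (indicator {0<..})"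

definition cut_proj :: "('a::{real_inner,banach} \<Rightarrow>\<^sub>L 'a) \<Rightarrow> nat \<Rightarrow> ('a \<Rightarrow>\<^sub>L 'a)" where
  "cut_proj S n = bfc (scaled_op S) (indicator {1 / real (Suc n)..})"

definition inv_sqrt_cut :: "nat \<Rightarrow> real \<Rightarrow> real" where
  "inv_sqrt_cut n r = (if 1 / real (Suc n) \<le> r then 1 / sqrt r else 0)"

text \<open>A bounded substitute for the possibly unbounded inverse of the square root of S, taken
  on the spectral part above a cut only. The factor in front undoes the scaling by
  \<open>pos_scale\<close>.\<close>

definition cut_inv :: "('a::{real_inner,banach} \<Rightarrow>\<^sub>L 'a) \<Rightarrow> nat \<Rightarrow> ('a \<Rightarrow>\<^sub>L 'a)" where
  "cut_inv S n = (1 / sqrt (pos_scale S)) *\<^sub>R bfc (scaled_op S) (inv_sqrt_cut n)"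

lemma inverse_Suc_le_imp_pos: "1 / real (Suc n) \<le> r \<Longrightarrow> 0 < r"
  by (rule less_le_trans[of _ "1 / real (Suc n)"]) auto

lemma bdd_borel_inv_sqrt_cut [simp]: "bdd_borel (inv_sqrt_cut n)"
proof (rule bdd_borelI[where K="sqrt (real (Suc n))"])
  show "inv_sqrt_cut n \<in> borel_measurable borel" unfolding inv_sqrt_cut_def[abs_def] by measurable
  fix r :: real
  show "\<bar>inv_sqrt_cut n r\<bar> \<le> sqrt (real (Suc n))"
  proof (cases "1 / real (Suc n) \<le> r")
    case True
    have r: "0 < r" using True by (rule inverse_Suc_le_imp_pos)
    have "1 / r \<le> real (Suc n)" using True r by (simp add: field_simps)
    then have "sqrt (1 / r) \<le> sqrt (real (Suc n))" by (rule real_sqrt_le_mono)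
    then show ?thesis using True r by (simp add: inv_sqrt_cut_def real_sqrt_divide)
  qed (simp add: inv_sqrt_cut_def)
qed

lemma inv_sqrt_cut_mult: "sqrt r * inv_sqrt_cut n r = indicator {1 / real (Suc n)..} r"
proof (cases "1 / real (Suc n) \<le> r")
  case True
  have r: "0 < r" using True by (rule inverse_Suc_le_imp_pos)
  then show ?thesis using True by (simp add: inv_sqrt_cut_def)
qed (simp add: inv_sqrt_cut_def)

context
  fixes S :: "'a::complex_hilbert \<Rightarrow>\<^sub>L 'a"
  assumes S: "pos_op S"
begin

lemma eff_S: "effect (scaled_op S)"
  using S by (simp add: effect_scaled_op pos_op_iff)

lemma clinear_S: "clinear_op (scaled_op S)"
  using S by (simp add: pos_op_iff scaled_op_def clinear_op_scaleR)

lemma supp_proj_props: "clinear_op (supp_proj S)" "sym_op (supp_proj S)" "supp_proj S (supp_proj S x) = supp_proj S x"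
  using bfc_mult[OF eff_S, of "indicator {0<..}" "indicator {0<..}" x]
  by (simp_all add: supp_proj_def clinear_op_bfc[OF eff_S clinear_S] sym_op_bfc[OF eff_S]
      flip: indicator_inter_arith)

lemma cut_inv_props: "clinear_op (cut_inv S n)" "sym_op (cut_inv S n)"
  by (simp_all add: cut_inv_def clinear_op_bfc[OF eff_S clinear_S] sym_op_bfc[OF eff_S] clinear_op_scaleR sym_op_scaleR)

lemma cut_proj_tendsto: "(\<lambda>n. cut_proj S n x) \<longlonglongrightarrow> supp_proj S x"
  unfolding cut_proj_def supp_proj_def
proof (rule bfc_strong_tendsto[OF eff_S, where K=1])
  fix r :: real
  show "(\<lambda>n. indicator {1 / real (Suc n)..} r) \<longlonglongrightarrow> (indicator {0<..} r :: real)"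
  proof (cases "0 < r")
    case True
    then obtain N where N: "inverse (real (Suc N)) < r" using reals_Archimedean by blast
    have "indicator {1 / real (Suc n)..} r = (indicator {0<..} r :: real)" if "N \<le> n" for n
    proof -
      have "inverse (real (Suc n)) \<le> inverse (real (Suc N))" using that by (intro le_imp_inverse_le) auto
      then have "1 / real (Suc n) \<le> r" using N by (simp add: inverse_eq_divide)
      then show ?thesis using True by simp
    qed
    then show ?thesis by (intro tendsto_eventually eventually_sequentiallyI[of N])
  next
    case False
    have "indicator {1 / real (Suc n)..} r = (0::real)" for n
    proof -
      show ?thesis using False inverse_Suc_le_imp_pos[of n r] by (auto simp: indicator_def simp del: of_nat_Suc)
    qed
    then show ?thesis using False by (simp del: of_nat_Suc)
  qed
qed (auto simp: indicator_def)

lemma sqrt_cut_inv: "op_sqrt S (cut_inv S n x) = cut_proj S n x"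
  using bfc_mult[OF eff_S bdd_borel_sqrt bdd_borel_inv_sqrt_cut, of n x] pos_scale_pos[of S]
  by (simp add: op_sqrt_eq(1)[OF S] cut_inv_def cut_proj_def inv_sqrt_cut_mult blinfun.bilinear_simps)

lemma cut_inv_sqrt: "cut_inv S n (op_sqrt S x) = cut_proj S n x"
  using bfc_mult[OF eff_S bdd_borel_inv_sqrt_cut bdd_borel_sqrt, of n x] pos_scale_pos[of S]
  by (simp add: op_sqrt_eq(1)[OF S] cut_inv_def cut_proj_def inv_sqrt_cut_mult mult.commute[of "inv_sqrt_cut _ _"]
      blinfun.bilinear_simps)

lemma sqrt_supp: "op_sqrt S (supp_proj S x) = op_sqrt S x" "supp_proj S (op_sqrt S x) = op_sqrt S x"
proof -
  have 1: "bfc (scaled_op S) (\<lambda>r. sqrt r * indicator {0<..} r) = bfc (scaled_op S) sqrt"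
    by (rule bfc_cong[OF eff_S bdd_borel_mult[OF bdd_borel_sqrt bdd_borel_indicator] bdd_borel_sqrt])
      (auto simp: indicator_def)
  have 2: "bfc (scaled_op S) (\<lambda>r. indicator {0<..} r * sqrt r) = bfc (scaled_op S) sqrt"
    by (rule bfc_cong[OF eff_S bdd_borel_mult[OF bdd_borel_indicator bdd_borel_sqrt] bdd_borel_sqrt])
      (auto simp: indicator_def)
  from 1 2 show "op_sqrt S (supp_proj S x) = op_sqrt S x" "supp_proj S (op_sqrt S x) = op_sqrt S x"
    using bfc_mult[OF eff_S bdd_borel_sqrt bdd_borel_indicator, of "{0<..}" x]
      bfc_mult[OF eff_S bdd_borel_indicator bdd_borel_sqrt, of "{0<..}" x]
    by (simp_all add: op_sqrt_eq(1)[OF S] supp_proj_def blinfun.bilinear_simps)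
qed

lemma cut_inv_cut:
  assumes "m \<le> n"
  shows "cut_inv S n (cut_proj S m x) = cut_inv S m x" "cut_proj S m (cut_inv S n x) = cut_inv S m x"
proof -
  have le: "1 / real (Suc n) \<le> 1 / real (Suc m)" using assms by (simp add: field_simps)
  have e: "inv_sqrt_cut n r * indicator {1 / real (Suc m)..} r = inv_sqrt_cut m r" for r
    using le by (simp add: inv_sqrt_cut_def indicator_def del: of_nat_Suc)
  show "cut_inv S n (cut_proj S m x) = cut_inv S m x" "cut_proj S m (cut_inv S n x) = cut_inv S m x"
    using bfc_mult[OF eff_S bdd_borel_inv_sqrt_cut bdd_borel_indicator, of "{1 / real (Suc m)..}" n x]
      bfc_mult[OF eff_S bdd_borel_indicator bdd_borel_inv_sqrt_cut, of "{1 / real (Suc m)..}" n x]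
    by (simp_all add: cut_inv_def cut_proj_def e mult.commute[of "indicator _ _"] blinfun.bilinear_simps del: of_nat_Suc)
qed

lemma cut_inv_supp: "cut_inv S n (supp_proj S x) = cut_inv S n x"
proof -
  have e: "inv_sqrt_cut n r * indicator {0<..} r = inv_sqrt_cut n r" for r
  proof -
    show ?thesis using inverse_Suc_le_imp_pos[of n r] by (auto simp: inv_sqrt_cut_def indicator_def simp del: of_nat_Suc)
  qed
  show ?thesis
    using bfc_mult[OF eff_S bdd_borel_inv_sqrt_cut bdd_borel_indicator, of "{0<..}" n x]
    by (simp add: cut_inv_def supp_proj_def e blinfun.bilinear_simps)
qed

lemma norm_cut_proj: "norm (cut_proj S n x) \<le> norm x"
proof -
  have "(norm (cut_proj S n x))\<^sup>2 = (\<integral>r. (indicator {1 / real (Suc n)..} r)\<^sup>2 \<partial>effect_measure (scaled_op S) x)"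
    unfolding cut_proj_def by (rule bfc_norm_sq[OF eff_S]) simp
  also have "\<dots> = inner x (cut_proj S n x)"
    unfolding cut_proj_def inner_bfc[OF eff_S bdd_borel_indicator[OF borel_closed[OF closed_atLeast]]]
    by (rule Bochner_Integration.integral_cong) (auto simp: indicator_def)
  also have "\<dots> \<le> norm x * norm (cut_proj S n x)" by (rule norm_cauchy_schwarz)
  finally show ?thesis
    by (cases "cut_proj S n x = 0") (auto simp: power2_eq_square)
qed

text \<open>With K_n for \<open>cut_inv S n\<close>, the vectors \<open>cut_proj S n x\<close> equal
  S K_n K_n x, so they lie in the range of S, and they tend to \<open>supp_proj S x\<close>.
  Conversely the projection fixes the range of S, and its own range is closed.\<close>

lemma proj_onto_supp: "proj_onto (closure (range S)) (supp_proj S)"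
proof -
  let ?P = "supp_proj S" and ?T = "op_sqrt S"
  have TT: "S x = ?T (?T x)" for x by (simp add: op_sqrt_eq(3)[OF S])
  have closed: "closed (range ?P)"
  proof -
    have "range ?P = {x. ?P x = x}"
      using supp_proj_props(3) by (auto intro: range_eqI[OF sym])
    moreover have "closed {x. ?P x = x}"
      by (rule closed_Collect_eq[OF linear_continuous_on[OF blinfun.bounded_linear_right] continuous_on_id])
    ultimately show ?thesis by simp
  qed
  have "closure (range S) \<subseteq> range ?P"
  proof (rule closure_minimal[OF _ closed])
    show "range S \<subseteq> range ?P" using TT sqrt_supp(2) by (metis image_subsetI rangeI)
  qed
  moreover have "range ?P \<subseteq> closure (range S)"
  proof
    fix y assume "y \<in> range ?P"
    then obtain x where y: "y = ?P x" by auto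
    have "cut_proj S n x \<in> range S" for n
    proof -
      have "S (cut_inv S n (cut_inv S n x)) = ?T (?T (cut_inv S n (cut_inv S n x)))" by (rule TT)
      also have "\<dots> = ?T (cut_proj S n (cut_inv S n x))" by (simp only: sqrt_cut_inv)
      also have "\<dots> = cut_proj S n x" by (simp only: sqrt_cut_inv cut_inv_cut(2)[OF order_refl])
      finally show ?thesis by (metis rangeI)
    qed
    then show "y \<in> closure (range S)"
      unfolding y closure_sequential
      by (intro exI[of _ "\<lambda>n. cut_proj S n x"] conjI allI cut_proj_tendsto)
  qed
  ultimately show ?thesis using supp_proj_props by (simp add: proj_onto_def)
qed

end

section \<open>Pusz--Woronowicz calculus\<close>

lemma pos_op_add: "pos_op A \<Longrightarrow> pos_op B \<Longrightarrow> pos_op (A + B)"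
  by (auto simp: pos_op_iff psd_op_def clinear_op_add sym_op_add blinfun.add_left inner_add_right)

context
  fixes A B :: "'a::complex_hilbert \<Rightarrow>\<^sub>L 'a"
  assumes A: "pos_op A" and B: "pos_op B"
begin

abbreviation (input) "SS \<equiv> A + B"

lemma S_pos: "pos_op SS"
  using A B by (rule pos_op_add)

lemma A_le_S: "0 \<le> inner x (A x)" "inner x (A x) \<le> inner x (SS x)"
  using A B by (auto simp: pos_op_iff psd_op_def blinfun.add_left inner_add_right)

lemma sym_sqrt_S: "sym_op (op_sqrt SS)" "clinear_op (op_sqrt SS)"
  using op_sqrt_eq(2)[OF S_pos] by (auto simp: pos_op_iff psd_op_def)

lemma inner_S: "inner x (SS x) = (norm (op_sqrt SS x))\<^sup>2"
  using sym_opD[OF sym_sqrt_S(1), of x "op_sqrt SS x"] op_sqrt_eq(3)[OF S_pos, of x]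
  by (simp add: power2_norm_eq_inner)

text \<open>Domination: T kills the complement of the support of A + B, and since 0 \<le> A \<le> A
  + B the form of A vanishes there; a positive operator with vanishing form at a vector annihilates
  it.\<close>

lemma A_supp: "A (supp_proj SS x) = A x"
proof -
  let ?P = "supp_proj SS"
  have "op_sqrt SS (x - ?P x) = 0"
    by (simp add: blinfun.diff_right sqrt_supp[OF S_pos])
  then have "inner (x - ?P x) (A (x - ?P x)) = 0"
    using A_le_S[of "x - ?P x"] inner_S[of "x - ?P x"] by simp
  then have "A (x - ?P x) = 0"
    using A psd_op_zero by (auto simp: pos_op_iff)
  then show ?thesis by (simp add: blinfun.diff_right)
qed

text \<open>R ought to be the compression of A by the inverse of T. The truncations
  \<open>G n\<close>, with the bounded cut inverses in place of that inverse, are effects because A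
  \<le> A + B. Their forms converge at every vector, and the limit is R. The final bound by the
  support projection is what makes its partner S positive.\<close>

lemma pw_R_exists:
  "\<exists>R. effect R \<and> clinear_op R \<and> (\<forall>x. R (supp_proj SS x) = R x) \<and> (\<forall>x. supp_proj SS (R x) = R x) \<and>
     (\<forall>x. op_sqrt SS (R (op_sqrt SS x)) = A x) \<and> (\<forall>x. inner x (R x) \<le> inner x (supp_proj SS x))"
proof -
  let ?P = "supp_proj SS" and ?T = "op_sqrt SS" and ?K = "cut_inv SS" and ?C = "cut_proj SS"
  note K = cut_inv_props[OF S_pos] and Pp = supp_proj_props[OF S_pos]
  have symA: "sym_op A" and linA: "clinear_op A" using A by (auto simp: pos_op_iff psd_op_def)
  define G where "G n = ?K n o\<^sub>L A o\<^sub>L ?K n" for n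
  have G_inner: "inner x (G n y) = inner (?K n x) (A (?K n y))" for n x y
    by (simp add: G_def sym_opD[OF K(2)])
  have symG: "sym_op (G n)" for n
    unfolding sym_op_def
  proof (intro allI)
    fix x y
    have "inner x (G n y) = inner (A (?K n x)) (?K n y)"
      unfolding G_inner by (rule sym_opD[OF symA])
    also have "\<dots> = inner y (G n x)"
      unfolding G_inner by (rule inner_commute)
    finally show "inner x (G n y) = inner (G n x) y" by (simp only: inner_commute)
  qed
  have G_ge: "0 \<le> inner x (G n x)" for n x
    unfolding G_inner by (rule A_le_S(1))
  have G_le: "inner x (G n x) \<le> (norm (?C n x))\<^sup>2" for n x
    unfolding G_inner using A_le_S(2)[of "?K n x"] inner_S[of "?K n x"] by (simp add: sqrt_cut_inv[OF S_pos])
  have G_le1: "inner x (G n x) \<le> inner x x" for n x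
    using G_le[of x n] power_mono[OF norm_cut_proj[OF S_pos, of n x] norm_ge_zero, of 2]
    by (simp add: power2_norm_eq_inner)
  have G_bd: "\<bar>inner x (G n x)\<bar> \<le> 1 * (norm x)\<^sup>2" for n x
    using G_ge[of x n] G_le1[of x n] by (simp add: power2_norm_eq_inner)
  have G_norm: "norm (G n x) \<le> norm x" for n x
    using sym_op_norm_le[OF symG G_bd, of n x] by simp
  have G_cut: "inner (?C m x) (G n (?C m y)) = inner x (G m y)" if "m \<le> n" for m n x y
    unfolding G_inner by (simp add: cut_inv_cut[OF S_pos that])
  have G_supp: "inner (?P x) (G n (?P x)) = inner x (G n x)" for n x
    unfolding G_inner by (simp add: cut_inv_supp[OF S_pos])
  \<comment> \<open>Both values are values of the form of \<open>G n\<close>, at P x and at C_m x.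
    Since \<open>G n\<close> has norm at most 1, their difference is controlled by |P x - C_m x|
    uniformly in n.\<close>
  have diff: "\<bar>inner x (G n x) - inner x (G m x)\<bar> \<le> norm (?P x - ?C m x) * (norm (?P x) + norm (?C m x))"
    if "m \<le> n" for m n x
  proof -
    let ?y = "?P x" and ?z = "?C m x"
    have "inner x (G n x) - inner x (G m x) = inner ?y (G n ?y) - inner ?z (G n ?z)"
      by (simp only: G_supp G_cut[OF that])
    also have "\<dots> = inner (?y - ?z) (G n ?y) + inner ?z (G n (?y - ?z))"
      by (simp add: inner_diff_left inner_diff_right blinfun.diff_right)
    also have "inner ?z (G n (?y - ?z)) = inner (?y - ?z) (G n ?z)"
      using sym_opD[OF symG, of ?z n "?y - ?z"] by (simp only: inner_commute)
    finally have "\<bar>inner x (G n x) - inner x (G m x)\<bar> \<le> \<bar>inner (?y - ?z) (G n ?y)\<bar> + \<bar>inner (?y - ?z) (G n ?z)\<bar>"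
      by linarith
    also have "\<dots> \<le> norm (?y - ?z) * norm ?y + norm (?y - ?z) * norm ?z"
      by (intro add_mono order_trans[OF Cauchy_Schwarz_ineq2] mult_left_mono G_norm norm_ge_zero)
    finally show ?thesis by (simp add: distrib_left)
  qed
  have "\<exists>l. (\<lambda>n. inner x (G n x)) \<longlonglongrightarrow> l" for x
  proof -
    have "(\<lambda>m. norm (?P x - ?C m x) * (norm (?P x) + norm (?C m x))) \<longlonglongrightarrow> norm (?P x - ?P x) * (norm (?P x) + norm (?P x))"
      by (intro tendsto_intros cut_proj_tendsto[OF S_pos])
    then have lim: "(\<lambda>m. norm (?P x - ?C m x) * (norm (?P x) + norm (?C m x))) \<longlonglongrightarrow> 0" by simp
    have "Cauchy (\<lambda>n. inner x (G n x))"
    proof (rule metric_CauchyI)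
      fix e :: real assume e: "0 < e"
      obtain m where m: "norm (?P x - ?C m x) * (norm (?P x) + norm (?C m x)) < e / 2"
        using eventually_happens[OF order_tendstoD(2)[OF lim half_gt_zero[OF e]]] by auto
      show "\<exists>M. \<forall>i\<ge>M. \<forall>j\<ge>M. dist (inner x (G i x)) (inner x (G j x)) < e"
      proof (intro exI[of _ m] allI impI)
        fix i j assume ij: "m \<le> i" "m \<le> j"
        have "\<bar>inner x (G i x) - inner x (G m x)\<bar> < e / 2" "\<bar>inner x (G j x) - inner x (G m x)\<bar> < e / 2"
          using diff[OF ij(1), of x] diff[OF ij(2), of x] m by linarith+
        then show "dist (inner x (G i x)) (inner x (G j x)) < e"
          unfolding dist_real_def by linarith
      qed
    qed
    then show ?thesis by (simp add: Cauchy_convergent_iff convergent_def)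
  qed
  then obtain q where q: "\<And>x. (\<lambda>n. inner x (G n x)) \<longlonglongrightarrow> q x" by metis
  obtain R where symR: "sym_op R" and Rq: "\<And>x. inner x (R x) = q x"
    using sym_op_weak_limit[OF symG G_bd q] by blast
  have R_lim: "(\<lambda>n. inner x (G n x)) \<longlonglongrightarrow> inner x (R x)" for x
    using q[of x] by (simp only: Rq)
  have R_ge: "0 \<le> inner x (R x)" for x
    by (rule LIMSEQ_le_const[OF R_lim]) (use G_ge in blast)
  have R_le: "inner x (R x) \<le> inner x (?P x)" for x
  proof -
    have "(\<lambda>n. (norm (?C n x))\<^sup>2) \<longlonglongrightarrow> (norm (?P x))\<^sup>2"
      by (intro tendsto_intros cut_proj_tendsto[OF S_pos])
    moreover have "(norm (?P x))\<^sup>2 = inner x (?P x)"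
      using sym_opD[OF Pp(2), of x "?P x"] by (simp add: power2_norm_eq_inner Pp(3))
    ultimately show ?thesis
      using LIMSEQ_le[OF R_lim] G_le by fastforce
  qed
  have R_le1: "inner x (R x) \<le> inner x x" for x
    by (rule LIMSEQ_le_const2[OF R_lim]) (use G_le1 in blast)
  have effR: "effect R" using symR R_ge R_le1 by (simp add: effect_def)
  have linR: "clinear_op R"
  proof (rule sym_op_clinearI[OF symR])
    fix x
    have "inner (\<i> *\<^sub>C x) (G n (\<i> *\<^sub>C x)) = inner x (G n x)" for n
      unfolding G_inner by (simp add: clinear_opD[OF K(1)] clinear_opD[OF linA] inner_ii)
    then show "inner (\<i> *\<^sub>C x) (R (\<i> *\<^sub>C x)) = inner x (R x)"
      using LIMSEQ_unique[OF R_lim[of "\<i> *\<^sub>C x"]] R_lim[of x] by simp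
  qed
  have PRP: "?P (R (?P x)) = R x" for x
  proof -
    have "?P o\<^sub>L R o\<^sub>L ?P = R"
    proof (rule sym_op_eqI[OF _ symR])
      show "sym_op (?P o\<^sub>L R o\<^sub>L ?P)"
        unfolding sym_op_def by (simp add: sym_opD[OF Pp(2)] sym_opD[OF symR])
      fix x
      have "inner (?P x) (R (?P x)) = inner x (R x)"
        using LIMSEQ_unique[OF R_lim[of "?P x"]] R_lim[of x] by (simp only: G_supp)
      then show "inner x ((?P o\<^sub>L R o\<^sub>L ?P) x) = inner x (R x)"
        using sym_opD[OF Pp(2), of x "R (?P x)"] by simp
    qed
    then show ?thesis by (metis blinfun_apply_blinfun_compose)
  qed
  have PR: "?P (R x) = R x" "R (?P x) = R x" for x
    using PRP[of x] PRP[of "?P x"] Pp(3) by metis+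
  have TRT: "?T (R (?T x)) = A x" for x
  proof -
    have "?T o\<^sub>L R o\<^sub>L ?T = A"
    proof (rule sym_op_eqI[OF _ symA])
      show "sym_op (?T o\<^sub>L R o\<^sub>L ?T)"
        unfolding sym_op_def by (simp add: sym_opD[OF sym_sqrt_S(1)] sym_opD[OF symR])
      fix x
      have "inner (?T x) (G n (?T x)) = inner (?C n x) (A (?C n x))" for n
        unfolding G_inner by (simp add: cut_inv_sqrt[OF S_pos])
      moreover have "(\<lambda>n. inner (?C n x) (A (?C n x))) \<longlonglongrightarrow> inner (?P x) (A (?P x))"
        by (intro tendsto_intros cut_proj_tendsto[OF S_pos])
      ultimately have "inner (?T x) (R (?T x)) = inner (?P x) (A (?P x))"
        using LIMSEQ_unique[OF R_lim[of "?T x"]] by simp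
      also have "\<dots> = inner x (A x)"
        using sym_opD[OF symA, of "?P x" x] sym_opD[OF symA, of x x] by (simp add: A_supp)
      finally show "inner x ((?T o\<^sub>L R o\<^sub>L ?T) x) = inner x (A x)"
        using sym_opD[OF sym_sqrt_S(1), of x "R (?T x)"] by simp
    qed
    then show ?thesis by (metis blinfun_apply_blinfun_compose)
  qed
  show ?thesis
    using effR linR PR TRT R_le by blast
qed

text \<open>The vectors C_n x = T K_n x are in the range of T, so the two operators have equal forms
  there; these vectors converge to the projection of x onto the space.\<close>

lemma compression_unique:
  assumes R: "op_on (pw_space A B) R" and R': "op_on (pw_space A B) R'"
    and eq: "\<And>x. op_sqrt SS (R (op_sqrt SS x)) = op_sqrt SS (R' (op_sqrt SS x))"
  shows "R = R'"
proof (rule blinfun_eqI)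
  fix y
  let ?P = "supp_proj SS" and ?T = "op_sqrt SS" and ?K = "cut_inv SS" and ?C = "cut_proj SS"
  note Pon = op_on_iff[OF proj_onto_supp[OF S_pos], folded pw_space_def]
  have c: "inner (?C n x) (R (?C n y)) = inner (?C n x) (R' (?C n y))" for n x y
  proof -
    have "inner (?C n x) (Q (?C n y)) = inner (?K n x) (?T (Q (?T (?K n y))))" for Q :: "'a \<Rightarrow>\<^sub>L 'a"
      by (simp add: sym_opD[OF sym_sqrt_S(1)] sqrt_cut_inv[OF S_pos])
    then show ?thesis by (simp only: eq)
  qed
  have lim: "(\<lambda>n. inner (?C n x) (Q (?C n y))) \<longlonglongrightarrow> inner (?P x) (Q (?P y))" for x and Q :: "'a \<Rightarrow>\<^sub>L 'a"
    by (intro tendsto_intros cut_proj_tendsto[OF S_pos])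
  have "inner (?P x) (R (?P y)) = inner (?P x) (R' (?P y))" for x
    using LIMSEQ_unique[OF lim[of x R]] lim[of x R'] by (simp only: c)
  moreover have "inner (?P x) (Q (?P y)) = inner x (Q y)" if "op_on (pw_space A B) Q" for x Q
    using that sym_opD[OF supp_proj_props(2)[OF S_pos], of x "Q y"] by (simp add: Pon)
  ultimately have "inner x (R y) = inner x (R' y)" for x using R R' by metis
  then show "R y = R' y" by (metis vector_eq_ldot)
qed

lemma pw_R_props:
  "effect (pw_R A B)" "clinear_op (pw_R A B)" "op_on (pw_space A B) (pw_R A B)"
  "pw_R A B (supp_proj SS x) = pw_R A B x" "supp_proj SS (pw_R A B x) = pw_R A B x"
  "op_sqrt SS (pw_R A B (op_sqrt SS x)) = A x"
proof -
  let ?P = "supp_proj SS" and ?T = "op_sqrt SS"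
  note Pp = supp_proj_props[OF S_pos]
  note Pon = op_on_iff[OF proj_onto_supp[OF S_pos], folded pw_space_def]
  have adj: "op_adj ?T = ?T" "pw_T A B = ?T"
    by (simp_all add: pw_T_def op_adj_sym sym_sqrt_S)
  obtain R where R: "effect R" "clinear_op R" "\<And>x. R (?P x) = R x" "\<And>x. ?P (R x) = R x"
    "\<And>x. ?T (R (?T x)) = A x" "\<And>x. inner x (R x) \<le> inner x (?P x)"
    using pw_R_exists by blast
  have onR: "op_on (pw_space A B) R" using R by (simp add: Pon)
  \<comment> \<open>The partner of R in B(M): the identity of the subspace is represented by the
    support projection.\<close>
  define Q where "Q = ?P - R"
  have symR: "sym_op R" using R(1) by (simp add: effect_def)
  have linQ: "clinear_op Q" unfolding Q_def using Pp(1) R(2) by (rule clinear_op_diff)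
  have symQ: "sym_op Q" unfolding Q_def using Pp(2) symR by (rule sym_op_diff)
  have Q_ge: "0 \<le> inner x (Q x)" for x
    using R(6)[of x] by (simp add: Q_def blinfun.diff_left inner_diff_right)
  have Q_le: "inner x (Q x) \<le> inner x x" for x
  proof -
    have "(norm (?P x))\<^sup>2 = inner x (?P x)"
      using sym_opD[OF Pp(2), of x "?P x"] by (simp add: power2_norm_eq_inner Pp(3))
    then have "norm (?P x) * norm (?P x) \<le> norm x * norm (?P x)"
      using norm_cauchy_schwarz[of x "?P x"] by (simp add: power2_eq_square)
    then have "norm (?P x) \<le> norm x" by (cases "?P x = 0") auto
    then have "norm x * norm (?P x) \<le> norm x * norm x" by (intro mult_left_mono) auto
    then have "inner x (?P x) \<le> inner x x"
      using norm_cauchy_schwarz[of x "?P x"] by (simp add: power2_norm_eq_inner[symmetric] power2_eq_square)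
    then show ?thesis
      using R(1) by (simp add: Q_def blinfun.diff_left inner_diff_right effect_def) (smt (verit))
  qed
  have contraction: "pos_contraction_on (pw_space A B) Z"
    if "effect Z" "clinear_op Z" "op_on (pw_space A B) Z" for Z
  proof -
    have "norm (Z x) \<le> 1 * norm x" for x
      using that by (intro sym_op_norm_le) (auto simp: effect_def power2_norm_eq_inner)
    then have "norm Z \<le> 1" by (intro norm_blinfun_bound) auto
    then show ?thesis using that by (simp add: pos_contraction_on_def pos_op_iff psd_op_def effect_def)
  qed
  have effQ: "effect Q" using symQ Q_ge Q_le by (simp add: effect_def)
  have onQ: "op_on (pw_space A B) Q"
    unfolding Pon using linQ R by (simp add: Q_def blinfun.diff_left blinfun.diff_right Pp)
  have BQ: "B x = ?T (Q (?T x))" for x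
    using op_sqrt_eq(3)[OF S_pos, of x]
    by (simp add: Q_def blinfun.diff_left blinfun.diff_right R sqrt_supp[OF S_pos] blinfun.add_left)
  have "pw_R A B = R"
    unfolding pw_R_def adj
  proof (rule the_equality)
    show "\<exists>S. pos_contraction_on (pw_space A B) R \<and> pos_contraction_on (pw_space A B) S \<and>
        (\<forall>x\<in>pw_space A B. R x + S x = x) \<and> A = ?T o\<^sub>L R o\<^sub>L ?T \<and> B = ?T o\<^sub>L S o\<^sub>L ?T"
    proof (intro exI[of _ Q] conjI ballI)
      show "pos_contraction_on (pw_space A B) R" using R onR by (intro contraction)
      show "pos_contraction_on (pw_space A B) Q" using effQ linQ onQ by (intro contraction)
      show "R x + Q x = x" if "x \<in> pw_space A B" for x
        using that proj_onto_mem[OF proj_onto_supp[OF S_pos]]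
        by (simp add: Q_def blinfun.diff_left pw_space_def)
      show "A = ?T o\<^sub>L R o\<^sub>L ?T" by (rule blinfun_eqI) (simp add: R)
      show "B = ?T o\<^sub>L Q o\<^sub>L ?T" by (rule blinfun_eqI) (simp add: BQ)
    qed
  next
    fix R'
    assume "\<exists>S. pos_contraction_on (pw_space A B) R' \<and> pos_contraction_on (pw_space A B) S \<and>
        (\<forall>x\<in>pw_space A B. R' x + S x = x) \<and> A = ?T o\<^sub>L R' o\<^sub>L ?T \<and> B = ?T o\<^sub>L S o\<^sub>L ?T"
    then have R': "op_on (pw_space A B) R'" "A = ?T o\<^sub>L R' o\<^sub>L ?T"
      by (auto simp: pos_contraction_on_def)
    show "R' = R"
    proof (rule compression_unique[OF R'(1) onR])
      fix x
      have "?T (R' (?T x)) = A x" by (subst R'(2)) simp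
      then show "?T (R' (?T x)) = ?T (R (?T x))" by (simp add: R)
    qed
  qed
  with R onR show "effect (pw_R A B)" "clinear_op (pw_R A B)" "op_on (pw_space A B) (pw_R A B)"
    "pw_R A B (supp_proj SS x) = pw_R A B x" "supp_proj SS (pw_R A B x) = pw_R A B x"
    "op_sqrt SS (pw_R A B (op_sqrt SS x)) = A x" by auto
qed

lemma pw_R_B: "op_sqrt SS (op_sqrt SS x) - op_sqrt SS (pw_R A B (op_sqrt SS x)) = B x"
  by (simp add: pw_R_props op_sqrt_eq(3)[OF S_pos] blinfun.add_left)

lemma pw_density:
  assumes D: "\<Delta> \<in> sets borel"
  shows "(op_adj (pw_T A B) o\<^sub>L spectral_measure (pw_space A B) (pw_R A B) \<Delta> o\<^sub>L pw_T A B) =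
    op_sqrt SS o\<^sub>L bfc (pw_R A B) (indicator \<Delta>) o\<^sub>L op_sqrt SS"
proof -
  have "spectral_measure (pw_space A B) (pw_R A B) \<Delta> = bfc (pw_R A B) (indicator \<Delta>) o\<^sub>L supp_proj SS"
    using D by (subst spectral_measure_eq[OF proj_onto_supp[OF S_pos, folded pw_space_def] pw_R_props(1,2,3)]) simp
  then show ?thesis
    by (intro blinfun_eqI) (simp add: pw_T_def op_adj_sym sym_sqrt_S sqrt_supp[OF S_pos])
qed

end

section \<open>The measures of vector functionals and the variational formula\<close>

definition pw_measure :: "('a::complex_hilbert \<Rightarrow>\<^sub>L 'a) \<Rightarrow> ('a \<Rightarrow>\<^sub>L 'a) \<Rightarrow> 'a \<Rightarrow> real measure" where
  "pw_measure A B v = effect_measure (pw_R A B) (op_sqrt (A + B) v)"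

text \<open>For \<alpha> = 1 and \<beta> = s this is the perspective of (t - 1)^2 / (t + s) at (r, 1
  - r). A general \<alpha> only rescales the kernel and saves a normalisation when [0,1] is
  contracted.\<close>

definition kern :: "real \<Rightarrow> real \<Rightarrow> real \<Rightarrow> real" where
  "kern \<alpha> \<beta> r = (2 * r - 1)\<^sup>2 / (\<alpha> * r + \<beta> * (1 - r))"

lemma kern_denom:
  fixes \<alpha> \<beta> r :: real
  assumes "0 < \<alpha>" "0 < \<beta>" "r \<in> {0..1}"
  shows "min \<alpha> \<beta> \<le> \<alpha> * r + \<beta> * (1 - r)"
proof -
  have "min \<alpha> \<beta> * r + min \<alpha> \<beta> * (1 - r) \<le> \<alpha> * r + \<beta> * (1 - r)"
    using assms by (intro add_mono mult_right_mono) auto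
  then show ?thesis by (simp add: algebra_simps)
qed

lemma bdd_borel_kern_ratio:
  assumes ab: "0 < \<alpha>" "0 < \<beta>"
  shows "bdd_borel (\<lambda>r. (2 * r - 1) / (\<alpha> * r + \<beta> * (1 - r)))"
proof (rule bdd_borelI[where K="1 / min \<alpha> \<beta>"])
  fix r :: real assume r: "r \<in> {0..1}"
  have "\<bar>2 * r - 1\<bar> \<le> 1" using r by auto
  moreover have "min \<alpha> \<beta> \<le> \<bar>\<alpha> * r + \<beta> * (1 - r)\<bar>" "0 < min \<alpha> \<beta>" using kern_denom[OF ab r] ab by auto
  ultimately show "\<bar>(2 * r - 1) / (\<alpha> * r + \<beta> * (1 - r))\<bar> \<le> 1 / min \<alpha> \<beta>"
    unfolding abs_divide by (intro frac_le) auto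
qed measurable

lemma bdd_borel_kern:
  assumes "0 < \<alpha>" "0 < \<beta>"
  shows "bdd_borel (kern \<alpha> \<beta>)"
proof -
  have "bdd_borel (\<lambda>r. (2 * r - 1) * ((2 * r - 1) / (\<alpha> * r + \<beta> * (1 - r))))"
    by (intro bdd_borel_mult bdd_borel_kern_ratio assms bdd_borel_diff bdd_borel_const bdd_borel_id)
  then show ?thesis by (simp add: kern_def[abs_def] power2_eq_square)
qed

context
  fixes A B :: "'a::complex_hilbert \<Rightarrow>\<^sub>L 'a"
  assumes A: "pos_op A" and B: "pos_op B"
begin

lemma unit_pw_measure: "unit_measure (pw_measure A B v)"
  unfolding pw_measure_def by (rule effect_measure_unit[OF pw_R_props(1)[OF A B]])

lemma pw_measure_indicator:
  assumes D: "\<Delta> \<in> sets borel"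
  shows "measure (pw_measure A B v) \<Delta> =
    inner v ((op_sqrt (A + B) o\<^sub>L bfc (pw_R A B) (indicator \<Delta>) o\<^sub>L op_sqrt (A + B)) v)"
  using D inner_bfc[OF pw_R_props(1)[OF A B] bdd_borel_indicator[OF D], of "op_sqrt (A + B) v"]
    unit_measureD(2,4)[OF unit_pw_measure, of v] sym_opD[OF sym_sqrt_S(1)[OF A B], of v]
  by (simp add: pw_measure_def)

lemma pw_measure_mass: "(\<integral>r. 1 \<partial>pw_measure A B v) = inner v (A v) + inner v (B v)"
  unfolding pw_measure_def effect_measure_mass[OF pw_R_props(1)[OF A B]]
  using inner_S[OF A B, of v] by (simp add: power2_norm_eq_inner blinfun.add_left inner_add_right)

lemma pw_measure_id: "(\<integral>r. r \<partial>pw_measure A B v) = inner v (A v)"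
  using inner_bfc[OF pw_R_props(1)[OF A B] bdd_borel_id, of "op_sqrt (A + B) v"]
    sym_opD[OF sym_sqrt_S(1)[OF A B], of v "pw_R A B (op_sqrt (A + B) v)"]
  by (simp add: pw_measure_def bfc_id[OF pw_R_props(1)[OF A B]] pw_R_props(6)[OF A B])

lemma pw_measure_affine: "(\<integral>r. a * r + b * (1 - r) \<partial>pw_measure A B v) = a * inner v (A v) + b * inner v (B v)"
proof -
  note int = unit_measure_integrable[OF unit_pw_measure, of _ v]
  have "(\<integral>r. a * r + b * (1 - r) \<partial>pw_measure A B v) =
      (\<integral>r. a * r \<partial>pw_measure A B v) + (\<integral>r. b * (1 - r) \<partial>pw_measure A B v)"
    by (intro Bochner_Integration.integral_add int bdd_borel_mult bdd_borel_diff bdd_borel_const bdd_borel_id)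
  also have "(\<integral>r. b * (1 - r) \<partial>pw_measure A B v) = b * ((\<integral>r. 1 \<partial>pw_measure A B v) - (\<integral>r. r \<partial>pw_measure A B v))"
    by (subst Bochner_Integration.integral_diff[symmetric])
      (auto intro!: int bdd_borel_const bdd_borel_id integral_mult_right_zero)
  also have "(\<integral>r. a * r \<partial>pw_measure A B v) = a * (\<integral>r. r \<partial>pw_measure A B v)"
    by (rule integral_mult_right_zero)
  finally show ?thesis
    unfolding pw_measure_mass pw_measure_id by simp
qed

context
  fixes \<alpha> \<beta> :: real
  assumes ab: "0 < \<alpha>" "0 < \<beta>"
begin

text \<open>Completing the square shows that the form \<open>2\<langle>Dw, \<zeta>\<rangle> - \<langle>\<zeta>, N\<zeta>\<rangle>\<close> with \<open>D = 2R - 1\<close> and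
  \<open>N = \<alpha>R + \<beta>(1 - R)\<close> has the maximum \<open>\<langle>w, D N\<^sup>-\<^sup>1 D w\<rangle>\<close>, the integral of the kernel.\<close>

lemma kern_square:
  fixes v :: 'a
  defines "w \<equiv> op_sqrt (A + B) v"
  defines "y \<equiv> bfc (pw_R A B) (\<lambda>r. (2 * r - 1) / (\<alpha> * r + \<beta> * (1 - r))) w"
  shows "2 * inner (A v - B v) \<eta> - (\<alpha> * inner \<eta> (A \<eta>) + \<beta> * inner \<eta> (B \<eta>)) =
    (\<integral>r. kern \<alpha> \<beta> r \<partial>pw_measure A B v) -
    inner (y - op_sqrt (A + B) \<eta>) (bfc (pw_R A B) (\<lambda>r. \<alpha> * r + \<beta> * (1 - r)) (y - op_sqrt (A + B) \<eta>))"
proof -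
  let ?R = "pw_R A B" and ?T = "op_sqrt (A + B)"
  note R = pw_R_props(1)[OF A B]
  define z where "z = ?T \<eta>"
  define N where "N = bfc ?R (\<lambda>r. \<alpha> * r + \<beta> * (1 - r))"
  define D where "D = bfc ?R (\<lambda>r. 2 * r - 1)"
  let ?j = "\<lambda>r. (2 * r - 1) / (\<alpha> * r + \<beta> * (1 - r))"
  have bN: "bdd_borel (\<lambda>r. \<alpha> * r + \<beta> * (1 - r))" and bD: "bdd_borel (\<lambda>r. 2 * r - 1 :: real)"
    by (intro bdd_borel_add bdd_borel_mult bdd_borel_diff bdd_borel_const bdd_borel_id)+
  note bj = bdd_borel_kern_ratio[OF ab]
  have symN: "sym_op N" and symD: "sym_op D"
    unfolding N_def D_def by (rule sym_op_bfc[OF R bN], rule sym_op_bfc[OF R bD])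
  have N_eq: "N x = \<alpha> *\<^sub>R ?R x + \<beta> *\<^sub>R (x - ?R x)" for x
    unfolding N_def
    by (simp add: bfc_add[OF R] bfc_scale[OF R] bfc_diff[OF R] bfc_one[OF R] bfc_id[OF R]
        bdd_borel_mult bdd_borel_diff blinfun.bilinear_simps)
  have D_eq: "D x = 2 *\<^sub>R ?R x - x" for x
    unfolding D_def
    by (simp add: bfc_diff[OF R] bfc_scale[OF R] bfc_one[OF R] bfc_id[OF R] bdd_borel_mult blinfun.bilinear_simps)
  have Ny: "N y = D w"
  proof -
    have "N y = bfc ?R (\<lambda>r. (\<alpha> * r + \<beta> * (1 - r)) * ?j r) w"
      unfolding N_def y_def by (rule bfc_mult[OF R bN bj, symmetric])
    also have "bfc ?R (\<lambda>r. (\<alpha> * r + \<beta> * (1 - r)) * ?j r) = D"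
      unfolding D_def
    proof (rule bfc_cong[OF R bdd_borel_mult[OF bN bj] bD])
      fix r :: real assume "r \<in> {0..1}"
      from kern_denom[OF ab this] have "\<alpha> * r + \<beta> * (1 - r) \<noteq> 0" using ab by auto
      then show "(\<alpha> * r + \<beta> * (1 - r)) * ?j r = 2 * r - 1" by simp
    qed
    finally show ?thesis .
  qed
  have int: "(\<integral>r. kern \<alpha> \<beta> r \<partial>pw_measure A B v) = inner y (N y)"
  proof -
    have "(\<integral>r. kern \<alpha> \<beta> r \<partial>pw_measure A B v) = inner w (bfc ?R (kern \<alpha> \<beta>) w)"
      unfolding pw_measure_def w_def by (rule inner_bfc[OF R bdd_borel_kern[OF ab], symmetric])
    also have "bfc ?R (kern \<alpha> \<beta>) w = D y"
      using bfc_mult[OF R bD bj, of w] unfolding D_def y_def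
      by (simp add: kern_def[abs_def] power2_eq_square)
    also have "inner w (D y) = inner (N y) y" unfolding Ny by (rule sym_opD[OF symD])
    finally show ?thesis by (simp only: inner_commute)
  qed
  have TT: "(A + B) x = ?T (?T x)" for x by (simp add: op_sqrt_eq(3)[OF S_pos[OF A B]])
  have A_eq: "A x = ?T (?R (?T x))" and B_eq: "B x = ?T (?T x - ?R (?T x))" for x
    using pw_R_props(6)[OF A B, of x] pw_R_B[OF A B, of x] by (simp_all add: blinfun.diff_right)
  have Tsym: "inner (?T x) y = inner x (?T y)" for x y
    using sym_opD[OF sym_sqrt_S(1)[OF A B], of x y] by simp
  have "inner (A v - B v) \<eta> = inner (D w) z"
    unfolding A_eq B_eq D_eq w_def z_def blinfun.diff_right[symmetric] Tsym
    by (simp add: scaleR_2 algebra_simps)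
  moreover have "\<alpha> * inner \<eta> (A \<eta>) + \<beta> * inner \<eta> (B \<eta>) = inner z (N z)"
    unfolding A_eq B_eq N_eq z_def Tsym[symmetric] by (simp add: inner_add_right)
  moreover have "inner (y - z) (N (y - z)) = inner y (N y) - 2 * inner (N y) z + inner z (N z)"
    using sym_opD[OF symN, of z y]
    by (simp add: blinfun.diff_right inner_diff_left inner_diff_right sym_opD[OF symN, of y z] inner_commute[of z "N y"])
  ultimately show ?thesis
    unfolding int N_def[symmetric] z_def[symmetric] Ny by simp
qed

lemma kern_upper:
  "2 * inner (A v - B v) \<eta> - (\<alpha> * inner \<eta> (A \<eta>) + \<beta> * inner \<eta> (B \<eta>)) \<le> (\<integral>r. kern \<alpha> \<beta> r \<partial>pw_measure A B v)"
proof -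
  have "0 \<le> inner x (bfc (pw_R A B) (\<lambda>r. \<alpha> * r + \<beta> * (1 - r)) x)" for x
  proof (rule bfc_nonneg[OF pw_R_props(1)[OF A B]])
    show "0 \<le> \<alpha> * r + \<beta> * (1 - r)" if "r \<in> {0..1}" for r using kern_denom[OF ab that] ab by simp
  qed (intro bdd_borel_add bdd_borel_mult bdd_borel_diff bdd_borel_const bdd_borel_id)
  then show ?thesis unfolding kern_square by simp
qed

text \<open>The maximiser would be a preimage of y under T, but y need not lie in the range of T. It
  lies in the closure: the vectors C_n y = T K_n y tend to y, so the supremum is approached without
  being attained.\<close>

lemma kern_lower:
  assumes e: "e < (\<integral>r. kern \<alpha> \<beta> r \<partial>pw_measure A B v)"
  shows "\<exists>\<eta>. e < 2 * inner (A v - B v) \<eta> - (\<alpha> * inner \<eta> (A \<eta>) + \<beta> * inner \<eta> (B \<eta>))"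
proof -
  let ?R = "pw_R A B" and ?T = "op_sqrt (A + B)" and ?P = "supp_proj (A + B)"
  note R = pw_R_props(1)[OF A B]
  let ?j = "\<lambda>r. (2 * r - 1) / (\<alpha> * r + \<beta> * (1 - r))"
  define y where "y = bfc ?R ?j (?T v)"
  define N where "N = bfc ?R (\<lambda>r. \<alpha> * r + \<beta> * (1 - r))"
  let ?I = "\<integral>r. kern \<alpha> \<beta> r \<partial>pw_measure A B v"
  \<comment> \<open>P commutes with R, hence with functions of R, and it fixes T v.\<close>
  have Py: "?P y = y"
  proof -
    have "?P y = bfc ?R ?j (?P (?T v))"
      unfolding y_def
      by (rule bfc_commute[OF R _ bdd_borel_kern_ratio[OF ab], symmetric]) (simp add: pw_R_props[OF A B])
    then show ?thesis by (simp add: y_def sqrt_supp[OF S_pos[OF A B]])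
  qed
  have "(\<lambda>n. cut_proj (A + B) n y) \<longlonglongrightarrow> y"
    using cut_proj_tendsto[OF S_pos[OF A B], of y] by (simp add: Py)
  then have "(\<lambda>n. ?I - inner (y - cut_proj (A + B) n y) (N (y - cut_proj (A + B) n y))) \<longlonglongrightarrow> ?I - inner (y - y) (N (y - y))"
    by (intro tendsto_intros)
  then have "(\<lambda>n. ?I - inner (y - cut_proj (A + B) n y) (N (y - cut_proj (A + B) n y))) \<longlonglongrightarrow> ?I"
    by simp
  from eventually_happens[OF order_tendstoD(1)[OF this e]]
  obtain n where n: "e < ?I - inner (y - cut_proj (A + B) n y) (N (y - cut_proj (A + B) n y))" by auto
  have "cut_proj (A + B) n y = ?T (cut_inv (A + B) n y)"
    by (simp add: sqrt_cut_inv[OF S_pos[OF A B]])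
  with n show ?thesis
    by (intro exI[of _ "cut_inv (A + B) n y"]) (simp add: kern_square y_def N_def)
qed

end

end

text \<open>The last term is the exact change for an affine h = a r + b (1 - r), where the
  coefficient of <v, X v> is a + b = 2 h(1/2); it vanishes for the kernels. In this form the
  inequality is stable under sums and nonnegative multiples.\<close>

definition shift_ok where
  "shift_ok A B X v h \<longleftrightarrow> (\<integral>r. h r \<partial>pw_measure (A + X) (B + X) v) \<le>
     (\<integral>r. h r \<partial>pw_measure A B v) + 2 * h (1 / 2) * inner v (blinfun_apply X v)"

definition conv_ok where
  "conv_ok A B X v h \<longleftrightarrow> (\<lambda>n::nat. \<integral>r. h r \<partial>pw_measure (A + X n) (B + X n) v) \<longlonglongrightarrow>
     (\<integral>r. h r \<partial>pw_measure A B v)"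

lemma pw_integral_uniform:
  assumes A: "pos_op A" and B: "pos_op B" and h: "bdd_borel h" "bdd_borel h'"
    and e: "\<And>r. r \<in> {0..1} \<Longrightarrow> \<bar>h r - h' r\<bar> \<le> e"
  shows "\<bar>(\<integral>r. h r \<partial>pw_measure A B v) - (\<integral>r. h' r \<partial>pw_measure A B v)\<bar> \<le> e * (inner v (A v) + inner v (B v))"
  using unit_measure_integral_bound[OF unit_pw_measure[OF A B] bdd_borel_diff[OF h] e, of v]
    unit_measure_integrable[OF unit_pw_measure[OF A B] h(1), of v]
    unit_measure_integrable[OF unit_pw_measure[OF A B] h(2), of v]
  unfolding pw_measure_mass[OF A B] by simp

inductive kern_cone :: "(real \<Rightarrow> real) \<Rightarrow> bool" where
  affine: "kern_cone (\<lambda>r. a * r + b * (1 - r))"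
| kern: "0 < \<alpha> \<Longrightarrow> 0 < \<beta> \<Longrightarrow> kern_cone (kern \<alpha> \<beta>)"
| add: "kern_cone h \<Longrightarrow> kern_cone h' \<Longrightarrow> kern_cone (\<lambda>r. h r + h' r)"
| scale: "kern_cone h \<Longrightarrow> 0 \<le> c \<Longrightarrow> kern_cone (\<lambda>r. c * h r)"

lemma bdd_borel_kern_cone: "kern_cone h \<Longrightarrow> bdd_borel h"
  by (induction rule: kern_cone.induct)
    (intro bdd_borel_add bdd_borel_mult bdd_borel_diff bdd_borel_const bdd_borel_id bdd_borel_kern; assumption)+

context
  fixes A B :: "'a::complex_hilbert \<Rightarrow>\<^sub>L 'a" and v :: 'a
  assumes A: "pos_op A" and B: "pos_op B"
begin

text \<open>At a fixed \<eta> the difference A - B does not change, while the subtracted form grows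
  by (\<alpha> + \<beta>) <\<eta>, X \<eta>>.\<close>

lemma kern_shift_le:
  assumes X: "pos_op X" and ab: "0 < \<alpha>" "0 < \<beta>"
  shows "(\<integral>r. kern \<alpha> \<beta> r \<partial>pw_measure (A + X) (B + X) v) \<le> (\<integral>r. kern \<alpha> \<beta> r \<partial>pw_measure A B v)"
proof (rule ccontr)
  assume "\<not> ?thesis"
  then have "(\<integral>r. kern \<alpha> \<beta> r \<partial>pw_measure A B v) < (\<integral>r. kern \<alpha> \<beta> r \<partial>pw_measure (A + X) (B + X) v)" by simp
  from kern_lower[OF pos_op_add[OF A X] pos_op_add[OF B X] ab this]
  obtain \<eta> where \<eta>: "(\<integral>r. kern \<alpha> \<beta> r \<partial>pw_measure A B v) < 2 * inner ((A + X) v - (B + X) v) \<eta> -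
      (\<alpha> * inner \<eta> ((A + X) \<eta>) + \<beta> * inner \<eta> ((B + X) \<eta>))" by blast
  have "0 \<le> (\<alpha> + \<beta>) * inner \<eta> (X \<eta>)"
    using X ab by (simp add: pos_op_iff psd_op_def)
  then have "2 * inner ((A + X) v - (B + X) v) \<eta> - (\<alpha> * inner \<eta> ((A + X) \<eta>) + \<beta> * inner \<eta> ((B + X) \<eta>))
      \<le> 2 * inner (A v - B v) \<eta> - (\<alpha> * inner \<eta> (A \<eta>) + \<beta> * inner \<eta> (B \<eta>))"
    by (simp add: blinfun.add_left inner_add_right distrib_left distrib_right)
  with \<eta> kern_upper[OF A B ab, of v \<eta>] show False by linarith
qed

lemma kern_cone_shift:
  assumes X: "pos_op X" and h: "kern_cone h"
  shows "shift_ok A B X v h"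
  using h
proof (induction rule: kern_cone.induct)
  case (affine a b)
  show ?case
    unfolding shift_ok_def pw_measure_affine[OF A B] pw_measure_affine[OF pos_op_add[OF A X] pos_op_add[OF B X]]
    by (simp add: blinfun.add_left inner_add_right algebra_simps)
next
  case (kern \<alpha> \<beta>)
  then show ?case using kern_shift_le[OF X kern] by (simp add: shift_ok_def kern_def)
next
  case (add h h')
  note int = unit_measure_integrable[OF unit_pw_measure[OF A B], of _ v]
    unit_measure_integrable[OF unit_pw_measure[OF pos_op_add[OF A X] pos_op_add[OF B X]], of _ v]
  from add show ?case
    by (simp add: shift_ok_def int bdd_borel_kern_cone algebra_simps)
next
  case (scale h c)
  then show ?case
    using mult_left_mono[OF scale.IH[unfolded shift_ok_def], of c]
    by (simp add: shift_ok_def algebra_simps)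
qed

lemma uniform_shift:
  assumes X: "pos_op X" and h: "bdd_borel h"
    and approx: "\<And>e. 0 < e \<Longrightarrow> \<exists>h'. kern_cone h' \<and> (\<forall>r\<in>{0..1}. \<bar>h r - h' r\<bar> \<le> e)"
  shows "shift_ok A B X v h"
proof -
  let ?I = "\<lambda>h. \<integral>r. h r \<partial>pw_measure A B v" and ?J = "\<lambda>h. \<integral>r. h r \<partial>pw_measure (A + X) (B + X) v"
  note AX = pos_op_add[OF A X] and BX = pos_op_add[OF B X]
  define m where "m = inner v (A v) + inner v (B v)"
  define m' where "m' = inner v ((A + X) v) + inner v ((B + X) v)"
  define x where "x = inner v (X v)"
  have nn: "0 \<le> m" "0 \<le> m'" "0 \<le> x"
    using A B AX BX X by (auto simp: m_def m'_def x_def pos_op_iff psd_op_def)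
  have "?J h \<le> ?I h + 2 * h (1 / 2) * x + e" if e: "0 < e" for e
  proof -
    \<comment> \<open>The three errors are d times the two masses and, from the value at 1/2, 2 d x;
      the summand 1 avoids a zero denominator.\<close>
    define d where "d = e / (m + m' + 2 * x + 1)"
    have pos: "0 < m + m' + 2 * x + 1" using nn by linarith
    have d: "0 < d" using e pos by (simp add: d_def)
    have "d * (m + m' + 2 * x) \<le> d * (m + m' + 2 * x + 1)" using d by (intro mult_left_mono) auto
    also have "\<dots> = e" using pos by (simp add: d_def)
    finally have de: "d * m + d * m' + 2 * (d * x) \<le> e" by (simp add: algebra_simps)
    obtain h' where h': "kern_cone h'" "\<And>r. r \<in> {0..1} \<Longrightarrow> \<bar>h r - h' r\<bar> \<le> d" using approx[OF d] by blast
    have 1: "\<bar>?I h - ?I h'\<bar> \<le> d * m"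
      unfolding m_def by (rule pw_integral_uniform[OF A B h bdd_borel_kern_cone[OF h'(1)] h'(2)])
    have 2: "\<bar>?J h - ?J h'\<bar> \<le> d * m'"
      unfolding m'_def by (rule pw_integral_uniform[OF AX BX h bdd_borel_kern_cone[OF h'(1)] h'(2)])
    have 3: "?J h' \<le> ?I h' + 2 * (h' (1 / 2) * x)"
      using kern_cone_shift[OF X h'(1)] by (simp add: shift_ok_def x_def)
    have "h' (1 / 2) - h (1 / 2) \<le> d" using h'(2)[of "1/2"] by (simp add: abs_le_iff)
    then have "(h' (1 / 2) - h (1 / 2)) * x \<le> d * x" using nn by (intro mult_right_mono)
    then have 4: "h' (1 / 2) * x \<le> h (1 / 2) * x + d * x" by (simp add: algebra_simps)
    from 1 2 3 4 de show ?thesis by (simp add: abs_le_iff)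
  qed
  then have "?J h \<le> ?I h + 2 * h (1 / 2) * x" by (rule field_le_epsilon)
  then show ?thesis by (simp add: shift_ok_def x_def)
qed

context
  fixes X :: "nat \<Rightarrow> 'a \<Rightarrow>\<^sub>L 'a"
  assumes X: "\<And>n. pos_op (X n)" and X0: "\<And>\<xi>. (\<lambda>n. X n \<xi>) \<longlonglongrightarrow> 0"
begin

lemma inner_X_tendsto: "(\<lambda>n. inner x (X n y)) \<longlonglongrightarrow> 0"
  using tendsto_inner[OF tendsto_const[of x] X0[of y]] by simp

text \<open>From below, an \<eta> that is nearly optimal for (A, B) is kept fixed along the
  sequence, where only <\<eta>, X n \<eta>> moves. From above, monotonicity holds for every
  n.\<close>

lemma kern_conv:
  assumes ab: "0 < \<alpha>" "0 < \<beta>"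
  shows "conv_ok A B X v (kern \<alpha> \<beta>)"
  unfolding conv_ok_def
proof (rule order_tendstoI)
  fix a assume "a < (\<integral>r. kern \<alpha> \<beta> r \<partial>pw_measure A B v)"
  from kern_lower[OF A B ab this]
  obtain \<eta> where \<eta>: "a < 2 * inner (A v - B v) \<eta> - (\<alpha> * inner \<eta> (A \<eta>) + \<beta> * inner \<eta> (B \<eta>))" by blast
  let ?F = "\<lambda>n. 2 * inner ((A + X n) v - (B + X n) v) \<eta> -
      (\<alpha> * inner \<eta> ((A + X n) \<eta>) + \<beta> * inner \<eta> ((B + X n) \<eta>))"
  have "?F n = 2 * inner (A v - B v) \<eta> - (\<alpha> * inner \<eta> (A \<eta>) + \<beta> * inner \<eta> (B \<eta>)) - (\<alpha> + \<beta>) * inner \<eta> (X n \<eta>)" for n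
    by (simp add: blinfun.add_left inner_add_right distrib_left distrib_right)
  moreover have "(\<lambda>n. 2 * inner (A v - B v) \<eta> - (\<alpha> * inner \<eta> (A \<eta>) + \<beta> * inner \<eta> (B \<eta>)) - (\<alpha> + \<beta>) * inner \<eta> (X n \<eta>))
      \<longlonglongrightarrow> 2 * inner (A v - B v) \<eta> - (\<alpha> * inner \<eta> (A \<eta>) + \<beta> * inner \<eta> (B \<eta>)) - (\<alpha> + \<beta>) * 0"
    by (intro tendsto_intros inner_X_tendsto)
  ultimately have "?F \<longlonglongrightarrow> 2 * inner (A v - B v) \<eta> - (\<alpha> * inner \<eta> (A \<eta>) + \<beta> * inner \<eta> (B \<eta>))"
    by simp
  from order_tendstoD(1)[OF this \<eta>]
  show "\<forall>\<^sub>F n in sequentially. a < (\<integral>r. kern \<alpha> \<beta> r \<partial>pw_measure (A + X n) (B + X n) v)"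
  proof eventually_elim
    case (elim n)
    then show ?case
      using kern_upper[OF pos_op_add[OF A X[of n]] pos_op_add[OF B X[of n]] ab, of v \<eta>] by linarith
  qed
next
  fix a assume "(\<integral>r. kern \<alpha> \<beta> r \<partial>pw_measure A B v) < a"
  then show "\<forall>\<^sub>F n in sequentially. (\<integral>r. kern \<alpha> \<beta> r \<partial>pw_measure (A + X n) (B + X n) v) < a"
    using kern_shift_le[OF X ab] by (intro always_eventually allI) (rule le_less_trans)
qed

lemma kern_cone_conv:
  assumes h: "kern_cone h"
  shows "conv_ok A B X v h"
  using h
proof (induction rule: kern_cone.induct)
  case (affine a b)
  have "(\<lambda>n. a * (inner v (A v) + inner v (X n v)) + b * (inner v (B v) + inner v (X n v)))
    \<longlonglongrightarrow> a * (inner v (A v) + 0) + b * (inner v (B v) + 0)"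
    by (intro tendsto_intros inner_X_tendsto)
  then show ?case
    unfolding conv_ok_def pw_measure_affine[OF A B] pw_measure_affine[OF pos_op_add[OF A X] pos_op_add[OF B X]]
    by (simp add: blinfun.add_left inner_add_right)
next
  case (kern \<alpha> \<beta>)
  then show ?case by (rule kern_conv)
next
  case (add h h')
  note int = unit_measure_integrable[OF unit_pw_measure[OF A B], of _ v]
    unit_measure_integrable[OF unit_pw_measure[OF pos_op_add[OF A X] pos_op_add[OF B X]]]
  from add show ?case
    by (simp add: conv_ok_def int bdd_borel_kern_cone tendsto_add)
next
  case (scale h c)
  then show ?case by (simp add: conv_ok_def tendsto_mult_left)
qed

lemma uniform_conv:
  assumes h: "bdd_borel h"
    and approx: "\<And>e. 0 < e \<Longrightarrow> \<exists>h'. kern_cone h' \<and> (\<forall>r\<in>{0..1}. \<bar>h r - h' r\<bar> \<le> e)"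
  shows "conv_ok A B X v h"
  unfolding conv_ok_def
proof (rule LIMSEQ_I)
  let ?I = "\<lambda>h. \<integral>r. h r \<partial>pw_measure A B v" and ?J = "\<lambda>n h. \<integral>r. h r \<partial>pw_measure (A + X n) (B + X n) v"
  define m where "m = inner v (A v) + inner v (B v)"
  have m: "0 \<le> m" using A B by (auto simp: m_def pos_op_iff psd_op_def)
  fix e :: real assume e: "0 < e"
  define d where "d = e / (4 * (m + 1))"
  have d: "0 < d" "d * (m + 1) = e / 4" using e m by (simp_all add: d_def field_simps)
  obtain h' where h': "kern_cone h'" "\<And>r. r \<in> {0..1} \<Longrightarrow> \<bar>h r - h' r\<bar> \<le> d" using approx[OF d(1)] by blast
  have 1: "\<bar>?I h - ?I h'\<bar> \<le> d * (m + 1)"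
    using pw_integral_uniform[OF A B h bdd_borel_kern_cone[OF h'(1)] h'(2), of v] d
    by (simp add: m_def algebra_simps)
  \<comment> \<open>X n enters the total mass twice, once with A and once with B, so the bound 1/2
    keeps the mass of the shifted measure below m + 1.\<close>
  have "\<forall>\<^sub>F n in sequentially. inner v (X n v) < 1 / 2"
    using order_tendstoD(2)[OF inner_X_tendsto, of "1/2"] by simp
  moreover have "\<forall>\<^sub>F n in sequentially. \<bar>?J n h' - ?I h'\<bar> < e / 4"
    using tendstoD[OF kern_cone_conv[OF h'(1), unfolded conv_ok_def], of "e / 4"] e by (simp add: dist_real_def)
  ultimately have "\<forall>\<^sub>F n in sequentially. norm (?J n h - ?I h) < e"
  proof eventually_elim
    case (elim n)
    have "\<bar>?J n h - ?J n h'\<bar> \<le> d * (inner v ((A + X n) v) + inner v ((B + X n) v))"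
      by (rule pw_integral_uniform[OF pos_op_add[OF A X] pos_op_add[OF B X] h bdd_borel_kern_cone[OF h'(1)] h'(2)])
    also have "\<dots> \<le> d * (m + 1)"
      using d elim by (intro mult_left_mono) (auto simp: m_def blinfun.add_left inner_add_right)
    finally show ?case using 1 d(2) elim(2) e unfolding real_norm_def by linarith
  qed
  then show "\<exists>no. \<forall>n\<ge>no. norm (?J n h - ?I h) < e" by (simp add: eventually_sequentially)
qed

end

end

section \<open>Positive normal functionals\<close>

text \<open>Orthonormal bases may be uncountable; sums of nonnegative terms are turned into
  integrals over a counting measure, where their order can be exchanged freely.\<close>

lemma has_sum_imp_nn_integral:
  fixes f :: "'b \<Rightarrow> real"
  assumes f: "\<And>x. x \<in> A \<Longrightarrow> 0 \<le> f x" and s: "(f has_sum s) A"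
  shows "(\<integral>\<^sup>+x. ennreal (f x) \<partial>count_space A) = ennreal s"
proof -
  have "f summable_on A" using s by (auto simp: summable_on_def)
  then have "(\<lambda>x. norm (f x)) summable_on A"
    using f by (subst summable_on_cong[where g=f]) auto
  then have abs: "Infinite_Set_Sum.abs_summable_on f A" using abs_summable_equivalent by blast
  then have int: "integrable (count_space A) f" by (simp add: Infinite_Set_Sum.abs_summable_on_def)
  have "(\<integral>\<^sup>+x. ennreal (f x) \<partial>count_space A) = ennreal (integral\<^sup>L (count_space A) f)"
    by (rule nn_integral_eq_integral[OF int]) (simp add: AE_count_space f)
  also have "integral\<^sup>L (count_space A) f = s"
    using infsetsum_infsum[OF abs] infsumI[OF s] by (simp add: infsetsum_def)
  finally show ?thesis .
qed

lemma nn_integral_imp_has_sum: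
  fixes f :: "'b \<Rightarrow> real"
  assumes f: "\<And>x. x \<in> A \<Longrightarrow> 0 \<le> f x" and s: "(\<integral>\<^sup>+x. ennreal (f x) \<partial>count_space A) = ennreal s" "0 \<le> s"
  shows "(f has_sum s) A"
proof -
  have int: "integrable (count_space A) f"
    by (rule integrableI_nonneg) (auto simp: AE_count_space f s)
  then have abs: "Infinite_Set_Sum.abs_summable_on f A" by (simp add: Infinite_Set_Sum.abs_summable_on_def)
  then have "(\<lambda>x. norm (f x)) summable_on A" using abs_summable_equivalent by blast
  then have sum: "f summable_on A" by (rule abs_summable_summable)
  have "ennreal (infsum f A) = ennreal s"
    using has_sum_imp_nn_integral[OF f has_sum_infsum[OF sum]] s by simp
  moreover have "0 \<le> infsum f A" using f by (rule infsum_nonneg)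
  ultimately have "infsum f A = s" using s by simp
  with has_sum_infsum[OF sum] show ?thesis by simp
qed

lemma nn_integral_count_space_UNIV:
  "(\<integral>\<^sup>+x. h x \<partial>count_space X) = (\<integral>\<^sup>+x. h x * indicator X x \<partial>count_space UNIV)"
  by (cases "X = UNIV") (simp_all add: nn_integral_count_space_indicator)

text \<open>Valid for index sets of any size: indicators move both integrals to the whole types,
  where each iterated integral equals the one over the product.\<close>

lemma nn_integral_count_space_swap:
  fixes f :: "'b \<Rightarrow> 'c \<Rightarrow> ennreal"
  shows "(\<integral>\<^sup>+x. (\<integral>\<^sup>+y. f x y \<partial>count_space B) \<partial>count_space A) = (\<integral>\<^sup>+y. (\<integral>\<^sup>+x. f x y \<partial>count_space A) \<partial>count_space B)"
proof -
  define g where "g p = f (fst p) (snd p) * indicator A (fst p) * indicator B (snd p)" for p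
  have "(\<integral>\<^sup>+x. (\<integral>\<^sup>+y. f x y \<partial>count_space B) \<partial>count_space A) = (\<integral>\<^sup>+x. (\<integral>\<^sup>+y. g (x, y) \<partial>count_space UNIV) \<partial>count_space UNIV)"
    unfolding nn_integral_count_space_UNIV[of A] nn_integral_count_space_UNIV[of B] g_def
    by (rule nn_integral_cong) (simp add: indicator_def)
  also have "\<dots> = (\<integral>\<^sup>+y. (\<integral>\<^sup>+x. g (x, y) \<partial>count_space UNIV) \<partial>count_space UNIV)"
    unfolding nn_integral_fst_count_space nn_integral_snd_count_space ..
  also have "\<dots> = (\<integral>\<^sup>+y. (\<integral>\<^sup>+x. f x y \<partial>count_space A) \<partial>count_space B)"
    unfolding nn_integral_count_space_UNIV[of A] nn_integral_count_space_UNIV[of B] g_def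
    by (rule nn_integral_cong) (simp add: indicator_def)
  finally show ?thesis .
qed

section \<open>Orthonormal bases, Parseval's identity and the trace\<close>

lemma cinner_self: "cinner x x = complex_of_real ((norm x)\<^sup>2)" for x :: "'a::complex_hilbert"
proof -
  have "Im (cinner x x) = 0" using cinner_commute[of x x] by (metis complex_cnj_cancel_iff Reals_cnj_iff complex_is_Real_iff)
  then show ?thesis by (simp add: complex_eq_iff Re_cinner power2_norm_eq_inner)
qed

lemma cmod_scaleC_norm: "norm (c *\<^sub>C x) = cmod c * norm (x::'a::complex_hilbert)"
proof -
  have "complex_of_real ((norm (c *\<^sub>C x))\<^sup>2) = (c * cnj c) * cinner x x"
    unfolding cinner_self[symmetric] by (simp add: cinner_scaleC_left cinner_scaleC_right)
  also have "\<dots> = complex_of_real ((cmod c)\<^sup>2 * (norm x)\<^sup>2)"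
    unfolding cinner_self complex_norm_square[symmetric] by simp
  finally have "(norm (c *\<^sub>C x))\<^sup>2 = (cmod c)\<^sup>2 * (norm x)\<^sup>2" by (simp only: of_real_eq_iff)
  then show ?thesis by (simp add: power_mult_distrib[symmetric])
qed

lemma cmod_cinner_le: "cmod (cinner x y) \<le> norm x * norm (y::'a::complex_hilbert)"
proof (cases "cinner x y = 0")
  case False
  define c where "c = cnj (cinner x y) / cmod (cinner x y)"
  have "cmod c = 1" using False by (simp add: c_def norm_divide)
  have "cinner x (c *\<^sub>C y) = complex_of_real (cmod (cinner x y))"
    using False by (simp add: c_def cinner_scaleC_right mult.commute[of "cnj _"] complex_norm_square[symmetric] power2_eq_square)
  then have "cmod (cinner x y) = inner x (c *\<^sub>C y)" by (simp add: Re_cinner[symmetric])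
  also have "\<dots> \<le> norm x * norm (c *\<^sub>C y)" by (rule norm_cauchy_schwarz)
  finally show ?thesis by (simp add: cmod_scaleC_norm \<open>cmod c = 1\<close>)
qed simp

lemma cinner_zero_right [simp]: "cinner x 0 = (0::complex)" for x :: "'a::complex_hilbert"
  using cinner_add_right[of x 0 0] by simp

lemma cinner_zero_left [simp]: "cinner 0 x = (0::complex)" for x :: "'a::complex_hilbert"
  using cinner_add_left[of 0 0 x] by simp

lemma cinner_sum_right: "cinner x (\<Sum>i\<in>I. f i) = (\<Sum>i\<in>I. cinner x (f i))" for x :: "'a::complex_hilbert"
  by (induction I rule: infinite_finite_induct) (simp_all add: cinner_add_right)

lemma cinner_diff_right: "cinner x (y - z) = cinner x y - cinner x z" for x :: "'a::complex_hilbert"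
  using cinner_add_right[of x "y - z" z] by simp

lemma cinner_sum_left: "cinner (\<Sum>i\<in>I. f i) x = (\<Sum>i\<in>I. cinner (f i) x)" for x :: "'a::complex_hilbert"
  by (induction I rule: infinite_finite_induct) (simp_all add: cinner_add_left)

lemma norm_add_sq: "inner x y = 0 \<Longrightarrow> (norm (x + y))\<^sup>2 = (norm x)\<^sup>2 + (norm y)\<^sup>2" for x :: "'a::real_inner"
  unfolding power2_norm_eq_inner by (simp add: inner_add_left inner_add_right inner_commute[of y x])

lemma tendsto_cinner: "(f \<longlongrightarrow> z) F \<Longrightarrow> ((\<lambda>n. cinner e (f n)) \<longlongrightarrow> cinner e z) F" for e :: "'a::complex_hilbert"
  unfolding cinner_eq by (intro tendsto_Complex tendsto_inner tendsto_const)

lemma norm_sum_orthonormal: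
  assumes "finite F" and on: "\<And>e e'. e \<in> F \<Longrightarrow> e' \<in> F \<Longrightarrow> cinner e e' = (if e = e' then 1 else 0)"
  shows "(norm (\<Sum>e\<in>F. c e *\<^sub>C (e::'a::complex_hilbert)))\<^sup>2 = (\<Sum>e\<in>F. (cmod (c e))\<^sup>2)"
  using assms
proof (induction F rule: finite_induct)
  case (insert a F)
  have o: "cinner a (\<Sum>e\<in>F. c e *\<^sub>C e) = 0"
    using insert by (auto simp: cinner_sum_right cinner_scaleC_right intro!: sum.neutral)
  have "cinner (c a *\<^sub>C a) (\<Sum>e\<in>F. c e *\<^sub>C e) = 0"
    by (simp add: cinner_scaleC_left o)
  then have "inner (c a *\<^sub>C a) (\<Sum>e\<in>F. c e *\<^sub>C e) = 0"
    by (metis Re_cinner zero_complex.sel(1))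
  moreover have "(norm a)\<^sup>2 = 1"
    using insert.prems[of a a] cinner_self[of a] by (metis insertI1 of_real_eq_1_iff)
  ultimately have "(norm (c a *\<^sub>C a + (\<Sum>e\<in>F. c e *\<^sub>C e)))\<^sup>2 = (cmod (c a))\<^sup>2 + (norm (\<Sum>e\<in>F. c e *\<^sub>C e))\<^sup>2"
    by (simp add: norm_add_sq cmod_scaleC_norm power_mult_distrib)
  then show ?case using insert by simp
qed simp

text \<open>Zorn's lemma: a nonzero vector orthogonal to a maximal orthonormal set could be
  normalised and added to it.\<close>

theorem orthonormal_basis_exists: "\<exists>B :: 'a::complex_hilbert set. orthonormal_basis B"
proof -
  let ?on = "\<lambda>B :: 'a set. \<forall>e\<in>B. \<forall>e'\<in>B. cinner e e' = (if e = e' then 1 else 0)"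
  have "\<exists>M\<in>{B. ?on B}. \<forall>X\<in>{B. ?on B}. M \<subseteq> X \<longrightarrow> X = M"
  proof (rule subset_Zorn')
    fix C assume C: "subset.chain {B. ?on B} C"
    have "cinner e e' = (if e = e' then 1 else 0)" if e: "e \<in> \<Union> C" "e' \<in> \<Union> C" for e e'
    proof -
      obtain X Y where XY: "X \<in> C" "Y \<in> C" "e \<in> X" "e' \<in> Y" using e by auto
      then have "X \<subseteq> Y \<or> Y \<subseteq> X" using C unfolding subset.chain_def by blast
      then obtain Z where "Z \<in> C" "e \<in> Z" "e' \<in> Z" using XY by auto
      then show ?thesis using C by (auto simp: subset.chain_def)
    qed
    then show "\<Union> C \<in> {B. ?on B}" by blast
  qed
  then obtain M where "M \<in> {B. ?on B}" and max': "\<forall>X\<in>{B. ?on B}. M \<subseteq> X \<longrightarrow> X = M" by (rule bexE)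
  then have M: "?on M" by (simp only: mem_Collect_eq)
  have max: "X = M" if "?on X" "M \<subseteq> X" for X
    using max'[rule_format, of X] that by (simp only: mem_Collect_eq)
  have "x = 0" if x: "\<And>e. e \<in> M \<Longrightarrow> cinner e x = 0" for x
  proof (rule ccontr)
    assume "x \<noteq> 0"
    define u where "u = (1 / norm x) *\<^sub>R x"
    have "cinner u u = 1" using \<open>x \<noteq> 0\<close> by (simp add: cinner_self u_def)
    moreover have eu: "cinner e u = 0" if "e \<in> M" for e
      using x[OF that] by (simp add: u_def scaleC_of_real[symmetric] cinner_scaleC_right del: of_real_divide)
    moreover have "cinner u e = 0" if "e \<in> M" for e
      using eu[OF that] cinner_commute[of u e] by simp
    moreover have "u \<notin> M" using \<open>cinner u u = 1\<close> eu[of u] by auto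
    ultimately have "?on (insert u M)"
      using M by (intro ballI) (metis insertE)
    then have "insert u M = M" by (rule max) auto
    then show False using \<open>u \<notin> M\<close> by auto
  qed
  then show ?thesis using M by (intro exI[of _ M]) (auto simp: orthonormal_basis_def)
qed

text \<open>Bessel's inequality gives summability. An increasing sequence of finite sets
  \<open>F n\<close> whose sums tend to the total has Cauchy partial expansions, and their limit z
  has the same coefficients as x; a basis determines a vector by its coefficients, so z = x.\<close>

theorem parseval:
  fixes x :: "'a::complex_hilbert"
  assumes B: "orthonormal_basis B"
  shows "((\<lambda>e. (cmod (cinner e x))\<^sup>2) has_sum (norm x)\<^sup>2) B"
proof -
  let ?a = "\<lambda>e. (cmod (cinner e x))\<^sup>2" and ?y = "\<lambda>F. \<Sum>e\<in>F. cinner e x *\<^sub>C e"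
  have on: "cinner e e' = (if e = e' then 1 else 0)" if "e \<in> B" "e' \<in> B" for e e'
    using B that by (simp add: orthonormal_basis_def)
  have pyth: "(norm (?y F))\<^sup>2 = sum ?a F" if "finite F" "F \<subseteq> B" for F
    using that by (intro norm_sum_orthonormal on) auto
  have coeff: "cinner e (?y F) = (if e \<in> F then cinner e x else 0)" if "finite F" "F \<subseteq> B" "e \<in> B" for e F
  proof -
    have "cinner e (?y F) = (\<Sum>e'\<in>F. if e = e' then cinner e x else 0)"
      unfolding cinner_sum_right using that on
      by (intro sum.cong) (auto simp: cinner_scaleC_right)
    then show ?thesis using that by simp
  qed
  have bessel: "sum ?a F \<le> (norm x)\<^sup>2" if F: "finite F" "F \<subseteq> B" for F
  proof -
    have "cinner (?y F) x = (\<Sum>e\<in>F. complex_of_real (?a e))"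
      unfolding cinner_sum_left cinner_scaleC_left complex_norm_square by (simp add: mult.commute)
    also have "\<dots> = complex_of_real (sum ?a F)" by simp
    finally have i: "inner (?y F) x = sum ?a F" unfolding Re_cinner[symmetric] by simp
    have "0 \<le> (norm (x - ?y F))\<^sup>2" by simp
    also have "\<dots> = (norm x)\<^sup>2 - 2 * inner (?y F) x + (norm (?y F))\<^sup>2"
      unfolding power2_norm_eq_inner inner_diff_left inner_diff_right inner_commute[of x "?y F"] by simp
    finally show ?thesis using pyth[OF F] i by simp
  qed
  have summ: "?a summable_on B"
    by (rule nonneg_bdd_above_summable_on) (auto intro!: bdd_aboveI2[where M="(norm x)\<^sup>2"] bessel)
  define s where "s = infsum ?a B"
  have hs: "(?a has_sum s) B" unfolding s_def by (rule has_sum_infsum[OF summ])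
  have le_s: "sum ?a F \<le> s" if "finite F" "F \<subseteq> B" for F
    unfolding s_def by (rule finite_sum_le_infsum[OF summ that]) simp
  have "\<exists>F. finite F \<and> F \<subseteq> B \<and> s - inverse (real (Suc n)) < sum ?a F" for n
  proof -
    have "\<forall>\<^sub>F F in finite_subsets_at_top B. s - inverse (real (Suc n)) < sum ?a F"
      using hs by (intro order_tendstoD(1)) (auto simp: has_sum_def simp del: of_nat_Suc)
    then show ?thesis
      unfolding eventually_finite_subsets_at_top by auto
  qed
  then obtain G where G: "\<And>n. finite (G n)" "\<And>n. G n \<subseteq> B" "\<And>n. s - inverse (real (Suc n)) < sum ?a (G n)"
    by metis
  define F where "F n = (\<Union>k\<le>n. G k)" for n
  have F: "finite (F n)" "F n \<subseteq> B" for n using G by (auto simp: F_def)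
  have F_mono: "F m \<subseteq> F n" if "m \<le> n" for m n using that by (auto simp: F_def intro: order_trans)
  have F_ge: "s - inverse (real (Suc n)) < sum ?a (F n)" for n
  proof -
    have "sum ?a (G n) \<le> sum ?a (F n)" by (rule sum_mono2[OF F(1)]) (auto simp: F_def)
    with G(3)[of n] show ?thesis by linarith
  qed
  have F_diff: "(norm (?y (F n) - ?y (F m)))\<^sup>2 < inverse (real (Suc m))" if mn: "m \<le> n" for m n
  proof -
    have "?y (F n) - ?y (F m) = ?y (F n - F m)"
      using sum_diff[OF F(1) F_mono[OF mn], of "\<lambda>e. cinner e x *\<^sub>C e"] by simp
    then have "(norm (?y (F n) - ?y (F m)))\<^sup>2 = sum ?a (F n - F m)"
      using F by (simp add: pyth Diff_subset_conv le_supI2)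
    also have "\<dots> = sum ?a (F n) - sum ?a (F m)"
      by (rule sum_diff[OF F(1) F_mono[OF mn]])
    finally show ?thesis using F_ge[of m] le_s[OF F, of n] by linarith
  qed
  have "Cauchy (\<lambda>n. ?y (F n))"
  proof (rule CauchyI')
    fix e :: real assume e: "0 < e"
    then obtain N where N: "inverse (real (Suc N)) < e\<^sup>2" using reals_Archimedean[of "e\<^sup>2"] by auto
    show "\<exists>M. \<forall>m\<ge>M. \<forall>n>m. dist (?y (F m)) (?y (F n)) < e"
    proof (intro exI[of _ N] allI impI)
      fix m n assume "N \<le> m" "m < n"
      then have "(norm (?y (F n) - ?y (F m)))\<^sup>2 < inverse (real (Suc m))" by (intro F_diff) simp
      also have "\<dots> \<le> inverse (real (Suc N))" using \<open>N \<le> m\<close> by (intro le_imp_inverse_le) auto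
      finally have "(norm (?y (F n) - ?y (F m)))\<^sup>2 < e\<^sup>2" using N by linarith
      then show "dist (?y (F m)) (?y (F n)) < e"
        using e by (simp add: dist_norm norm_minus_commute power_less_imp_less_base)
    qed
  qed
  then obtain z where z: "(\<lambda>n. ?y (F n)) \<longlonglongrightarrow> z" by (auto simp: Cauchy_convergent_iff convergent_def)
  have lim_c: "(\<lambda>n. cinner e (?y (F n))) \<longlonglongrightarrow> cinner e z" for e
    by (rule tendsto_cinner[OF z])
  have "cinner e (x - z) = 0" if e: "e \<in> B" for e
  proof (cases "\<exists>m. e \<in> F m")
    case True
    then obtain m where "e \<in> F m" by auto
    then have "cinner e (?y (F n)) = cinner e x" if "m \<le> n" for n
      using F_mono[OF that] F coeff[OF F e] by auto
    then have "(\<lambda>n. cinner e (?y (F n))) \<longlonglongrightarrow> cinner e x"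
      by (intro tendsto_eventually eventually_sequentiallyI[of m])
    then show ?thesis using LIMSEQ_unique[OF lim_c] by (simp add: cinner_diff_right)
  next
    case False
    \<comment> \<open>A basis vector outside all \<open>F n\<close> could be added to each of them,
      so the square of its coefficient is below every gap to the total.\<close>
    have "?a e < inverse (real (Suc n))" for n
      using le_s[of "insert e (F n)"] F[of n] e False F_ge[of n] by simp
    then have "?a e \<le> 0"
      using reals_Archimedean[of "?a e"] by (meson less_asym not_le)
    then have "cinner e x = 0" by simp
    moreover have "cinner e z = 0"
      using LIMSEQ_unique[OF lim_c[of e]] coeff[OF F e] False by simp
    ultimately show ?thesis by (simp add: cinner_diff_right)
  qed
  then have "x = z" using B unfolding orthonormal_basis_def by (metis eq_iff_diff_eq_0)
  have "(\<lambda>n. sum ?a (F n)) \<longlonglongrightarrow> (norm x)\<^sup>2"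
    using tendsto_power[OF tendsto_norm[OF z], of 2] pyth[OF F] \<open>x = z\<close> by simp
  moreover have "(\<lambda>n. sum ?a (F n)) \<longlonglongrightarrow> s"
  proof (rule tendsto_sandwich)
    show "(\<lambda>n. s - inverse (real (Suc n))) \<longlonglongrightarrow> s"
      using tendsto_diff[OF tendsto_const[of s] LIMSEQ_inverse_real_of_nat] by simp
    show "\<forall>\<^sub>F n in sequentially. s - inverse (real (Suc n)) \<le> sum ?a (F n)"
      using F_ge less_imp_le by (intro always_eventually allI) blast
    show "\<forall>\<^sub>F n in sequentially. sum ?a (F n) \<le> s"
      using le_s[OF F] by (intro always_eventually allI)
  qed (rule tendsto_const)
  ultimately have "(norm x)\<^sup>2 = s" by (rule LIMSEQ_unique)
  with hs show ?thesis by simp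
qed

lemma parseval_nn: 
  assumes "orthonormal_basis B"
  shows "(\<integral>\<^sup>+e. ennreal ((cmod (cinner e x))\<^sup>2) \<partial>count_space B) = ennreal ((norm x)\<^sup>2)"
  by (rule has_sum_imp_nn_integral[OF _ parseval[OF assms]]) simp

text \<open>By Parseval both sides are the double sum of the squared matrix coefficients, taken in
  the two orders.\<close>

lemma hilbert_schmidt_swap:
  assumes B: "orthonormal_basis B" and adj: "\<And>x y. cinner x (Y y) = cinner (Y' x) y"
  shows "(\<integral>\<^sup>+e. ennreal ((norm (Y e))\<^sup>2) \<partial>count_space B) = (\<integral>\<^sup>+e. ennreal ((norm (Y' e))\<^sup>2) \<partial>count_space B)"
proof -
  have c: "cmod (cinner e (Y f)) = cmod (cinner f (Y' e))" for e f
    using adj[of e f] cinner_commute[of "Y' e" f] by simp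
  have "(\<integral>\<^sup>+f. ennreal ((norm (Y f))\<^sup>2) \<partial>count_space B) =
    (\<integral>\<^sup>+f. (\<integral>\<^sup>+e. ennreal ((cmod (cinner e (Y f)))\<^sup>2) \<partial>count_space B) \<partial>count_space B)"
    by (simp only: parseval_nn[OF B])
  also have "\<dots> = (\<integral>\<^sup>+e. (\<integral>\<^sup>+f. ennreal ((cmod (cinner e (Y f)))\<^sup>2) \<partial>count_space B) \<partial>count_space B)"
    by (rule nn_integral_count_space_swap)
  also have "\<dots> = (\<integral>\<^sup>+e. ennreal ((norm (Y' e))\<^sup>2) \<partial>count_space B)"
    by (simp only: c parseval_nn[OF B])
  finally show ?thesis .
qed

lemma has_sum_real_diff:
  fixes f g :: "'b \<Rightarrow> real"
  shows "(f has_sum a) B \<Longrightarrow> (g has_sum b) B \<Longrightarrow> ((\<lambda>x. f x - g x) has_sum (a - b)) B"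
  using has_sum_add[of f B a "\<lambda>x. - g x" "- b"] by (simp add: has_sum_uminus)

text \<open>With C the square root of D, the claim is the cyclicity that moves one factor C past X.
  Polarisation reduces it to Hilbert-Schmidt norms, where the sums of |C Z e|^2 and |Z C e|^2 agree;
  it is applied with Z = X + 1 and Z = X - 1.\<close>

theorem op_trace_eq:
  fixes D X :: "'a::complex_hilbert \<Rightarrow>\<^sub>L 'a"
  assumes D: "pos_trace_class D" and X: "sym_op X" "clinear_op X"
  defines "B \<equiv> SOME B. orthonormal_basis B"
  shows "((\<lambda>e. inner (op_sqrt D e) (X (op_sqrt D e))) has_sum Re (op_trace (X o\<^sub>L D))) B"
    and "(\<lambda>e. (norm (op_sqrt D e))\<^sup>2) summable_on B"
proof -
  define C where "C = op_sqrt D"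
  have B: "orthonormal_basis B"
    unfolding B_def using orthonormal_basis_exists by (rule someI_ex)
  have posD: "pos_op D" using D by (simp add: pos_trace_class_def)
  have CC: "C (C x) = D x" for x unfolding C_def by (rule op_sqrt_eq(3)[OF posD])
  have symC: "sym_op C" and linC: "clinear_op C"
    using op_sqrt_eq(2)[OF posD] by (auto simp: C_def pos_op_iff psd_op_def)
  have "(\<lambda>e. cinner e (D e)) summable_on B" using D B by (simp add: pos_trace_class_def)
  then have "(\<lambda>e. Re (cinner e (D e))) summable_on B" by (rule summable_on_Re)
  moreover have "Re (cinner e (D e)) = (norm (C e))\<^sup>2" for e
    using sym_opD[OF symC, of e "C e"] by (simp add: Re_cinner CC power2_norm_eq_inner)
  ultimately show sumC: "(\<lambda>e. (norm (op_sqrt D e))\<^sup>2) summable_on B"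
    by (simp add: C_def)
  define t where "t = infsum (\<lambda>e. (norm (C e))\<^sup>2) B"
  have t: "((\<lambda>e. (norm (C e))\<^sup>2) has_sum t) B"
    unfolding t_def using sumC by (simp add: C_def has_sum_infsum)
  have main: "\<exists>s. ((\<lambda>e. (norm (C (Z e)))\<^sup>2) has_sum s) B \<and> ((\<lambda>e. (norm (Z (C e)))\<^sup>2) has_sum s) B"
    if Z: "sym_op Z" "clinear_op Z" for Z
  proof -
    have bd: "(norm (Z (C e)))\<^sup>2 \<le> (norm Z)\<^sup>2 * (norm (C e))\<^sup>2" for e
      using power_mono[OF norm_blinfun[of Z "C e"] norm_ge_zero, of 2] by (simp add: power_mult_distrib)
    have "(\<lambda>e. (norm Z)\<^sup>2 * (norm (C e))\<^sup>2) summable_on B"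
      using t by (intro summable_on_cmult_right) (auto simp: summable_on_def)
    then have "(\<lambda>e. (norm (Z (C e)))\<^sup>2) summable_on B"
      by (rule summable_on_comparison_test) (use bd in auto)
    then have s: "((\<lambda>e. (norm (Z (C e)))\<^sup>2) has_sum (infsum (\<lambda>e. (norm (Z (C e)))\<^sup>2) B)) B" (is "(_ has_sum ?s) B")
      by (rule has_sum_infsum)
    have "0 \<le> ?s" by (rule infsum_nonneg) simp
    have "(\<integral>\<^sup>+e. ennreal ((norm (C (Z e)))\<^sup>2) \<partial>count_space B) = (\<integral>\<^sup>+e. ennreal ((norm (Z (C e)))\<^sup>2) \<partial>count_space B)"
      by (rule hilbert_schmidt_swap[OF B]) (simp add: sym_clinear_cinner[OF symC linC] sym_clinear_cinner[OF Z])
    also have "\<dots> = ennreal ?s" by (rule has_sum_imp_nn_integral[OF _ s]) simp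
    finally have "((\<lambda>e. (norm (C (Z e)))\<^sup>2) has_sum ?s) B"
      by (intro nn_integral_imp_has_sum \<open>0 \<le> ?s\<close>) auto
    with s show ?thesis by blast
  qed
  have idX: "sym_op (X + id_blinfun)" "clinear_op (X + id_blinfun)" "sym_op (X - id_blinfun)" "clinear_op (X - id_blinfun)"
    using X by (simp_all add: sym_op_add sym_op_diff sym_op_id clinear_op_add clinear_op_diff clinear_op_id)
  from main[OF idX(1,2)] obtain sp where
    sp: "((\<lambda>e. (norm (C (X e) + C e))\<^sup>2) has_sum sp) B" "((\<lambda>e. (norm (X (C e) + C e))\<^sup>2) has_sum sp) B"
    by (auto simp: blinfun.add_left blinfun.add_right)
  from main[OF idX(3,4)] obtain sm where
    sm: "((\<lambda>e. (norm (C (X e) - C e))\<^sup>2) has_sum sm) B" "((\<lambda>e. (norm (X (C e) - C e))\<^sup>2) has_sum sm) B"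
    by (auto simp: blinfun.diff_left blinfun.diff_right)
  have pol: "inner u w = (1 / 4) * ((norm (u + w))\<^sup>2 - (norm (u - w))\<^sup>2)" for u w :: 'a
    unfolding power2_norm_eq_inner inner_add_left inner_add_right inner_diff_left inner_diff_right
    by (simp add: inner_commute[of w u])
  have 1: "((\<lambda>e. inner (C (X e)) (C e)) has_sum (1 / 4) * (sp - sm)) B"
    unfolding pol by (intro has_sum_cmult_right has_sum_real_diff sp sm)
  have "((\<lambda>e. inner (X (C e)) (C e)) has_sum (1 / 4) * (sp - sm)) B"
    unfolding pol by (intro has_sum_cmult_right has_sum_real_diff sp sm)
  then have 2: "((\<lambda>e. inner (C e) (X (C e))) has_sum (1 / 4) * (sp - sm)) B"
    by (simp only: inner_commute)
  have tr_eq: "cinner e ((X o\<^sub>L D) e) = cinner (C (X e)) (C e)" for e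
    by (simp add: CC[symmetric] sym_clinear_cinner[OF symC linC] sym_clinear_cinner[OF X])
  obtain sx where sx: "((\<lambda>e. (norm (C (X e)))\<^sup>2) has_sum sx) B" using main[OF X] by blast
  have "(\<lambda>e. (norm (C (X e)))\<^sup>2 + (norm (C e))\<^sup>2) summable_on B"
    using has_sum_add[OF sx t] by (auto simp: summable_on_def)
  moreover have bd: "norm (cinner (C (X e)) (C e)) \<le> (norm (C (X e)))\<^sup>2 + (norm (C e))\<^sup>2" for e
  proof -
    have "norm (cinner (C (X e)) (C e)) \<le> norm (C (X e)) * norm (C e)" by (rule cmod_cinner_le)
    moreover have "2 * (norm (C (X e)) * norm (C e)) \<le> (norm (C (X e)))\<^sup>2 + (norm (C e))\<^sup>2"
      using sum_squares_bound[of "norm (C (X e))" "norm (C e)"] by simp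
    moreover have "0 \<le> norm (C (X e)) * norm (C e)" by simp
    ultimately show ?thesis by linarith
  qed
  ultimately have "(\<lambda>e. norm (cinner (C (X e)) (C e))) summable_on B"
    by (rule summable_on_comparison_test) (rule norm_ge_zero)
  then have "(\<lambda>e. cinner (C (X e)) (C e)) summable_on B" by (rule abs_summable_summable)
  from has_sum_Re[OF has_sum_infsum[OF this]]
  have "((\<lambda>e. inner (C (X e)) (C e)) has_sum Re (op_trace (X o\<^sub>L D))) B"
    unfolding op_trace_def B_def[symmetric] tr_eq Re_cinner .
  with 1 have "Re (op_trace (X o\<^sub>L D)) = (1 / 4) * (sp - sm)" by (metis has_sum_unique)
  with 2 show "((\<lambda>e. inner (op_sqrt D e) (X (op_sqrt D e))) has_sum Re (op_trace (X o\<^sub>L D))) B"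
    unfolding C_def by (simp only:)
qed

text \<open>The vectors are the images of an orthonormal basis under the square root of the density.
  Dropping those that vanish leaves a countable index set, because the squared norms are
  summable.\<close>

theorem pos_normal_functional_rep:
  fixes \<rho> :: "('a::complex_hilbert \<Rightarrow>\<^sub>L 'a) \<Rightarrow> complex"
  assumes "\<rho> \<in> pos_normal_functionals"
  obtains I and v :: "'a \<Rightarrow> 'a" where "countable I" "(\<lambda>i. (norm (v i))\<^sup>2) summable_on I"
    "\<And>X. sym_op X \<Longrightarrow> clinear_op X \<Longrightarrow> ((\<lambda>i. inner (v i) (X (v i))) has_sum Re (\<rho> X)) I"
proof -
  obtain D where D: "pos_trace_class D" and \<rho>: "\<rho> = (\<lambda>X. op_trace (X o\<^sub>L D))"
    using assms by (auto simp: pos_normal_functionals_def)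
  define B :: "'a set" where "B = (SOME B. orthonormal_basis B)"
  define I where "I = {e\<in>B. (norm (op_sqrt D e))\<^sup>2 \<noteq> 0}"
  have idc: "sym_op (id_blinfun :: 'a \<Rightarrow>\<^sub>L 'a)" "clinear_op (id_blinfun :: 'a \<Rightarrow>\<^sub>L 'a)"
    by (simp_all add: sym_op_id clinear_op_id)
  have sum: "(\<lambda>e. (norm (op_sqrt D e))\<^sup>2) summable_on B"
    unfolding B_def by (rule op_trace_eq(2)[OF D idc])
  show ?thesis
  proof (rule that[of I "\<lambda>e. op_sqrt D e"])
    show "countable I"
      unfolding I_def by (rule summable_countable_real[OF sum])
    show "(\<lambda>i. (norm (op_sqrt D i))\<^sup>2) summable_on I"
      by (rule summable_on_subset_banach[OF sum]) (auto simp: I_def)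
    fix X :: "'a \<Rightarrow>\<^sub>L 'a" assume X: "sym_op X" "clinear_op X"
    have "((\<lambda>e. inner (op_sqrt D e) (X (op_sqrt D e))) has_sum Re (\<rho> X)) B"
      unfolding \<rho> B_def by (rule op_trace_eq(1)[OF D X])
    then show "((\<lambda>e. inner (op_sqrt D e) (X (op_sqrt D e))) has_sum Re (\<rho> X)) I"
      by (subst has_sum_cong_neutral[where T=B and g="\<lambda>e. inner (op_sqrt D e) (X (op_sqrt D e))"])
        (auto simp: I_def)
  qed
qed

text \<open>Baire's theorem gives a ball on which all \<open>X n\<close> are bounded by the same k.
  The factor 2 comes from writing a vector of length r as a difference of two points of the ball.
  The bound later supplies the dominating function for normal functionals.\<close>

lemma uniform_boundedness:
  fixes X :: "nat \<Rightarrow> 'a::banach \<Rightarrow>\<^sub>L 'b::real_normed_vector"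
  assumes "\<And>x. (\<lambda>n. X n x) \<longlonglongrightarrow> 0"
  shows "\<exists>K. \<forall>n. norm (X n) \<le> K"
proof -
  define S where "S k = {x. \<forall>n. norm (X n x) \<le> real k}" for k
  have closed: "closed (S k)" for k
  proof -
    have "S k = (\<Inter>n. {x. norm (X n x) \<le> real k})" by (auto simp: S_def)
    moreover have "closed {x. norm (X n x) \<le> real k}" for n
      by (intro closed_Collect_le continuous_on_norm continuous_on_const
          linear_continuous_on blinfun.bounded_linear_right)
    ultimately show ?thesis by auto
  qed
  have "\<exists>k. x \<in> S k" for x
  proof -
    have "Bseq (\<lambda>n. X n x)" using assms by (intro convergent_imp_Bseq) (auto simp: convergent_def)
    then obtain K where K: "\<And>n. norm (X n x) \<le> K" by (auto simp: Bseq_def)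
    obtain k where "K \<le> real k" using real_arch_simple by blast
    then show ?thesis using K by (auto simp: S_def intro: order_trans)
  qed
  then have UN: "\<Union> (range S) = UNIV" by blast
  have "\<exists>k. interior (S k) \<noteq> {}"
  proof (rule ccontr)
    assume "\<not> ?thesis"
    then have "euclidean interior_of \<Union> (range S) = {}"
      using closed by (intro Baire_category_alt)
        (auto simp: completely_metrizable_space_euclidean interior_of_def interior_def)
    then show False unfolding UN by simp
  qed
  then obtain k x0 where "x0 \<in> interior (S k)" by blast
  then obtain r where r: "0 < r" "cball x0 r \<subseteq> S k" by (auto simp: mem_interior_cball)
  have "norm (X n x) \<le> (2 * real k / r) * norm x" for n x
  proof (cases "x = 0")
    case False
    define y where "y = (r / norm x) *\<^sub>R x"
    have "norm y = r" using False r by (simp add: y_def)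
    then have "x0 + y \<in> S k" "x0 \<in> S k" using r by (auto simp: dist_norm subset_iff)
    then have "norm (X n (x0 + y)) \<le> real k" "norm (X n x0) \<le> real k" by (auto simp: S_def)
    moreover have "X n y = X n (x0 + y) - X n x0" by (simp add: blinfun.add_right)
    ultimately have "norm (X n y) \<le> 2 * real k"
      using norm_triangle_ineq4[of "X n (x0 + y)" "X n x0"] by simp
    moreover have "norm (X n y) = (r / norm x) * norm (X n x)"
      using r by (simp add: y_def blinfun.scaleR_right)
    ultimately show ?thesis using False r by (simp add: field_simps)
  qed simp
  moreover have "0 \<le> 2 * real k / r" using r by simp
  ultimately have "norm (X n) \<le> 2 * real k / r" for n by (intro norm_blinfun_bound) auto
  then show ?thesis by blast
qed

section \<open>Normal functionals as mixtures of vector functionals\<close>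

lemma nn_integral_mixture:
  fixes N :: "real measure"
  assumes I: "countable I" and N: "sets N = sets borel" and \<mu>: "\<And>i. i \<in> I \<Longrightarrow> sets (\<mu> i) = sets borel"
    and em: "\<And>\<Delta>. \<Delta> \<in> sets borel \<Longrightarrow> emeasure N \<Delta> = (\<integral>\<^sup>+i. emeasure (\<mu> i) \<Delta> \<partial>count_space I)"
    and g: "g \<in> borel_measurable borel"
  shows "(\<integral>\<^sup>+r. g r \<partial>N) = (\<integral>\<^sup>+i. (\<integral>\<^sup>+r. g r \<partial>\<mu> i) \<partial>count_space I)"
  using g
proof (induction rule: borel_measurable_induct)
  case (cong f g)
  then show ?case by (metis (no_types, lifting) ext UNIV_I space_borel)
next
  case (set A)
  have "(\<integral>\<^sup>+i. (\<integral>\<^sup>+r. indicator A r \<partial>\<mu> i) \<partial>count_space I) = (\<integral>\<^sup>+i. emeasure (\<mu> i) A \<partial>count_space I)"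
    by (rule nn_integral_cong) (use set \<mu> in auto)
  then show ?case using set N em by simp
next
  case (mult u c)
  have [measurable]: "u \<in> borel_measurable N" "\<And>i. i \<in> I \<Longrightarrow> u \<in> borel_measurable (\<mu> i)"
    using mult N \<mu> by (auto cong: measurable_cong_sets)
  have "(\<integral>\<^sup>+i. (\<integral>\<^sup>+r. c * u r \<partial>\<mu> i) \<partial>count_space I) = (\<integral>\<^sup>+i. c * (\<integral>\<^sup>+r. u r \<partial>\<mu> i) \<partial>count_space I)"
    by (rule nn_integral_cong) (simp add: nn_integral_cmult)
  then show ?case using mult by (simp add: nn_integral_cmult)
next
  case (add u v)
  have [measurable]: "u \<in> borel_measurable N" "\<And>i. i \<in> I \<Longrightarrow> u \<in> borel_measurable (\<mu> i)"
    "v \<in> borel_measurable N" "\<And>i. i \<in> I \<Longrightarrow> v \<in> borel_measurable (\<mu> i)"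
    using add N \<mu> by (auto cong: measurable_cong_sets)
  have "(\<integral>\<^sup>+i. (\<integral>\<^sup>+r. v r + u r \<partial>\<mu> i) \<partial>count_space I) = (\<integral>\<^sup>+i. (\<integral>\<^sup>+r. v r \<partial>\<mu> i) + (\<integral>\<^sup>+r. u r \<partial>\<mu> i) \<partial>count_space I)"
    by (rule nn_integral_cong) (simp add: nn_integral_add)
  then show ?case using add by (simp add: nn_integral_add)
next
  case (seq U)
  have [measurable]: "U n \<in> borel_measurable N" "\<And>i. i \<in> I \<Longrightarrow> U n \<in> borel_measurable (\<mu> i)" for n
    using seq N \<mu> by (auto cong: measurable_cong_sets)
  have s: "(\<lambda>r. (SUP n. U n) r) = (\<lambda>r. SUP n. U n r)" by (simp add: image_comp)
  have "(\<integral>\<^sup>+i. (\<integral>\<^sup>+r. (SUP n. U n r) \<partial>\<mu> i) \<partial>count_space I) = (\<integral>\<^sup>+i. (SUP n. (\<integral>\<^sup>+r. U n r \<partial>\<mu> i)) \<partial>count_space I)"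
    by (rule nn_integral_cong) (simp add: nn_integral_monotone_convergence_SUP seq)
  also have "\<dots> = (SUP n. (\<integral>\<^sup>+i. (\<integral>\<^sup>+r. U n r \<partial>\<mu> i) \<partial>count_space I))"
    by (rule nn_integral_monotone_convergence_SUP)
      (use seq in \<open>auto simp: incseq_def le_fun_def intro!: nn_integral_mono\<close>)
  also have "\<dots> = (SUP n. (\<integral>\<^sup>+r. U n r \<partial>N))" using seq by simp
  also have "\<dots> = (\<integral>\<^sup>+r. (SUP n. U n r) \<partial>N)"
    by (rule nn_integral_monotone_convergence_SUP[symmetric]) (use seq in auto)
  finally show ?case unfolding s by simp
qed

lemma nn_integral_pw_measure:
  assumes A: "pos_op A" and B: "pos_op B" and g: "bdd_borel g" "\<And>r. r \<in> {0..1} \<Longrightarrow> 0 \<le> g r"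
  shows "(\<integral>\<^sup>+r. ennreal (g r) \<partial>pw_measure A B x) = ennreal (\<integral>r. g r \<partial>pw_measure A B x)"
  by (rule nn_integral_eq_integral[OF unit_measure_integrable[OF unit_pw_measure[OF A B] g(1)]])
    (use unit_measureD(3)[OF unit_pw_measure[OF A B, of x]] g(2) in auto)

context
  fixes \<rho> :: "('a::complex_hilbert \<Rightarrow>\<^sub>L 'a) \<Rightarrow> complex" and I and v :: "'a \<Rightarrow> 'a"
    and A B :: "'a \<Rightarrow>\<^sub>L 'a"
  assumes I: "countable I"
    and rep: "\<And>X. sym_op X \<Longrightarrow> clinear_op X \<Longrightarrow> ((\<lambda>i. inner (v i) (X (v i))) has_sum Re (\<rho> X)) I"
    and A: "pos_op A" and B: "pos_op B"
begin

text \<open>The measure over which \<open>operator_perspective\<close> integrates; by the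
  representation of \<rho> it is the mixture of the measures of the vectors v i, so integrals of
  nonnegative functions can be computed vector by vector.\<close>

definition "pw_scalar = scalar_measure (\<lambda>\<Delta>. \<rho> (op_adj (pw_T A B) o\<^sub>L
          spectral_measure (pw_space A B) (pw_R A B) \<Delta> o\<^sub>L pw_T A B))"

lemma emeasure_pw_measure: "emeasure (pw_measure A B x) \<Delta> = ennreal (measure (pw_measure A B x) \<Delta>)"
  using unit_measureD(1)[OF unit_pw_measure[OF A B, of x]] by (rule finite_measure.emeasure_eq_measure)

lemma Re_rho_density:
  assumes D: "\<Delta> \<in> sets borel"
  shows "ennreal (Re (\<rho> (op_adj (pw_T A B) o\<^sub>L spectral_measure (pw_space A B) (pw_R A B) \<Delta> o\<^sub>L pw_T A B))) =
    (\<integral>\<^sup>+i. emeasure (pw_measure A B (v i)) \<Delta> \<partial>count_space I)"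
proof -
  let ?X = "op_sqrt (A + B) o\<^sub>L bfc (pw_R A B) (indicator \<Delta>) o\<^sub>L op_sqrt (A + B)"
  note e = sym_op_bfc[OF pw_R_props(1)[OF A B] bdd_borel_indicator[OF D]]
    clinear_op_bfc[OF pw_R_props(1,2)[OF A B] bdd_borel_indicator[OF D]]
  have "sym_op ?X"
    unfolding sym_op_def by (simp add: sym_opD[OF sym_sqrt_S(1)[OF A B]] sym_opD[OF e(1)])
  moreover have "clinear_op ?X" by (intro clinear_op_compose e(2) sym_sqrt_S[OF A B])
  ultimately have hs: "((\<lambda>i. inner (v i) (?X (v i))) has_sum Re (\<rho> ?X)) I" by (rule rep)
  have eq: "inner (v i) (?X (v i)) = measure (pw_measure A B (v i)) \<Delta>" for i
    by (rule pw_measure_indicator[OF A B D, symmetric])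
  show ?thesis
    unfolding pw_density[OF A B D] emeasure_pw_measure
    using has_sum_imp_nn_integral[OF _ hs] unfolding eq by simp
qed

lemma emeasure_pw_scalar:
  assumes D: "\<Delta> \<in> sets borel"
  shows "emeasure pw_scalar \<Delta> = (\<integral>\<^sup>+i. emeasure (pw_measure A B (v i)) \<Delta> \<partial>count_space I)"
proof -
  let ?m = "\<lambda>\<Delta>. \<rho> (op_adj (pw_T A B) o\<^sub>L spectral_measure (pw_space A B) (pw_R A B) \<Delta> o\<^sub>L pw_T A B)"
  note sets_pw = unit_measureD(2)[OF unit_pw_measure[OF A B]]
  have "emeasure pw_scalar \<Delta> = ennreal (Re (?m \<Delta>))"
  proof (rule emeasure_measure_of[OF pw_scalar_def[unfolded scalar_measure_def]])
    have sets: "sets pw_scalar = sets borel" by (simp add: pw_scalar_def)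
    show "positive (sets pw_scalar) (\<lambda>\<Delta>. ennreal (Re (?m \<Delta>)))"
      by (simp add: positive_def Re_rho_density)
    show "countably_additive (sets pw_scalar) (\<lambda>\<Delta>. ennreal (Re (?m \<Delta>)))"
    proof (rule countably_additiveI)
      fix F :: "nat \<Rightarrow> real set" assume F: "range F \<subseteq> sets pw_scalar" "disjoint_family F"
      then have Fb: "F n \<in> sets borel" for n by (auto simp: sets)
      have "(\<Sum>n. \<integral>\<^sup>+i. emeasure (pw_measure A B (v i)) (F n) \<partial>count_space I) =
        (\<integral>\<^sup>+i. (\<Sum>n. emeasure (pw_measure A B (v i)) (F n)) \<partial>count_space I)"
        by (rule nn_integral_suminf[symmetric]) simp
      also have "\<dots> = (\<integral>\<^sup>+i. emeasure (pw_measure A B (v i)) (\<Union>n. F n) \<partial>count_space I)"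
        using F Fb by (intro nn_integral_cong suminf_emeasure) (auto simp: sets_pw)
      finally show "(\<Sum>n. ennreal (Re (?m (F n)))) = ennreal (Re (?m (\<Union> (range F))))"
        using Fb by (simp add: Re_rho_density)
    qed
  qed (use D in \<open>auto simp: pw_scalar_def\<close>)
  then show ?thesis by (simp add: Re_rho_density D)
qed

lemma nn_integral_pw_scalar:
  assumes "g \<in> borel_measurable borel"
  shows "(\<integral>\<^sup>+r. g r \<partial>pw_scalar) = (\<integral>\<^sup>+i. (\<integral>\<^sup>+r. g r \<partial>pw_measure A B (v i)) \<partial>count_space I)"
  by (rule nn_integral_mixture[OF I _ _ emeasure_pw_scalar assms])
    (simp_all add: pw_scalar_def unit_measureD(2)[OF unit_pw_measure[OF A B]])

lemma pw_scalar_first: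
  "(\<integral>\<^sup>+r. ennreal r \<partial>pw_scalar) = ennreal (Re (\<rho> A))"
  "(\<integral>\<^sup>+r. ennreal (1 - r) \<partial>pw_scalar) = ennreal (Re (\<rho> B))"
proof -
  have symA: "sym_op A" "clinear_op A" "\<And>x. 0 \<le> inner x (A x)" and symB: "sym_op B" "clinear_op B" "\<And>x. 0 \<le> inner x (B x)"
    using A B by (auto simp: pos_op_iff psd_op_def)
  have "(\<integral>\<^sup>+r. ennreal r \<partial>pw_measure A B x) = ennreal (inner x (A x))" for x
    using nn_integral_pw_measure[OF A B bdd_borel_id, of x] by (simp add: pw_measure_id[OF A B])
  then show "(\<integral>\<^sup>+r. ennreal r \<partial>pw_scalar) = ennreal (Re (\<rho> A))"
    using has_sum_imp_nn_integral[OF _ rep[OF symA(1,2)]] symA(3) by (simp add: nn_integral_pw_scalar)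
  have "(\<integral>\<^sup>+r. ennreal (1 - r) \<partial>pw_measure A B x) = ennreal (inner x (B x))" for x
    using nn_integral_pw_measure[OF A B bdd_borel_diff[OF bdd_borel_const bdd_borel_id], of 1 x] pw_measure_affine[OF A B, where a=0 and b=1 and v=x]
    by simp
  then show "(\<integral>\<^sup>+r. ennreal (1 - r) \<partial>pw_scalar) = ennreal (Re (\<rho> B))"
    using has_sum_imp_nn_integral[OF _ rep[OF symB(1,2)]] symB(3) by (simp add: nn_integral_pw_scalar)
qed

lemma pw_scalar_AE: "AE r in pw_scalar. r \<in> {0..1}"
proof (rule AE_I[of _ _ "- {0..1}"])
  have "emeasure (pw_measure A B x) (- {0..1}) = 0" for x
  proof -
    have "emeasure (pw_measure A B x) {r \<in> space (pw_measure A B x). r \<notin> {0..1}} = 0"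
      using unit_measureD(2,3,4)[OF unit_pw_measure[OF A B, of x]] by (subst AE_iff_measurable[symmetric, OF _ refl]) auto
    moreover have "{r \<in> space (pw_measure A B x). r \<notin> {0..1}} = - {0..1}"
      using unit_measureD(4)[OF unit_pw_measure[OF A B, of x]] by auto
    ultimately show ?thesis by simp
  qed
  then show "emeasure pw_scalar (- {0..1}) = 0" by (subst emeasure_pw_scalar) auto
qed (auto simp: pw_scalar_def)

end

section \<open>Kraus inequalities\<close>

lemma mat_adjoint_index:
  "mat_adjoint A \<in> carrier_mat (dim_col A) (dim_row A)"
  "i < dim_col A \<Longrightarrow> j < dim_row A \<Longrightarrow> mat_adjoint A $$ (i, j) = conjugate (A $$ (j, i))"
  by (auto simp: mat_adjoint_def mat_of_rows_def)

text \<open>Independence of the diagonalisation: W = V' U intertwines the two diagonal matrices, so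
  its entry at (i, j) vanishes unless e i = d j, and W then intertwines their images under f as
  well.\<close>

lemma mat_fun_eqI:
  fixes A U :: "complex mat"
  assumes U: "mat_unitary n U" and A: "A \<in> carrier_mat n n"
    and AU: "A = U * mat_diag n (\<lambda>i. complex_of_real (d i)) * mat_adjoint U"
  shows "mat_fun f A = U * mat_diag n (\<lambda>i. complex_of_real (f (d i))) * mat_adjoint U"
  unfolding mat_fun_def
proof (rule the_equality)
  have n: "dim_row A = n" using A by simp
  show "\<exists>U' d'. mat_unitary (dim_row A) U' \<and>
     A = U' * mat_diag (dim_row A) (\<lambda>i. complex_of_real (d' i)) * mat_adjoint U' \<and>
     U * mat_diag n (\<lambda>i. complex_of_real (f (d i))) * mat_adjoint U =
     U' * mat_diag (dim_row A) (\<lambda>i. complex_of_real (f (d' i))) * mat_adjoint U'"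
    unfolding n using U AU by blast
  fix M
  assume "\<exists>U' d'. mat_unitary (dim_row A) U' \<and>
     A = U' * mat_diag (dim_row A) (\<lambda>i. complex_of_real (d' i)) * mat_adjoint U' \<and>
     M = U' * mat_diag (dim_row A) (\<lambda>i. complex_of_real (f (d' i))) * mat_adjoint U'"
  then obtain V e where V: "mat_unitary n V"
    and AV: "A = V * mat_diag n (\<lambda>i. complex_of_real (e i)) * mat_adjoint V"
    and M: "M = V * mat_diag n (\<lambda>i. complex_of_real (f (e i))) * mat_adjoint V"
    unfolding n by blast
  define U' V' where "U' = mat_adjoint U" and "V' = mat_adjoint V"
  have Uc: "U \<in> carrier_mat n n" and Vc: "V \<in> carrier_mat n n" using U V by (auto simp: mat_unitary_def)
  have U'c: "U' \<in> carrier_mat n n" and V'c: "V' \<in> carrier_mat n n"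
    using Uc Vc mat_adjoint_index(1)[of U] mat_adjoint_index(1)[of V] by (auto simp: U'_def V'_def)
  have inv: "U * U' = 1\<^sub>m n" "U' * U = 1\<^sub>m n" "V * V' = 1\<^sub>m n" "V' * V = 1\<^sub>m n"
    using U V by (auto simp: mat_unitary_def U'_def V'_def)
  let ?D = "\<lambda>g. mat_diag n (\<lambda>i. complex_of_real (g i))"
  have Dc: "?D g \<in> carrier_mat n n" for g :: "nat \<Rightarrow> real" by simp
  have mc: "X * Y \<in> carrier_mat n n" if "X \<in> carrier_mat n n" "Y \<in> carrier_mat n n" for X Y :: "complex mat"
    using that by simp
  have assoc: "X * Y * Z = X * (Y * Z)"
    if "X \<in> carrier_mat n n" "Y \<in> carrier_mat n n" "Z \<in> carrier_mat n n" for X Y Z :: "complex mat"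
    using that by (rule assoc_mult_mat)
  define W where "W = V' * U"
  have Wc: "W \<in> carrier_mat n n" unfolding W_def using V'c Uc by simp
  have move: "V' * (X * D1 * X') * U = (V' * X) * D1 * (X' * U)"
    if "X \<in> carrier_mat n n" "X' \<in> carrier_mat n n" "D1 \<in> carrier_mat n n" for X D1 X' :: "complex mat"
    using that V'c Uc by (simp only: assoc mc)
  have "V' * A * U = W * ?D d"
  proof -
    have "V' * A * U = (V' * U) * ?D d * (U' * U)"
      unfolding AU U'_def[symmetric] by (rule move[OF Uc U'c Dc])
    then show ?thesis using Wc by (simp add: inv W_def right_mult_one_mat[of _ n n])
  qed
  moreover have "V' * A * U = ?D e * W"
  proof -
    have "V' * A * U = (V' * V) * ?D e * (V' * U)"
      unfolding AV V'_def[symmetric] by (rule move[OF Vc V'c Dc])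
    then show ?thesis by (simp add: inv W_def left_mult_one_mat[of _ n n])
  qed
  ultimately have WD: "W * ?D d = ?D e * W" by simp
  have "W * ?D (\<lambda>i. f (d i)) = ?D (\<lambda>i. f (e i)) * W"
  proof (rule eq_matI)
    fix i j assume "i < dim_row (?D (\<lambda>i. f (e i)) * W)" "j < dim_col (?D (\<lambda>i. f (e i)) * W)"
    then have ij: "i < n" "j < n" using Wc carrier_matD[OF Dc] by auto
    have "(W * ?D d) $$ (i, j) = (?D e * W) $$ (i, j)" by (simp only: WD)
    then have "W $$ (i, j) * complex_of_real (d j) = complex_of_real (e i) * W $$ (i, j)"
      using ij Wc by (simp add: mat_diag_mult_left[of _ n n] mat_diag_mult_right[of _ n n])
    then have "W $$ (i, j) = 0 \<or> d j = e i" by auto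
    then show "(W * ?D (\<lambda>i. f (d i))) $$ (i, j) = (?D (\<lambda>i. f (e i)) * W) $$ (i, j)"
      using ij Wc by (auto simp: mat_diag_mult_left[of _ n n] mat_diag_mult_right[of _ n n])
  qed (use Wc carrier_matD[OF Dc] in auto)
  then have "V * (W * ?D (\<lambda>i. f (d i))) * U' = V * (?D (\<lambda>i. f (e i)) * W) * U'" by simp
  moreover have "V * (W * ?D (\<lambda>i. f (d i))) * U' = (V * V') * (U * ?D (\<lambda>i. f (d i)) * U')"
    unfolding W_def using Uc Vc U'c V'c Dc by (simp only: assoc mc)
  moreover have "V * (?D (\<lambda>i. f (e i)) * W) * U' = (V * ?D (\<lambda>i. f (e i)) * V') * (U * U')"
    unfolding W_def using Uc Vc U'c V'c Dc by (simp only: assoc mc)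
  ultimately have "U * ?D (\<lambda>i. f (d i)) * U' = V * ?D (\<lambda>i. f (e i)) * V'"
    using Uc Vc U'c V'c by (simp add: inv left_mult_one_mat[of _ n n] right_mult_one_mat[of _ n n])
  then show "M = U * mat_diag n (\<lambda>i. complex_of_real (f (d i))) * mat_adjoint U"
    unfolding M U'_def V'_def by simp
qed

section \<open>Operator convexity for matrices with explicit real eigenvectors\<close>

definition real_mat :: "nat \<Rightarrow> (nat \<Rightarrow> nat \<Rightarrow> real) \<Rightarrow> complex mat" where
  "real_mat n F = Matrix.mat n n (\<lambda>(i, j). complex_of_real (F i j))"

definition orthonormal_cols :: "nat \<Rightarrow> (nat \<Rightarrow> nat \<Rightarrow> real) \<Rightarrow> bool" where
  "orthonormal_cols n U \<longleftrightarrow> (\<forall>i<n. \<forall>j<n. (\<Sum>k<n. U k i * U k j) = (if i = j then 1 else 0))"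

text \<open>The entries of U diag(d) U^T.\<close>

definition spectral_comb :: "nat \<Rightarrow> (nat \<Rightarrow> nat \<Rightarrow> real) \<Rightarrow> (nat \<Rightarrow> real) \<Rightarrow> nat \<Rightarrow> nat \<Rightarrow> real" where
  "spectral_comb n U d i j = (\<Sum>k<n. U i k * d k * U j k)"

lemma real_mat_carrier [simp]: "real_mat n F \<in> carrier_mat n n" "dim_row (real_mat n F) = n" "dim_col (real_mat n F) = n"
  by (auto simp: real_mat_def)

lemma real_mat_index [simp]: "i < n \<Longrightarrow> j < n \<Longrightarrow> real_mat n F $$ (i, j) = complex_of_real (F i j)"
  by (simp add: real_mat_def)

lemma real_mat_adjoint: "mat_adjoint (real_mat n F) = real_mat n (\<lambda>i j. F j i)"
  by (rule eq_matI) (use mat_adjoint_index[where A="real_mat n F"] in auto)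

lemma real_mat_mult: "real_mat n F * real_mat n G = real_mat n (\<lambda>i j. \<Sum>k<n. F i k * G k j)"
  by (rule eq_matI) (auto simp: scalar_prod_def atLeast0LessThan)

lemma orthonormal_cols_unitary:
  assumes "orthonormal_cols n U" shows "mat_unitary n (real_mat n U)"
proof -
  have "real_mat n (\<lambda>i j. U j i) * real_mat n U = 1\<^sub>m n"
    unfolding real_mat_mult by (rule eq_matI) (use assms in \<open>auto simp: orthonormal_cols_def\<close>)
  moreover from this have "real_mat n U * real_mat n (\<lambda>i j. U j i) = 1\<^sub>m n"
    by (rule mat_mult_left_right_inverse[OF real_mat_carrier(1) real_mat_carrier(1)])
  ultimately show ?thesis by (simp add: mat_unitary_def real_mat_adjoint)
qed

lemma orthonormal_cols_rows:
  assumes "orthonormal_cols n U" "i < n" "j < n"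
  shows "(\<Sum>k<n. U i k * U j k) = (if i = j then 1 else 0)"
proof -
  have "real_mat n U * real_mat n (\<lambda>i j. U j i) = 1\<^sub>m n"
    using orthonormal_cols_unitary[OF assms(1)] by (simp add: mat_unitary_def real_mat_adjoint)
  then have "(real_mat n U * real_mat n (\<lambda>i j. U j i)) $$ (i, j) = (1\<^sub>m n :: complex mat) $$ (i, j)" by simp
  then have "complex_of_real (\<Sum>k<n. U i k * U j k) = complex_of_real (if i = j then 1 else 0)"
    using assms(2,3) by (simp only: real_mat_mult real_mat_index index_one_mat) simp
  then show ?thesis by (simp only: of_real_eq_iff)
qed

lemma real_mat_spectral:
  "real_mat n U * mat_diag n (\<lambda>i. complex_of_real (d i)) * mat_adjoint (real_mat n U) = real_mat n (spectral_comb n U d)"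
proof -
  have "real_mat n U * mat_diag n (\<lambda>i. complex_of_real (d i)) = real_mat n (\<lambda>i j. U i j * d j)"
    by (rule eq_matI) (auto simp: mat_diag_mult_right[of _ n n])
  then show ?thesis by (simp add: real_mat_adjoint real_mat_mult spectral_comb_def[abs_def])
qed

lemma mat_fun_spectral:
  "orthonormal_cols n U \<Longrightarrow> mat_fun f (real_mat n (spectral_comb n U d)) = real_mat n (spectral_comb n U (\<lambda>k. f (d k)))"
  using mat_fun_eqI[OF orthonormal_cols_unitary, of n U _ d f] real_mat_spectral[of n U d]
    real_mat_spectral[of n U "\<lambda>k. f (d k)"] by simp

lemma spectral_comb_form:
  fixes v :: "nat \<Rightarrow> complex"
  shows "(\<Sum>i<n. (\<Sum>j<n. complex_of_real (spectral_comb n U d i j) * v j) * cnj (v i)) =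
    complex_of_real (\<Sum>k<n. d k * (cmod (\<Sum>i<n. complex_of_real (U i k) * v i))\<^sup>2)"
proof -
  have "(\<Sum>i<n. (\<Sum>j<n. complex_of_real (spectral_comb n U d i j) * v j) * cnj (v i)) =
    (\<Sum>i<n. \<Sum>j<n. \<Sum>k<n. complex_of_real (d k) * (complex_of_real (U j k) * v j) * cnj (complex_of_real (U i k) * v i))"
    unfolding spectral_comb_def
    by (intro sum.cong refl) (simp add: sum_distrib_left sum_distrib_right mult_ac)
  also have "\<dots> = (\<Sum>i<n. \<Sum>k<n. \<Sum>j<n. complex_of_real (d k) * (complex_of_real (U j k) * v j) * cnj (complex_of_real (U i k) * v i))"
    by (rule sum.cong[OF refl]) (rule sum.swap)
  also have "\<dots> = (\<Sum>k<n. \<Sum>i<n. \<Sum>j<n. complex_of_real (d k) * (complex_of_real (U j k) * v j) * cnj (complex_of_real (U i k) * v i))"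
    by (rule sum.swap)
  also have "\<dots> = (\<Sum>k<n. complex_of_real (d k) * ((\<Sum>j<n. complex_of_real (U j k) * v j) * cnj (\<Sum>i<n. complex_of_real (U i k) * v i)))"
  proof (intro sum.cong refl)
    fix k
    have "(\<Sum>i<n. \<Sum>j<n. complex_of_real (d k) * (complex_of_real (U j k) * v j) * cnj (complex_of_real (U i k) * v i)) =
      (\<Sum>j<n. \<Sum>i<n. complex_of_real (d k) * (complex_of_real (U j k) * v j) * cnj (complex_of_real (U i k) * v i))"
      by (rule sum.swap)
    also have "\<dots> = complex_of_real (d k) * ((\<Sum>j<n. complex_of_real (U j k) * v j) * cnj (\<Sum>i<n. complex_of_real (U i k) * v i))"
      unfolding cnj_sum sum_product by (simp only: sum_distrib_left mult.assoc)
    finally show "(\<Sum>i<n. \<Sum>j<n. complex_of_real (d k) * (complex_of_real (U j k) * v j) * cnj (complex_of_real (U i k) * v i)) =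
      complex_of_real (d k) * ((\<Sum>j<n. complex_of_real (U j k) * v j) * cnj (\<Sum>i<n. complex_of_real (U i k) * v i))" .
  qed
  also have "\<dots> = complex_of_real (\<Sum>k<n. d k * (cmod (\<Sum>i<n. complex_of_real (U i k) * v i))\<^sup>2)"
    by (simp only: complex_norm_square[symmetric] of_real_sum of_real_mult of_real_power)
  finally show ?thesis .
qed

lemma real_mat_form:
  assumes "v \<in> carrier_vec n"
  shows "(real_mat n F *\<^sub>v v) \<bullet>c v = (\<Sum>i<n. (\<Sum>j<n. complex_of_real (F i j) * v $ j) * cnj (v $ i))"
  using assms by (simp add: scalar_prod_def atLeast0LessThan)

lemma spectral_posdef:
  assumes U: "orthonormal_cols n U" and d: "\<And>k. k < n \<Longrightarrow> 0 < d k"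
  shows "mat_posdef (real_mat n (spectral_comb n U d))"
  unfolding mat_posdef_def real_mat_carrier(2)
proof (intro conjI ballI impI)
  fix v :: "complex Matrix.vec" assume v: "v \<in> carrier_vec n" "v \<noteq> 0\<^sub>v n"
  let ?c = "\<lambda>k. \<Sum>i<n. complex_of_real (U i k) * v $ i"
  have "\<exists>k<n. ?c k \<noteq> 0"
  proof (rule ccontr)
    assume "\<not> ?thesis"
    then have c: "?c k = 0" if "k < n" for k using that by blast
    have "v $ j = 0" if j: "j < n" for j
    proof -
      have "(\<Sum>k<n. complex_of_real (U j k) * ?c k) = (\<Sum>k<n. \<Sum>i<n. complex_of_real (U j k * U i k) * v $ i)"
        by (simp add: sum_distrib_left mult.assoc)
      also have "\<dots> = (\<Sum>i<n. \<Sum>k<n. complex_of_real (U j k * U i k) * v $ i)" by (rule sum.swap)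
      also have "\<dots> = (\<Sum>i<n. complex_of_real (\<Sum>k<n. U j k * U i k) * v $ i)"
        by (simp only: of_real_sum sum_distrib_right)
      also have "\<dots> = (\<Sum>i<n. if j = i then v $ i else 0)"
        using orthonormal_cols_rows[OF U j] by (intro sum.cong) auto
      also have "\<dots> = v $ j" using j by simp
      finally show ?thesis using c by simp
    qed
    then have "v = 0\<^sub>v n" using v(1) by (intro eq_vecI) auto
    with v show False by simp
  qed
  then obtain k where k: "k < n" "?c k \<noteq> 0" by blast
  have "0 < (\<Sum>k<n. d k * (cmod (?c k))\<^sup>2)"
    by (rule sum_pos2[of _ k]) (use k d in \<open>auto intro!: mult_nonneg_nonneg simp: less_imp_le\<close>)
  then show "0 < (real_mat n (spectral_comb n U d) *\<^sub>v v) \<bullet>c v"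
    unfolding real_mat_form[OF v(1)] spectral_comb_form by (simp only: less_complex_def) simp
qed simp

text \<open>Midpoint convexity, tested on a real vector w, with the two matrices and their mean
  given by eigenvalues and eigenvectors. Operator convexity of f is unfolded here only; all further
  consequences are drawn from this scalar inequality.\<close>

lemma operator_convex_spectral:
  assumes f: "operator_convex f"
    and U: "orthonormal_cols n U" and V: "orthonormal_cols n V" and W: "orthonormal_cols n W"
    and d: "\<And>k. k < n \<Longrightarrow> 0 < d k" and d': "\<And>k. k < n \<Longrightarrow> 0 < d' k"
    and mid: "\<And>i j. i < n \<Longrightarrow> j < n \<Longrightarrow> spectral_comb n U d i j + spectral_comb n V d' i j = 2 * spectral_comb n W e i j"
  shows "2 * (\<Sum>k<n. f (e k) * (\<Sum>i<n. W i k * w i)\<^sup>2) \<le>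
    (\<Sum>k<n. f (d k) * (\<Sum>i<n. U i k * w i)\<^sup>2) + (\<Sum>k<n. f (d' k) * (\<Sum>i<n. V i k * w i)\<^sup>2)"
proof -
  let ?A = "real_mat n (spectral_comb n U d)" and ?B = "real_mat n (spectral_comb n V d')"
    and ?C = "real_mat n (spectral_comb n W e)"
  have C: "complex_of_real (1/2) \<cdot>\<^sub>m ?A + complex_of_real (1 - 1/2) \<cdot>\<^sub>m ?B = ?C"
  proof (rule eq_matI)
    fix i j assume "i < dim_row ?C" "j < dim_col ?C"
    then have ij: "i < n" "j < n" by auto
    have "(1/2) * spectral_comb n U d i j + (1/2) * spectral_comb n V d' i j = spectral_comb n W e i j"
      using mid[OF ij] by simp
    then have "complex_of_real ((1/2) * spectral_comb n U d i j + (1/2) * spectral_comb n V d' i j) = complex_of_real (spectral_comb n W e i j)"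
      by simp
    then show "(complex_of_real (1/2) \<cdot>\<^sub>m ?A + complex_of_real (1 - 1/2) \<cdot>\<^sub>m ?B) $$ (i, j) = ?C $$ (i, j)"
      using ij by simp
  qed auto
  let ?F = "\<lambda>U d. spectral_comb n U (\<lambda>k. f (d k))"
  have "mat_possemidef (complex_of_real (1/2) \<cdot>\<^sub>m mat_fun f ?A + complex_of_real (1 - 1/2) \<cdot>\<^sub>m mat_fun f ?B
      - mat_fun f (complex_of_real (1/2) \<cdot>\<^sub>m ?A + complex_of_real (1 - 1/2) \<cdot>\<^sub>m ?B))"
    using f[unfolded operator_convex_def, rule_format, of ?A n ?B "1/2"] spectral_posdef[OF U d] spectral_posdef[OF V d'] by simp
  then have psd: "mat_possemidef (complex_of_real (1/2) \<cdot>\<^sub>m real_mat n (?F U d) + complex_of_real (1 - 1/2) \<cdot>\<^sub>m real_mat n (?F V d')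
      - real_mat n (?F W e))"
    unfolding C by (simp only: mat_fun_spectral U V W)
  define G where "G i j = (1/2) * ?F U d i j + (1/2) * ?F V d' i j - ?F W e i j" for i j
  have "complex_of_real (1/2) \<cdot>\<^sub>m real_mat n (?F U d) + complex_of_real (1 - 1/2) \<cdot>\<^sub>m real_mat n (?F V d')
      - real_mat n (?F W e) = real_mat n G"
    by (rule eq_matI) (auto simp: G_def)
  with psd have psd: "mat_possemidef (real_mat n G)" by simp
  define v where "v = Matrix.vec n (\<lambda>i. complex_of_real (w i))"
  have v: "v \<in> carrier_vec n" by (simp add: v_def)
  have vi: "v $ i = complex_of_real (w i)" if "i < n" for i using that by (simp add: v_def)
  have form: "(\<Sum>i<n. (\<Sum>j<n. complex_of_real (spectral_comb n U d i j) * v $ j) * cnj (v $ i)) =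
     complex_of_real (\<Sum>k<n. d k * (\<Sum>i<n. U i k * w i)\<^sup>2)" for U d
  proof -
    have "(\<Sum>i<n. complex_of_real (U i k) * v $ i) = complex_of_real (\<Sum>i<n. U i k * w i)" for k
      by (simp add: vi)
    then show ?thesis unfolding spectral_comb_form by (simp only: norm_of_real power2_abs)
  qed
  have "(real_mat n G *\<^sub>v v) \<bullet>c v =
      (1/2) * (\<Sum>i<n. (\<Sum>j<n. complex_of_real (?F U d i j) * v $ j) * cnj (v $ i)) +
      (1/2) * (\<Sum>i<n. (\<Sum>j<n. complex_of_real (?F V d' i j) * v $ j) * cnj (v $ i)) -
      (\<Sum>i<n. (\<Sum>j<n. complex_of_real (?F W e i j) * v $ j) * cnj (v $ i))"
    unfolding real_mat_form[OF v] G_def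
    by (simp add: sum_distrib_left sum_distrib_right sum.distrib sum_subtractf left_diff_distrib distrib_right mult.assoc)
  also have "\<dots> = complex_of_real ((1/2) * (\<Sum>k<n. f (d k) * (\<Sum>i<n. U i k * w i)\<^sup>2) +
      (1/2) * (\<Sum>k<n. f (d' k) * (\<Sum>i<n. V i k * w i)\<^sup>2) - (\<Sum>k<n. f (e k) * (\<Sum>i<n. W i k * w i)\<^sup>2))"
    unfolding form by simp
  finally have eq: "(real_mat n G *\<^sub>v v) \<bullet>c v = complex_of_real ((1/2) * (\<Sum>k<n. f (d k) * (\<Sum>i<n. U i k * w i)\<^sup>2) +
      (1/2) * (\<Sum>k<n. f (d' k) * (\<Sum>i<n. V i k * w i)\<^sup>2) - (\<Sum>k<n. f (e k) * (\<Sum>i<n. W i k * w i)\<^sup>2))" .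
  have "0 \<le> (real_mat n G *\<^sub>v v) \<bullet>c v"
    using psd v by (simp add: mat_possemidef_def)
  then have "0 \<le> (1/2) * (\<Sum>k<n. f (d k) * (\<Sum>i<n. U i k * w i)\<^sup>2) +
      (1/2) * (\<Sum>k<n. f (d' k) * (\<Sum>i<n. V i k * w i)\<^sup>2) - (\<Sum>k<n. f (e k) * (\<Sum>i<n. W i k * w i)\<^sup>2)"
    unfolding eq by (simp only: less_eq_complex_def Re_complex_of_real zero_complex.sel)
  then show ?thesis by linarith
qed

section \<open>Lagrange interpolation, divided differences and partial fractions\<close>

lemma monic_prod_linear:
  fixes x :: "'i \<Rightarrow> real"
  assumes "finite I"
  shows "degree (\<Prod>i\<in>I. [:- x i, 1:]) = card I" "coeff (\<Prod>i\<in>I. [:- x i, 1:]) (card I) = 1"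
proof -
  show 1: "degree (\<Prod>i\<in>I. [:- x i, 1:]) = card I"
    using assms by (subst degree_prod_sum_eq) auto
  have "lead_coeff (\<Prod>i\<in>I. [:- x i, 1:]) = 1"
    by (subst lead_coeff_prod) simp
  then show "coeff (\<Prod>i\<in>I. [:- x i, 1:]) (card I) = 1" unfolding 1 .
qed

lemma lagrange_interpolation:
  fixes x :: "'i \<Rightarrow> real"
  assumes I: "finite I" "inj_on x I" and p: "degree p < card I"
  shows "p = (\<Sum>i\<in>I. Polynomial.smult (poly p (x i) / (\<Prod>j\<in>I - {i}. x i - x j)) (\<Prod>j\<in>I - {i}. [:- x j, 1:]))"
    (is "p = ?q")
proof (rule poly_eqI_degree[where A="x ` I"])
  have card: "card (x ` I) = card I" using I by (simp add: card_image)
  then show "degree p < card (x ` I)" using p by simp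
  have "degree ?q \<le> card I - 1"
  proof (rule degree_sum_le)
    fix i assume "i \<in> I"
    have "degree (\<Prod>j\<in>I - {i}. [:- x j, 1:]) = card I - 1"
      using I \<open>i \<in> I\<close> by (subst monic_prod_linear) auto
    then show "degree (Polynomial.smult (poly p (x i) / (\<Prod>j\<in>I - {i}. x i - x j)) (\<Prod>j\<in>I - {i}. [:- x j, 1:])) \<le> card I - 1"
      by (metis degree_smult_le)
  qed (rule I)
  then show "degree ?q < card (x ` I)" using p card by linarith
  fix z assume "z \<in> x ` I"
  then obtain k where k: "k \<in> I" "z = x k" by auto
  have "poly ?q z = (\<Sum>i\<in>I. poly p (x i) / (\<Prod>j\<in>I - {i}. x i - x j) * (\<Prod>j\<in>I - {i}. x k - x j))"
    by (simp add: poly_sum poly_prod k)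
  also have "\<dots> = poly p (x k) / (\<Prod>j\<in>I - {k}. x k - x j) * (\<Prod>j\<in>I - {k}. x k - x j)"
  proof (subst sum.remove[OF I(1) k(1)])
    have "(\<Prod>j\<in>I - {i}. x k - x j) = 0" if "i \<in> I - {k}" for i
      using I k that by (intro prod_zero) auto
    then show "poly p (x k) / (\<Prod>j\<in>I - {k}. x k - x j) * (\<Prod>j\<in>I - {k}. x k - x j) +
      (\<Sum>i\<in>I - {k}. poly p (x i) / (\<Prod>j\<in>I - {i}. x i - x j) * (\<Prod>j\<in>I - {i}. x k - x j)) =
      poly p (x k) / (\<Prod>j\<in>I - {k}. x k - x j) * (\<Prod>j\<in>I - {k}. x k - x j)" by simp
  qed
  also have "\<dots> = poly p z"
  proof -
    have "(\<Prod>j\<in>I - {k}. x k - x j) \<noteq> 0"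
      using I k by (auto simp: prod_zero_iff inj_on_def)
    then show ?thesis by (simp add: k)
  qed
  finally show "poly p z = poly ?q z" by simp
qed

text \<open>Compare the coefficients of degree \<open>card I - 1\<close> in Lagrange's formula. For
  p of smaller degree the sum is 0, the source of the orthogonality relations in the interlacing
  system.\<close>

lemma divided_difference_poly:
  fixes x :: "'i \<Rightarrow> real"
  assumes I: "finite I" "inj_on x I" and p: "degree p < card I"
  shows "(\<Sum>i\<in>I. poly p (x i) / (\<Prod>j\<in>I - {i}. x i - x j)) = coeff p (card I - 1)"
proof -
  have "coeff p (card I - 1) = (\<Sum>i\<in>I. poly p (x i) / (\<Prod>j\<in>I - {i}. x i - x j) * coeff (\<Prod>j\<in>I - {i}. [:- x j, 1:]) (card I - 1))"
    by (subst lagrange_interpolation[OF assms]) (simp add: coeff_sum)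
  also have "\<dots> = (\<Sum>i\<in>I. poly p (x i) / (\<Prod>j\<in>I - {i}. x i - x j))"
  proof (rule sum.cong[OF refl])
    fix i assume "i \<in> I"
    then have "coeff (\<Prod>j\<in>I - {i}. [:- x j, 1:]) (card I - 1) = 1"
      using monic_prod_linear(2)[of "I - {i}" x] I by simp
    then show "poly p (x i) / (\<Prod>j\<in>I - {i}. x i - x j) * coeff (\<Prod>j\<in>I - {i}. [:- x j, 1:]) (card I - 1) =
      poly p (x i) / (\<Prod>j\<in>I - {i}. x i - x j)" by simp
  qed
  finally show ?thesis by simp
qed

lemma partial_fraction_step:
  fixes a b c d P R :: real
  assumes "b - a \<noteq> 0" "d \<noteq> 0" "P = (a - b) * R"
  shows "c / d * R = P * - (c / (d * (b - a)))"
  using assms(1,2) unfolding assms(3) by (simp add: divide_simps) (simp add: algebra_simps)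

text \<open>Lagrange's formula at z, divided by the product of all z - x i.\<close>

lemma partial_fractions:
  fixes x :: "'i \<Rightarrow> real"
  assumes I: "finite I" "inj_on x I" and p: "degree p < card I" and z: "z \<notin> x ` I"
  shows "(\<Sum>i\<in>I. poly p (x i) / ((\<Prod>j\<in>I - {i}. x i - x j) * (x i - z))) = - (poly p z / (\<Prod>i\<in>I. z - x i))"
proof -
  have nz: "(\<Prod>i\<in>I. z - x i) \<noteq> 0" using I z by (auto simp: prod_zero_iff)
  have "poly p z = (\<Sum>i\<in>I. poly p (x i) / (\<Prod>j\<in>I - {i}. x i - x j) * (\<Prod>j\<in>I - {i}. z - x j))"
    by (subst lagrange_interpolation[OF I p]) (simp add: poly_sum poly_prod)
  also have "\<dots> = (\<Sum>i\<in>I. (\<Prod>i\<in>I. z - x i) * - (poly p (x i) / ((\<Prod>j\<in>I - {i}. x i - x j) * (x i - z))))"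
  proof (rule sum.cong[OF refl])
    fix i assume i: "i \<in> I"
    have "(\<Prod>i\<in>I. z - x i) = (z - x i) * (\<Prod>j\<in>I - {i}. z - x j)" by (rule prod.remove[OF I(1) i])
    moreover have "x i - z \<noteq> 0" using i z by auto
    moreover have "(\<Prod>j\<in>I - {i}. x i - x j) \<noteq> 0" using I i by (auto simp: prod_zero_iff inj_on_def)
    ultimately show "poly p (x i) / (\<Prod>j\<in>I - {i}. x i - x j) * (\<Prod>j\<in>I - {i}. z - x j) =
      (\<Prod>i\<in>I. z - x i) * - (poly p (x i) / ((\<Prod>j\<in>I - {i}. x i - x j) * (x i - z)))"
      by (intro partial_fraction_step)
  qed
  also have "\<dots> = (\<Prod>i\<in>I. z - x i) * - (\<Sum>i\<in>I. poly p (x i) / ((\<Prod>j\<in>I - {i}. x i - x j) * (x i - z)))"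
    by (simp add: sum_distrib_left sum_negf)
  finally show ?thesis using nz by (simp add: field_simps)
qed

section \<open>The Kraus reflection for interlacing nodes\<close>

text \<open>An inverse eigenvalue problem: the numbers are prescribed, and a unit vector u is wanted
  such that the compression of diag(lam) to the complement of u has the eigenvalues nu. Strict
  interlacing is what makes it solvable.\<close>

locale interlacing =
  fixes k :: nat and lam nu :: "nat \<Rightarrow> real"
  assumes inter: "\<And>i. i < k \<Longrightarrow> lam i < nu i" "\<And>i. i < k \<Longrightarrow> nu i < lam (Suc i)"
begin

lemma lam_mono: "i < j \<Longrightarrow> j \<le> k \<Longrightarrow> lam i < lam j"
proof (induction j)
  case (Suc j)
  have "lam j < lam (Suc j)" using inter[of j] Suc.prems by linarith
  then show ?case using Suc by (cases "i = j") (auto intro: less_trans)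
qed simp

lemma nu_mono: "i < j \<Longrightarrow> j < k \<Longrightarrow> nu i < nu j"
  using inter(2)[of i] inter(1)[of j] lam_mono[of "Suc i" j] by (cases "Suc i = j") auto

lemma lam_less_nu: "i \<le> j \<Longrightarrow> j < k \<Longrightarrow> lam i < nu j"
  using inter(1)[of j] lam_mono[of i j] by (cases "i = j") auto

lemma nu_less_lam: "i < j \<Longrightarrow> j \<le> k \<Longrightarrow> nu i < lam j"
  using inter(2)[of i] lam_mono[of "Suc i" j] by (cases "Suc i = j") auto

lemma inj_lam: "inj_on lam {..k}"
  by (rule linorder_inj_onI) (auto dest: lam_mono)

lemma inj_nu: "inj_on nu {..<k}"
  by (rule linorder_inj_onI) (auto dest: nu_mono)

lemma lam_neq_nu: "i \<le> k \<Longrightarrow> j < k \<Longrightarrow> lam i \<noteq> nu j"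
  using lam_less_nu[of i j] nu_less_lam[of j i] by (cases "i \<le> j") auto

definition "om_nu z = (\<Prod>i<k. z - nu i)"
definition "om_lam z = (\<Prod>j\<le>k. z - lam j)"
definition "dlam j = (\<Prod>l\<in>{..k} - {j}. lam j - lam l)"
definition "dnu i = (\<Prod>l\<in>{..<k} - {i}. nu i - nu l)"
text \<open>The residues of \<open>om_nu z / om_lam z\<close> at the nodes lam j. They are the
  squares of the coordinates of u, since the zeros of the sum of wt j / (z - lam j) are to be the nu
  i.\<close>

definition "wt j = om_nu (lam j) / dlam j"

lemma om_nu_nz: "j \<le> k \<Longrightarrow> om_nu (lam j) \<noteq> 0"
  using lam_neq_nu by (auto simp: om_nu_def prod_zero_iff)

lemma om_lam_nz: "i < k \<Longrightarrow> om_lam (nu i) \<noteq> 0"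
proof
  assume "i < k" "om_lam (nu i) = 0"
  then obtain j where "j \<le> k" "nu i - lam j = 0" by (auto simp: om_lam_def prod_zero_iff)
  then show False using lam_neq_nu[of j i] \<open>i < k\<close> by simp
qed

lemma dnu_nz: "i < k \<Longrightarrow> dnu i \<noteq> 0"
  using inj_nu by (auto simp: dnu_def prod_zero_iff inj_on_def)

text \<open>The factors pair off: leaving out index j, the i-th remaining node lam lies on the same
  side of lam j as nu i, so every quotient is positive.\<close>

lemma wt_pos:
  assumes j: "j \<le> k"
  shows "0 < wt j"
proof -
  let ?s = "\<lambda>i. if i < j then i else Suc i"
  have bij: "bij_betw ?s {..<k} ({..k} - {j})"
    by (rule bij_betwI[where g="\<lambda>i. if i < j then i else i - 1"]) (use j in \<open>auto split: if_splits\<close>)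
  have "dlam j = (\<Prod>i<k. lam j - lam (?s i))"
    unfolding dlam_def by (rule prod.reindex_bij_betw[OF bij, symmetric])
  then have "wt j = (\<Prod>i<k. (lam j - nu i) / (lam j - lam (?s i)))"
    by (simp only: wt_def om_nu_def prod_dividef)
  also have "0 < \<dots>"
  proof (rule prod_pos)
    fix i assume "i \<in> {..<k}"
    then have i: "i < k" by simp
    show "0 < (lam j - nu i) / (lam j - lam (?s i))"
    proof (cases "i < j")
      case True
      then show ?thesis using nu_less_lam[of i j] lam_mono[of i j] j by simp
    next
      case False
      then have "lam j < nu i" "lam j < lam (Suc i)" using lam_less_nu[of j i] lam_mono[of j "Suc i"] i by auto
      then show ?thesis using False by (simp add: divide_neg_neg)
    qed
  qed
  finally show ?thesis .
qed

definition "nup K = (\<Prod>i\<in>K. [:- nu i, 1:])"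

lemma poly_nup: "poly (nup K) z = (\<Prod>i\<in>K. z - nu i)"
  by (simp add: nup_def poly_prod)

lemma degree_nup: "finite K \<Longrightarrow> degree (nup K) = card K"
  unfolding nup_def by (rule monic_prod_linear(1))

lemma sum_wt: "(\<Sum>j\<le>k. wt j) = 1"
proof -
  have "(\<Sum>j\<le>k. wt j) = (\<Sum>j\<le>k. poly (nup {..<k}) (lam j) / dlam j)"
    by (simp add: wt_def om_nu_def poly_nup)
  also have "\<dots> = coeff (nup {..<k}) (card {..k} - 1)"
    unfolding dlam_def using inj_lam degree_nup[of "{..<k}"] by (intro divided_difference_poly) auto
  also have "\<dots> = 1" using monic_prod_linear(2)[of "{..<k}" nu] by (simp add: nup_def)
  finally show ?thesis .
qed

text \<open>Let u_j be the root of wt j and y_i the vector with coordinates u_j / (lam j - nu i).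
  This sum and the two that follow are the inner products of y_i with u, with another y_l and with
  itself.\<close>

lemma sum_wt_nu:
  assumes i: "i < k" and K: "K = {..<k} - {i}"
  shows "(\<Sum>j\<le>k. wt j / (lam j - nu i)) = 0"
proof -
  have "(\<Sum>j\<le>k. wt j / (lam j - nu i)) = (\<Sum>j\<le>k. poly (nup K) (lam j) / dlam j)"
  proof (rule sum.cong[OF refl])
    fix j assume "j \<in> {..k}"
    then have "lam j - nu i \<noteq> 0" using lam_neq_nu[of j i] i by simp
    moreover have "om_nu (lam j) = (lam j - nu i) * poly (nup K) (lam j)"
      unfolding om_nu_def poly_nup K using i by (intro prod.remove) auto
    ultimately show "wt j / (lam j - nu i) = poly (nup K) (lam j) / dlam j" by (simp add: wt_def)
  qed
  also have "\<dots> = coeff (nup K) (card {..k} - 1)"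
    unfolding dlam_def using inj_lam i by (intro divided_difference_poly) (auto simp: degree_nup K)
  also have "\<dots> = 0" using i by (intro coeff_eq_0) (auto simp: degree_nup K)
  finally show ?thesis .
qed

lemma sum_wt_nu_nu:
  assumes i: "i < k" "l < k" "i \<noteq> l"
  shows "(\<Sum>j\<le>k. wt j / ((lam j - nu i) * (lam j - nu l))) = 0"
proof -
  let ?K = "{..<k} - {i} - {l}"
  have "(\<Sum>j\<le>k. wt j / ((lam j - nu i) * (lam j - nu l))) = (\<Sum>j\<le>k. poly (nup ?K) (lam j) / dlam j)"
  proof (rule sum.cong[OF refl])
    fix j assume "j \<in> {..k}"
    then have "lam j - nu i \<noteq> 0" "lam j - nu l \<noteq> 0" using lam_neq_nu[of j i] lam_neq_nu[of j l] i by auto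
    moreover have "om_nu (lam j) = (lam j - nu i) * (\<Prod>m\<in>{..<k} - {i}. lam j - nu m)"
      unfolding om_nu_def using i by (intro prod.remove) auto
    moreover have "(\<Prod>m\<in>{..<k} - {i}. lam j - nu m) = (lam j - nu l) * poly (nup ?K) (lam j)"
      unfolding poly_nup using i by (intro prod.remove) auto
    ultimately show "wt j / ((lam j - nu i) * (lam j - nu l)) = poly (nup ?K) (lam j) / dlam j" by (simp add: wt_def)
  qed
  also have "\<dots> = coeff (nup ?K) (card {..k} - 1)"
    unfolding dlam_def using inj_lam i by (intro divided_difference_poly) (auto simp: degree_nup)
  also have "\<dots> = 0" using i by (intro coeff_eq_0) (auto simp: degree_nup)
  finally show ?thesis .
qed

lemma sum_wt_nu_sq:
  assumes i: "i < k"
  shows "(\<Sum>j\<le>k. wt j / (lam j - nu i)\<^sup>2) = - (dnu i / om_lam (nu i))"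
proof -
  let ?K = "{..<k} - {i}"
  have "(\<Sum>j\<le>k. wt j / (lam j - nu i)\<^sup>2) = (\<Sum>j\<le>k. poly (nup ?K) (lam j) / (dlam j * (lam j - nu i)))"
  proof (rule sum.cong[OF refl])
    fix j assume "j \<in> {..k}"
    then have "lam j - nu i \<noteq> 0" using lam_neq_nu[of j i] i by simp
    moreover have "om_nu (lam j) = (lam j - nu i) * poly (nup ?K) (lam j)"
      unfolding om_nu_def poly_nup using i by (intro prod.remove) auto
    ultimately show "wt j / (lam j - nu i)\<^sup>2 = poly (nup ?K) (lam j) / (dlam j * (lam j - nu i))"
      by (simp add: wt_def power2_eq_square)
  qed
  also have "\<dots> = - (poly (nup ?K) (nu i) / om_lam (nu i))"
    unfolding dlam_def om_lam_def using inj_lam i lam_neq_nu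
    by (intro partial_fractions) (auto simp: degree_nup image_iff, metis)
  finally show ?thesis by (simp add: poly_nup dnu_def)
qed

text \<open>Midpoint convexity at \<open>D = diag(lam)\<close> and \<open>HDH\<close> with the reflection \<open>H = 1 - 2uu\<^sup>T\<close>,
  \<open>u\<^sub>j\<^sup>2 = wt j\<close>. The mean of the two is block diagonal with respect to \<open>u\<close> and its complement, where
  its eigenvalues are the \<open>nu i\<close>; the test vector \<open>w\<close> is orthogonal to \<open>u\<close>.\<close>

lemma kraus_interlacing:
  assumes f: "operator_convex f" and pos: "0 < lam 0" and q: "degree q < k"
  shows "0 \<le> (\<Sum>j\<le>k. f (lam j) * (poly q (lam j))\<^sup>2 / (dlam j * om_nu (lam j))) +
    (\<Sum>i<k. f (nu i) * (poly q (nu i))\<^sup>2 / (dnu i * om_lam (nu i)))"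
proof -
  let ?n = "Suc k"
  define u where "u j = sqrt (wt j)" for j
  have uu: "u j * u j = wt j" if "j \<le> k" for j using wt_pos[OF that] by (simp add: u_def)
  define y where "y i j = u j / (lam j - nu i)" for i j
  define \<kappa> where "\<kappa> i = - (dnu i / om_lam (nu i))" for i
  have range: "{..<?n} = {..k}" by auto
  have y_sq: "(\<Sum>j\<le>k. y i j * y i j) = \<kappa> i" if "i < k" for i
    unfolding \<kappa>_def sum_wt_nu_sq[OF that, symmetric]
    by (rule sum.cong[OF refl]) (simp add: y_def uu power2_eq_square)
  have y_orth: "(\<Sum>j\<le>k. y i j * y l j) = 0" if "i < k" "l < k" "i \<noteq> l" for i l
    unfolding sum_wt_nu_nu[OF that, symmetric]
    by (rule sum.cong[OF refl]) (simp add: y_def uu)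
  have uy: "(\<Sum>j\<le>k. u j * y i j) = 0" if "i < k" for i
    unfolding sum_wt_nu[OF that refl, symmetric]
    by (rule sum.cong[OF refl]) (simp add: y_def uu)
  have u1: "(\<Sum>j\<le>k. u j * u j) = 1"
    unfolding sum_wt[symmetric] by (rule sum.cong[OF refl]) (simp add: uu)
  have \<kappa>_pos: "0 < \<kappa> i" if i: "i < k" for i
  proof -
    have "\<kappa> i \<noteq> 0" using dnu_nz[OF i] om_lam_nz[OF i] by (simp add: \<kappa>_def)
    moreover have "0 \<le> \<kappa> i" unfolding y_sq[OF i, symmetric] by (intro sum_nonneg) simp
    ultimately show ?thesis by simp
  qed
  \<comment> \<open>The eigenvalue of the mean at u, which is <u, D u>. It does not enter the
    result, because the test vector is orthogonal to u.\<close>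
  define \<theta> where "\<theta> = (\<Sum>j\<le>k. lam j * (u j * u j))"
  define W where "W j i = (if i < k then y i j / sqrt (\<kappa> i) else u j)" for j i
  define e where "e i = (if i < k then nu i else \<theta>)" for i
  define H where "H i j = (if i = j then 1 else 0) - 2 * u i * u j" for i j
  define U :: "nat \<Rightarrow> nat \<Rightarrow> real" where "U i j = (if i = j then 1 else 0)" for i j
  have Ucols: "orthonormal_cols ?n U"
    by (auto simp: orthonormal_cols_def U_def if_distrib[of "\<lambda>x. x * _"] cong: if_cong)
  have Wcols: "orthonormal_cols ?n W"
    unfolding orthonormal_cols_def range
  proof (intro allI impI)
    fix i j assume "i < ?n" "j < ?n"
    then have ij: "i < k \<or> i = k" "j < k \<or> j = k" by auto
    have sq: "sqrt (\<kappa> i) * sqrt (\<kappa> i) = \<kappa> i" if "i < k" for i using \<kappa>_pos[OF that] by simp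
    have a: "(\<Sum>l\<le>k. W l i * W l j) = (\<Sum>l\<le>k. y i l * y j l) / (sqrt (\<kappa> i) * sqrt (\<kappa> j))" if "i < k" "j < k"
      using that by (simp add: W_def sum_divide_distrib)
    have b: "(\<Sum>l\<le>k. W l i * W l j) = (\<Sum>l\<le>k. u l * y i l) / sqrt (\<kappa> i)" if "i < k" "j = k"
      using that by (simp add: W_def sum_divide_distrib mult.commute)
    have c: "(\<Sum>l\<le>k. W l i * W l j) = (\<Sum>l\<le>k. u l * y j l) / sqrt (\<kappa> j)" if "i = k" "j < k"
      using that by (simp add: W_def sum_divide_distrib)
    have d: "(\<Sum>l\<le>k. W l i * W l j) = (\<Sum>l\<le>k. u l * u l)" if "i = k" "j = k"
      using that by (simp add: W_def)
    show "(\<Sum>l\<le>k. W l i * W l j) = (if i = j then 1 else 0)"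
      using ij a b c d uy[of i] uy[of j] u1 y_sq[of i] y_orth[of i j] sq[of i] \<kappa>_pos[of i]
      by (cases "i < k"; cases "j < k"; cases "i = j") auto
  qed
  have Hcols: "orthonormal_cols ?n H"
    unfolding orthonormal_cols_def range
  proof (intro allI impI)
    fix i j assume "i < ?n" "j < ?n"
    then have ij: "i \<le> k" "j \<le> k" by auto
    have "H l i * H l j = (if l = i then (if i = j then 1 else 0) else 0) - (if l = i then 2 * u i * u j else 0)
        - (if l = j then 2 * u i * u j else 0) + 4 * u i * u j * (u l * u l)" for l
      by (auto simp: H_def algebra_simps)
    then have "(\<Sum>l\<le>k. H l i * H l j) = (if i = j then 1 else 0) - 2 * u i * u j - 2 * u i * u j + 4 * u i * u j * (\<Sum>l\<le>k. u l * u l)"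
      using ij by (simp add: sum.distrib sum_subtractf sum_distrib_left)
    then show "(\<Sum>l\<le>k. H l i * H l j) = (if i = j then 1 else 0)" by (simp add: u1)
  qed
  \<comment> \<open>The mean of D and H D H, written out with the help of |u| = 1.\<close>
  define M where "M i l = (if i = l then lam i else 0) - u i * u l * (lam i + lam l) + 2 * \<theta> * u i * u l" for i l
  have combU: "spectral_comb ?n U lam i l = (if i = l then lam i else 0)" if "i \<le> k" "l \<le> k" for i l
    using that unfolding spectral_comb_def range by (auto simp: U_def if_distrib[of "\<lambda>x. x * _"] cong: if_cong)
  have combH: "spectral_comb ?n H lam i l = (if i = l then lam i else 0) - 2 * u i * u l * (lam i + lam l) + 4 * \<theta> * u i * u l"
    if "i \<le> k" "l \<le> k" for i l
  proof -
    have "H i m * lam m * H l m = (if m = i then (if i = l then lam i else 0) else 0) - (if m = i then 2 * u i * u l * lam i else 0)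
      - (if m = l then 2 * u i * u l * lam l else 0) + 4 * u i * u l * (lam m * (u m * u m))" for m
      by (auto simp: H_def algebra_simps)
    then have "spectral_comb ?n H lam i l = (if i = l then lam i else 0) - 2 * u i * u l * lam i - 2 * u i * u l * lam l + 4 * u i * u l * \<theta>"
      using that unfolding spectral_comb_def range \<theta>_def by (simp add: sum.distrib sum_subtractf sum_distrib_left)
    then show ?thesis by (simp add: algebra_simps)
  qed
  have MW: "(\<Sum>l\<le>k. M i l * W l m) = e m * W i m" if i: "i \<le> k" and m: "m \<le> k" for i m
  proof -
    have gen: "(\<Sum>l\<le>k. M i l * z l) = lam i * z i - u i * lam i * (\<Sum>l\<le>k. u l * z l) - u i * (\<Sum>l\<le>k. lam l * u l * z l)
      + 2 * \<theta> * u i * (\<Sum>l\<le>k. u l * z l)" for z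
    proof -
      have "M i l * z l = (if l = i then lam i * z i else 0) - u i * lam i * (u l * z l) - u i * (lam l * u l * z l) + 2 * \<theta> * u i * (u l * z l)" for l
        by (auto simp: M_def algebra_simps)
      then show ?thesis using i by (simp add: sum.distrib sum_subtractf sum_distrib_left)
    qed
    show ?thesis
    proof (cases "m < k")
      case True
      \<comment> \<open>That is (D - nu m) y_m = u: on the complement of u the right side
        disappears, so y_m is an eigenvector of the compression.\<close>
      have yl: "lam l * y m l = u l + nu m * y m l" if "l \<le> k" for l
        using lam_neq_nu[of l m] True that by (simp add: y_def field_simps)
      have "(\<Sum>l\<le>k. lam l * u l * y m l) = (\<Sum>l\<le>k. u l * u l + nu m * (u l * y m l))"
      proof (rule sum.cong[OF refl])
        fix l assume "l \<in> {..k}"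
        then have "lam l * u l * y m l = u l * (u l + nu m * y m l)" using yl[of l] by (simp add: mult_ac)
        then show "lam l * u l * y m l = u l * u l + nu m * (u l * y m l)" by (simp add: algebra_simps)
      qed
      also have "\<dots> = 1" by (simp add: sum.distrib sum_distrib_left[symmetric] u1 uy[OF True])
      finally have "(\<Sum>l\<le>k. M i l * y m l) = nu m * y m i"
        unfolding gen uy[OF True] using yl[OF i] by (simp add: algebra_simps)
      then show ?thesis using True by (simp add: W_def e_def sum_divide_distrib[symmetric])
    next
      case False
      have "(\<Sum>l\<le>k. lam l * u l * u l) = \<theta>" by (simp add: \<theta>_def mult.assoc)
      then have "(\<Sum>l\<le>k. M i l * u l) = \<theta> * u i"
        unfolding gen u1 by (simp add: algebra_simps)
      then show ?thesis using False by (simp add: W_def e_def)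
    qed
  qed
  have combW: "spectral_comb ?n W e i j = M i j" if ij: "i \<le> k" "j \<le> k" for i j
  proof -
    have "spectral_comb ?n W e i j = (\<Sum>m\<le>k. (\<Sum>l\<le>k. M i l * W l m) * W j m)"
      unfolding spectral_comb_def range using ij MW by (intro sum.cong refl) (simp add: mult.commute)
    also have "\<dots> = (\<Sum>m\<le>k. \<Sum>l\<le>k. M i l * (W l m * W j m))" by (simp add: sum_distrib_right mult.assoc)
    also have "\<dots> = (\<Sum>l\<le>k. \<Sum>m\<le>k. M i l * (W l m * W j m))" by (rule sum.swap)
    also have "\<dots> = (\<Sum>l\<le>k. M i l * (if l = j then 1 else 0))"
      using orthonormal_cols_rows[OF Wcols] ij unfolding range
      by (intro sum.cong[OF refl]) (simp add: sum_distrib_left[symmetric])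
    also have "\<dots> = (\<Sum>l\<le>k. if l = j then M i l else 0)" by (rule sum.cong[OF refl]) simp
    also have "\<dots> = M i j" using ij by simp
    finally show ?thesis .
  qed
  \<comment> \<open>Chosen so that u_j w_j is the term q(lam j) / dlam j of a divided difference: it
    sums to 0 since degree q < k, and against y_i it gives q(nu i) by partial fractions.\<close>
  define w where "w j = u j * poly q (lam j) / om_nu (lam j)" for j
  have uw_j: "u j * w j = poly q (lam j) / dlam j" if "j \<le> k" for j
    using uu[OF that] om_nu_nz[OF that] by (simp add: w_def wt_def mult.assoc[symmetric])
  have uw: "(\<Sum>j\<le>k. u j * w j) = 0"
  proof -
    have "(\<Sum>j\<le>k. u j * w j) = (\<Sum>j\<le>k. poly q (lam j) / dlam j)" by (rule sum.cong[OF refl]) (simp add: uw_j)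
    also have "\<dots> = coeff q (card {..k} - 1)"
      unfolding dlam_def using inj_lam q by (intro divided_difference_poly) auto
    also have "\<dots> = 0" using q by (intro coeff_eq_0) simp
    finally show ?thesis .
  qed
  have yw: "(\<Sum>j\<le>k. y i j * w j) = - (poly q (nu i) / om_lam (nu i))" if i: "i < k" for i
  proof -
    have "(\<Sum>j\<le>k. y i j * w j) = (\<Sum>j\<le>k. poly q (lam j) / (dlam j * (lam j - nu i)))"
    proof (rule sum.cong[OF refl])
      fix j assume "j \<in> {..k}"
      then have "y i j * w j = (u j * w j) / (lam j - nu i)" "j \<le> k" by (simp_all add: y_def)
      then show "y i j * w j = poly q (lam j) / (dlam j * (lam j - nu i))" by (simp add: uw_j)
    qed
    also have "\<dots> = - (poly q (nu i) / om_lam (nu i))"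
      unfolding dlam_def om_lam_def using inj_lam i lam_neq_nu q
      by (intro partial_fractions) (auto simp: image_iff, metis)
    finally show ?thesis .
  qed
  have lam_pos: "0 < lam j" if "j \<le> k" for j
    using pos lam_mono[of 0 j] that by (cases "j = 0") auto
  have "2 * (\<Sum>m<?n. f (e m) * (\<Sum>i<?n. W i m * w i)\<^sup>2) \<le>
    (\<Sum>m<?n. f (lam m) * (\<Sum>i<?n. U i m * w i)\<^sup>2) + (\<Sum>m<?n. f (lam m) * (\<Sum>i<?n. H i m * w i)\<^sup>2)"
    by (rule operator_convex_spectral[OF f Ucols Hcols Wcols])
      (auto simp: lam_pos combU combH combW M_def algebra_simps less_Suc_eq_le)
  moreover have "(\<Sum>m\<le>k. f (lam m) * (\<Sum>i\<le>k. U i m * w i)\<^sup>2) = (\<Sum>m\<le>k. f (lam m) * (w m)\<^sup>2)"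
    by (intro sum.cong refl) (simp add: U_def if_distrib[of "\<lambda>x. x * _"] cong: if_cong)
  moreover have "(\<Sum>m\<le>k. f (lam m) * (\<Sum>i\<le>k. H i m * w i)\<^sup>2) = (\<Sum>m\<le>k. f (lam m) * (w m)\<^sup>2)"
  proof (intro sum.cong refl)
    fix m assume m: "m \<in> {..k}"
    have "H i m * w i = (if i = m then w m else 0) - 2 * u m * (u i * w i)" for i
      by (auto simp: H_def algebra_simps)
    then have "(\<Sum>i\<le>k. H i m * w i) = w m - 2 * u m * (\<Sum>i\<le>k. u i * w i)"
      using m by (simp add: sum_subtractf sum_distrib_left)
    then show "f (lam m) * (\<Sum>i\<le>k. H i m * w i)\<^sup>2 = f (lam m) * (w m)\<^sup>2" by (simp add: uw)
  qed
  moreover have "(\<Sum>m\<le>k. f (e m) * (\<Sum>i\<le>k. W i m * w i)\<^sup>2) = (\<Sum>i<k. f (nu i) * (- ((poly q (nu i))\<^sup>2 / (dnu i * om_lam (nu i)))))"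
  proof -
    have "(\<Sum>m\<le>k. f (e m) * (\<Sum>i\<le>k. W i m * w i)\<^sup>2) = (\<Sum>m<k. f (e m) * (\<Sum>i\<le>k. W i m * w i)\<^sup>2) + f (e k) * (\<Sum>i\<le>k. W i k * w i)\<^sup>2"
      by (simp only: lessThan_Suc_atMost[symmetric] sum.lessThan_Suc)
    also have "(\<Sum>i\<le>k. W i k * w i) = 0" using uw by (simp add: W_def)
    also have "(\<Sum>m<k. f (e m) * (\<Sum>i\<le>k. W i m * w i)\<^sup>2) = (\<Sum>i<k. f (nu i) * (- ((poly q (nu i))\<^sup>2 / (dnu i * om_lam (nu i)))))"
    proof (rule sum.cong[OF refl])
      fix m assume "m \<in> {..<k}"
      then have m: "m < k" by simp
      have "(\<Sum>i\<le>k. W i m * w i) = (\<Sum>i\<le>k. y m i * w i) / sqrt (\<kappa> m)"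
        using m by (simp add: W_def sum_divide_distrib)
      then have "(\<Sum>i\<le>k. W i m * w i)\<^sup>2 = (poly q (nu m) / om_lam (nu m))\<^sup>2 / \<kappa> m"
        using \<kappa>_pos[OF m] by (simp add: yw[OF m] power_divide power_mult_distrib)
      also have "\<dots> = - ((poly q (nu m))\<^sup>2 / (dnu m * om_lam (nu m)))"
        using dnu_nz[OF m] om_lam_nz[OF m] by (simp add: \<kappa>_def power2_eq_square)
      finally show "f (e m) * (\<Sum>i\<le>k. W i m * w i)\<^sup>2 = f (nu m) * (- ((poly q (nu m))\<^sup>2 / (dnu m * om_lam (nu m))))"
        using m by (simp add: e_def)
    qed
    finally show ?thesis by simp
  qed
  moreover have "(\<Sum>m\<le>k. f (lam m) * (w m)\<^sup>2) = (\<Sum>j\<le>k. f (lam j) * (poly q (lam j))\<^sup>2 / (dlam j * om_nu (lam j)))"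
  proof (rule sum.cong[OF refl])
    fix j assume "j \<in> {..k}"
    then have j: "j \<le> k" by simp
    have "(w j)\<^sup>2 = (u j * u j) * (poly q (lam j))\<^sup>2 / (om_nu (lam j))\<^sup>2"
      by (simp add: w_def power2_eq_square)
    also have "\<dots> = (poly q (lam j))\<^sup>2 / (dlam j * om_nu (lam j))"
      using om_nu_nz[OF j] by (simp add: uu[OF j] wt_def power2_eq_square)
    finally show "f (lam j) * (w j)\<^sup>2 = f (lam j) * (poly q (lam j))\<^sup>2 / (dlam j * om_nu (lam j))" by simp
  qed
  ultimately show ?thesis
    unfolding range by (simp add: sum_negf)
qed

end

text \<open>In increasing order the points at even positions serve as lam and those at odd positions
  as nu, and the odd cardinality supplies the extra lam. The product over all other points splits
  into the two products of the locale.\<close>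

lemma kraus_inequality:
  fixes X :: "real set"
  assumes f: "operator_convex f" and X: "finite X" "card X = 2 * k + 1" "X \<subseteq> {0<..}" and q: "degree q < k"
  shows "0 \<le> (\<Sum>x\<in>X. f x * (poly q x)\<^sup>2 / (\<Prod>y\<in>X - {x}. x - y))"
proof -
  define xs where "xs = sorted_list_of_set X"
  have len: "length xs = 2 * k + 1" and set: "set xs = X" and sorted: "sorted_wrt (<) xs"
    using X by (simp_all add: xs_def)
  have less: "xs ! i < xs ! j" if "i < j" "j < 2 * k + 1" for i j
    using sorted that len by (simp add: sorted_wrt_iff_nth_less)
  define lam where "lam j = xs ! (2 * j)" for j
  define nu where "nu i = xs ! (2 * i + 1)" for i
  have inter: "lam i < nu i" "nu i < lam (Suc i)" if "i < k" for i
    using that by (auto simp: lam_def nu_def intro!: less)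
  then interpret interlacing k lam nu by unfold_locales
  have X_eq: "X = lam ` {..k} \<union> nu ` {..<k}"
  proof -
    have "X = (\<lambda>m. xs ! m) ` {..<2 * k + 1}"
      using set len by (auto simp: set_conv_nth image_iff)
    also have "{..<2 * k + 1} = (\<lambda>j. 2 * j) ` {..k} \<union> (\<lambda>i. 2 * i + 1) ` {..<k}"
    proof (intro equalityI subsetI)
      fix m assume "m \<in> {..<2 * k + 1}"
      then show "m \<in> (\<lambda>j. 2 * j) ` {..k} \<union> (\<lambda>i. 2 * i + 1) ` {..<k}"
        by (cases "even m") (auto elim!: evenE oddE)
    qed auto
    finally show ?thesis by (auto simp: image_Un image_image lam_def nu_def)
  qed
  have disj: "lam ` {..k} \<inter> nu ` {..<k} = {}"
    using lam_neq_nu by fastforce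
  note inj_l = inj_lam and inj_n = inj_nu
  have prod_l: "(\<Prod>y\<in>X - {lam j}. lam j - y) = dlam j * om_nu (lam j)" if j: "j \<le> k" for j
  proof -
    have "lam j \<notin> nu ` {..<k}" using disj j by auto
    moreover have "lam ` {..k} - {lam j} = lam ` ({..k} - {j})"
      using inj_on_image_set_diff[OF inj_l, of "{..k}" "{j}"] j by simp
    ultimately have "X - {lam j} = lam ` ({..k} - {j}) \<union> nu ` {..<k}" by (auto simp: X_eq)
    moreover have "lam ` ({..k} - {j}) \<inter> nu ` {..<k} = {}" using disj by auto
    ultimately have "(\<Prod>y\<in>X - {lam j}. lam j - y) = (\<Prod>y\<in>lam ` ({..k} - {j}). lam j - y) * (\<Prod>y\<in>nu ` {..<k}. lam j - y)"
      by (simp add: prod.union_disjoint)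
    also have "(\<Prod>y\<in>lam ` ({..k} - {j}). lam j - y) = dlam j"
      unfolding dlam_def by (subst prod.reindex) (auto intro: inj_on_subset[OF inj_l])
    also have "(\<Prod>y\<in>nu ` {..<k}. lam j - y) = om_nu (lam j)"
      unfolding om_nu_def by (subst prod.reindex[OF inj_n]) simp
    finally show ?thesis .
  qed
  have prod_n: "(\<Prod>y\<in>X - {nu i}. nu i - y) = dnu i * om_lam (nu i)" if i: "i < k" for i
  proof -
    have "nu i \<notin> lam ` {..k}" using disj i by auto
    moreover have "nu ` {..<k} - {nu i} = nu ` ({..<k} - {i})"
      using inj_on_image_set_diff[OF inj_n, of "{..<k}" "{i}"] i by simp
    ultimately have "X - {nu i} = nu ` ({..<k} - {i}) \<union> lam ` {..k}" by (auto simp: X_eq)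
    moreover have "nu ` ({..<k} - {i}) \<inter> lam ` {..k} = {}" using disj by auto
    ultimately have "(\<Prod>y\<in>X - {nu i}. nu i - y) = (\<Prod>y\<in>nu ` ({..<k} - {i}). nu i - y) * (\<Prod>y\<in>lam ` {..k}. nu i - y)"
      by (simp add: prod.union_disjoint)
    also have "(\<Prod>y\<in>nu ` ({..<k} - {i}). nu i - y) = dnu i"
      unfolding dnu_def by (subst prod.reindex) (auto intro: inj_on_subset[OF inj_n])
    also have "(\<Prod>y\<in>lam ` {..k}. nu i - y) = om_lam (nu i)"
      unfolding om_lam_def by (subst prod.reindex[OF inj_l]) simp
    finally show ?thesis .
  qed
  have "lam 0 \<in> X" by (auto simp: X_eq)
  then have "0 < lam 0" using X by auto
  from kraus_interlacing[OF f this q]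
  have "0 \<le> (\<Sum>j\<le>k. f (lam j) * (poly q (lam j))\<^sup>2 / (\<Prod>y\<in>X - {lam j}. lam j - y)) +
    (\<Sum>i<k. f (nu i) * (poly q (nu i))\<^sup>2 / (\<Prod>y\<in>X - {nu i}. nu i - y))"
    by (simp add: prod_l prod_n)
  also have "\<dots> = (\<Sum>x\<in>lam ` {..k}. f x * (poly q x)\<^sup>2 / (\<Prod>y\<in>X - {x}. x - y)) +
    (\<Sum>x\<in>nu ` {..<k}. f x * (poly q x)\<^sup>2 / (\<Prod>y\<in>X - {x}. x - y))"
    by (simp add: sum.reindex[OF inj_l] sum.reindex[OF inj_n])
  also have "\<dots> = (\<Sum>x\<in>X. f x * (poly q x)\<^sup>2 / (\<Prod>y\<in>X - {x}. x - y))"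
    by (subst (3) X_eq) (rule sum.union_disjoint[symmetric], use disj in auto)
  finally show ?thesis .
qed

text \<open>Adding a point near \<open>0\<close> and one near \<open>\<infinity>\<close>, with \<open>q\<close> vanishing at both, turns the weight \<open>r\<^sup>2\<close>
  into \<open>-t r\<^sup>2\<close> in the limit.\<close>

lemma kraus_inequality_shifted:
  fixes X :: "real set"
  assumes f: "operator_convex f" and X: "finite X" "card X = 2 * k + 1" "X \<subseteq> {0<..}" and r: "degree r + 1 < k"
  shows "(\<Sum>x\<in>X. f x * (x * (poly r x)\<^sup>2) / (\<Prod>y\<in>X - {x}. x - y)) \<le> 0"
proof -
  let ?P = "\<lambda>x. \<Prod>y\<in>X - {x}. x - y"
  have ne: "X \<noteq> {}" using X by auto
  have X0: "0 < x" if "x \<in> X" for x using X that by auto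
  have key: "0 \<le> (\<Sum>x\<in>X. f x * ((x - e) * (x / L - 1) * (poly r x)\<^sup>2) / ?P x)"
    if e: "0 < e" "\<And>x. x \<in> X \<Longrightarrow> e < x" and L: "\<And>x. x \<in> X \<Longrightarrow> x < L" for e L
  proof -
    have eL: "e < L" using ne e(2) L by force
    have L0: "0 < L" using e eL by linarith
    have enX: "e \<notin> X" "L \<notin> X" using e(2) L by auto
    \<comment> \<open>The square of q has double zeros at e and L against simple ones in the
      product, which leaves (x - e)(x - L); division by L > 0 keeps this bounded as L grows.\<close>
    define q where "q = [:- e, 1:] * [:- L, 1:] * r"
    define Z where "Z = insert e (insert L X)"
    have Z: "finite Z" "card Z = 2 * (k + 1) + 1" "Z \<subseteq> {0<..}"
      using X enX eL e L0 by (auto simp: Z_def)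
    have "degree q \<le> 2 + degree r"
    proof -
      have "degree q \<le> degree ([:- e, 1:] * [:- L, 1:]) + degree r" unfolding q_def by (rule degree_mult_le)
      also have "degree ([:- e, 1:] * [:- L, 1:]) \<le> degree [:- e, 1:] + degree [:- L, 1:]" by (rule degree_mult_le)
      finally show ?thesis by simp
    qed
    then have "degree q < k + 1" using r by linarith
    have q_poly: "poly q x = (x - e) * (x - L) * poly r x" for x
      by (simp add: q_def algebra_simps)
    from kraus_inequality[OF f Z \<open>degree q < k + 1\<close>]
    have "0 \<le> (\<Sum>x\<in>Z. f x * (poly q x)\<^sup>2 / (\<Prod>y\<in>Z - {x}. x - y))" .
    also have "\<dots> = (\<Sum>x\<in>X. f x * (poly q x)\<^sup>2 / (\<Prod>y\<in>Z - {x}. x - y))"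
      unfolding Z_def using X enX eL by (simp add: q_poly)
    also have "\<dots> = (\<Sum>x\<in>X. L * (f x * ((x - e) * (x / L - 1) * (poly r x)\<^sup>2) / ?P x))"
    proof (rule sum.cong[OF refl])
      fix x assume x: "x \<in> X"
      have "Z - {x} = insert e (insert L (X - {x}))" using x enX by (auto simp: Z_def)
      then have "(\<Prod>y\<in>Z - {x}. x - y) = (x - e) * ((x - L) * ?P x)" using X enX eL by simp
      moreover have "x - e \<noteq> 0" "x - L \<noteq> 0" using e(2)[OF x] L[OF x] by auto
      moreover note q_poly[of x]
      moreover have "x / L - 1 = (x - L) / L" using L0 by (simp add: field_simps)
      ultimately show "f x * (poly q x)\<^sup>2 / (\<Prod>y\<in>Z - {x}. x - y) = L * (f x * ((x - e) * (x / L - 1) * (poly r x)\<^sup>2) / ?P x)"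
        using L0 by (simp add: power2_eq_square)
    qed
    also have "\<dots> = L * (\<Sum>x\<in>X. f x * ((x - e) * (x / L - 1) * (poly r x)\<^sup>2) / ?P x)"
      by (rule sum_distrib_left[symmetric])
    finally show ?thesis
      using L0 by (simp add: zero_le_mult_iff)
  qed
  define m M where "m = Min X" and "M = Max X"
  have m: "0 < m" "\<And>x. x \<in> X \<Longrightarrow> m \<le> x" "\<And>x. x \<in> X \<Longrightarrow> x \<le> M"
    using X ne X0 by (auto simp: m_def M_def)
  have "(\<lambda>n. \<Sum>x\<in>X. f x * ((x - m / real (n + 2)) * (x / (M + 1 + real n) - 1) * (poly r x)\<^sup>2) / ?P x)
    \<longlonglongrightarrow> (\<Sum>x\<in>X. f x * ((x - 0) * (0 - 1) * (poly r x)\<^sup>2) / ?P x)"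
  proof (intro tendsto_sum tendsto_divide tendsto_mult tendsto_diff tendsto_const)
    show "(\<lambda>n. m / real (n + 2)) \<longlonglongrightarrow> 0" by real_asymp
    show "(\<lambda>n. x / (M + 1 + real n)) \<longlonglongrightarrow> 0" for x by real_asymp
    fix x assume "x \<in> X" then show "?P x \<noteq> 0" using X by (auto simp: prod_zero_iff)
  qed
  moreover have "0 \<le> (\<Sum>x\<in>X. f x * ((x - m / real (n + 2)) * (x / (M + 1 + real n) - 1) * (poly r x)\<^sup>2) / ?P x)" for n
  proof (rule key)
    show "0 < m / real (n + 2)" using m by simp
    have "0 < m + m * real n" using m(1) by (intro add_pos_nonneg) auto
    then have "m / real (n + 2) < m" by (simp add: field_simps)
    then show "m / real (n + 2) < x" if "x \<in> X" for x using m(2)[OF that] by linarith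
    show "x < M + 1 + real n" if "x \<in> X" for x using m(3)[OF that] by simp
  qed
  ultimately have "0 \<le> (\<Sum>x\<in>X. f x * ((x - 0) * (0 - 1) * (poly r x)\<^sup>2) / ?P x)"
    by (intro LIMSEQ_le_const) auto
  then show ?thesis by (simp add: sum_negf)
qed

section \<open>Polynomials that are nonnegative on the half line\<close>

text \<open>The bound d restricts every summand and not just the sum, because each of them is later
  inserted into a Kraus inequality with a degree restriction of its own.\<close>

inductive half_line_sos :: "nat \<Rightarrow> real poly \<Rightarrow> bool" where
  zero: "half_line_sos d 0"
| sq: "2 * degree q \<le> d \<Longrightarrow> half_line_sos d (q ^ 2)"
| Xsq: "2 * degree r + 1 \<le> d \<Longrightarrow> half_line_sos d ([:0, 1:] * r ^ 2)"
| add: "half_line_sos d p \<Longrightarrow> half_line_sos d q \<Longrightarrow> half_line_sos d (p + q)"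

lemma half_line_sos_mono: "half_line_sos d p \<Longrightarrow> d \<le> e \<Longrightarrow> half_line_sos e p"
  by (induction rule: half_line_sos.induct) (auto intro: half_line_sos.intros simp del: mult_pCons_left)

text \<open>Closure under products rests on x a^2 * x r^2 = (x a r)^2; the two odd degree bounds add
  up to an even one.\<close>

lemma half_line_sos_mult_aux:
  assumes "half_line_sos e q"
  shows "2 * degree a \<le> d \<Longrightarrow> half_line_sos (d + e) (a ^ 2 * q)"
    and "2 * degree a + 1 \<le> d \<Longrightarrow> half_line_sos (d + e) ([:0, 1:] * a ^ 2 * q)"
  using assms
proof (induction rule: half_line_sos.induct)
  case (zero e)
  { case 1 show ?case by (simp add: half_line_sos.zero) next case 2 show ?case by (simp add: half_line_sos.zero) }
next
  case (sq q e)
  have deg: "degree (a * q) \<le> degree a + degree q" by (rule degree_mult_le)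
  {
    case 1
    then have "half_line_sos (d + e) ((a * q) ^ 2)" using sq deg by (intro half_line_sos.sq) linarith
    then show ?case by (simp add: power_mult_distrib)
  next
    case 2
    then have "half_line_sos (d + e) ([:0, 1:] * (a * q) ^ 2)" using sq deg by (intro half_line_sos.Xsq) linarith
    then show ?case by (simp only: power_mult_distrib mult.assoc)
  }
next
  case (Xsq r e)
  have deg: "degree (a * r) \<le> degree a + degree r" by (rule degree_mult_le)
  {
    case 1
    then have "half_line_sos (d + e) ([:0, 1:] * (a * r) ^ 2)" using Xsq deg by (intro half_line_sos.Xsq) linarith
    then show ?case by (simp only: power_mult_distrib mult_ac)
  next
    case 2
    have "degree ([:0, 1:] * (a * r)) \<le> 1 + (degree a + degree r)"
      using degree_mult_le[of "[:0, 1::real:]" "a * r"] deg by simp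
    then have "half_line_sos (d + e) (([:0, 1:] * (a * r)) ^ 2)" using Xsq 2 by (intro half_line_sos.sq) linarith
    then show ?case by (simp only: power_mult_distrib power2_eq_square mult_ac)
  }
next
  case (add e p q)
  {
    case 1
    then show ?case using add by (simp add: distrib_left half_line_sos.add)
  next
    case 2
    then show ?case using add by (simp add: distrib_left half_line_sos.add del: mult_pCons_left)
  }
qed

lemma half_line_sos_mult: "half_line_sos d p \<Longrightarrow> half_line_sos e q \<Longrightarrow> half_line_sos (d + e) (p * q)"
  by (induction rule: half_line_sos.induct)
    (auto simp: distrib_right intro: half_line_sos.intros half_line_sos_mult_aux simp del: mult_pCons_left)

definition cev :: "real poly \<Rightarrow> complex \<Rightarrow> complex" where
  "cev p z = poly (map_poly complex_of_real p) z"

lemma cev_0 [simp]: "cev 0 z = 0" by (simp add: cev_def)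

lemma cev_pCons [simp]: "cev (pCons a p) z = complex_of_real a + z * cev p z"
  by (cases "a = 0 \<and> p = 0") (auto simp: cev_def map_poly_pCons)

lemma cev_add: "cev (p + q) z = cev p z + cev q z"
  by (induction p q rule: poly_induct2) (simp_all add: algebra_simps)

lemma cev_smult: "cev (Polynomial.smult c p) z = complex_of_real c * cev p z"
  by (induction p) (simp_all add: algebra_simps)

lemma cev_mult: "cev (p * q) z = cev p z * cev q z"
  by (induction p) (simp_all add: cev_add cev_smult algebra_simps)

lemma cev_of_real: "cev p (complex_of_real x) = complex_of_real (poly p x)"
  by (induction p) simp_all

lemma cev_root_exists:
  assumes "0 < degree p"
  shows "\<exists>z. cev p z = 0"
proof -
  have "degree (map_poly complex_of_real p) = degree p" by (rule degree_map_poly) simp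
  then have "\<not> constant (poly (map_poly complex_of_real p))" using assms by (simp add: constant_degree)
  then show ?thesis unfolding cev_def by (rule fundamental_theorem_of_algebra)
qed

lemma poly_nonneg_limit:
  fixes p :: "real poly"
  assumes "\<And>x. 0 < x \<Longrightarrow> x \<noteq> a \<Longrightarrow> 0 \<le> poly p x" "0 < a"
  shows "0 \<le> poly p a"
proof (rule tendsto_lowerbound)
  show "(poly p \<longlongrightarrow> poly p a) (at a)" by (intro tendsto_intros)
  have "\<forall>\<^sub>F x in at a. 0 < x" using eventually_at_top_dense order_tendstoD(1)[OF tendsto_ident_at \<open>0 < a\<close>] by blast
  then show "\<forall>\<^sub>F x in at a. 0 \<le> poly p x"
    using eventually_neq_at_within[of a a UNIV] by eventually_elim (use assms in auto)
qed simp

text \<open>Induction on the degree, splitting off the factor of a complex root z: X - a for a real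
  root a \<le> 0, the square of X - a for a > 0, and (X - Re z)^2 + (Im z)^2 otherwise. Each factor
  is in the cone, and the cofactor is again nonnegative on the half line.\<close>

theorem half_line_sos_nonneg:
  assumes "\<And>x. 0 < x \<Longrightarrow> 0 \<le> poly p x" and "degree p \<le> d"
  shows "half_line_sos d p"
proof -
  have "(\<forall>x>0. 0 \<le> poly p x) \<longrightarrow> half_line_sos (degree p) p"
  proof (induction "degree p" arbitrary: p rule: less_induct)
    case less
    show ?case
    proof (intro impI)
      assume nn: "\<forall>x>0. 0 \<le> poly p x"
      show "half_line_sos (degree p) p"
      proof (cases "degree p = 0")
        case True
        then obtain c where c: "p = [:c:]" by (rule degree_eq_zeroE)
        then have "0 \<le> c" using nn[rule_format, of 1] by simp
        then have "p = [:sqrt c:] ^ 2" by (simp add: c power2_eq_square)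
        then show ?thesis using half_line_sos.sq[of "[:sqrt c:]" 0] True by simp
      next
        case False
        have p0: "p \<noteq> 0" using False by auto
        have step: "half_line_sos (degree p) p"
          if pq: "p = g * h" and g: "half_line_sos (degree g) g" "0 < degree g"
            and h: "\<forall>x>0. 0 \<le> poly h x" for g h
        proof -
          have "degree p = degree g + degree h" using p0 unfolding pq by (intro degree_mult_eq) auto
          then show ?thesis
            using half_line_sos_mult[OF g(1), of "degree h" h] less[of h] g(2) h by (simp add: pq)
        qed
        obtain z where z: "cev p z = 0" using cev_root_exists False by auto
        show ?thesis
        proof (cases "Im z = 0")
          case True
          then have "z = complex_of_real (Re z)" by (simp add: complex_eq_iff)
          define a where "a = Re z"
          have "poly p a = 0" using z \<open>z = _\<close> by (metis a_def cev_of_real of_real_eq_0_iff)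
          then obtain h where h: "p = [:- a, 1:] * h" by (metis poly_eq_0_iff_dvd dvdE)
          have ph: "poly p x = (x - a) * poly h x" for x by (simp add: h algebra_simps)
          show ?thesis
          proof (cases "a \<le> 0")
            case True
            show ?thesis
            proof (rule step[OF h])
              have "half_line_sos 1 ([:0, 1:] * 1 ^ 2)" by (rule half_line_sos.Xsq) simp
              moreover have "half_line_sos 1 ([:sqrt (- a):] ^ 2)" by (rule half_line_sos.sq) simp
              ultimately have "half_line_sos 1 ([:0, 1:] * 1 ^ 2 + [:sqrt (- a):] ^ 2)" by (rule half_line_sos.add)
              then show "half_line_sos (degree [:- a, 1:]) [:- a, 1:]" using True by (simp add: power2_eq_square)
              show "\<forall>x>0. 0 \<le> poly h x"
              proof (intro allI impI)
                fix x :: real assume "0 < x"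
                then have "0 \<le> (x - a) * poly h x" "0 < x - a" using nn True by (auto simp: ph[symmetric])
                then show "0 \<le> poly h x" by (simp add: zero_le_mult_iff)
              qed
            qed simp
          next
            case False
            \<comment> \<open>At a simple positive root p would change its sign.\<close>
            have "poly h a = 0"
            proof (rule antisym)
              have "0 \<le> poly (- h) x" if "0 < x" "x < a" for x
              proof -
                have "0 \<le> (x - a) * poly h x" using nn that by (simp add: ph[symmetric])
                then show ?thesis using that by (simp add: zero_le_mult_iff)
              qed
              moreover have "(poly (- h) \<longlongrightarrow> poly (- h) a) (at_left a)" by (intro tendsto_intros)
              ultimately have "0 \<le> poly (- h) a"
                using False by (intro tendsto_lowerbound[of _ _ "at_left a"])
                  (auto intro!: eventually_at_leftI[of 0])
              then show "poly h a \<le> 0" by simp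
              have "0 \<le> poly h x" if "a < x" for x
              proof -
                have "0 \<le> (x - a) * poly h x" using nn that False by (simp add: ph[symmetric])
                then show ?thesis using that by (simp add: zero_le_mult_iff)
              qed
              moreover have "(poly h \<longlongrightarrow> poly h a) (at_right a)" by (intro tendsto_intros)
              ultimately show "0 \<le> poly h a"
                by (intro tendsto_lowerbound[of _ _ "at_right a"])
                  (auto intro!: eventually_at_rightI[of a "a + 1"])
            qed
            then obtain g where g: "h = [:- a, 1:] * g" by (metis poly_eq_0_iff_dvd dvdE)
            have pg: "poly p x = (x - a)\<^sup>2 * poly g x" for x by (simp add: ph g algebra_simps power2_eq_square)
            show ?thesis
            proof (rule step)
              show "p = [:- a, 1:] ^ 2 * g" by (simp only: h g power2_eq_square mult.assoc)
              have d2: "degree ([:- a, 1:] ^ 2) = 2" by (simp add: degree_power_eq)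
              then show "0 < degree ([:- a, 1:] ^ 2)" by simp
              show "half_line_sos (degree ([:- a, 1:] ^ 2)) ([:- a, 1:] ^ 2)"
                unfolding d2 by (rule half_line_sos.sq) simp
              have gx: "0 \<le> poly g x" if "0 < x" "x \<noteq> a" for x
              proof -
                have "0 \<le> (x - a)\<^sup>2 * poly g x" using nn that by (simp add: pg[symmetric])
                then show ?thesis using that by (simp add: zero_le_mult_iff)
              qed
              then show "\<forall>x>0. 0 \<le> poly g x"
                using poly_nonneg_limit[of a g] False by (metis not_le)
            qed
          qed
        next
          case False
          define Q where "Q = [:(Re z)\<^sup>2 + (Im z)\<^sup>2, - 2 * Re z, 1:]"
          have dQ: "degree Q = 2" by (simp add: Q_def)
          have "cev Q z = 0"
            by (simp add: Q_def complex_eq_iff power2_eq_square algebra_simps)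
          define R where "R = p mod Q"
          have "p = Q * (p div Q) + R" by (simp add: R_def)
          then have "cev R z = 0" using z \<open>cev Q z = 0\<close> cev_add[of "Q * (p div Q)" R z] cev_mult[of Q "p div Q" z] by simp
          moreover have "degree R < 2"
          proof (cases "R = 0")
            case False
            moreover have "Q \<noteq> 0" using dQ by auto
            ultimately show ?thesis using degree_mod_less[of Q p] dQ by (auto simp: R_def)
          qed simp
          then obtain b c where R: "R = [:b, c:]"
          proof -
            have "R = [:coeff R 0, coeff R 1:]"
              using \<open>degree R < 2\<close> by (intro poly_eqI) (auto simp: coeff_pCons coeff_eq_0 split: nat.splits)
            then show ?thesis by (rule that)
          qed
          \<comment> \<open>The remainder is a real polynomial of degree at most 1 with a nonreal
            root, so it is 0.\<close>
          ultimately have "Im (z * complex_of_real c) = 0" "Re (complex_of_real b + z * complex_of_real c) = 0"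
            by (auto simp: complex_eq_iff)
          then have "c = 0" "b = 0" using False by auto
          then have pQ: "p = Q * (p div Q)" using R \<open>p = Q * (p div Q) + R\<close> by simp
          have Qx: "poly Q x = (x - Re z)\<^sup>2 + (Im z)\<^sup>2" for x
            by (simp add: Q_def power2_eq_square algebra_simps)
          show ?thesis
          proof (rule step[OF pQ])
            have "half_line_sos 2 ([:- Re z, 1:] ^ 2 + [:Im z:] ^ 2)"
              by (intro half_line_sos.add half_line_sos.sq) auto
            also have "[:- Re z, 1:] ^ 2 + [:Im z:] ^ 2 = Q"
              by (simp add: Q_def power2_eq_square algebra_simps)
            finally show "half_line_sos (degree Q) Q" by (simp add: dQ)
            show "0 < degree Q" by (simp add: dQ)
            show "\<forall>x>0. 0 \<le> poly (p div Q) x"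
            proof (intro allI impI)
              fix x :: real assume x: "0 < x"
              have "0 < poly Q x" unfolding Qx using False by (intro add_nonneg_pos) auto
              moreover have "poly p x = poly Q x * poly (p div Q) x" by (subst pQ) (simp only: poly_mult)
              ultimately show "0 \<le> poly (p div Q) x" using nn x by (metis mult_pos_neg not_le)
            qed
          qed
        qed
      qed
    qed
  qed
  with assms show ?thesis using half_line_sos_mono by blast
qed

text \<open>\<open>P\<close> interpolates \<open>a\<^sub>x \<Prod>(x - y)\<close>; the two moment conditions on \<open>a\<close> cancel its two leading
  coefficients, and \<open>s \<mapsto> P(-s)\<close> is \<open>\<Sum> a\<^sub>x / (x + s)\<close> up to a positive factor.\<close>

lemma operator_convex_dual_odd:
  fixes X :: "real set"
  assumes f: "operator_convex f" and X: "finite X" "card X = 2 * k + 1" "X \<subseteq> {0<..}"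
    and a: "(\<Sum>x\<in>X. a x) = 0" "(\<Sum>x\<in>X. a x * x) = 0" "\<And>s. 0 < s \<Longrightarrow> 0 \<le> (\<Sum>x\<in>X. a x / (x + s))"
  shows "0 \<le> (\<Sum>x\<in>X. a x * f x)"
proof (cases "k = 0")
  case True
  then obtain x where "X = {x}" using X by (auto simp: card_1_singleton_iff)
  then show ?thesis using a by simp
next
  case k: False
  let ?D = "\<lambda>x. \<Prod>y\<in>X - {x}. x - y"
  define P where "P = (\<Sum>x\<in>X. Polynomial.smult (a x) (\<Prod>y\<in>X - {x}. [:- y, 1:]))"
  have D_nz: "?D x \<noteq> 0" if "x \<in> X" for x using X by (auto simp: prod_zero_iff)
  have poly_P: "poly P z = (\<Sum>x\<in>X. a x * (\<Prod>y\<in>X - {x}. z - y))" for z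
    by (simp add: P_def poly_sum poly_prod)
  have P_at: "poly P x = a x * ?D x" if x: "x \<in> X" for x
  proof -
    have "(\<Prod>y\<in>X - {i}. x - y) = 0" if "i \<in> X - {x}" for i
      using X x that by (intro prod_zero) auto
    then have "(\<Sum>i\<in>X - {x}. a i * (\<Prod>y\<in>X - {i}. x - y)) = 0" by (intro sum.neutral) simp
    then show ?thesis
      unfolding poly_P sum.remove[OF X(1) x] by simp
  qed
  have "degree P \<le> 2 * k"
    unfolding P_def
  proof (rule degree_sum_le)
    fix x assume "x \<in> X"
    then have "degree (\<Prod>y\<in>X - {x}. [:- y, 1:]) = 2 * k"
      using X monic_prod_linear(1)[of "X - {x}" "\<lambda>x. x"] by simp
    then show "degree (Polynomial.smult (a x) (\<Prod>y\<in>X - {x}. [:- y, 1:])) \<le> 2 * k"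
      by (metis degree_smult_le)
  qed (rule X)
  moreover have "coeff P (2 * k) = 0"
  proof -
    have "coeff P (2 * k) = (\<Sum>x\<in>X. poly P x / ?D x)"
      using divided_difference_poly[of X "\<lambda>x. x" P] X \<open>degree P \<le> 2 * k\<close> by simp
    also have "\<dots> = (\<Sum>x\<in>X. a x)" using P_at D_nz by (intro sum.cong) auto
    finally show ?thesis using a by simp
  qed
  ultimately have deg1: "degree P \<le> 2 * k - 1"
    using k eq_zero_or_degree_less[of P "2 * k"] by fastforce
  have "coeff P (2 * k - 1) = 0"
  proof -
    \<comment> \<open>\<open>pCons 0 P\<close> is t P(t), with values a_x x times the product at the
      nodes; its divided difference reads off the next coefficient of P.\<close>
    have deg: "degree (pCons 0 P) < card X" using deg1 k X by (cases "P = 0") auto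
    have "coeff P (2 * k - 1) = coeff (pCons 0 P) (card X - 1)" using k X by (simp add: coeff_pCons split: nat.split)
    also have "\<dots> = (\<Sum>x\<in>X. poly (pCons 0 P) x / ?D x)"
      using divided_difference_poly[of X "\<lambda>x. x" "pCons 0 P"] X deg by simp
    also have "\<dots> = (\<Sum>x\<in>X. a x * x)" using P_at D_nz by (intro sum.cong) auto
    finally show ?thesis using a by simp
  qed
  then have deg2: "degree P \<le> 2 * k - 2"
    using deg1 k eq_zero_or_degree_less[of P "2 * k - 1"] by fastforce
  define p where "p = pcompose P [:0, -1:]"
  have poly_p: "poly p s = poly P (- s)" for s by (simp add: p_def poly_pcompose)
  have "half_line_sos (2 * k - 2) p"
  proof (rule half_line_sos_nonneg)
    show "degree p \<le> 2 * k - 2" using deg2 by (simp add: p_def)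
    fix s :: real assume s: "0 < s"
    have nz: "x + s \<noteq> 0" if "x \<in> X" for x using X s that by force
    have "poly p s = (\<Sum>x\<in>X. (\<Prod>y\<in>X. y + s) * (a x / (x + s)))"
      unfolding poly_p poly_P
    proof (rule sum.cong[OF refl])
      fix x assume x: "x \<in> X"
      have "(\<Prod>y\<in>X - {x}. - s - y) = (\<Prod>y\<in>X - {x}. (-1) * (y + s))" by (rule prod.cong) auto
      also have "\<dots> = (\<Prod>y\<in>X - {x}. y + s)"
        unfolding prod.distrib prod_constant using X x by simp
      finally show "a x * (\<Prod>y\<in>X - {x}. - s - y) = (\<Prod>y\<in>X. y + s) * (a x / (x + s))"
        using nz[OF x] by (simp add: prod.remove[OF X(1) x])
    qed
    also have "\<dots> = (\<Prod>y\<in>X. y + s) * (\<Sum>x\<in>X. a x / (x + s))" by (rule sum_distrib_left[symmetric])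
    also have "0 \<le> \<dots>" using X s a(3)[OF s] by (intro mult_nonneg_nonneg prod_nonneg) (auto intro: add_nonneg_nonneg less_imp_le)
    finally show "0 \<le> poly p s" .
  qed
  moreover have "0 \<le> (\<Sum>x\<in>X. f x * poly q (- x) / ?D x)" if "half_line_sos d q" "d \<le> 2 * k - 2" for d q
    using that
  proof (induction rule: half_line_sos.induct)
    case (sq q d)
    have "degree (pcompose q [:0, -1:]) < k" using sq k by simp
    from kraus_inequality[OF f X this] show ?case by (simp add: poly_pcompose)
  next
    case (Xsq r d)
    have "degree (pcompose r [:0, -1:]) + 1 < k" using Xsq k by simp
    from kraus_inequality_shifted[OF f X this] show ?case by (simp add: poly_pcompose sum_negf)
  next
    case (add d p q)
    then show ?case by (simp add: distrib_left add_divide_distrib sum.distrib)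
  qed simp
  ultimately have "0 \<le> (\<Sum>x\<in>X. f x * poly p (- x) / ?D x)" by blast
  also have "\<dots> = (\<Sum>x\<in>X. a x * f x)"
    using P_at D_nz by (intro sum.cong) (auto simp: poly_p)
  finally show ?thesis .
qed

theorem operator_convex_dual:
  fixes X :: "real set"
  assumes f: "operator_convex f" and X: "finite X" "X \<subseteq> {0<..}"
    and a: "(\<Sum>x\<in>X. a x) = 0" "(\<Sum>x\<in>X. a x * x) = 0" "\<And>s. 0 < s \<Longrightarrow> 0 \<le> (\<Sum>x\<in>X. a x / (x + s))"
  shows "0 \<le> (\<Sum>x\<in>X. a x * f x)"
proof (cases "even (card X)")
  case False
  then show ?thesis using operator_convex_dual_odd[OF f X(1) _ X(2) a] by (auto elim!: oddE)
next
  case True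
  \<comment> \<open>Exceeding every element of X, this is a new node; with weight 0 it makes the
    number of nodes odd and changes no sum.\<close>
  define y where "y = 1 + (\<Sum>x\<in>X. x)"
  have y: "y \<notin> X" "0 < y"
  proof -
    have nn: "0 \<le> x" if "x \<in> X" for x using X that by force
    then show "0 < y" unfolding y_def by (intro add_pos_nonneg sum_nonneg) auto
    have "x < y" if "x \<in> X" for x
      using member_le_sum[of x X "\<lambda>x. x"] X that nn by (auto simp: y_def intro: le_less_trans)
    then show "y \<notin> X" by blast
  qed
  obtain k where "card X = 2 * k" using True by (elim evenE)
  then have card: "card (insert y X) = 2 * k + 1" using X y by simp
  let ?a = "a(y := 0)"
  have eq: "(\<Sum>x\<in>insert y X. ?a x * h x) = (\<Sum>x\<in>X. a x * h x)" for h
    using X y by (subst sum.insert) (auto intro!: sum.cong)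
  have "0 \<le> (\<Sum>x\<in>insert y X. ?a x * f x)"
  proof (rule operator_convex_dual_odd[OF f _ card])
    show "(\<Sum>x\<in>insert y X. ?a x) = 0" using eq[of "\<lambda>_. 1"] a by simp
    show "(\<Sum>x\<in>insert y X. ?a x * x) = 0" using eq[of "\<lambda>x. x"] a by simp
    show "0 \<le> (\<Sum>x\<in>insert y X. ?a x / (x + s))" if "0 < s" for s
      using eq[of "\<lambda>x. 1 / (x + s)"] a(3)[OF that] by simp
  qed (use X y in auto)
  then show ?thesis unfolding eq .
qed

section \<open>Approximation by generators\<close>

lemma nonneg_if_small_quadratic:
  fixes S G :: real
  assumes "\<And>t. 0 < t \<Longrightarrow> t < 1 \<Longrightarrow> 0 \<le> 2 * t * S + t\<^sup>2 * G"
  shows "0 \<le> S"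
proof -
  have "0 \<le> 2 * S + inverse (real (n + 2)) * G" for n
  proof -
    define t where "t = inverse (real (n + 2))"
    have t: "0 < t" "t < 1" by (auto simp: t_def field_simps)
    then have "0 \<le> t * (2 * S + t * G)" using assms[OF t] by (simp add: power2_eq_square algebra_simps)
    then show ?thesis using t by (simp only: zero_le_mult_iff t_def[symmetric]) auto
  qed
  moreover have "(\<lambda>n. 2 * S + inverse (real (n + 2)) * G) \<longlonglongrightarrow> 2 * S + 0 * G"
    by (intro tendsto_intros) real_asymp
  ultimately have "0 \<le> 2 * S + 0 * G" by (intro LIMSEQ_le_const) auto
  then show ?thesis by simp
qed

text \<open>The limit \<open>l\<close> of a minimising sequence for the distance to \<open>f\<close> satisfies
  \<open>\<langle>l - f, c\<rangle> \<ge> 0\<close> on the cone and \<open>\<langle>l - f, l\<rangle> = 0\<close>.\<close>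

lemma finite_bipolar:
  fixes f :: "'b \<Rightarrow> real"
  assumes X: "finite X" and ne: "c0 \<in> K"
    and add: "\<And>c d. c \<in> K \<Longrightarrow> d \<in> K \<Longrightarrow> (\<lambda>x. c x + d x) \<in> K"
    and scale: "\<And>c t. c \<in> K \<Longrightarrow> 0 \<le> t \<Longrightarrow> (\<lambda>x. t * c x) \<in> K"
    and dual: "\<And>a. (\<And>c. c \<in> K \<Longrightarrow> 0 \<le> (\<Sum>x\<in>X. a x * c x)) \<Longrightarrow> 0 \<le> (\<Sum>x\<in>X. a x * f x)"
    and e: "0 < e"
  shows "\<exists>c\<in>K. \<forall>x\<in>X. \<bar>f x - c x\<bar> < e"
proof -
  define N where "N c = (\<Sum>x\<in>X. (c x - f x)\<^sup>2)" for c
  define d where "d = Inf (N ` K)"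
  have N0: "0 \<le> N c" for c unfolding N_def by (intro sum_nonneg) simp
  have d_le: "d \<le> N c" if "c \<in> K" for c
    unfolding d_def by (rule cInf_lower) (use that N0 in \<open>auto intro!: bdd_belowI[of _ 0]\<close>)
  have "\<exists>c\<in>K. N c < d + inverse (real (Suc n))" for n
  proof -
    have "Inf (N ` K) < d + inverse (real (Suc n))" by (simp add: d_def)
    then show ?thesis
      by (subst (asm) cInf_less_iff) (use ne N0 in \<open>auto intro!: bdd_belowI[of _ 0]\<close>)
  qed
  then obtain c where c: "\<And>n. c n \<in> K" "\<And>n. N (c n) < d + inverse (real (Suc n))" by metis
  have close: "(c n x - c m x)\<^sup>2 \<le> 2 * inverse (real (Suc n)) + 2 * inverse (real (Suc m))" if x: "x \<in> X" for n m x
  proof -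
    \<comment> \<open>The midpoint of two members stays in K, so the parallelogram law makes the
      minimising sequence Cauchy on X.\<close>
    have mid: "(\<lambda>x. 1 / 2 * (c n x + c m x)) \<in> K" by (intro scale add c) simp
    have "(c n x - c m x)\<^sup>2 \<le> (\<Sum>x\<in>X. (c n x - c m x)\<^sup>2)" using X x by (intro member_le_sum) auto
    also have "\<dots> = 2 * N (c n) + 2 * N (c m) - 4 * N (\<lambda>x. 1 / 2 * (c n x + c m x))"
      unfolding N_def sum_distrib_left sum.distrib[symmetric] sum_subtractf[symmetric]
      by (rule sum.cong[OF refl]) (simp add: power2_eq_square algebra_simps)
    also have "\<dots> \<le> 2 * inverse (real (Suc n)) + 2 * inverse (real (Suc m))"
      using c(2)[of n] c(2)[of m] d_le[OF mid] by linarith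
    finally show ?thesis .
  qed
  have "Cauchy (\<lambda>n. c n x)" if x: "x \<in> X" for x
  proof (rule CauchyI)
    fix e :: real assume e: "0 < e"
    obtain M where M: "4 * inverse (real (Suc M)) < e\<^sup>2"
      using reals_Archimedean[of "e\<^sup>2 / 4"] e by (auto simp: mult.commute simp del: of_nat_Suc)
    have "norm (c m x - c n x) < e" if "m \<ge> M" "n \<ge> M" for m n
    proof -
      have "inverse (real (Suc m)) \<le> inverse (real (Suc M))" "inverse (real (Suc n)) \<le> inverse (real (Suc M))"
        using that by (auto intro: le_imp_inverse_le)
      then have "(c m x - c n x)\<^sup>2 < e\<^sup>2" using close[OF x, of m n] M by linarith
      then have "\<bar>c m x - c n x\<bar>\<^sup>2 < e\<^sup>2" by simp
      from power_less_imp_less_base[OF this] show ?thesis using e by simp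
    qed
    then show "\<exists>M. \<forall>m\<ge>M. \<forall>n\<ge>M. norm (c m x - c n x) < e" by blast
  qed
  then have l: "(\<lambda>n. c n x) \<longlonglongrightarrow> lim (\<lambda>n. c n x)" if "x \<in> X" for x
    using that by (simp add: Cauchy_convergent_iff convergent_LIMSEQ_iff)
  define l where "l x = lim (\<lambda>n. c n x)" for x
  note l = l[folded l_def]
  define a where "a x = l x - f x" for x
  have lim: "(\<lambda>n. N (\<lambda>x. u * c n x + t * g x)) \<longlonglongrightarrow> (\<Sum>x\<in>X. (u * l x + t * g x - f x)\<^sup>2)" for u t g
    unfolding N_def by (intro tendsto_intros l)
  have "(\<lambda>n. N (c n)) \<longlonglongrightarrow> d"
  proof (rule tendsto_sandwich)
    show "\<forall>\<^sub>F n in sequentially. d \<le> N (c n)" by (intro always_eventually allI d_le c)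
    show "\<forall>\<^sub>F n in sequentially. N (c n) \<le> d + inverse (real (Suc n))" by (intro always_eventually allI less_imp_le c)
    show "(\<lambda>n. d + inverse (real (Suc n))) \<longlonglongrightarrow> d" using tendsto_add[OF tendsto_const[of d] LIMSEQ_inverse_real_of_nat] by simp
  qed simp
  moreover have "(\<lambda>n. N (c n)) \<longlonglongrightarrow> (\<Sum>x\<in>X. (a x)\<^sup>2)" using lim[of 1 0] by (simp add: a_def)
  ultimately have d: "d = (\<Sum>x\<in>X. (a x)\<^sup>2)" by (rule LIMSEQ_unique)
  have "0 \<le> (\<Sum>x\<in>X. a x * g x)" if g: "g \<in> K" for g
  proof (rule nonneg_if_small_quadratic)
    fix t :: real assume t: "0 < t"
    have "d \<le> N (\<lambda>x. 1 * c n x + t * g x)" for n by (rule d_le) (use add scale c g t in simp)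
    with lim[of 1 t g] have "d \<le> (\<Sum>x\<in>X. (1 * l x + t * g x - f x)\<^sup>2)" by (intro LIMSEQ_le_const) auto
    also have "\<dots> = d + (2 * t * (\<Sum>x\<in>X. a x * g x) + t\<^sup>2 * (\<Sum>x\<in>X. (g x)\<^sup>2))"
      unfolding d sum_distrib_left sum.distrib[symmetric]
      by (rule sum.cong[OF refl]) (simp add: a_def power2_eq_square algebra_simps)
    finally show "0 \<le> 2 * t * (\<Sum>x\<in>X. a x * g x) + t\<^sup>2 * (\<Sum>x\<in>X. (g x)\<^sup>2)" by simp
  qed
  then have "0 \<le> (\<Sum>x\<in>X. a x * f x)" by (rule dual)
  \<comment> \<open>Replacing l by (1 - t) l stays within the closed cone, and minimality gives the
    inequality opposite to the one for the direction +l.\<close>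
  moreover have "0 \<le> - (\<Sum>x\<in>X. a x * l x)"
  proof (rule nonneg_if_small_quadratic)
    fix t :: real assume t: "0 < t" "t < 1"
    have "d \<le> N (\<lambda>x. (1 - t) * c n x + 0 * c n x)" for n by (rule d_le) (use scale c t in simp)
    with lim[of "1 - t" 0] have "d \<le> (\<Sum>x\<in>X. ((1 - t) * l x - f x)\<^sup>2)" by (intro LIMSEQ_le_const) auto
    also have "\<dots> = d + (2 * t * - (\<Sum>x\<in>X. a x * l x) + t\<^sup>2 * (\<Sum>x\<in>X. (l x)\<^sup>2))"
      unfolding d sum_distrib_left sum_negf[symmetric] sum.distrib[symmetric]
      by (rule sum.cong[OF refl]) (simp add: a_def power2_eq_square algebra_simps)
    finally show "0 \<le> 2 * t * - (\<Sum>x\<in>X. a x * l x) + t\<^sup>2 * (\<Sum>x\<in>X. (l x)\<^sup>2)" by simp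
  qed
  \<comment> \<open>The squared distance is <a, l> - <a, f>, where the first term is at most 0 and
    the second at least 0 by duality; so the distance is 0.\<close>
  moreover have "d = (\<Sum>x\<in>X. a x * l x) - (\<Sum>x\<in>X. a x * f x)"
    unfolding d sum_subtractf[symmetric] by (rule sum.cong[OF refl]) (simp add: a_def power2_eq_square algebra_simps)
  ultimately have d0: "d \<le> 0" by linarith
  obtain n where "inverse (real (Suc n)) < e\<^sup>2" using reals_Archimedean[of "e\<^sup>2"] e by auto
  then have n: "N (c n) < e\<^sup>2" using c(2)[of n] d0 by linarith
  have "\<bar>f x - c n x\<bar> < e" if x: "x \<in> X" for x
  proof -
    have "(f x - c n x)\<^sup>2 \<le> N (c n)" unfolding N_def using X x member_le_sum[of x X "\<lambda>x. (c n x - f x)\<^sup>2"] by (simp add: power2_commute)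
    then have "(f x - c n x)\<^sup>2 < e\<^sup>2" using n by linarith
    then have "\<bar>f x - c n x\<bar>\<^sup>2 < e\<^sup>2" by simp
    from power_less_imp_less_base[OF this] show ?thesis using e by simp
  qed
  then show ?thesis using c(1) by blast
qed

section \<open>From finite sets to compact intervals\<close>

inductive convex_cone_gen :: "(real \<Rightarrow> real) \<Rightarrow> bool" where
  affine: "convex_cone_gen (\<lambda>x. a + b * x)"
| kern: "0 < s \<Longrightarrow> convex_cone_gen (\<lambda>x. (x - 1)\<^sup>2 / (x + s))"
| add: "convex_cone_gen c \<Longrightarrow> convex_cone_gen d \<Longrightarrow> convex_cone_gen (\<lambda>x. c x + d x)"
| scale: "convex_cone_gen c \<Longrightarrow> 0 \<le> t \<Longrightarrow> convex_cone_gen (\<lambda>x. t * c x)"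

text \<open>The polynomial part is affine, so a functional that kills affine functions sees only a
  multiple of 1 / (x + s).\<close>

lemma generator_expand:
  fixes x s :: real
  assumes "x + s \<noteq> 0"
  shows "(x - 1)\<^sup>2 / (x + s) = (x - s - 2) + (1 + s)\<^sup>2 / (x + s)"
  using assms by (simp add: divide_simps) (simp add: power2_eq_square algebra_simps)

text \<open>A functional in the dual cone is nonnegative on affine functions of both signs, hence
  kills 1 and x. Its value at a kernel is then (1 + s)^2 times the sum of a_x / (x + s), which is
  the remaining condition of \<open>operator_convex_dual\<close>.\<close>

lemma operator_convex_finite_approx:
  assumes f: "operator_convex f" and X: "finite X" "X \<subseteq> {0<..}" and e: "0 < e"
  shows "\<exists>c. convex_cone_gen c \<and> (\<forall>x\<in>X. \<bar>f x - c x\<bar> < e)"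
proof -
  have "\<exists>c\<in>Collect convex_cone_gen. \<forall>x\<in>X. \<bar>f x - c x\<bar> < e"
  proof (rule finite_bipolar[OF X(1) _ _ _ _ e])
    show "(\<lambda>x. 0 + 0 * x) \<in> Collect convex_cone_gen" unfolding mem_Collect_eq by (rule convex_cone_gen.affine)
    fix a assume a: "\<And>c. c \<in> Collect convex_cone_gen \<Longrightarrow> 0 \<le> (\<Sum>x\<in>X. a x * c x)"
    have 0: "(\<Sum>x\<in>X. a x) = 0"
      using a[of "\<lambda>x. 1 + 0 * x"] a[of "\<lambda>x. - 1 + 0 * x"] convex_cone_gen.affine[of 1 0] convex_cone_gen.affine[of "-1" 0]
      by (simp add: sum_negf)
    have 1: "(\<Sum>x\<in>X. a x * x) = 0"
      using a[of "\<lambda>x. 0 + 1 * x"] a[of "\<lambda>x. 0 + - 1 * x"] convex_cone_gen.affine[of 0 1] convex_cone_gen.affine[of 0 "-1"]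
      by (simp add: sum_negf)
    show "0 \<le> (\<Sum>x\<in>X. a x * f x)"
    proof (rule operator_convex_dual[OF f X 0 1])
      fix s :: real assume s: "0 < s"
      have nz: "x + s \<noteq> 0" if "x \<in> X" for x using that X s by force
      have "0 \<le> (\<Sum>x\<in>X. a x * ((x - 1)\<^sup>2 / (x + s)))"
        using a[of "\<lambda>x. (x - 1)\<^sup>2 / (x + s)"] convex_cone_gen.kern[OF s] by simp
      also have "\<dots> = (\<Sum>x\<in>X. a x * x - (s + 2) * a x + (1 + s)\<^sup>2 * (a x / (x + s)))"
        by (rule sum.cong[OF refl]) (simp only: generator_expand[OF nz], simp add: algebra_simps)
      also have "\<dots> = (1 + s)\<^sup>2 * (\<Sum>x\<in>X. a x / (x + s))"
        unfolding sum.distrib sum_subtractf sum_distrib_left[symmetric] 0 1 by simp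
      finally show "0 \<le> (\<Sum>x\<in>X. a x / (x + s))" using s by (simp add: zero_le_mult_iff)
    qed
  next
    show "(\<lambda>x. c x + d x) \<in> Collect convex_cone_gen" if "c \<in> Collect convex_cone_gen" "d \<in> Collect convex_cone_gen" for c d
      using that unfolding mem_Collect_eq by (rule convex_cone_gen.add)
    show "(\<lambda>x. t * c x) \<in> Collect convex_cone_gen" if "c \<in> Collect convex_cone_gen" "0 \<le> t" for c t
      using that unfolding mem_Collect_eq by (rule convex_cone_gen.scale)
  qed
  then show ?thesis unfolding Bex_def mem_Collect_eq .
qed

text \<open>Convexity cleared of denominators, so that coinciding points are included.\<close>

lemma convex_on_three_points:
  fixes g :: "real \<Rightarrow> real"
  assumes g: "convex_on {0<..} g" and xyz: "0 < x" "x \<le> y" "y \<le> z"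
  shows "(z - x) * g y \<le> (z - y) * g x + (y - x) * g z"
proof (cases "x = z")
  case False
  define t where "t = (y - x) / (z - x)"
  have d: "0 < z - x" using False xyz by simp
  have t: "0 \<le> t" "t \<le> 1" using d xyz by (auto simp: t_def divide_simps)
  have "t * (z - x) = y - x" using d by (simp add: t_def)
  then have y: "(1 - t) *\<^sub>R x + t *\<^sub>R z = y" by (simp add: algebra_simps)
  have "g y \<le> (1 - t) * g x + t * g z"
    using convex_onD[OF g t, of x z] y xyz by simp
  then have "(z - x) * g y \<le> (z - x) * ((1 - t) * g x + t * g z)" using d by (intro mult_left_mono) auto
  also have "\<dots> = (z - x) * (1 - t) * g x + (z - x) * t * g z" by (simp add: algebra_simps)
  also have "(z - x) * t = y - x" using d by (simp add: t_def)
  also have "(z - x) * (1 - t) = z - y" using d by (simp add: t_def field_simps)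
  finally show ?thesis .
qed (use xyz in simp)

text \<open>Kraus's inequality for k = 1 and q = 1: the second divided difference on three points is
  nonnegative.\<close>

lemma operator_convex_convex_on:
  assumes f: "operator_convex f"
  shows "convex_on {0<..} f"
proof (rule convex_on_linorderI)
  fix t x y :: real assume t: "0 < t" "t < 1" and xy: "x \<in> {0<..}" "y \<in> {0<..}" "x < y"
  define d where "d = y - x"
  define m where "m = x + t * d"
  have d: "0 < d" using xy by (simp add: d_def)
  have mx: "m - x = t * d" "x - m = - (t * d)" "y - m = (1 - t) * d" "m - y = - ((1 - t) * d)" "y - x = d" "x - y = - d"
    by (simp_all add: m_def d_def algebra_simps)
  have "0 < m - x" "0 < y - m" unfolding mx using t d by simp_all
  then have lt: "x < m" "m < y" by simp_all
  have "0 \<le> (\<Sum>z\<in>{x, m, y}. f z * (poly 1 z)\<^sup>2 / (\<Prod>w\<in>{x, m, y} - {z}. z - w))"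
    by (rule kraus_inequality[OF f, where k=1]) (use xy lt in auto)
  also have "\<dots> = f x / ((x - m) * (x - y)) + (f m / ((m - x) * (m - y)) + f y / ((y - x) * (y - m)))"
  proof -
    have "{x, m, y} - {x} = {m, y}" "{x, m, y} - {m} = {x, y}" "{x, m, y} - {y} = {x, m}" using lt by auto
    then show ?thesis using lt by simp
  qed
  also have "\<dots> = ((1 - t) * f x + t * f y - f m) / (t * (1 - t) * d\<^sup>2)"
    unfolding mx using t d by (simp add: divide_simps power2_eq_square)
  finally have "0 \<le> ((1 - t) * f x + t * f y - f m) / (t * (1 - t) * d\<^sup>2)" .
  moreover have "0 < t * (1 - t) * d\<^sup>2" using t d by simp
  ultimately have "0 \<le> (1 - t) * f x + t * f y - f m" by (simp only: zero_le_divide_iff) linarith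
  moreover have "(1 - t) *\<^sub>R x + t *\<^sub>R y = m" by (simp add: m_def d_def algebra_simps)
  ultimately show "f ((1 - t) *\<^sub>R x + t *\<^sub>R y) \<le> (1 - t) * f x + t * f y" by simp
qed (rule convex_real_interval)

lemma convex_cone_gen_convex_on:
  assumes "convex_cone_gen c"
  shows "convex_on {0<..} c"
  using assms
proof (induction rule: convex_cone_gen.induct)
  case (affine a b)
  show ?case by (rule convex_onI) (auto simp: algebra_simps convex_real_interval)
next
  case (kern s)
  show ?case
  proof (rule convex_onI)
    fix t x y :: real assume t: "0 < t" "t < 1" and xy: "x \<in> {0<..}" "y \<in> {0<..}"
    define m where "m = (1 - t) * x + t * y"
    \<comment> \<open>Completing the square exhibits the kernel as a supremum of affine functions of
      z; this \<eta> gives the one that touches at m.\<close>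
    define \<eta> where "\<eta> = (m - 1) / (m + s)"
    have m: "0 < m" unfolding m_def using t xy by (intro add_pos_pos mult_pos_pos) auto
    have le: "2 * (z - 1) * \<eta> - (z + s) * \<eta>\<^sup>2 \<le> (z - 1)\<^sup>2 / (z + s)" if "0 < z" for z
    proof -
      have "0 \<le> ((z - 1) - (z + s) * \<eta>)\<^sup>2" by simp
      then have "(2 * (z - 1) * \<eta> - (z + s) * \<eta>\<^sup>2) * (z + s) \<le> (z - 1)\<^sup>2"
        by (simp add: power2_eq_square algebra_simps)
      then show ?thesis using that kern by (simp add: pos_le_divide_eq)
    qed
    have "(m - 1)\<^sup>2 / (m + s) = 2 * (m - 1) * \<eta> - (m + s) * \<eta>\<^sup>2"
      using m kern by (simp add: \<eta>_def power2_eq_square divide_simps)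
    also have "\<dots> = (1 - t) * (2 * (x - 1) * \<eta> - (x + s) * \<eta>\<^sup>2) + t * (2 * (y - 1) * \<eta> - (y + s) * \<eta>\<^sup>2)"
      by (simp add: m_def algebra_simps)
    also have "\<dots> \<le> (1 - t) * ((x - 1)\<^sup>2 / (x + s)) + t * ((y - 1)\<^sup>2 / (y + s))"
      using t xy le by (intro add_mono mult_left_mono) auto
    finally show "((1 - t) *\<^sub>R x + t *\<^sub>R y - 1)\<^sup>2 / ((1 - t) *\<^sub>R x + t *\<^sub>R y + s)
        \<le> (1 - t) * ((x - 1)\<^sup>2 / (x + s)) + t * ((y - 1)\<^sup>2 / (y + s))"
      by (simp add: m_def)
  qed (rule convex_real_interval)
next
  case (add c d)
  from add.IH show ?case by (rule convex_on_add)
next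
  case (scale c t)
  from scale.hyps(2) scale.IH show ?case by (rule convex_on_cmul)
qed

text \<open>Closeness on a fine grid is enough because the approximant is convex: between neighbours
  it lies below its chord, and above the line extended from the interval to the left. Only f is
  compared by uniform continuity.\<close>

theorem operator_convex_uniform_approx:
  assumes f: "operator_convex f" and ab: "0 < a" and e: "0 < e"
  shows "\<exists>c. convex_cone_gen c \<and> (\<forall>x\<in>{a..b}. \<bar>f x - c x\<bar> \<le> e)"
proof -
  \<comment> \<open>The lower estimate costs 4 w against the value of f at the grid point, and
    passing from there to x costs one more w.\<close>
  define w where "w = e / 5"
  have w: "0 < w" using e by (simp add: w_def)
  have "continuous_on {0<..} f"
    using operator_convex_convex_on[OF f] by (intro convex_on_continuous) auto
  then have "continuous_on {a/2..b + a} f" by (rule continuous_on_subset) (use ab in auto)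
  then have "uniformly_continuous_on {a/2..b + a} f" by (intro compact_uniformly_continuous) auto
  then obtain \<delta> where \<delta>: "0 < \<delta>" "\<And>x y. x \<in> {a/2..b + a} \<Longrightarrow> y \<in> {a/2..b + a} \<Longrightarrow> \<bar>y - x\<bar> < \<delta> \<Longrightarrow> \<bar>f y - f x\<bar> < w"
    unfolding uniformly_continuous_on_def dist_real_def using w by meson
  define h where "h = min (\<delta> / 2) (a / 2)"
  have h: "0 < h" "h < \<delta>" "h \<le> a / 2" using \<delta>(1) ab by (auto simp: h_def)
  define N where "N = nat \<lceil>(b - a) / h\<rceil>"
  \<comment> \<open>The grid starts one step to the left of a and ends beyond b, since the estimate
    at x uses p - h, p and p + h. As h \<le> a / 2, all its points are positive.\<close>
  define X where "X = (\<lambda>i. a - h + real i * h) ` {..N + 2}"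
  have "finite X" "X \<subseteq> {0<..}" using h ab by (auto simp: X_def intro!: add_pos_nonneg)
  from operator_convex_finite_approx[OF f this w]
  obtain c where c: "convex_cone_gen c" "\<And>x. x \<in> X \<Longrightarrow> \<bar>f x - c x\<bar> < w" by blast
  have "\<bar>f x - c x\<bar> \<le> e" if x: "x \<in> {a..b}" for x
  proof -
    define i where "i = nat \<lfloor>(x - a) / h\<rfloor>"
    define p where "p = a + real i * h"
    have i: "real i \<le> (x - a) / h" "(x - a) / h < real i + 1"
      using x h by (auto simp: i_def)
    have px: "p \<le> x" "x < p + h" using i h by (auto simp: p_def field_simps)
    have "i \<le> N"
    proof -
      have "(x - a) / h \<le> (b - a) / h" using x h by (simp add: divide_right_mono)
      then show ?thesis unfolding i_def N_def by (intro nat_mono) linarith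
    qed
    have X: "p - h \<in> X" "p \<in> X" "p + h \<in> X"
      unfolding X_def p_def using \<open>i \<le> N\<close>
      by (auto intro: image_eqI[of _ _ i] image_eqI[of _ _ "i + 1"] image_eqI[of _ _ "i + 2"] simp: algebra_simps)
    have ap: "a \<le> p" using h by (simp add: p_def)
    have mem: "p - h \<in> {a/2..b + a}" "p \<in> {a/2..b + a}" "p + h \<in> {a/2..b + a}" "x \<in> {a/2..b + a}"
      using ap px x h ab by auto
    have fm: "\<bar>f (p - h) - f p\<bar> < w" "\<bar>f (p + h) - f p\<bar> < w" "\<bar>f x - f p\<bar> < w"
      using \<delta>(2)[OF mem(2,1)] \<delta>(2)[OF mem(2,3)] \<delta>(2)[OF mem(2,4)] h px by auto
    have cm: "c p - f p \<le> w" "f p - c p \<le> w" "c (p + h) - f p \<le> 2 * w" "c (p - h) - f p \<le> 2 * w"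
      using c(2)[OF X(1)] c(2)[OF X(2)] c(2)[OF X(3)] fm by linarith+
    note conv = convex_on_three_points[OF convex_cone_gen_convex_on[OF c(1)]]
    define u where "u = x - p"
    have u: "0 \<le> u" "u \<le> h" using px by (auto simp: u_def)
    have p0: "0 < p - h" "0 < p" using ap h ab by auto
    have "h * c x \<le> (h - u) * c p + u * c (p + h)"
      using conv[of p x "p + h"] p0 px by (simp add: u_def algebra_simps)
    also have "\<dots> \<le> (h - u) * (f p + 2 * w) + u * (f p + 2 * w)"
      using u cm w by (intro add_mono mult_left_mono) linarith+
    also have "\<dots> = h * (f p + 2 * w)" by (simp add: algebra_simps)
    finally have up: "c x \<le> f p + 2 * w" using h by simp
    have "(u + h) * (f p - w) \<le> (u + h) * c p" using u h cm by (intro mult_left_mono) linarith+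
    also have "\<dots> \<le> h * c x + u * c (p - h)"
      using conv[of "p - h" p x] p0 px h by (simp add: u_def algebra_simps)
    also have "\<dots> \<le> h * c x + u * (f p + 2 * w)" using u cm by (intro add_mono mult_left_mono) linarith+
    finally have "h * (f p - w) - 3 * w * u \<le> h * c x" by (simp add: algebra_simps)
    moreover have "3 * w * u \<le> 3 * w * h" using u w by (intro mult_left_mono) auto
    ultimately have "h * (f p - 4 * w) \<le> h * c x" by (simp add: algebra_simps)
    then have "f p - 4 * w \<le> c x" using h by simp
    moreover have "e = 5 * w" by (simp add: w_def)
    ultimately show ?thesis using up fm(3) by linarith
  qed
  then show ?thesis using c(1) by blast
qed

section \<open>The scalar perspective\<close>

lemma tendsto_SUP_at_top:
  fixes F :: "real \<Rightarrow> 'b::{complete_linorder,linorder_topology}"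
  assumes mono: "\<And>s t. a \<le> s \<Longrightarrow> s \<le> t \<Longrightarrow> F s \<le> F t"
  shows "(F \<longlongrightarrow> (SUP t\<in>{a..}. F t)) at_top"
proof (rule order_tendstoI)
  fix y assume "y < (SUP t\<in>{a..}. F t)"
  then obtain s where s: "a \<le> s" "y < F s" by (auto simp: less_SUP_iff)
  show "\<forall>\<^sub>F t in at_top. y < F t"
    using eventually_ge_at_top[of s] by eventually_elim (use s mono in \<open>blast intro: less_le_trans\<close>)
next
  fix y assume *: "(SUP t\<in>{a..}. F t) < y"
  show "\<forall>\<^sub>F t in at_top. F t < y"
    using eventually_ge_at_top[of a] by eventually_elim (use * in \<open>auto intro: le_less_trans[OF SUP_upper]\<close>)
qed

lemma tendsto_SUP_at_right_0:
  fixes F :: "real \<Rightarrow> 'b::{complete_linorder,linorder_topology}"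
  assumes mono: "\<And>s t. 0 < t \<Longrightarrow> t \<le> s \<Longrightarrow> s \<le> a \<Longrightarrow> F s \<le> F t" and a: "0 < a"
  shows "(F \<longlongrightarrow> (SUP t\<in>{0<..a}. F t)) (at_right 0)"
proof (rule order_tendstoI)
  fix y assume "y < (SUP t\<in>{0<..a}. F t)"
  then obtain s where s: "0 < s" "s \<le> a" "y < F s" by (auto simp: less_SUP_iff)
  show "\<forall>\<^sub>F t in at_right 0. y < F t"
    using eventually_at_right_less[of 0] eventually_at_right_real[OF s(1)]
  proof eventually_elim
    case (elim t)
    then have "F s \<le> F t" using s by (intro mono) auto
    with s(3) show ?case by (rule less_le_trans)
  qed
next
  fix y assume *: "(SUP t\<in>{0<..a}. F t) < y"
  show "\<forall>\<^sub>F t in at_right 0. F t < y"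
    using eventually_at_right_real[OF a]
  proof eventually_elim
    case (elim t)
    then have "F t \<le> (SUP t\<in>{0<..a}. F t)" by (intro SUP_upper) auto
    from le_less_trans[OF this *] show ?case .
  qed
qed

locale convex_at_one =
  fixes g :: "real \<Rightarrow> real"
  assumes conv: "convex_on {0<..} g" and nonneg: "\<And>t. 0 < t \<Longrightarrow> 0 \<le> g t" and one: "g 1 = 0"
begin

text \<open>Since g(1) = 0 the slopes g(s) / (s - 1) increase, and so do the quotients g(s) / (s +
  k). With k = 1 this gives the monotonicity of \<phi> to the right of 1/2, with k = 0 that of g(t)
  / t, hence the limit at infinity.\<close>

lemma growth_right:
  assumes st: "1 \<le> s" "s \<le> t" and k: "0 \<le> k"
  shows "g s * (t + k) \<le> g t * (s + k)"
proof (cases "t = 1")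
  case True then show ?thesis using st one by simp
next
  case False
  then have t: "0 < t - 1" using st by simp
  have "(t - 1) * (g s * (t + k)) = ((t - 1) * g s) * (t + k)" by simp
  also have "\<dots> \<le> ((s - 1) * g t) * (t + k)"
    using convex_on_three_points[OF conv, of 1 s t] st k one by (intro mult_right_mono) auto
  also have "\<dots> = ((s - 1) * (t + k)) * g t" by simp
  also have "\<dots> \<le> ((t - 1) * (s + k)) * g t"
  proof (rule mult_right_mono)
    have "0 \<le> (t - s) * (k + 1)" using st k by simp
    then show "(s - 1) * (t + k) \<le> (t - 1) * (s + k)" by (simp add: algebra_simps)
    show "0 \<le> g t" using st nonneg by simp
  qed
  finally have "(t - 1) * (g s * (t + k)) \<le> (t - 1) * (g t * (s + k))" by (simp add: mult_ac)
  then show ?thesis using t by simp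
qed

text \<open>The mirror image, with quotients g(s) / (1 + k s): k = 1 serves \<phi> to the left of
  1/2, and k = 0 the limit of g at 0.\<close>

lemma growth_left:
  assumes st: "0 < t" "t \<le> s" "s \<le> 1"
  shows "g s * (1 + t) \<le> g t * (1 + s)" "g s \<le> g t"
proof -
  have *: "g s * (1 + k * t) \<le> g t * (1 + k * s)" if k: "0 \<le> k" for k
  proof (cases "t = 1")
    case True then show ?thesis using st one by simp
  next
    case False
    then have t: "0 < 1 - t" using st by simp
    have "(1 - t) * (g s * (1 + k * t)) = ((1 - t) * g s) * (1 + k * t)" by simp
    also have "\<dots> \<le> ((1 - s) * g t) * (1 + k * t)"
      using convex_on_three_points[OF conv, of t s 1] st k one by (intro mult_right_mono) auto
    also have "\<dots> = ((1 - s) * (1 + k * t)) * g t" by simp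
    also have "\<dots> \<le> ((1 - t) * (1 + k * s)) * g t"
    proof (rule mult_right_mono)
      have "0 \<le> (s - t) * (k + 1)" using st k by simp
      then show "(1 - s) * (1 + k * t) \<le> (1 - t) * (1 + k * s)" by (simp add: algebra_simps)
      show "0 \<le> g t" using st nonneg by simp
    qed
    finally have "(1 - t) * (g s * (1 + k * t)) \<le> (1 - t) * (g t * (1 + k * s))" by (simp add: mult_ac)
    then show ?thesis using t by simp
  qed
  show "g s * (1 + t) \<le> g t * (1 + s)" using *[of 1] by simp
  show "g s \<le> g t" using *[of 0] by simp
qed

definition \<phi> :: "real \<Rightarrow> real" where "\<phi> r = (1 - r) * g (r / (1 - r))"

lemma \<phi>_eq:
  assumes "0 < r" "r < 1"
  shows "\<exists>t>0. r = t / (1 + t) \<and> \<phi> r = g t / (1 + t)"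
proof (intro exI conjI)
  show "0 < r / (1 - r)" using assms by simp
  show "r = r / (1 - r) / (1 + r / (1 - r))" using assms by (simp add: field_simps)
  show "\<phi> r = g (r / (1 - r)) / (1 + r / (1 - r))" using assms by (simp add: \<phi>_def field_simps)
qed

lemma \<phi>_nonneg: "0 < r \<Longrightarrow> r < 1 \<Longrightarrow> 0 \<le> \<phi> r"
  by (simp add: \<phi>_def nonneg)

lemma \<phi>_half: "\<phi> (1 / 2) = 0"
  by (simp add: \<phi>_def one)

lemma \<phi>_mono_right:
  assumes "1 / 2 \<le> p" "p \<le> q" "q < 1"
  shows "\<phi> p \<le> \<phi> q"
proof -
  have "0 < p" "p < 1" "0 < q" "q < 1" using assms by simp_all
  with \<phi>_eq[of p] \<phi>_eq[of q] obtain s t where s: "0 < s" "p = s / (1 + s)" "\<phi> p = g s / (1 + s)"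
    and t: "0 < t" "q = t / (1 + t)" "\<phi> q = g t / (1 + t)" by blast
  have "1 \<le> s" "s \<le> t" using assms s(1) t(1) unfolding s(2) t(2) by (auto simp: field_simps)
  from growth_right[OF this, of 1] show ?thesis using s(1) t(1) unfolding s(3) t(3) by (simp add: field_simps)
qed

lemma \<phi>_mono_left:
  assumes "0 < q" "q \<le> p" "p \<le> 1 / 2"
  shows "\<phi> p \<le> \<phi> q"
proof -
  have "0 < p" "p < 1" "0 < q" "q < 1" using assms by simp_all
  with \<phi>_eq[of p] \<phi>_eq[of q] obtain s t where s: "0 < s" "p = s / (1 + s)" "\<phi> p = g s / (1 + s)"
    and t: "0 < t" "q = t / (1 + t)" "\<phi> q = g t / (1 + t)" by blast
  have "t \<le> s" "s \<le> 1" using assms s(1) t(1) unfolding s(2) t(2) by (auto simp: field_simps)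
  from growth_left(1)[OF t(1) this] show ?thesis using s(1) t(1) unfolding s(3) t(3) by (simp add: field_simps)
qed

lemma continuous_on_\<phi>: "continuous_on {0<..<1} \<phi>"
proof -
  have "continuous_on {0<..} g" using conv by (intro convex_on_continuous) auto
  then have "continuous_on {0<..<1} (\<lambda>r. g (r / (1 - r)))"
    by (rule continuous_on_compose2) (auto intro!: continuous_intros)
  then show ?thesis unfolding \<phi>_def[abs_def] by (intro continuous_intros)
qed

definition \<delta> :: "nat \<Rightarrow> real" where "\<delta> m = 1 / (real m + 1)"

text \<open>The affine contraction of [0,1] onto the interval from \<delta>/2 to 1 - \<delta>/2,
  fixing 1/2; the clamp makes its bounds and its continuity valid on the whole line.\<close>

definition shrink :: "nat \<Rightarrow> real \<Rightarrow> real" where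
  "shrink m r = (1 - \<delta> m) * max 0 (min 1 r) + \<delta> m / 2"

lemma \<delta>: "0 < \<delta> m" "\<delta> m \<le> 1" "\<delta> (Suc m) \<le> \<delta> m"
  by (auto simp: \<delta>_def field_simps)

lemma shrink_unit: "r \<in> {0..1} \<Longrightarrow> shrink m r = (1 - \<delta> m) * r + \<delta> m / 2"
  by (simp add: shrink_def)

lemma shrink_bounds: "\<delta> m / 2 \<le> shrink m r" "shrink m r \<le> 1 - \<delta> m / 2" "0 < shrink m r" "shrink m r < 1"
proof -
  have "0 \<le> (1 - \<delta> m) * max 0 (min 1 r)" using \<delta>[of m] by simp
  moreover have "(1 - \<delta> m) * max 0 (min 1 r) \<le> (1 - \<delta> m) * 1" using \<delta>[of m] by (intro mult_left_mono) auto
  ultimately show "\<delta> m / 2 \<le> shrink m r" "shrink m r \<le> 1 - \<delta> m / 2" by (auto simp: shrink_def)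
  then show "0 < shrink m r" "shrink m r < 1" using \<delta>(1)[of m] by linarith+
qed

definition h :: "nat \<Rightarrow> real \<Rightarrow> real" where "h m r = \<phi> (shrink m r)"

lemma h_nonneg: "0 \<le> h m r"
  unfolding h_def by (intro \<phi>_nonneg shrink_bounds)

lemma h_half: "h m (1 / 2) = 0"
proof -
  have "shrink m (1 / 2) = 1 / 2" by (simp add: shrink_unit field_simps)
  then show ?thesis unfolding h_def by (simp only: \<phi>_half)
qed

text \<open>As m grows the contracted point moves away from 1/2 on its own side, and \<phi>
  increases in that direction.\<close>

lemma h_mono: "h m r \<le> h (Suc m) r"
proof -
  define c where "c = max 0 (min 1 r)"
  define D where "D m = \<delta> m * (1 / 2 - c)" for m
  have s: "shrink m r = c + D m" for m by (simp add: shrink_def D_def c_def algebra_simps)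
  show ?thesis
  proof (cases "1 / 2 \<le> c")
    case True
    have "D m \<le> D (Suc m)" unfolding D_def using True \<delta>(3) by (intro mult_right_mono_neg) auto
    moreover have "1 * (1 / 2 - c) \<le> D m" unfolding D_def using True \<delta>(2) by (intro mult_right_mono_neg) auto
    ultimately have "1 / 2 \<le> shrink m r" "shrink m r \<le> shrink (Suc m) r" unfolding s by simp_all
    then show ?thesis unfolding h_def by (rule \<phi>_mono_right) (rule shrink_bounds)
  next
    case False
    have "D (Suc m) \<le> D m" unfolding D_def using False \<delta>(3) by (intro mult_right_mono) auto
    moreover have "D m \<le> 1 * (1 / 2 - c)" unfolding D_def using False \<delta>(2) by (intro mult_right_mono) auto
    ultimately have "shrink m r \<le> 1 / 2" "shrink (Suc m) r \<le> shrink m r" unfolding s by simp_all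
    then show ?thesis unfolding h_def by (intro \<phi>_mono_left shrink_bounds)
  qed
qed

lemma continuous_on_h: "continuous_on UNIV (h m)"
  unfolding h_def[abs_def]
proof (rule continuous_on_compose2[OF continuous_on_\<phi>])
  show "continuous_on UNIV (shrink m)" unfolding shrink_def[abs_def] by (intro continuous_intros)
  show "shrink m ` UNIV \<subseteq> {0<..<1}" using shrink_bounds by auto
qed

lemma h_tendsto_interior:
  assumes r: "0 < r" "r < 1"
  shows "(\<lambda>m. h m r) \<longlonglongrightarrow> \<phi> r"
proof -
  have "isCont \<phi> r" using continuous_on_\<phi> r by (simp add: continuous_on_eq_continuous_at)
  moreover have "(\<lambda>m. (1 - \<delta> m) * r + \<delta> m / 2) \<longlonglongrightarrow> r" unfolding \<delta>_def by real_asymp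
  then have "(\<lambda>m. shrink m r) \<longlonglongrightarrow> r" using r by (simp add: shrink_unit)
  ultimately show ?thesis unfolding h_def by (rule isCont_tendsto_compose)
qed

definition "slope_inf = (SUP t\<in>{1..}. ereal (g t / t))"
definition "value_zero = (SUP t\<in>{0<..1}. ereal (g t))"

lemma tendsto_slope_inf: "((\<lambda>t. ereal (g t / t)) \<longlongrightarrow> slope_inf) at_top"
  unfolding slope_inf_def
proof (rule tendsto_SUP_at_top)
  fix s t :: real assume "1 \<le> s" "s \<le> t"
  with growth_right[OF this, of 0] show "ereal (g s / s) \<le> ereal (g t / t)" by (simp add: field_simps)
qed

lemma tendsto_value_zero: "((\<lambda>t. ereal (g t)) \<longlongrightarrow> value_zero) (at_right 0)"
  unfolding value_zero_def by (rule tendsto_SUP_at_right_0) (auto intro: growth_left)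

text \<open>The contracted end point corresponds to the ratio t = 2 m + 1, so \<open>h m 1\<close>
  is g(t) / t there up to the factor (2 m + 1) / (2 m + 2), which tends to 1. At 0 the ratio is 1 /
  (2 m + 1).\<close>

lemma h_tendsto_1: "(\<lambda>m. ereal (h m 1)) \<longlonglongrightarrow> slope_inf"
proof -
  have eq: "ereal (h m 1) = ereal (g (2 * real m + 1) / (2 * real m + 1)) * ereal ((2 * real m + 1) / (2 * real m + 2))" for m
  proof -
    have nz: "real m + 1 \<noteq> 0" "2 * real m + 2 \<noteq> 0" "2 * real m + 1 \<noteq> 0" using of_nat_0_le_iff[of m, where 'a=real] by linarith+
    have \<delta>2: "\<delta> m / 2 = 1 / (2 * real m + 2)" by (simp add: \<delta>_def)
    have s: "shrink m 1 = (2 * real m + 1) / (2 * real m + 2)"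
      using nz \<delta>2 by (simp add: shrink_unit) (simp add: field_simps)
    have "1 - shrink m 1 = 1 / (2 * real m + 2)" unfolding s using nz by (simp add: field_simps)
    then have "h m 1 = g (2 * real m + 1) / (2 * real m + 2)" by (simp add: h_def \<phi>_def s)
    then show ?thesis using nz by simp
  qed
  have "filterlim (\<lambda>m. 2 * real m + 1) at_top sequentially" by real_asymp
  from filterlim_compose[OF tendsto_slope_inf this]
  have 1: "(\<lambda>m. ereal (g (2 * real m + 1) / (2 * real m + 1))) \<longlonglongrightarrow> slope_inf" .
  have "(\<lambda>m. (2 * real m + 1) / (2 * real m + 2)) \<longlonglongrightarrow> 1" by real_asymp
  then have "(\<lambda>m. ereal ((2 * real m + 1) / (2 * real m + 2))) \<longlonglongrightarrow> ereal 1" by (simp only: lim_ereal)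
  from tendsto_mult_ereal[OF 1 this] show ?thesis unfolding eq by (simp add: one_ereal_def[symmetric])
qed

lemma h_tendsto_0: "(\<lambda>m. ereal (h m 0)) \<longlonglongrightarrow> value_zero"
proof -
  have eq: "ereal (h m 0) = ereal (g (1 / (2 * real m + 1))) * ereal ((2 * real m + 1) / (2 * real m + 2))" for m
  proof -
    have nz: "real m + 1 \<noteq> 0" "2 * real m + 2 \<noteq> 0" "2 * real m + 1 \<noteq> 0" using of_nat_0_le_iff[of m, where 'a=real] by linarith+
    have \<delta>2: "\<delta> m / 2 = 1 / (2 * real m + 2)" by (simp add: \<delta>_def)
    have s: "shrink m 0 = 1 / (2 * real m + 2)"
      unfolding shrink_unit[OF atLeastAtMost_iff[THEN iffD2, OF conjI[OF order_refl zero_le_one]]] \<delta>2 by simp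
    have s': "1 - shrink m 0 = (2 * real m + 1) / (2 * real m + 2)" unfolding s using nz by (simp add: field_simps)
    have "shrink m 0 / (1 - shrink m 0) = 1 / (2 * real m + 1)" unfolding s s' using nz by (simp add: field_simps)
    then show ?thesis by (simp add: h_def \<phi>_def s' mult.commute)
  qed
  have "filterlim (\<lambda>m. 1 / (2 * real m + 1)) (at_right 0) sequentially" by real_asymp
  from filterlim_compose[OF tendsto_value_zero this]
  have 1: "(\<lambda>m. ereal (g (1 / (2 * real m + 1)))) \<longlonglongrightarrow> value_zero" .
  have "(\<lambda>m. (2 * real m + 1) / (2 * real m + 2)) \<longlonglongrightarrow> 1" by real_asymp
  then have "(\<lambda>m. ereal ((2 * real m + 1) / (2 * real m + 2))) \<longlonglongrightarrow> ereal 1" by (simp only: lim_ereal)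
  from tendsto_mult_ereal[OF 1 this] show ?thesis unfolding eq by (simp add: one_ereal_def[symmetric])
qed

definition hsup :: "real \<Rightarrow> ennreal" where "hsup r = (SUP m. ennreal (h m r))"

lemma incseq_h: "incseq (\<lambda>m. ennreal (h m r))"
  by (intro incseq_SucI ennreal_leI h_mono)

lemma hsup_tendsto: "(\<lambda>m. ereal (h m r)) \<longlonglongrightarrow> enn2ereal (hsup r)"
proof -
  have "(\<lambda>m. ennreal (h m r)) \<longlonglongrightarrow> hsup r" unfolding hsup_def by (rule LIMSEQ_SUP[OF incseq_h])
  then have "(\<lambda>m. enn2ereal (ennreal (h m r))) \<longlonglongrightarrow> enn2ereal (hsup r)" by (simp add: tendsto_enn2ereal_iff)
  then show ?thesis by (simp add: enn2ereal_ennreal h_nonneg)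
qed

text \<open>At the end points the limits of the h m are the two limits in the definition of the
  perspective, taken for g; the affine part contributes finite limits, so the extended sums are
  unambiguous.\<close>

lemma perspective_eq:
  assumes f: "\<And>t. 0 < t \<Longrightarrow> f t = g t + (d + c * t)" and r: "r \<in> {0..1}"
  shows "perspective f r (1 - r) = ereal (c * r + d * (1 - r)) + enn2ereal (hsup r)"
proof -
  consider "r = 0" | "r = 1" | "0 < r" "r < 1" using r by fastforce
  then show ?thesis
  proof cases
    case 1
    have "((\<lambda>t. d + c * t) \<longlongrightarrow> d + c * 0) (at_right 0)" by (intro tendsto_intros)
    then have "((\<lambda>t. ereal (g t) + ereal (d + c * t)) \<longlongrightarrow> value_zero + ereal d) (at_right 0)"
      by (intro tendsto_add_ereal_general1 tendsto_value_zero) simp_all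
    moreover have "\<forall>\<^sub>F t in at_right 0. ereal (g t) + ereal (d + c * t) = ereal (f t)"
      using eventually_at_right_less[of 0] by eventually_elim (simp add: f)
    ultimately have "((\<lambda>t. ereal (f t)) \<longlongrightarrow> value_zero + ereal d) (at_right 0)"
      by (rule Lim_transform_eventually)
    then have "Lim (at_right 0) (\<lambda>t. ereal (f t)) = value_zero + ereal d" by (intro tendsto_Lim) auto
    moreover have "enn2ereal (hsup 0) = value_zero" by (rule LIMSEQ_unique[OF hsup_tendsto h_tendsto_0])
    ultimately show ?thesis using 1 by (simp add: perspective_def one_ereal_def[symmetric] add.commute)
  next
    case 2
    have "((\<lambda>t. d / t + c) \<longlongrightarrow> c) at_top" by real_asymp
    then have "((\<lambda>t. ereal (g t / t) + ereal (d / t + c)) \<longlongrightarrow> slope_inf + ereal c) at_top"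
      by (intro tendsto_add_ereal_general1 tendsto_slope_inf) simp_all
    moreover have "\<forall>\<^sub>F t in at_top. ereal (g t / t) + ereal (d / t + c) = ereal (f t / t)"
      using eventually_gt_at_top[of 0] by eventually_elim (simp add: f field_simps)
    ultimately have "((\<lambda>t. ereal (f t / t)) \<longlongrightarrow> slope_inf + ereal c) at_top"
      by (rule Lim_transform_eventually)
    then have "Lim at_top (\<lambda>t. ereal (f t / t)) = slope_inf + ereal c" by (intro tendsto_Lim) auto
    moreover have "enn2ereal (hsup 1) = slope_inf" by (rule LIMSEQ_unique[OF hsup_tendsto h_tendsto_1])
    ultimately show ?thesis using 2 by (simp add: perspective_def one_ereal_def[symmetric] add.commute)
  next
    case 3
    have "(\<lambda>m. ereal (h m r)) \<longlonglongrightarrow> ereal (\<phi> r)" using h_tendsto_interior[OF 3] by simp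
    then have "enn2ereal (hsup r) = ereal (\<phi> r)" by (rule LIMSEQ_unique[OF hsup_tendsto])
    then show ?thesis using 3 by (simp add: perspective_def \<phi>_def f field_simps)
  qed
qed

end

section \<open>The perspective as an affine part plus an increasing limit\<close>

text \<open>The slope c is the infimum of the slopes of chords from 1 to the right; every chord
  slope to the left lies below all of these.\<close>

lemma convex_subgradient_at_1:
  fixes f :: "real \<Rightarrow> real"
  assumes f: "convex_on {0<..} f"
  shows "\<exists>c. \<forall>t>0. f 1 + c * (t - 1) \<le> f t"
proof (intro exI allI impI)
  define S where "S = (\<lambda>t. (f t - f 1) / (t - 1)) ` {1<..}"
  have slope: "(f s - f 1) / (s - 1) \<le> (f t - f 1) / (t - 1)" if "0 < s" "s < 1" "1 < t" for s t
  proof -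
    have "(t - s) * f 1 \<le> (t - 1) * f s + (1 - s) * f t"
      using convex_on_three_points[OF f, of s 1 t] that by simp
    then have "(f 1 - f s) * (t - 1) \<le> (f t - f 1) * (1 - s)" by (simp add: algebra_simps)
    then have "(f 1 - f s) / (1 - s) \<le> (f t - f 1) / (t - 1)" using that by (simp add: divide_simps)
    moreover have "(f s - f 1) / (s - 1) = (f 1 - f s) / (1 - s)"
      using minus_divide_divide[of "f s - f 1" "s - 1"] by simp
    ultimately show ?thesis by simp
  qed
  have bdd: "bdd_below S" unfolding S_def
    by (rule bdd_belowI[of _ "(f (1 / 2) - f 1) / (1 / 2 - 1)"]) (use slope[of "1 / 2"] in auto)
  have ne: "S \<noteq> {}" unfolding S_def by (metis image_is_empty greaterThan_non_empty)
  fix t :: real assume t: "0 < t"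
  show "f 1 + Inf S * (t - 1) \<le> f t"
  proof (cases t "1::real" rule: linorder_cases)
    case less
    have "(f t - f 1) / (t - 1) \<le> Inf S"
      by (rule cInf_greatest[OF ne]) (use slope[OF t less] in \<open>auto simp: S_def\<close>)
    then show ?thesis using less by (simp add: divide_simps split: if_splits)
  next
    case greater
    then have "Inf S \<le> (f t - f 1) / (t - 1)" by (intro cInf_lower bdd) (auto simp: S_def)
    then show ?thesis using greater by (simp add: divide_simps split: if_splits)
  qed simp
qed

text \<open>Under the affine contraction p of r the numerator 2 p - 1 is a multiple of 2 r - 1,
  because 1/2 is fixed, and p + s (1 - p) is again a positive combination of r and 1 - r. So the
  contracted perspective of a generator stays in the cone of kernels.\<close>

lemma convex_cone_gen_kern_cone:
  assumes "convex_cone_gen c" and \<delta>: "0 < \<delta>" "\<delta> \<le> 1"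
  shows "\<exists>h. kern_cone h \<and> (\<forall>r\<in>{0..1}. \<forall>p. p = (1 - \<delta>) * r + \<delta> / 2 \<longrightarrow> (1 - p) * c (p / (1 - p)) = h r)"
  using assms(1)
proof (induction rule: convex_cone_gen.induct)
  case (affine a b)
  let ?h = "\<lambda>r. (a * (\<delta> / 2) + b * (1 - \<delta> / 2)) * r + (a * (1 - \<delta> / 2) + b * (\<delta> / 2)) * (1 - r)"
  have "(1 - p) * (a + b * (p / (1 - p))) = ?h r"
    if r: "r \<in> {0..1}" and p: "p = (1 - \<delta>) * r + \<delta> / 2" for r p
  proof -
    have "(1 - \<delta>) * r \<le> (1 - \<delta>) * 1" using r \<delta> by (intro mult_left_mono) auto
    then have "1 - p \<noteq> 0" using p \<delta> by simp
    then have "(1 - p) * (a + b * (p / (1 - p))) = a * (1 - p) + b * p" by (simp add: field_simps)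
    also have "\<dots> = ?h r" by (simp add: p field_simps)
    finally show ?thesis .
  qed
  then show ?case using kern_cone.affine by blast
next
  case (kern s)
  \<comment> \<open>The values of p + s (1 - p) at r = 1 and at r = 0.\<close>
  let ?\<alpha> = "1 - \<delta> / 2 + s * (\<delta> / 2)" and ?\<beta> = "\<delta> / 2 + s * (1 - \<delta> / 2)"
  have pos: "0 < ?\<alpha>" "0 < ?\<beta>" using \<delta> kern by (auto intro!: add_pos_pos add_pos_nonneg mult_pos_pos)
  have "(1 - p) * ((p / (1 - p) - 1)\<^sup>2 / (p / (1 - p) + s)) = (1 - \<delta>)\<^sup>2 * kern ?\<alpha> ?\<beta> r"
    if r: "r \<in> {0..1}" and p: "p = (1 - \<delta>) * r + \<delta> / 2" for r p
  proof -
    have "(1 - \<delta>) * r \<le> (1 - \<delta>) * 1" using r \<delta> by (intro mult_left_mono) auto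
    moreover have "0 \<le> (1 - \<delta>) * r" using r \<delta> by simp
    ultimately have p1: "0 < 1 - p" "0 < p" using p \<delta> by simp_all
    have 1: "p / (1 - p) - 1 = (2 * p - 1) / (1 - p)" "p / (1 - p) + s = (p + s * (1 - p)) / (1 - p)"
      using p1 by (simp_all add: field_simps)
    have 2: "2 * p - 1 = (1 - \<delta>) * (2 * r - 1)" "p + s * (1 - p) = ?\<alpha> * r + ?\<beta> * (1 - r)"
      by (simp_all add: p field_simps)
    have "(1 - p) * ((p / (1 - p) - 1)\<^sup>2 / (p / (1 - p) + s)) = (2 * p - 1)\<^sup>2 / (p + s * (1 - p))"
      unfolding 1 using p1 by (simp add: power2_eq_square)
    also have "\<dots> = (1 - \<delta>)\<^sup>2 * kern ?\<alpha> ?\<beta> r" unfolding 2 by (simp add: kern_def power_mult_distrib)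
    finally show ?thesis .
  qed
  moreover have "kern_cone (\<lambda>r. (1 - \<delta>)\<^sup>2 * kern ?\<alpha> ?\<beta> r)" by (intro kern_cone.scale kern_cone.kern pos) simp
  ultimately show ?case by blast
next
  case (add c d)
  then obtain h h' where h: "kern_cone h" "\<forall>r\<in>{0..1}. \<forall>p. p = (1 - \<delta>) * r + \<delta> / 2 \<longrightarrow> (1 - p) * c (p / (1 - p)) = h r"
    and h': "kern_cone h'" "\<forall>r\<in>{0..1}. \<forall>p. p = (1 - \<delta>) * r + \<delta> / 2 \<longrightarrow> (1 - p) * d (p / (1 - p)) = h' r"
    by blast
  show ?case
    by (intro exI[of _ "\<lambda>r. h r + h' r"] conjI kern_cone.add h(1) h'(1)) (use h(2) h'(2) in \<open>simp add: distrib_left\<close>)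
next
  case (scale c t)
  then obtain h where h: "kern_cone h" "\<forall>r\<in>{0..1}. \<forall>p. p = (1 - \<delta>) * r + \<delta> / 2 \<longrightarrow> (1 - p) * c (p / (1 - p)) = h r"
    by blast
  show ?case
    by (intro exI[of _ "\<lambda>r. t * h r"] conjI kern_cone.scale h(1) scale.hyps) (use h(2) in \<open>simp add: mult.left_commute\<close>)
qed

text \<open>All that the convergence proof uses of f: an affine part, whose value is linear in A and
  B, and an increasing sequence of bounded functions approximable by kernels. Their vanishing at 1/2
  removes the correction term of \<open>shift_ok\<close>.\<close>

theorem operator_convex_perspective_decomposition:
  assumes f: "operator_convex f"
  shows "\<exists>c h. (\<forall>m r. 0 \<le> h m r) \<and> (\<forall>m. h m (1 / 2) = 0) \<and> (\<forall>m r. h m r \<le> h (Suc m) r) \<and>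
    (\<forall>m. bdd_borel (h m)) \<and>
    (\<forall>m. \<forall>e>0. \<exists>h'. kern_cone h' \<and> (\<forall>r\<in>{0..1}. \<bar>h m r - h' r\<bar> \<le> e)) \<and>
    (\<forall>r\<in>{0..1}. perspective f r (1 - r) =
      ereal (c * r + (f 1 - c) * (1 - r)) + enn2ereal (SUP m::nat. ennreal (h m r)))"
proof -
  note conv_f = operator_convex_convex_on[OF f]
  obtain c where c: "\<And>t. 0 < t \<Longrightarrow> f 1 + c * (t - 1) \<le> f t" using convex_subgradient_at_1[OF conv_f] by blast
  define g where "g t = f t + (- (f 1 - c) + - c * t)" for t
  have fg: "f t = g t + ((f 1 - c) + c * t)" for t by (simp add: g_def)
  interpret convex_at_one g
  proof
    have "convex_on {0<..} (\<lambda>t. - (f 1 - c) + - c * t)"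
      by (rule convex_cone_gen_convex_on[OF convex_cone_gen.affine])
    from convex_on_add[OF conv_f this] show "convex_on {0<..} g" by (simp only: g_def[abs_def])
    show "0 \<le> g t" if "0 < t" for t using c[OF that] by (simp add: g_def algebra_simps)
    show "g 1 = 0" by (simp add: g_def)
  qed
  have approx: "\<exists>h'. kern_cone h' \<and> (\<forall>r\<in>{0..1}. \<bar>h m r - h' r\<bar> \<le> e)" if e: "0 < e" for m e
  proof -
    let ?d = "\<delta> m / 2"
    have d: "0 < ?d" "?d < 1" using \<delta>[of m] by auto
    \<comment> \<open>The contracted point stays between \<open>?d\<close> and
      \<open>1 - ?d\<close>, so its ratio p / (1 - p) stays in this compact interval.\<close>
    obtain k where k: "convex_cone_gen k" "\<And>t. t \<in> {?d / (1 - ?d)..(1 - ?d) / ?d} \<Longrightarrow> \<bar>f t - k t\<bar> \<le> e"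
      using operator_convex_uniform_approx[OF f _ e, of "?d / (1 - ?d)" "(1 - ?d) / ?d"] d by auto
    have k': "convex_cone_gen (\<lambda>t. k t + (- (f 1 - c) + - c * t))"
      by (intro convex_cone_gen.add k(1) convex_cone_gen.affine)
    obtain h' where h': "kern_cone h'" "\<And>r p. r \<in> {0..1} \<Longrightarrow> p = (1 - \<delta> m) * r + \<delta> m / 2 \<Longrightarrow>
        (1 - p) * (k (p / (1 - p)) + (- (f 1 - c) + - c * (p / (1 - p)))) = h' r"
      using convex_cone_gen_kern_cone[OF k' \<delta>(1,2), of m] by blast
    have "\<bar>h m r - h' r\<bar> \<le> e" if r: "r \<in> {0..1}" for r
    proof -
      define p where "p = shrink m r"
      note b = shrink_bounds[where m=m and r=r, folded p_def]
      have t: "p / (1 - p) \<in> {?d / (1 - ?d)..(1 - ?d) / ?d}"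
      proof -
        have "?d / (1 - ?d) \<le> p / (1 - p)" using b d by (intro frac_le) auto
        moreover have "p / (1 - p) \<le> (1 - ?d) / ?d" using b d by (intro frac_le) auto
        ultimately show ?thesis by simp
      qed
      have "h m r = (1 - p) * g (p / (1 - p))" by (simp add: h_def \<phi>_def p_def)
      moreover have "h' r = (1 - p) * (k (p / (1 - p)) + (- (f 1 - c) + - c * (p / (1 - p))))"
        by (rule h'(2)[OF r, symmetric]) (simp add: p_def shrink_unit[OF r])
      ultimately have "h m r - h' r = (1 - p) * (f (p / (1 - p)) - k (p / (1 - p)))"
        by (simp add: g_def algebra_simps)
      then have "\<bar>h m r - h' r\<bar> = (1 - p) * \<bar>f (p / (1 - p)) - k (p / (1 - p))\<bar>"
        using b by (simp add: abs_mult)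
      also have "\<dots> \<le> 1 * e" using b k(2)[OF t] by (intro mult_mono) auto
      finally show ?thesis by simp
    qed
    then show ?thesis using h'(1) by blast
  qed
  show ?thesis
  proof (intro exI[of _ c] exI[of _ h] conjI allI ballI impI)
    show "perspective f r (1 - r) = ereal (c * r + (f 1 - c) * (1 - r)) + enn2ereal (SUP m. ennreal (h m r))"
      if "r \<in> {0..1}" for r using perspective_eq[OF fg that] by (simp add: hsup_def)
  qed (simp_all add: h_nonneg h_half h_mono approx bdd_borel_continuous[OF continuous_on_h])
qed

section \<open>Convergence\<close>

text \<open>The integral is defined by the positive and negative parts of p, while p is given as an
  affine function of either sign plus a possibly infinite G. Moving negative terms across gives an
  identity between nonnegative functions, which can be integrated; the finite integrals are
  subtracted afterwards.\<close>

lemma ereal_integral_affine_plus_nonneg: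
  fixes N :: "real measure" and G :: "real \<Rightarrow> ennreal"
  assumes sets: "sets N = sets borel" and ae: "AE r in N. r \<in> {0..1}"
    and ab: "(\<integral>\<^sup>+r. ennreal r \<partial>N) = ennreal a" "(\<integral>\<^sup>+r. ennreal (1 - r) \<partial>N) = ennreal b" "0 \<le> a" "0 \<le> b"
    and G[measurable]: "G \<in> borel_measurable borel"
    and p: "\<And>r. r \<in> {0..1} \<Longrightarrow> p r = ereal (c * r + d * (1 - r)) + enn2ereal (G r)"
  shows "ereal_integral N {0..1} p = ereal (c * a + d * b) + enn2ereal (\<integral>\<^sup>+r. G r \<partial>N)"
proof -
  note [measurable_cong] = sets
  \<comment> \<open>Splitting by the signs of the coefficients rather than of the affine function
    itself: the difference is the same, and both integrals are explicit in a and b.\<close>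
  define u where "u c d r = max c 0 * r + max d 0 * (1 - r)" for c d r :: real
  have u0: "0 \<le> u c d r" if "r \<in> {0..1}" for c d r using that by (auto simp: u_def intro!: add_nonneg_nonneg mult_nonneg_nonneg)
  have int_u: "(\<integral>\<^sup>+r. ennreal (u c d r) \<partial>N) = ennreal (max c 0 * a + max d 0 * b)" for c d
  proof -
    have "(\<integral>\<^sup>+r. ennreal (u c d r) \<partial>N) = (\<integral>\<^sup>+r. ennreal (max c 0) * ennreal r + ennreal (max d 0) * ennreal (1 - r) \<partial>N)"
      by (rule nn_integral_cong_AE) (use ae in eventually_elim, simp add: u_def ennreal_mult)
    also have "\<dots> = ennreal (max c 0) * (\<integral>\<^sup>+r. ennreal r \<partial>N) + ennreal (max d 0) * (\<integral>\<^sup>+r. ennreal (1 - r) \<partial>N)"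
      by (simp add: nn_integral_add nn_integral_cmult)
    also have "\<dots> = ennreal (max c 0 * a + max d 0 * b)"
      unfolding ab(1,2) using ab(3,4) by (simp add: ennreal_mult)
    finally show ?thesis .
  qed
  have u_diff: "u c d r - u (-c) (-d) r = c * r + d * (1 - r)" for r
    by (auto simp: u_def max_def algebra_simps)
  define P where "P r = e2ennreal (p r) * indicator {0..1} r" for r
  define M where "M r = e2ennreal (- p r) * indicator {0..1} r" for r
  have [measurable]: "P \<in> borel_measurable borel" "M \<in> borel_measurable borel"
  proof -
    have "P = (\<lambda>r. e2ennreal (ereal (c * r + d * (1 - r)) + enn2ereal (G r)) * indicator {0..1} r)"
      "M = (\<lambda>r. e2ennreal (- (ereal (c * r + d * (1 - r)) + enn2ereal (G r))) * indicator {0..1} r)"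
      by (auto simp: P_def M_def p fun_eq_iff indicator_def)
    then show "P \<in> borel_measurable borel" "M \<in> borel_measurable borel" by simp_all
  qed
  have pm: "P r + ennreal (u (-c) (-d) r) = M r + ennreal (u c d r) + G r \<and> M r \<le> ennreal (u (-c) (-d) r)"
    if r: "r \<in> {0..1}" for r
  proof (cases "G r")
    case (real \<gamma>)
    define x where "x = u c d r - u (-c) (-d) r + \<gamma>"
    have "p r = ereal x" using p[OF r] real by (simp add: x_def u_diff enn2ereal_ennreal)
    then have "P r = ennreal x" "M r = ennreal (- x)" using r by (simp_all add: P_def M_def e2ennreal_ereal)
    moreover note u0[OF r, of c d] u0[OF r, of "-c" "-d"]
    ultimately show ?thesis using real
      by (cases "0 \<le> x") (auto simp: x_def ennreal_neg ennreal_plus[symmetric] ennreal_leI simp del: ennreal_plus)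
  next
    case top
    then have "p r = \<infinity>" using p[OF r] by simp
    then show ?thesis using r top by (simp add: P_def M_def e2ennreal_neg)
  qed
  have "(\<integral>\<^sup>+r. P r \<partial>N) + (\<integral>\<^sup>+r. ennreal (u (-c) (-d) r) \<partial>N) = (\<integral>\<^sup>+r. P r + ennreal (u (-c) (-d) r) \<partial>N)"
    unfolding u_def by (intro nn_integral_add[symmetric]) measurable
  also have "\<dots> = (\<integral>\<^sup>+r. M r + ennreal (u c d r) + G r \<partial>N)"
    by (rule nn_integral_cong_AE) (use ae in eventually_elim, use pm in blast)
  also have "\<dots> = (\<integral>\<^sup>+r. M r \<partial>N) + (\<integral>\<^sup>+r. ennreal (u c d r) \<partial>N) + (\<integral>\<^sup>+r. G r \<partial>N)"
    unfolding u_def by (subst nn_integral_add, measurable)+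
  finally have eq: "(\<integral>\<^sup>+r. P r \<partial>N) + ennreal (max (-c) 0 * a + max (-d) 0 * b) =
      (\<integral>\<^sup>+r. M r \<partial>N) + ennreal (max c 0 * a + max d 0 * b) + (\<integral>\<^sup>+r. G r \<partial>N)"
    unfolding int_u .
  have "(\<integral>\<^sup>+r. M r \<partial>N) \<le> (\<integral>\<^sup>+r. ennreal (u (-c) (-d) r) \<partial>N)"
    by (rule nn_integral_mono_AE) (use ae in eventually_elim, use pm in blast)
  then have fin: "(\<integral>\<^sup>+r. M r \<partial>N) \<noteq> \<infinity>" unfolding int_u by (auto simp: top_unique)
  have val: "c * a + d * b = (max c 0 * a + max d 0 * b) - (max (-c) 0 * a + max (-d) 0 * b)"
    by (auto simp: max_def)
  have nn: "0 \<le> max c 0 * a + max d 0 * b" for c d using ab by (intro add_nonneg_nonneg mult_nonneg_nonneg) auto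
  have arith: "enn2ereal x - enn2ereal y = ereal (s - t) + enn2ereal z"
    if "x + ennreal t = y + ennreal s + z" "y \<noteq> \<infinity>" "0 \<le> s" "0 \<le> t" for x y z s t
    using that
    by (cases x; cases y; cases z) (auto simp: enn2ereal_ennreal ennreal_plus[symmetric] simp del: ennreal_plus)
  show ?thesis
    unfolding ereal_integral_def P_def[symmetric] M_def[symmetric] val by (rule arith[OF eq fin nn nn])
qed

lemma tendsto_if_le_liminf:
  fixes x :: "nat \<Rightarrow> 'b::{complete_linorder,linorder_topology}"
  assumes "\<And>n. x n \<le> l" "l \<le> liminf x"
  shows "x \<longlonglongrightarrow> l"
proof (rule order_tendstoI)
  fix y assume "y < l"
  then show "\<forall>\<^sub>F n in sequentially. y < x n" using assms(2) by (intro less_LiminfD) auto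
next
  fix y assume "l < y"
  then have "x n < y" for n using assms(1) by (rule le_less_trans[rotated])
  then show "\<forall>\<^sub>F n in sequentially. x n < y" by simp
qed

text \<open>Strong convergence gives convergence of each term; the uniform bound K on the norms
  provides the summable majorant K |v i|^2.\<close>

lemma pos_normal_tendsto_0:
  fixes \<rho> :: "('a::complex_hilbert \<Rightarrow>\<^sub>L 'a) \<Rightarrow> complex" and v :: "'a \<Rightarrow> 'a"
  assumes sum: "(\<lambda>i. (norm (v i))\<^sup>2) summable_on I"
    and rep: "\<And>X. sym_op X \<Longrightarrow> clinear_op X \<Longrightarrow> ((\<lambda>i. inner (v i) (X (v i))) has_sum Re (\<rho> X)) I"
    and X: "\<And>n. pos_op (X n)" and X0: "\<And>\<xi>. (\<lambda>n. X n \<xi>) \<longlonglongrightarrow> 0"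
  shows "(\<lambda>n. Re (\<rho> (X n))) \<longlonglongrightarrow> 0"
proof -
  have X': "sym_op (X n)" "clinear_op (X n)" "\<And>x. 0 \<le> inner x (X n x)" for n
    using X by (auto simp: pos_op_iff psd_op_def)
  obtain K where K: "\<And>n. norm (X n) \<le> K" using uniform_boundedness[OF X0] by blast
  have K0: "0 \<le> K" using K[of 0] norm_ge_zero order_trans by blast
  have nn: "(\<integral>\<^sup>+i. ennreal (inner (v i) (X n (v i))) \<partial>count_space I) = ennreal (Re (\<rho> (X n)))" for n
    by (rule has_sum_imp_nn_integral[OF X'(3) rep[OF X'(1,2)]])
  have "(\<lambda>n. \<integral>\<^sup>+i. ennreal (inner (v i) (X n (v i))) \<partial>count_space I) \<longlonglongrightarrow> (\<integral>\<^sup>+i. 0 \<partial>count_space I)"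
  proof (rule nn_integral_dominated_convergence[where w="\<lambda>i. ennreal (K * (norm (v i))\<^sup>2)"])
    obtain s where "((\<lambda>i. (norm (v i))\<^sup>2) has_sum s) I" using sum by (auto simp: summable_on_def)
    then have "((\<lambda>i. K * (norm (v i))\<^sup>2) has_sum (K * s)) I" by (rule has_sum_cmult_right)
    then have "(\<integral>\<^sup>+i. ennreal (K * (norm (v i))\<^sup>2) \<partial>count_space I) = ennreal (K * s)"
      using K0 by (intro has_sum_imp_nn_integral) auto
    then show "(\<integral>\<^sup>+i. ennreal (K * (norm (v i))\<^sup>2) \<partial>count_space I) < \<infinity>" by simp
    have "inner x (X n x) \<le> K * (norm x)\<^sup>2" for n x
    proof -
      have "inner x (X n x) \<le> norm x * norm (X n x)" by (rule norm_cauchy_schwarz)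
      also have "\<dots> \<le> norm x * (K * norm x)"
        using norm_blinfun[of "X n" x] mult_right_mono[OF K norm_ge_zero[of x]] by (intro mult_left_mono) (auto intro: order_trans)
      finally show ?thesis by (simp add: power2_eq_square mult_ac)
    qed
    then show "AE i in count_space I. ennreal (inner (v i) (X n (v i))) \<le> ennreal (K * (norm (v i))\<^sup>2)" for n
      by (auto intro!: ennreal_leI)
    have "(\<lambda>n. ennreal (inner (v i) (X n (v i)))) \<longlonglongrightarrow> ennreal 0" for i
      using tendsto_inner[OF tendsto_const[of "v i"] X0[of "v i"]] by (intro tendsto_ennrealI) simp
    then show "AE i in count_space I. (\<lambda>n. ennreal (inner (v i) (X n (v i)))) \<longlonglongrightarrow> 0" by simp
  qed simp_all
  then have "(\<lambda>n. ennreal (Re (\<rho> (X n)))) \<longlonglongrightarrow> ennreal 0" by (simp add: nn)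
  moreover have "0 \<le> Re (\<rho> (X n))" for n by (rule has_sum_nonneg[OF rep[OF X'(1,2)] X'(3)])
  ultimately show ?thesis by (subst (asm) tendsto_ennreal_iff) auto
qed

theorem theorem7p7:
  fixes f :: "real \<Rightarrow> real"
    and A B :: "'a::complex_hilbert \<Rightarrow>\<^sub>L 'a"
    and X :: "nat \<Rightarrow> ('a \<Rightarrow>\<^sub>L 'a)"
  assumes "operator_convex f"
    and "pos_op A" and "pos_op B"
    and "\<And>n. pos_op (X n)"
    and "\<And>\<xi>. (\<lambda>n. X n \<xi>) \<longlonglongrightarrow> 0"
  shows "(\<forall>\<rho>\<in>pos_normal_functionals.
            (\<lambda>n. operator_perspective f (A + X n) (B + X n) \<rho>)
              \<longlonglongrightarrow> operator_perspective f A B \<rho>) \<and>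
         (f 1 = 0 \<longrightarrow> (\<forall>n. pos_op (X n - X (Suc n))) \<longrightarrow>
            (\<forall>\<rho>\<in>pos_normal_functionals.
               incseq (\<lambda>n. operator_perspective f (A + X n) (B + X n) \<rho>)))"
proof -
  note A = assms(2) and B = assms(3) and X = assms(4) and X0 = assms(5)
  note AX = pos_op_add[OF A X] and BX = pos_op_add[OF B X]
  obtain c h where h: "\<And>m r. 0 \<le> h m r" "\<And>m. h m (1 / 2) = 0" "\<And>m r. h m r \<le> h (Suc m) r" "\<And>m. bdd_borel (h m)"
    "\<And>m e. 0 < e \<Longrightarrow> \<exists>h'. kern_cone h' \<and> (\<forall>r\<in>{0..1}. \<bar>h m r - h' r\<bar> \<le> e)"
    and f_h: "\<And>r. r \<in> {0..1} \<Longrightarrow> perspective f r (1 - r) =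
      ereal (c * r + (f 1 - c) * (1 - r)) + enn2ereal (SUP m::nat. ennreal (h m r))"
    using operator_convex_perspective_decomposition[OF assms(1)] by blast
  note [measurable] = bdd_borel_measurable[OF h(4)]
  have G: "(\<lambda>r. SUP m. ennreal (h m r)) \<in> borel_measurable borel" by measurable
  have inc: "incseq (\<lambda>m r. ennreal (h m r))"
    by (intro incseq_SucI le_funI ennreal_leI h)
  define J where "J m A B x = (\<integral>r. h m r \<partial>pw_measure A B x)" for m and A B :: "'a \<Rightarrow>\<^sub>L 'a" and x
  have J: "(\<integral>\<^sup>+r. ennreal (h m r) \<partial>pw_measure A B x) = ennreal (J m A B x)" if "pos_op A" "pos_op B" for m A B x
    unfolding J_def by (rule nn_integral_pw_measure[OF that h(4,1)])
  have J_inc: "incseq (\<lambda>m. ennreal (J m A B x))" if "pos_op A" "pos_op B" for A B x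
    unfolding J[OF that, symmetric] by (intro incseq_SucI nn_integral_mono ennreal_leI h)
  have J_sup: "(\<integral>\<^sup>+r. (SUP m. ennreal (h m r)) \<partial>pw_measure A B x) = (SUP m. ennreal (J m A B x))"
    if "pos_op A" "pos_op B" for A B x
    unfolding J[OF that, symmetric]
    by (rule nn_integral_monotone_convergence_SUP[OF inc])
      (simp add: measurable_cong_sets[OF unit_measureD(2)[OF unit_pw_measure[OF that]] refl])
  \<comment> \<open>The correction term of \<open>shift_ok\<close> is absent since h m vanishes at
    1/2.\<close>
  have J_shift: "J m (A + Y) (B + Y) x \<le> J m A B x" if "pos_op A" "pos_op B" "pos_op Y" for m A B Y x
    using uniform_shift[OF that h(4) h(5), where v=x] by (simp add: shift_ok_def J_def h(2))
  have J_conv: "(\<lambda>n. J m (A + X n) (B + X n) x) \<longlonglongrightarrow> J m A B x" for m x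
    using uniform_conv[OF A B X X0 h(4) h(5), where v=x] by (simp add: conv_ok_def J_def)
  have main: "(\<lambda>n. operator_perspective f (A + X n) (B + X n) \<rho>) \<longlonglongrightarrow> operator_perspective f A B \<rho> \<and>
      (f 1 = 0 \<longrightarrow> (\<forall>n. pos_op (X n - X (Suc n))) \<longrightarrow> incseq (\<lambda>n. operator_perspective f (A + X n) (B + X n) \<rho>))"
    if \<rho>: "\<rho> \<in> pos_normal_functionals" for \<rho>
  proof -
    obtain I and v :: "'a \<Rightarrow> 'a" where I: "countable I" and sum: "(\<lambda>i. (norm (v i))\<^sup>2) summable_on I"
      and rep: "\<And>X. sym_op X \<Longrightarrow> clinear_op X \<Longrightarrow> ((\<lambda>i. inner (v i) (X (v i))) has_sum Re (\<rho> X)) I"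
      using pos_normal_functional_rep[OF \<rho>] by metis
    \<comment> \<open>The nonnegative part of the value, possibly infinite, as a sum over vectors of
      increasing limits in m.\<close>
    define H where "H A B = (\<integral>\<^sup>+i. (SUP m. ennreal (J m A B (v i))) \<partial>count_space I)" for A B
    have \<rho>0: "0 \<le> Re (\<rho> A)" if "pos_op A" for A
      using that by (intro has_sum_nonneg[OF rep]) (auto simp: pos_op_iff psd_op_def)
    have \<rho>_add: "Re (\<rho> (A + B)) = Re (\<rho> A) + Re (\<rho> B)" if "pos_op A" "pos_op B" for A B
    proof -
      have s: "sym_op A" "clinear_op A" "sym_op B" "clinear_op B" "sym_op (A + B)" "clinear_op (A + B)"
        using that pos_op_add[OF that] by (auto simp: pos_op_iff psd_op_def)
      have "((\<lambda>i. inner (v i) ((A + B) (v i))) has_sum (Re (\<rho> A) + Re (\<rho> B))) I"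
        using has_sum_add[OF rep[OF s(1,2)] rep[OF s(3,4)]] by (simp add: blinfun.add_left inner_add_right)
      with rep[OF s(5,6)] show ?thesis by (rule has_sum_unique)
    qed
    have pers: "operator_perspective f A B \<rho> = ereal (c * Re (\<rho> A) + (f 1 - c) * Re (\<rho> B)) + enn2ereal (H A B)"
      if AB: "pos_op A" "pos_op B" for A B
    proof -
      have "operator_perspective f A B \<rho> = ereal_integral (pw_scalar \<rho> A B) {0..1} (\<lambda>r. perspective f r (1 - r))"
        by (simp add: operator_perspective_def pw_scalar_def[OF I rep AB])
      also have "\<dots> = ereal (c * Re (\<rho> A) + (f 1 - c) * Re (\<rho> B)) + enn2ereal (\<integral>\<^sup>+r. (SUP m. ennreal (h m r)) \<partial>pw_scalar \<rho> A B)"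
      proof (rule ereal_integral_affine_plus_nonneg[OF _ _ _ _ _ _ G])
        show "sets (pw_scalar \<rho> A B) = sets borel" by (simp add: pw_scalar_def[OF I rep AB])
        show "AE r in pw_scalar \<rho> A B. r \<in> {0..1}" by (rule pw_scalar_AE[OF I rep AB])
      qed (use f_h \<rho>0 AB pw_scalar_first[OF I rep AB] in auto)
      also have "(\<integral>\<^sup>+r. (SUP m. ennreal (h m r)) \<partial>pw_scalar \<rho> A B) = H A B"
        by (simp only: nn_integral_pw_scalar[OF I rep AB G] H_def J_sup[OF AB])
      finally show ?thesis .
    qed
    have H_shift: "H (A + Y) (B + Y) \<le> H A B" if "pos_op A" "pos_op B" "pos_op Y" for A B Y
      unfolding H_def by (intro nn_integral_mono SUP_mono') (simp add: ennreal_leI J_shift[OF that])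
    \<comment> \<open>For each m the terms converge as n grows, so Fatou over the index set applies;
      the supremum over m is taken last.\<close>
    have "H A B \<le> liminf (\<lambda>n. H (A + X n) (B + X n))"
    proof -
      have "H A B = (SUP m. \<integral>\<^sup>+i. ennreal (J m A B (v i)) \<partial>count_space I)"
        unfolding H_def by (rule nn_integral_monotone_convergence_SUP)
          (use J_inc[OF A B] in \<open>auto simp: incseq_def le_fun_def\<close>)
      also have "\<dots> \<le> liminf (\<lambda>n. H (A + X n) (B + X n))"
      proof (rule SUP_least)
        fix m
        have "liminf (\<lambda>n. ennreal (J m (A + X n) (B + X n) x)) = ennreal (J m A B x)" for x
          by (intro lim_imp_Liminf tendsto_ennrealI J_conv) simp
        then have "(\<integral>\<^sup>+i. ennreal (J m A B (v i)) \<partial>count_space I) =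
            (\<integral>\<^sup>+i. liminf (\<lambda>n. ennreal (J m (A + X n) (B + X n) (v i))) \<partial>count_space I)" by simp
        also have "\<dots> \<le> liminf (\<lambda>n. \<integral>\<^sup>+i. ennreal (J m (A + X n) (B + X n) (v i)) \<partial>count_space I)"
          by (rule nn_integral_liminf) simp
        also have "\<dots> \<le> liminf (\<lambda>n. H (A + X n) (B + X n))"
          unfolding H_def by (intro Liminf_mono always_eventually allI nn_integral_mono SUP_upper) simp
        finally show "(\<integral>\<^sup>+i. ennreal (J m A B (v i)) \<partial>count_space I) \<le> liminf (\<lambda>n. H (A + X n) (B + X n))" .
      qed
      finally show ?thesis .
    qed
    then have "(\<lambda>n. H (A + X n) (B + X n)) \<longlonglongrightarrow> H A B"
      by (intro tendsto_if_le_liminf H_shift A B X)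
    then have 1: "(\<lambda>n. enn2ereal (H (A + X n) (B + X n))) \<longlonglongrightarrow> enn2ereal (H A B)" by (simp add: tendsto_enn2ereal_iff)
    have "(\<lambda>n. c * (Re (\<rho> A) + Re (\<rho> (X n))) + (f 1 - c) * (Re (\<rho> B) + Re (\<rho> (X n)))) \<longlonglongrightarrow>
        c * (Re (\<rho> A) + 0) + (f 1 - c) * (Re (\<rho> B) + 0)"
      by (intro tendsto_intros pos_normal_tendsto_0[OF sum rep X X0])
    then have 2: "(\<lambda>n. ereal (c * Re (\<rho> (A + X n)) + (f 1 - c) * Re (\<rho> (B + X n)))) \<longlonglongrightarrow>
        ereal (c * Re (\<rho> A) + (f 1 - c) * Re (\<rho> B))"
      by (simp add: \<rho>_add A B X)
    have conv: "(\<lambda>n. operator_perspective f (A + X n) (B + X n) \<rho>) \<longlonglongrightarrow> operator_perspective f A B \<rho>"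
      unfolding pers[OF A B] pers[OF AX BX] by (rule tendsto_add_ereal_nonneg[OF _ _ 2 1]) auto
    have "incseq (\<lambda>n. operator_perspective f (A + X n) (B + X n) \<rho>)"
      if f1: "f 1 = 0" and dec: "\<And>n. pos_op (X n - X (Suc n))"
    proof (rule incseq_SucI)
      fix n
      \<comment> \<open>The pair at n is the pair at n + 1 with the positive operator X n - X (n +
        1) added to both entries. With f(1) = 0 the affine part is c times the difference of the two
        arguments, in which X n cancels.\<close>
      have "H (A + X (Suc n) + (X n - X (Suc n))) (B + X (Suc n) + (X n - X (Suc n))) \<le> H (A + X (Suc n)) (B + X (Suc n))"
        by (rule H_shift[OF AX BX dec])
      then have "H (A + X n) (B + X n) \<le> H (A + X (Suc n)) (B + X (Suc n))" by simp
      moreover have "c * Re (\<rho> (A + X n)) + (f 1 - c) * Re (\<rho> (B + X n)) = c * (Re (\<rho> A) - Re (\<rho> B))" for n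
        by (simp add: \<rho>_add A B X f1 algebra_simps)
      ultimately show "operator_perspective f (A + X n) (B + X n) \<rho> \<le> operator_perspective f (A + X (Suc n)) (B + X (Suc n)) \<rho>"
        unfolding pers[OF AX BX] by (simp add: add_left_mono less_eq_ennreal.rep_eq)
    qed
    with conv show ?thesis by blast
  qed
  then show ?thesis by blast
qed

end
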